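(* Let $X$ be a compact complex manifold of dimension $n$ equipped with a Hermitian-symplectic metric $\omega_0$, and let $\omega \in \mathcal{S}_{\{\omega_0\}}$. Suppose that (i) $\omega$ is a critical point of the Dinew-Popovici energy functional $F:\mathcal{S}_{\{\omega_0\}}\to[0,+\infty)$, and (ii) the $(2,0)$-torsion form of $\omega$ satisfies $\rho_\omega^{2,0}=\partial\xi$ for some smooth $(1,0)$-form $\xi$ on $X$ such that $\bar\partial \xi$ is weakly semi-positive. Then $\omega$ is a Kähler metric on $X$.
   Context: A Hermitian metric on $X$ is identified with a $C^\infty$ positive definite $(1,1)$-form $\omega$. It is Kähler if $d\omega=0$. It is Hermitian-symplectic if there exists a smooth $(2,0)$-form $\rho^{2,0}$ such that $d(\rho^{2,0}+\omega+\overline{\rho^{2,0}})=0$. Among all such $\rho^{2,0}$ there is a unique one of minimal $L^2_\omega$-norm; it is called the $(2,0)$-torsion form of $\omega$ and denoted $\rho_\omega^{2,0}$. For a fixed Hermitian-symplectic metric $\omega_0$, with $C^\infty_{1,0}(X,\mathbb{C})$ denoting the smooth $(1,0)$-forms, $$\mathcal{S}_{\{\omega_0\}}=\{\omega_0+\partial\bar u_0+\bar\partial u_0 \mid u_0\in C^\infty_{1,0}(X,\mathbb{C}),\ \omega_0+\partial\bar u_0+\bar\partial u_0>0\}.$$ All its elements are Hermitian-symplectic metrics. The Dinew-Popovici energy functional is $$F:\mathcal{S}_{\{\omega_0\}}\to[0,+\infty),\qquad F(\omega)=\int_X|\rho_\omega^{2,0}|_\omega^2\,dV_\omega=\|\rho_\omega^{2,0}\|_\omega^2,$$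 where $|\cdot|_\omega$ and $\|\cdot\|_\omega$ are the pointwise norm and the $L^2$ norm induced by $\omega$. A metric $\omega\in\mathcal{S}_{\{\omega_0\}}$ is a critical point of $F$ if the differential $d_\omega F(\gamma)=\frac{d}{ds}\big|_{s=0}F(\omega+s\gamma)$ vanishes for every $\gamma=\bar\partial u+\partial\bar u$ with $u\in C^\infty_{1,0}(X,\mathbb{C})$. A $(p,p)$-form $v$ on $X$ is weakly semi-positive if, at every point of $X$ and for all $(1,0)$-covectors $\alpha_1,\dots,\alpha_{n-p}$ at that point, $v\wedge i\alpha_1\wedge\bar\alpha_1\wedge\cdots\wedge i\alpha_{n-p}\wedge\bar\alpha_{n-p}\ge 0$ (with respect to the canonical orientation). *)

theory Defs
  imports "HOL-Analysis.Analysis" "HOL-Library.Function_Algebras"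
begin

section \<open>Complex manifolds\<close>

text \<open>
  The manifold is the whole type \<open>'m\<close>; its complex dimension is \<open>CARD('n)\<close>.  A chart is a pair
  \<open>(U, \<phi>)\<close>; values of \<open>\<phi>\<close> outside \<open>U\<close> are irrelevant.
\<close>

type_synonym ('m, 'n) chart = "'m set \<times> ('m \<Rightarrow> complex^'n)"

abbreviation chart_dom :: "('m, 'n) chart \<Rightarrow> 'm set" where
  "chart_dom \<equiv> fst"

abbreviation chart_fun :: "('m, 'n) chart \<Rightarrow> 'm \<Rightarrow> complex^'n" where
  "chart_fun \<equiv> snd"

definition chart_img :: "('m, 'n) chart \<Rightarrow> (complex^'n) set" where
  "chart_img c = chart_fun c ` chart_dom c"

definition chart_inv :: "('m, 'n) chart \<Rightarrow> complex^'n \<Rightarrow> 'm" where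
  "chart_inv c = inv_into (chart_dom c) (chart_fun c)"

definition holomorphic_map_on :: "(complex^'n::finite \<Rightarrow> complex^'m::finite) \<Rightarrow> (complex^'n) set \<Rightarrow> bool" where
  "holomorphic_map_on f S \<longleftrightarrow>
     (\<forall>z\<in>S. \<exists>D. (f has_derivative D) (at z) \<and> (\<forall>a v. D (a *s v) = a *s D v))"

definition complex_atlas :: "('m::topological_space, 'n::finite) chart set \<Rightarrow> bool" where
  "complex_atlas A \<longleftrightarrow>
     (\<Union>c\<in>A. chart_dom c) = UNIV \<and>
     (\<forall>c\<in>A. open (chart_dom c) \<and> open (chart_img c) \<and>
        homeomorphism (chart_dom c) (chart_img c) (chart_fun c) (chart_inv c)) \<and>
     (\<forall>c\<in>A. \<forall>c'\<in>A.
        holomorphic_map_on (chart_fun c' \<circ> chart_inv c) (chart_fun c ` (chart_dom c \<inter> chart_dom c')))"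

definition compact_complex_manifold :: "('m::t2_space, 'n::finite) chart set \<Rightarrow> bool" where
  "compact_complex_manifold A \<longleftrightarrow> compact (UNIV :: 'm set) \<and> complex_atlas A"


section \<open>Multilinear algebra on \<open>\<complex>\<^sup>n\<close>\<close>

text \<open>
  A complex-valued \<open>k\<close>-covector on the real vector space underlying \<open>\<complex>\<^sup>n\<close> is a function on lists of
  vectors which is alternating and real-multilinear on lists of length \<open>k\<close> and zero on all others.
  Thus the degree need not be passed as an argument to the wedge product.
\<close>

type_synonym 'n covector = "(complex^'n) list \<Rightarrow> complex"

text \<open>The sum over \<open>(k,l)\<close>-shuffles: \<open>I\<close> is the set of positions handed to the first factor.\<close>

definition wedge :: "'n covector \<Rightarrow> 'n covector \<Rightarrow> 'n covector" where
  "wedge a b vs =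
     (\<Sum>I\<in>Pow {..<length vs}.
        (-1) ^ card {(i, j). i \<in> I \<and> j \<in> {..<length vs} - I \<and> j < i}
          * a (nths vs I) * b (nths vs (- I)))"

definition wedge_list :: "'n covector list \<Rightarrow> 'n covector" where
  "wedge_list as = foldr wedge as (\<lambda>vs. if vs = [] then 1 else 0)"

definition cnj_covector :: "'n covector \<Rightarrow> 'n covector" where
  "cnj_covector a = (\<lambda>vs. cnj (a vs))"

definition dz :: "'n \<Rightarrow> 'n::finite covector" where
  "dz j vs = (case vs of [v] \<Rightarrow> v $ j | _ \<Rightarrow> 0)"

text \<open>Covectors \<open>\<Sum> f\<^bsub>IJ\<^esub> dz\<^bsub>I\<^esub> \<and> cnj dz\<^bsub>J\<^esub>\<close> with \<open>|I| = p\<close>, \<open>|J| = q\<close>, over all multi-indices.\<close>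

definition pq_covectors :: "nat \<Rightarrow> nat \<Rightarrow> 'n::finite covector set" where
  "pq_covectors p q =
     {a. \<exists>f. a = (\<lambda>vs. \<Sum>(I, J) \<in> {I. length I = p} \<times> {J. length J = q}.
                  f I J * wedge_list (map dz I @ map (\<lambda>j. cnj_covector (dz j)) J) vs)}"

text \<open>
  The real basis \<open>e\<^sub>1, i e\<^sub>1, \<dots>, e\<^sub>n, i e\<^sub>n\<close>.  It is positive for the canonical orientation, whatever the
  order in which the index type is listed, since the vectors come in pairs; and
  \<open>dx\<^sub>1 \<and> dy\<^sub>1 \<and> \<dots> \<and> dx\<^sub>n \<and> dy\<^sub>n\<close> takes the value 1 on it.
\<close>

definition canonical_frame :: "(complex^'n::finite) list" where
  "canonical_frame =
     concat (map (\<lambda>j. [axis j 1, axis j \<i>]) (SOME js. distinct js \<and> set js = UNIV))"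

definition top_nonneg :: "'n::finite covector \<Rightarrow> bool" where
  "top_nonneg a \<longleftrightarrow> a canonical_frame \<in> \<real>\<^sub>\<ge>\<^sub>0"

text \<open>
  For \<open>w = i \<Sum> w\<^bsub>jk\<^esub> dz\<^sub>j \<and> cnj dz\<^sub>k\<close> one has \<open>w(v, iv) = 2 \<Sum> w\<^bsub>jk\<^esub> v\<^sub>j cnj v\<^sub>k\<close>.
\<close>

definition positive_definite :: "'n::finite covector \<Rightarrow> bool" where
  "positive_definite w \<longleftrightarrow> cnj_covector w = w \<and> (\<forall>v. v \<noteq> 0 \<longrightarrow> Re (w [v, \<i> *s v]) > 0)"

text \<open>
  The Riemannian metric \<open>w(\<cdot>, i\<cdot>)\<close> of a positive \<open>(1,1)\<close>-covector \<open>w\<close>, and the norm it induces on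
  \<open>k\<close>-covectors, for which the products \<open>e\<^bsub>i1\<^esub>\<^sup>* \<and> \<dots> \<and> e\<^bsub>ik\<^esub>\<^sup>*\<close>, \<open>i1 < \<dots> < ik\<close>, of a dual orthonormal basis
  are orthonormal.  For \<open>w = i \<Sum> dz\<^sub>j \<and> cnj dz\<^sub>j\<close> this makes the \<open>dz\<^bsub>I\<^esub> \<and> cnj dz\<^bsub>J\<^esub>\<close> (increasing multi-indices)
  orthonormal.  The value does not depend on the chosen orthonormal basis.
\<close>

definition riem :: "'n::finite covector \<Rightarrow> complex^'n \<Rightarrow> complex^'n \<Rightarrow> real" where
  "riem w u v = Re (w [u, \<i> *s v])"

definition riem_orthonormal_basis :: "'n::finite covector \<Rightarrow> (complex^'n) set \<Rightarrow> bool" where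
  "riem_orthonormal_basis w B \<longleftrightarrow>
     finite B \<and> card B = 2 * CARD('n) \<and> (\<forall>u\<in>B. \<forall>v\<in>B. riem w u v = (if u = v then 1 else 0))"

definition covector_norm :: "'n::finite covector \<Rightarrow> nat \<Rightarrow> 'n covector \<Rightarrow> real" where
  "covector_norm w k a =
     (let B = SOME B. riem_orthonormal_basis w B
      in sqrt ((\<Sum>vs \<in> {vs. set vs \<subseteq> B \<and> length vs = k}. (cmod (a vs))\<^sup>2) / fact k))"

text \<open>\<open>w\<^sup>n / n!\<close>\<close>

definition volume_covector :: "'n::finite covector \<Rightarrow> 'n covector" where
  "volume_covector w = (\<lambda>vs. wedge_list (replicate CARD('n) w) vs / fact CARD('n))"


section \<open>Differential forms\<close>

text \<open>
  The tangent space at \<open>x\<close> is identified with \<open>\<complex>\<^sup>n\<close> through the differential of a chart \<open>chart_at A x\<close>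
  chosen once and for all around \<open>x\<close>.  A form is then a function of the point with values in the
  covectors on \<open>\<complex>\<^sup>n\<close>.  No continuity of \<open>chart_at A x\<close> in \<open>x\<close> is involved: regularity and
  derivatives refer to the local representations \<open>local_rep A \<alpha> c\<close>, the pull-backs of \<open>\<alpha>\<close> by the
  inverse of a chart \<open>c\<close>.
\<close>

type_synonym ('m, 'n) form = "'m \<Rightarrow> 'n covector"

definition chart_at :: "('m, 'n) chart set \<Rightarrow> 'm \<Rightarrow> ('m, 'n) chart" where
  "chart_at A x = (SOME c. c \<in> A \<and> x \<in> chart_dom c)"

definition local_rep ::
  "('m, 'n::finite) chart set \<Rightarrow> ('m, 'n) form \<Rightarrow> ('m, 'n) chart \<Rightarrow> complex^'n \<Rightarrow> 'n covector" where
  "local_rep A \<alpha> c z vs =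
     (let x = chart_inv c z
      in \<alpha> x (map (frechet_derivative (chart_fun (chart_at A x) \<circ> chart_inv c) (at z)) vs))"

fun C_k_on :: "nat \<Rightarrow> (complex^'n::finite) set \<Rightarrow> (complex^'n \<Rightarrow> complex) \<Rightarrow> bool" where
  "C_k_on 0 S f \<longleftrightarrow> continuous_on S f"
| "C_k_on (Suc k) S f \<longleftrightarrow>
     (\<forall>z\<in>S. f differentiable (at z)) \<and> (\<forall>v. C_k_on k S (\<lambda>z. frechet_derivative f (at z) v))"

definition smooth_on :: "(complex^'n::finite) set \<Rightarrow> (complex^'n \<Rightarrow> complex) \<Rightarrow> bool" where
  "smooth_on S f \<longleftrightarrow> (\<forall>k. C_k_on k S f)"

definition smooth_forms :: "('m, 'n::finite) chart set \<Rightarrow> nat \<Rightarrow> nat \<Rightarrow> ('m, 'n) form set" where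
  "smooth_forms A p q =
     {\<alpha>. (\<forall>x. \<alpha> x \<in> pq_covectors p q) \<and>
         (\<forall>c\<in>A. \<forall>vs. smooth_on (chart_img c) (\<lambda>z. local_rep A \<alpha> c z vs))}"

definition cnj_form :: "('m, 'n) form \<Rightarrow> ('m, 'n) form" where
  "cnj_form \<alpha> = (\<lambda>x. cnj_covector (\<alpha> x))"

definition scale_form :: "real \<Rightarrow> ('m, 'n) form \<Rightarrow> ('m, 'n) form" where
  "scale_form s \<alpha> = (\<lambda>x vs. of_real s * \<alpha> x vs)"

text \<open>
  \<open>D f z v\<close> stands for the derivative of \<open>f\<close> at \<open>z\<close> along \<open>v\<close> or for its \<open>\<complex>\<close>-linear or antilinear
  part in \<open>v\<close>.  If \<open>a = \<Sum> f\<^bsub>IJ\<^esub> dz\<^bsub>I\<^esub> \<and> cnj dz\<^bsub>J\<^esub>\<close> then the alternating sum below is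
  \<open>\<Sum> D f\<^bsub>IJ\<^esub> \<and> dz\<^bsub>I\<^esub> \<and> cnj dz\<^bsub>J\<^esub>\<close>, evaluated on \<open>vs\<close>.
\<close>

type_synonym 'n diff_operator = "(complex^'n \<Rightarrow> complex) \<Rightarrow> complex^'n \<Rightarrow> complex^'n \<Rightarrow> complex"

definition full_deriv :: "'n::finite diff_operator" where
  "full_deriv f z v = frechet_derivative f (at z) v"

definition hol_deriv :: "'n::finite diff_operator" where
  "hol_deriv f z v = (full_deriv f z v - \<i> * full_deriv f z (\<i> *s v)) / 2"

definition antihol_deriv :: "'n::finite diff_operator" where
  "antihol_deriv f z v = (full_deriv f z v + \<i> * full_deriv f z (\<i> *s v)) / 2"

definition alternating_deriv ::
  "'n::finite diff_operator \<Rightarrow> (complex^'n \<Rightarrow> 'n covector) \<Rightarrow> complex^'n \<Rightarrow> 'n covector" where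
  "alternating_deriv D a z vs =
     (\<Sum>i<length vs. (-1) ^ i * D (\<lambda>w. a w (take i vs @ drop (Suc i) vs)) z (vs ! i))"

definition form_deriv ::
  "'n::finite diff_operator \<Rightarrow> ('m, 'n) chart set \<Rightarrow> ('m, 'n) form \<Rightarrow> ('m, 'n) form" where
  "form_deriv D A \<alpha> x =
     (let c = chart_at A x in alternating_deriv D (local_rep A \<alpha> c) (chart_fun c x))"

definition d_form :: "('m, 'n::finite) chart set \<Rightarrow> ('m, 'n) form \<Rightarrow> ('m, 'n) form" where
  "d_form = form_deriv full_deriv"

definition del :: "('m, 'n::finite) chart set \<Rightarrow> ('m, 'n) form \<Rightarrow> ('m, 'n) form" where
  "del = form_deriv hol_deriv"

definition delbar :: "('m, 'n::finite) chart set \<Rightarrow> ('m, 'n) form \<Rightarrow> ('m, 'n) form" where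
  "delbar = form_deriv antihol_deriv"

text \<open>The argument \<open>v\<close> is meant to be a \<open>(p,p)\<close>-form with \<open>p \<le> CARD('n)\<close>.\<close>

definition weakly_semipositive :: "nat \<Rightarrow> ('m, 'n::finite) form \<Rightarrow> bool" where
  "weakly_semipositive p v \<longleftrightarrow>
     (\<forall>x. \<forall>as. length as = CARD('n) - p \<and> set as \<subseteq> pq_covectors 1 0 \<longrightarrow>
        top_nonneg (wedge_list (v x # map (\<lambda>a vs. \<i> * wedge a (cnj_covector a) vs) as)))"


section \<open>Integration of top-degree forms\<close>

definition partition_of_unity ::
  "('m::topological_space, 'n) chart set \<Rightarrow> ('m, 'n) chart set \<Rightarrow> (('m, 'n) chart \<Rightarrow> 'm \<Rightarrow> real) \<Rightarrow> bool" where
  "partition_of_unity A C \<eta> \<longleftrightarrow>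
     finite C \<and> C \<subseteq> A \<and>
     (\<forall>c\<in>C. continuous_on UNIV (\<eta> c) \<and> (\<forall>x. 0 \<le> \<eta> c x) \<and> closure {x. \<eta> c x \<noteq> 0} \<subseteq> chart_dom c) \<and>
     (\<forall>x. (\<Sum>c\<in>C. \<eta> c x) = 1)"

text \<open>On a compact complex manifold the integral does not depend on the chosen partition of unity.\<close>

definition form_integral :: "('m::topological_space, 'n::finite) chart set \<Rightarrow> ('m, 'n) form \<Rightarrow> complex" where
  "form_integral A \<tau> =
     (let (C, \<eta>) = (SOME (C, \<eta>). partition_of_unity A C \<eta>)
      in \<Sum>c\<in>C. LINT z : chart_img c | lborel.
            \<eta> c (chart_inv c z) *\<^sub>R local_rep A \<tau> c z canonical_frame)"

definition L2_norm_form ::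
  "('m::topological_space, 'n::finite) chart set \<Rightarrow> ('m, 'n) form \<Rightarrow> nat \<Rightarrow> ('m, 'n) form \<Rightarrow> real" where
  "L2_norm_form A \<omega> k \<alpha> =
     sqrt (Re (form_integral A
       (\<lambda>x vs. of_real ((covector_norm (\<omega> x) k (\<alpha> x))\<^sup>2) * volume_covector (\<omega> x) vs)))"


section \<open>Metrics and the energy functional\<close>

definition hermitian_metric :: "('m, 'n::finite) chart set \<Rightarrow> ('m, 'n) form \<Rightarrow> bool" where
  "hermitian_metric A \<omega> \<longleftrightarrow> \<omega> \<in> smooth_forms A 1 1 \<and> (\<forall>x. positive_definite (\<omega> x))"

definition kaehler_metric :: "('m, 'n::finite) chart set \<Rightarrow> ('m, 'n) form \<Rightarrow> bool" where
  "kaehler_metric A \<omega> \<longleftrightarrow> hermitian_metric A \<omega> \<and> d_form A \<omega> = 0"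

definition closing_20_forms :: "('m, 'n::finite) chart set \<Rightarrow> ('m, 'n) form \<Rightarrow> ('m, 'n) form set" where
  "closing_20_forms A \<omega> = {\<rho> \<in> smooth_forms A 2 0. d_form A (\<rho> + \<omega> + cnj_form \<rho>) = 0}"

definition hermitian_symplectic :: "('m, 'n::finite) chart set \<Rightarrow> ('m, 'n) form \<Rightarrow> bool" where
  "hermitian_symplectic A \<omega> \<longleftrightarrow> hermitian_metric A \<omega> \<and> (\<exists>\<rho>. \<rho> \<in> closing_20_forms A \<omega>)"

definition torsion_form ::
  "('m::topological_space, 'n::finite) chart set \<Rightarrow> ('m, 'n) form \<Rightarrow> ('m, 'n) form" where
  "torsion_form A \<omega> =
     (THE \<rho>. \<rho> \<in> closing_20_forms A \<omega> \<and>
        (\<forall>\<sigma>\<in>closing_20_forms A \<omega>. L2_norm_form A \<omega> 2 \<rho> \<le> L2_norm_form A \<omega> 2 \<sigma>))"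

definition metric_class :: "('m, 'n::finite) chart set \<Rightarrow> ('m, 'n) form \<Rightarrow> ('m, 'n) form set" where
  "metric_class A \<omega>\<^sub>0 =
     {\<omega>. (\<forall>x. positive_definite (\<omega> x)) \<and>
         (\<exists>u\<in>smooth_forms A 1 0. \<omega> = \<omega>\<^sub>0 + del A (cnj_form u) + delbar A u)}"

definition energy :: "('m::topological_space, 'n::finite) chart set \<Rightarrow> ('m, 'n) form \<Rightarrow> real" where
  "energy A \<omega> = (L2_norm_form A \<omega> 2 (torsion_form A \<omega>))\<^sup>2"

text \<open>
  For \<open>\<omega>\<close> in \<open>metric_class A \<omega>\<^sub>0\<close>, compactness puts \<open>\<omega> + s\<gamma>\<close> in the same class for all small \<open>s\<close>,
  so only values of the energy on this class enter the derivative at 0.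
\<close>

definition critical_point ::
  "('m::topological_space, 'n::finite) chart set \<Rightarrow> ('m, 'n) form \<Rightarrow> ('m, 'n) form \<Rightarrow> bool" where
  "critical_point A \<omega>\<^sub>0 \<omega> \<longleftrightarrow>
     \<omega> \<in> metric_class A \<omega>\<^sub>0 \<and>
     (\<forall>u\<in>smooth_forms A 1 0.
        ((\<lambda>s. energy A (\<omega> + scale_form s (delbar A u + del A (cnj_form u))))
           has_real_derivative 0) (at 0))"

end

theory Submission imports Defs "HOL-Complex_Analysis.Cauchy_Integral_Formula" begin

text \<open>
  Let \<open>\<rho> = \<partial>\<xi>\<close> be the torsion form of \<open>\<omega>\<close> and move \<open>\<omega>\<close> in the direction
  \<open>\<gamma> = delbar A \<xi> + del A (cnj_form \<xi>)\<close>.  Since \<open>d (d \<xi>) = 0\<close>, adding \<open>s \<gamma>\<close> to the metric is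
  compensated by adding \<open>s \<partial>\<xi> = s \<rho>\<close> to the closing form (\<open>closing_translate\<close>): the form \<open>(1 + s) \<rho>\<close>
  competes in the minimum that defines the energy of \<open>\<omega> + s \<gamma>\<close>, so that this energy is at most
  \<open>(1 + s)\<^sup>2\<close> times the squared norm of \<open>\<rho>\<close> for the metric \<open>\<omega> + s \<gamma>\<close>.

  A weakly semi-positive \<open>(1,1)\<close>-form is semi-positive (\<open>weakly_semipositive_imp_nonneg\<close>), so
  \<open>\<omega> + s \<gamma> \<le> \<omega>\<close> for \<open>s < 0\<close>.  The density of \<open>\<bar>\<rho>\<bar>\<^sup>2 dV\<close> for a fixed \<open>(2,0)\<close>-form is
  monotone in the metric (\<open>norm_density_mono\<close>): if the two metrics are diagonalized simultaneously, with
  eigenvalues \<open>l\<^sub>j \<le> 1\<close> of the smaller one, then the volume is multiplied by \<open>\<Prod>l\<^sub>i\<close> and the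
  coefficient \<open>\<bar>\<rho>\<^sub>j\<^sub>k\<bar>\<^sup>2\<close> by \<open>1 / (l\<^sub>j l\<^sub>k)\<close>; since \<open>j \<noteq> k\<close>, the two eigenvalues cancel against
  two factors of the product.  Altogether the energy of \<open>\<omega> + s \<gamma>\<close> is at most \<open>(1 + s)\<^sup>2\<close> times the energy of
  \<open>\<omega>\<close> for all small \<open>s < 0\<close> (\<open>energy_perturbation_le\<close>).  A function with this property and with
  derivative 0 at \<open>s = 0\<close> vanishes there (\<open>critical_value_zero\<close>).  Hence \<open>\<rho> = 0\<close> and \<open>d \<omega> = 0\<close>.

  The argument needs the torsion form to be a minimiser for each metric \<open>\<omega> + s \<gamma>\<close>, that is, existence
  and uniqueness of the closing form of least norm (\<open>minimal_closing_form\<close>).  Two closing forms differ by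
  a \<open>(2,0)\<close>-form \<open>h\<close> with \<open>d (h + cnj h) = 0\<close>.  The \<open>(2,1)\<close>-part of this equation says that \<open>h\<close> is
  holomorphic (\<open>closed_two_form_hol\<close>).  So the closing forms are an affine space over a space of holomorphic two-forms,
  and for these the mean value property bounds the values by the \<open>L\<^sup>2\<close>
  norm (\<open>hol_form_local_bound\<close>).  A minimising sequence is Cauchy in \<open>L\<^sup>2\<close> by the parallelogram law,
  hence it converges locally uniformly together with its derivatives (\<open>hol_on_limit\<close>), the limit is again a
  closing form, and Fatou's lemma shows that it is minimal.  This replaces the Hodge theory of an
  elliptic operator by elementary properties of holomorphic functions.
\<close>

section \<open>The recursion for the wedge product\<close>

lemma wedge_Nil [simp]: "wedge a b [] = a [] * b []"
  by (simp add: wedge_def)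

text \<open>
  The first vector goes either to \<open>a\<close> or to \<open>b\<close>; in the second case it must pass all the vectors
  that \<open>a\<close> receives, which costs the sign \<open>(-1) ^ length xs\<close>.  Most arguments below go by this
  recursion instead of the sum over shuffles.
\<close>

lemma wedge_Cons:
  "wedge a b (v # vs) =
     wedge (\<lambda>xs. a (v # xs)) b vs + wedge (\<lambda>xs. (-1) ^ length xs * a xs) (\<lambda>xs. b (v # xs)) vs"
proof -
  define n where "n = length vs"
  define inv where "inv N I = {(i, j). i \<in> I \<and> j \<in> {..<N} - I \<and> j < i}" for N and I :: "nat set"
  define trm where "trm I = (-1) ^ card (inv (Suc n) I) * a (nths (v # vs) I) * b (nths (v # vs) (- I))" for I
  have fin: "finite (inv N I)" if "finite I" for N I
  proof -
    have "inv N I \<subseteq> I \<times> {..<N}" by (auto simp: inv_def)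
    then show ?thesis using that finite_subset by blast
  qed
  have Pow_split: "Pow {..<Suc n} = (\<lambda>J. insert 0 (Suc ` J)) ` Pow {..<n} \<union> image Suc ` Pow {..<n}"
    (is "_ = ?A \<union> ?B")
  proof -
    have "{..<Suc n} = insert 0 (Suc ` {..<n})"
      by (simp add: lessThan_Suc_eq_insert_0)
    then have "Pow {..<Suc n} = Pow (Suc ` {..<n}) \<union> insert 0 ` Pow (Suc ` {..<n})"
      by (simp add: Pow_insert)
    then show ?thesis
      by (simp add: image_Pow_surj [OF refl, symmetric] image_image Un_commute)
  qed
  have disj: "?A \<inter> ?B = {}" by auto
  have inv0: "inv (Suc n) (insert 0 (Suc ` J)) = map_prod Suc Suc ` inv n J" for J
    by (auto simp: inv_def map_prod_def image_iff less_Suc_eq_0_disj gr0_conv_Suc)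
  have inv1: "inv (Suc n) (Suc ` J) = map_prod Suc Suc ` inv n J \<union> (\<lambda>i. (Suc i, 0)) ` J" for J
    by (auto simp: inv_def map_prod_def image_iff less_Suc_eq_0_disj gr0_conv_Suc)
  have card0: "card (inv (Suc n) (insert 0 (Suc ` J))) = card (inv n J)" for J
    unfolding inv0 by (rule card_image) (auto intro!: inj_onI)
  have card1: "card (inv (Suc n) (Suc ` J)) = card (inv n J) + card J" if "J \<subseteq> {..<n}" for J
  proof -
    have f: "finite J" using that finite_subset by blast
    have "card (inv (Suc n) (Suc ` J)) = card (map_prod Suc Suc ` inv n J) + card ((\<lambda>i. (Suc i, 0::nat)) ` J)"
      unfolding inv1 by (rule card_Un_disjoint) (auto simp: f fin)
    also have "card (map_prod Suc Suc ` inv n J) = card (inv n J)"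
      by (rule card_image) (auto intro!: inj_onI)
    also have "card ((\<lambda>i. (Suc i, 0::nat)) ` J) = card J"
      by (rule card_image) (auto intro!: inj_onI)
    finally show ?thesis .
  qed
  have compl0: "{j. Suc j \<in> - insert 0 (Suc ` J)} = - J" "{j. Suc j \<in> insert 0 (Suc ` J)} = J" for J
    by auto
  have compl1: "{j. Suc j \<in> - (Suc ` J)} = - J" "{j. Suc j \<in> Suc ` J} = J" for J
    by auto
  have len: "length (nths vs J) = card J" if "J \<subseteq> {..<n}" for J
  proof -
    have "{i. i < length vs \<and> i \<in> J} = J" using that by (auto simp: n_def)
    then show ?thesis by (simp add: length_nths)
  qed
  have "wedge a b (v # vs) = sum trm (Pow {..<Suc n})"
    unfolding wedge_def by (rule sum.cong) (simp_all add: trm_def inv_def n_def)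
  also have "\<dots> = sum trm ?A + sum trm ?B"
    unfolding Pow_split by (rule sum.union_disjoint) (use disj in auto)
  also have "sum trm ?A = (\<Sum>J\<in>Pow {..<n}. trm (insert 0 (Suc ` J)))"
  proof -
    have "inj_on (\<lambda>J. insert 0 (Suc ` J)) (Pow {..<n})"
      by (rule inj_onI) (metis compl0(2))
    then show ?thesis by (simp add: sum.reindex o_def)
  qed
  also have "\<dots> = wedge (\<lambda>xs. a (v # xs)) b vs"
    unfolding wedge_def n_def [symmetric] inv_def [symmetric]
    by (rule sum.cong) (simp_all only: trm_def card0 nths_Cons compl0, simp_all)
  also have "sum trm ?B = (\<Sum>J\<in>Pow {..<n}. trm (Suc ` J))"
  proof -
    have "inj_on (image Suc) (Pow {..<n})"
      by (rule inj_onI) (metis compl1(2))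
    then show ?thesis by (simp add: sum.reindex o_def)
  qed
  also have "\<dots> = wedge (\<lambda>xs. (-1) ^ length xs * a xs) (\<lambda>xs. b (v # xs)) vs"
    unfolding wedge_def n_def [symmetric] inv_def [symmetric]
    by (rule sum.cong) (simp_all only: trm_def card1 nths_Cons compl1 Pow_iff len power_add, simp_all)
  finally show ?thesis .
qed

lemma wedge_cong:
  assumes "\<And>xs. set xs \<subseteq> set vs \<Longrightarrow> a xs = a' xs" "\<And>xs. set xs \<subseteq> set vs \<Longrightarrow> b xs = b' xs"
  shows "wedge a b vs = wedge a' b' vs"
proof -
  have "set (nths vs I) \<subseteq> set vs" for I by (rule set_nths_subset)
  then show ?thesis unfolding wedge_def using assms by simp
qed

lemma wedge_zero_left:
  assumes "\<And>xs. set xs \<subseteq> set vs \<Longrightarrow> a xs = 0" shows "wedge a b vs = 0"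
  using assms wedge_cong [of vs a "\<lambda>_. 0" b b] by (simp add: wedge_def)

lemma wedge_zero_right:
  assumes "\<And>xs. set xs \<subseteq> set vs \<Longrightarrow> b xs = 0" shows "wedge a b vs = 0"
  using assms wedge_cong [of vs a a b "\<lambda>_. 0"] by (simp add: wedge_def)

lemma wedge_add_left: "wedge (\<lambda>xs. a xs + a' xs) b vs = wedge a b vs + wedge a' b vs"
  by (simp add: wedge_def algebra_simps sum.distrib)

lemma wedge_add_right: "wedge a (\<lambda>xs. b xs + b' xs) vs = wedge a b vs + wedge a b' vs"
  by (simp add: wedge_def algebra_simps sum.distrib)

lemma wedge_scale_left: "wedge (\<lambda>xs. c * a xs) b vs = c * wedge a b vs"
  by (simp add: wedge_def algebra_simps sum_distrib_left)

lemma wedge_scale_right: "wedge a (\<lambda>xs. c * b xs) vs = c * wedge a b vs"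
  by (simp add: wedge_def algebra_simps sum_distrib_left)

lemma wedge_const_left:
  fixes b :: "'n::finite covector"
  shows "wedge (\<lambda>xs. if xs = [] then c else 0) b vs = c * b vs"
proof (induction vs arbitrary: b c)
  case (Cons v vs)
  have "(\<lambda>xs :: (complex^'n) list. (-1) ^ length xs * (if xs = [] then c else 0)) = (\<lambda>xs. if xs = [] then c else 0)"
    by (auto simp: fun_eq_iff)
  then show ?case
    using Cons.IH [of c "\<lambda>xs. b (v # xs)"] by (simp add: wedge_Cons wedge_zero_left)
qed simp

lemma wedge_map: "wedge a b (map T vs) = wedge (\<lambda>xs. a (map T xs)) (\<lambda>xs. b (map T xs)) vs"
  by (simp add: wedge_def nths_map)

definition wedge_unit :: "'n covector" where "wedge_unit vs = (if vs = [] then 1 else 0)"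

lemma wedge_list_Nil: "wedge_list [] = wedge_unit"
  by (simp add: wedge_list_def wedge_unit_def fun_eq_iff)

lemma wedge_list_Cons: "wedge_list (a # as) = wedge a (wedge_list as)"
  by (simp add: wedge_list_def)

lemma wedge_list_map:
  "wedge_list as (map T vs) = wedge_list (map (\<lambda>a xs. a (map T xs)) as) vs"
proof (induction as arbitrary: vs)
  case (Cons a as)
  have "(\<lambda>xs. wedge_list as (map T xs)) = wedge_list (map (\<lambda>a xs. a (map T xs)) as)"
    using Cons.IH by blast
  then show ?case by (simp add: wedge_list_Cons wedge_map)
qed (simp add: wedge_list_Nil wedge_unit_def)

lemma length_nths_compl: "length (nths vs I) + length (nths vs (- I)) = length vs"
proof (induction vs arbitrary: I)
  case (Cons v vs)
  have "{j. Suc j \<in> - I} = - {j. Suc j \<in> I}" by auto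
  then show ?case using Cons.IH [of "{j. Suc j \<in> I}"] by (simp add: nths_Cons)
qed simp

lemma wedge_deg1_deg1:
  assumes a: "\<And>xs. length xs \<noteq> 1 \<Longrightarrow> a xs = 0" and b: "\<And>xs. length xs \<noteq> 1 \<Longrightarrow> b xs = 0"
  shows "wedge a b vs = (if length vs = 2 then a [vs ! 0] * b [vs ! 1] - a [vs ! 1] * b [vs ! 0] else 0)"
proof (cases "length vs = 2")
  case True
  then obtain u v where vs: "vs = [u, v]"
    by (auto simp: numeral_2_eq_2 length_Suc_conv)
  have "a [] = 0" "b [] = 0" "a [u, v] = 0" "b [u, v] = 0" by (rule a b, simp)+
  then show ?thesis by (simp add: vs wedge_Cons)
next
  case False
  have "a (nths vs I) * b (nths vs (- I)) = 0" for I
  proof -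
    have "length (nths vs I) \<noteq> 1 \<or> length (nths vs (- I)) \<noteq> 1"
      using length_nths_compl [of vs I] False by linarith
    then show ?thesis using a b by (metis mult_zero_left mult_zero_right)
  qed
  then have "wedge a b vs = 0"
    unfolding wedge_def mult.assoc by (simp only: mult_zero_right sum.neutral_const)
  then show ?thesis using False by simp
qed

lemma wedge_unit_right: "wedge a wedge_unit vs = a vs"
  by (induction vs arbitrary: a) (simp_all add: wedge_Cons wedge_unit_def wedge_zero_right)

section \<open>Alternating forms\<close>

definition alternating :: "'n::finite covector \<Rightarrow> bool" where
  "alternating a \<longleftrightarrow>
     (\<forall>xs u v ys. a (xs @ (u + v) # ys) = a (xs @ u # ys) + a (xs @ v # ys)) \<and>
     (\<forall>xs r u ys. a (xs @ (r *\<^sub>R u) # ys) = of_real r * a (xs @ u # ys)) \<and>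
     (\<forall>xs u ys. a (xs @ u # u # ys) = 0)"

lemma alternatingD:
  assumes "alternating a"
  shows "a (xs @ (u + v) # ys) = a (xs @ u # ys) + a (xs @ v # ys)"
    and "a (xs @ (r *\<^sub>R u) # ys) = of_real r * a (xs @ u # ys)"
    and "a (xs @ u # u # ys) = 0"
  using assms by (auto simp: alternating_def)

lemma alternatingD_Cons:
  assumes "alternating a"
  shows "a ((u + v) # ys) = a (u # ys) + a (v # ys)"
    and "a ((r *\<^sub>R u) # ys) = of_real r * a (u # ys)"
    and "a (u # u # ys) = 0"
  using alternatingD [OF assms, of "[]"] by simp_all

lemma alternating_contract:
  assumes "alternating a" shows "alternating (\<lambda>xs. a (v # xs))"
  using alternatingD [OF assms, of "v # _"] by (simp add: alternating_def)

lemma alternating_sign: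
  assumes "alternating a" shows "alternating (\<lambda>xs. (-1) ^ length xs * a xs)"
  using assms by (simp add: alternating_def algebra_simps)

text \<open>
  By the recursion, both summands of \<open>wedge a b (x # xs)\<close> are wedge products of alternating
  covectors evaluated on the shorter list \<open>xs\<close>.
\<close>

lemma alternating_wedge:
  assumes "alternating a" "alternating b" shows "alternating (wedge a b)"
proof -
  have "wedge a b (xs @ (u + v) # ys) = wedge a b (xs @ u # ys) + wedge a b (xs @ v # ys)
        \<and> wedge a b (xs @ (r *\<^sub>R u) # ys) = of_real r * wedge a b (xs @ u # ys)
        \<and> wedge a b (xs @ u # u # ys) = 0" for xs u v ys and r :: real
    using assms
  proof (induction xs arbitrary: a b)
    case Nil
    note a = alternatingD_Cons [OF Nil(1)] and b = alternatingD_Cons [OF Nil(2)]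
    have neg: "(\<lambda>xs. (-1) ^ length (u # xs) * a (u # xs)) = (\<lambda>xs. (-1) * ((-1) ^ length xs * a (u # xs)))"
      by (auto simp: fun_eq_iff)
    have "wedge a b (u # u # ys) = 0"
      by (simp add: wedge_Cons a b wedge_zero_left wedge_zero_right
          wedge_scale_left [of "-1", simplified])
    moreover have "wedge a b ((u + v) # ys) = wedge a b (u # ys) + wedge a b (v # ys)"
      by (simp add: wedge_Cons a b wedge_add_left wedge_add_right)
    moreover have "wedge a b ((r *\<^sub>R u) # ys) = of_real r * wedge a b (u # ys)"
      by (simp add: wedge_Cons a b wedge_scale_left wedge_scale_right algebra_simps)
    ultimately show ?case by simp
  next
    case (Cons x xs)
    note IH1 = Cons.IH [OF alternating_contract [OF Cons.prems(1), of x] Cons.prems(2)]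
    note IH2 = Cons.IH [OF alternating_sign [OF Cons.prems(1)] alternating_contract [OF Cons.prems(2), of x]]
    show ?case
      using IH1 IH2 by (simp add: wedge_Cons algebra_simps)
  qed
  then show ?thesis by (auto simp: alternating_def)
qed

lemma alternating_wedge_unit: "alternating wedge_unit"
  by (simp add: alternating_def wedge_unit_def)

lemma alternating_wedge_list:
  assumes "\<And>a. a \<in> set as \<Longrightarrow> alternating a" shows "alternating (wedge_list as)"
  using assms by (induction as) (auto simp: wedge_list_Nil wedge_list_Cons alternating_wedge_unit alternating_wedge)

lemma alternating_swap:
  assumes "alternating a" shows "a (xs @ u # v # ys) = - a (xs @ v # u # ys)"
proof -
  have "0 = a (xs @ (u + v) # (u + v) # ys)" using alternatingD(3) [OF assms] by simp
  also have "\<dots> = a (xs @ u # (u + v) # ys) + a (xs @ v # (u + v) # ys)"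
    using alternatingD(1) [OF assms] by simp
  also have "\<dots> = a (xs @ u # v # ys) + a (xs @ v # u # ys)"
    using alternatingD(1) [OF assms, of "xs @ [u]" u v ys] alternatingD(1) [OF assms, of "xs @ [v]" u v ys]
      alternatingD(3) [OF assms] by simp
  finally show ?thesis by (simp add: eq_neg_iff_add_eq_0)
qed

lemma alternating_move_to_front:
  assumes "alternating a" shows "a (xs @ u # ys) = (-1) ^ length xs * a (u # xs @ ys)"
proof (induction xs arbitrary: ys rule: rev_induct)
  case (snoc x xs)
  then show ?case using alternating_swap [OF assms, of xs x u ys] by simp
qed simp

lemma alternating_perm_zero:
  assumes "mset xs = mset ys" "alternating a" "a xs = 0" shows "a ys = 0"
  using assms
proof (induction xs arbitrary: a ys)
  case (Cons x xs)
  then have "x \<in> set ys" by (metis list.set_intros(1) mset_eq_setD)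
  then obtain us vs where ys: "ys = us @ x # vs" by (meson split_list)
  then have "mset xs = mset (us @ vs)" using Cons.prems(1) by simp
  then have "a (x # (us @ vs)) = 0"
    using Cons.IH [of "us @ vs" "\<lambda>zs. a (x # zs)"] Cons.prems alternating_contract by blast
  then show ?case using alternating_move_to_front [OF Cons.prems(2), of us x vs] ys by simp
qed simp

lemma alternating_not_distinct:
  assumes "alternating a" "\<not> distinct xs" shows "a xs = 0"
proof -
  obtain us vs ws y where xs: "xs = us @ [y] @ vs @ [y] @ ws"
    using not_distinct_decomp [OF assms(2)] by blast
  have "mset (y # y # us @ vs @ ws) = mset xs" by (simp add: xs)
  then show ?thesis using alternating_perm_zero assms(1) alternatingD_Cons(3) [OF assms(1)] by metis
qed

text \<open>
  Expand one vector after the other in the basis \<open>bs\<close>; a list of basis vectors of full length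
  is a permutation of \<open>bs\<close> or has a repetition.
\<close>

lemma alternating_zero_on_basis:
  assumes "alternating a" "span (set bs) = UNIV" "distinct bs" "a bs = 0" "length vs = length bs"
  shows "a vs = 0"
proof -
  have "a (xs @ ys) = 0" if "set xs \<subseteq> set bs" "length (xs @ ys) = length bs" for xs ys
    using that
  proof (induction ys arbitrary: xs)
    case Nil
    show ?case
    proof (cases "distinct xs")
      case True
      then have "set xs = set bs"
        using Nil assms(3) by (metis append_Nil2 card_subset_eq distinct_card finite_set)
      then have "mset bs = mset xs" using True assms(3) by (metis set_eq_iff_mset_eq_distinct)
      then show ?thesis using alternating_perm_zero assms(1,4) by fastforce
    next
      case False
      then show ?thesis using alternating_not_distinct [OF assms(1)] by simp
    qed
  next
    case (Cons y ys)
    have "y \<in> span (set bs)" using assms(2) by simp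
    then show ?case
    proof (induction y rule: span_induct_alt)
      case base
      show ?case using alternatingD(2) [OF assms(1), of xs 0 0 ys] by simp
    next
      case (step c x y)
      have "a (xs @ x # ys) = 0"
        using Cons.IH [of "xs @ [x]"] Cons.prems step by simp
      then show ?case
        using step alternatingD [OF assms(1), of xs] by simp
    qed
  qed
  from this [of "[]" vs] show ?thesis using assms(5) by simp
qed

lemma alternating_combine:
  assumes "alternating a" "alternating b" shows "alternating (\<lambda>xs. c * a xs - d * b xs)"
  using assms by (simp add: alternating_def algebra_simps)

lemma alternating_top_proportional:
  assumes "alternating a" "alternating b" "span (set bs) = UNIV" "distinct bs" "length vs = length bs"
  shows "a vs * b bs = b vs * a bs"
proof -
  have "b bs * a vs - a bs * b vs = 0"
    by (rule alternating_zero_on_basis [OF alternating_combine [OF assms(1,2)] assms(3,4) _ assms(5)]) simp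
  then show ?thesis by (simp add: algebra_simps)
qed

section \<open>The canonical frame\<close>

definition index_list :: "'n::finite list" where
  "index_list = (SOME js. distinct js \<and> set js = UNIV)"

lemma index_list: "distinct (index_list :: 'n::finite list)" "set (index_list :: 'n list) = UNIV"
proof -
  have "\<exists>js. distinct js \<and> set js = (UNIV :: 'n set)"
    using finite_distinct_list [OF finite_class.finite_UNIV] by blast
  then have "distinct (index_list :: 'n list) \<and> set (index_list :: 'n list) = UNIV"
    unfolding index_list_def by (rule someI_ex)
  then show "distinct (index_list :: 'n::finite list)" "set (index_list :: 'n list) = UNIV" by auto
qed

lemma length_index_list: "length (index_list :: 'n::finite list) = CARD('n)"
  using index_list by (metis distinct_card)

definition frame :: "('n::finite \<Rightarrow> complex^'n) \<Rightarrow> (complex^'n) list" where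
  "frame e = concat (map (\<lambda>j. [e j, \<i> *s e j]) index_list)"

lemma canonical_frame_eq: "(canonical_frame :: (complex^'n::finite) list) = frame (\<lambda>j. axis j 1)"
proof -
  have "\<i> *s axis j 1 = axis j \<i>" for j :: 'n by (simp add: axis_def vec_eq_iff)
  then have "(\<lambda>j :: 'n. [axis j 1, axis j \<i>]) = (\<lambda>j. [axis j 1, \<i> *s axis j 1])" by (simp add: fun_eq_iff)
  then show ?thesis by (simp only: frame_def canonical_frame_def index_list_def)
qed

lemma set_frame: "set (frame e) = range e \<union> range (\<lambda>j. \<i> *s e j)"
  by (auto simp: frame_def index_list)

lemma length_frame: "length (frame (e :: 'n::finite \<Rightarrow> _)) = 2 * CARD('n)"
  by (simp add: frame_def length_concat o_def sum_list_triv length_index_list)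

lemma set_canonical_frame: "set (canonical_frame :: (complex^'n::finite) list) = Basis"
proof -
  have "\<i> *s axis j 1 = axis j \<i>" for j :: 'n by (simp add: axis_def vec_eq_iff)
  then show ?thesis
    unfolding canonical_frame_eq set_frame by (auto simp: Basis_vec_def Basis_complex_def)
qed

lemma distinct_canonical_frame: "distinct (canonical_frame :: (complex^'n::finite) list)"
proof (rule card_distinct)
  have "card (Basis :: (complex^'n) set) = 2 * CARD('n)" by simp
  moreover have "length (canonical_frame :: (complex^'n) list) = 2 * CARD('n)"
    unfolding canonical_frame_eq by (rule length_frame)
  ultimately show "card (set (canonical_frame :: (complex^'n) list)) = length (canonical_frame :: (complex^'n) list)"
    unfolding set_canonical_frame by (rule trans [OF _ sym])
qed

lemma smult_ii: "\<i> *s (\<i> *s v) = - v" for v :: "complex^'n::finite"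
  by (simp add: vec_eq_iff)

lemma smult_scaleR: "c *s (r *\<^sub>R v) = r *\<^sub>R (c *s v)" for v :: "complex^'n::finite"
  by (simp add: vec_eq_iff)

lemma smult_complex: "c *s v = Re c *\<^sub>R v + Im c *\<^sub>R (\<i> *s v)" for v :: "complex^'n::finite"
proof -
  have "c * x = Re c *\<^sub>R x + Im c *\<^sub>R (\<i> * x)" for x :: complex
    by (simp add: complex_eq_iff)
  then show ?thesis by (simp add: vec_eq_iff)
qed

lemma smult_add: "c *s (u + v) = c *s u + c *s v" for v :: "complex^'n::finite"
  by (simp add: vec_eq_iff algebra_simps)

section \<open>Forms of type (1,0), (2,0) and (1,1)\<close>

lemma alternating_linear2:
  assumes "alternating a"
  shows "linear (\<lambda>u. a [u, v])" "linear (\<lambda>v. a [u, v])"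
  using alternatingD_Cons [OF assms, where ys = "[v]"] alternatingD [OF assms, where xs = "[u]" and ys = "[]"]
  by (auto intro!: linearI simp: scaleR_conv_of_real)

lemma alternating_skew: "alternating a \<Longrightarrow> a [v, u] = - a [u, v]"
  using alternating_swap [of a "[]" v u "[]"] by simp

lemma alternating_sum:
  assumes "\<And>i. i \<in> S \<Longrightarrow> alternating (F i)"
  shows "alternating (\<lambda>vs. \<Sum>i\<in>S. c i * F i vs)"
proof -
  have "(\<Sum>i\<in>S. c i * F i (xs @ (u + v) # ys)) = (\<Sum>i\<in>S. c i * F i (xs @ u # ys)) + (\<Sum>i\<in>S. c i * F i (xs @ v # ys))"
    for xs u v ys
    unfolding sum.distrib [symmetric]
    by (rule sum.cong) (simp_all add: alternatingD(1) [OF assms] algebra_simps)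
  moreover have "(\<Sum>i\<in>S. c i * F i (xs @ (r *\<^sub>R u) # ys)) = of_real r * (\<Sum>i\<in>S. c i * F i (xs @ u # ys))" for xs r u ys
    unfolding sum_distrib_left
    by (rule sum.cong) (simp_all add: alternatingD(2) [OF assms] algebra_simps)
  moreover have "(\<Sum>i\<in>S. c i * F i (xs @ u # u # ys)) = 0" for xs u ys
    by (rule sum.neutral) (simp add: alternatingD(3) [OF assms])
  ultimately show ?thesis unfolding alternating_def by blast
qed

lemma dz_wrong_degree: "length xs \<noteq> 1 \<Longrightarrow> dz j xs = 0"
  by (auto simp: dz_def split: list.splits)

lemma dz_single [simp]: "dz j [v] = v $ j"
  by (simp add: dz_def)

lemma alternating_deg1:
  assumes "\<And>xs. length xs \<noteq> 1 \<Longrightarrow> a xs = 0" "linear (\<lambda>v. a [v])"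
  shows "alternating a"
proof -
  have "a (xs @ (u + v) # ys) = a (xs @ u # ys) + a (xs @ v # ys)" for xs u v ys
    using assms(1) linear_add [OF assms(2), of u v] by (cases "length (xs @ u # ys) = 1") auto
  moreover have "a (xs @ (r *\<^sub>R u) # ys) = of_real r * a (xs @ u # ys)" for xs r u ys
    using assms(1) linear_scale [OF assms(2), of r u]
    by (cases "length (xs @ u # ys) = 1") (auto simp: scaleR_conv_of_real)
  moreover have "a (xs @ u # u # ys) = 0" for xs u ys
    using assms(1) by simp
  ultimately show ?thesis unfolding alternating_def by blast
qed

lemma alternating_dz: "alternating (dz j)"
  by (rule alternating_deg1) (auto simp: dz_wrong_degree intro!: linearI)

lemma alternating_cnj: "alternating a \<Longrightarrow> alternating (cnj_covector a)"
  by (simp add: alternating_def cnj_covector_def)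

lemma alternating_scale: "alternating a \<Longrightarrow> alternating (\<lambda>vs. c * a vs)"
  by (simp add: alternating_def algebra_simps)

lemma alternating_add: "alternating a \<Longrightarrow> alternating b \<Longrightarrow> alternating (\<lambda>vs. a vs + b vs)"
  by (simp add: alternating_def algebra_simps)

lemma pq_alternating: "a \<in> pq_covectors p q \<Longrightarrow> alternating a"
proof -
  assume "a \<in> pq_covectors p q"
  then obtain f where a: "a = (\<lambda>vs. \<Sum>(I, J) \<in> {I. length I = p} \<times> {J. length J = q}.
                  f I J * wedge_list (map dz I @ map (\<lambda>j. cnj_covector (dz j)) J) vs)"
    by (auto simp: pq_covectors_def)
  have "alternating (\<lambda>vs. \<Sum>IJ \<in> {I. length I = p} \<times> {J. length J = q}.
          (\<lambda>(I, J). f I J) IJ * (\<lambda>(I, J). wedge_list (map dz I @ map (\<lambda>j. cnj_covector (dz j)) J)) IJ vs)"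
    by (rule alternating_sum) (auto intro!: alternating_wedge_list alternating_dz alternating_cnj)
  then show ?thesis by (simp add: a case_prod_unfold)
qed

lemma sum_index_lists_1_0:
  "(\<Sum>(I, J) \<in> {I :: 'n::finite list. length I = 1} \<times> {J :: 'n list. length J = 0}. F I J) = (\<Sum>j\<in>UNIV. F [j] [])"
  by (rule sum.reindex_bij_witness [where i = "\<lambda>j. ([j], [])" and j = "\<lambda>(I, J). hd I"])
     (auto simp: length_Suc_conv)

lemma sum_index_lists_2_0:
  "(\<Sum>(I, J) \<in> {I :: 'n::finite list. length I = 2} \<times> {J :: 'n list. length J = 0}. F I J) = (\<Sum>(j, k)\<in>UNIV. F [j, k] [])"
  by (rule sum.reindex_bij_witness [where i = "\<lambda>(j, k). ([j, k], [])" and j = "\<lambda>(I, J). (hd I, hd (tl I))"])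
     (auto simp: length_Suc_conv numeral_2_eq_2)

lemma sum_index_lists_1_1:
  "(\<Sum>(I, J) \<in> {I :: 'n::finite list. length I = 1} \<times> {J :: 'n list. length J = 1}. F I J) = (\<Sum>(j, k)\<in>UNIV. F [j] [k])"
  by (rule sum.reindex_bij_witness [where i = "\<lambda>(j, k). ([j], [k])" and j = "\<lambda>(I, J). (hd I, hd J)"])
     (auto simp: length_Suc_conv)

lemma cnj_covector_single [simp]: "cnj_covector a vs = cnj (a vs)"
  by (simp add: cnj_covector_def)

lemma wedge_list_two:
  assumes "\<And>xs. length xs \<noteq> 1 \<Longrightarrow> a xs = 0" "\<And>xs. length xs \<noteq> 1 \<Longrightarrow> b xs = 0"
  shows "wedge_list [a, b] vs = (if length vs = 2 then a [vs ! 0] * b [vs ! 1] - a [vs ! 1] * b [vs ! 0] else 0)"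
proof -
  have "wedge b wedge_unit = b" by (simp add: fun_eq_iff wedge_unit_right)
  then show ?thesis unfolding wedge_list_Cons wedge_list_Nil using wedge_deg1_deg1 [of a b vs, OF assms] by metis
qed

lemma pq_covectors_1_0_eq:
  "pq_covectors 1 0 = {a :: 'n::finite covector. \<exists>f. a = (\<lambda>vs. \<Sum>j\<in>UNIV. f j * dz j vs)}"
proof -
  have "wedge_list [dz j] = dz j" for j :: 'n
    by (simp add: wedge_list_Cons wedge_list_Nil fun_eq_iff wedge_unit_right)
  then have "pq_covectors 1 0 = {a :: 'n covector. \<exists>f. a = (\<lambda>vs. \<Sum>j\<in>UNIV. f [j] ([] :: 'n list) * dz j vs)}"
    unfolding pq_covectors_def sum_index_lists_1_0 by simp
  also have "\<dots> = {a :: 'n covector. \<exists>f. a = (\<lambda>vs. \<Sum>j\<in>UNIV. f j * dz j vs)}"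
  proof (intro Collect_cong iffI; elim exE)
    fix a :: "'n covector" and f assume "a = (\<lambda>vs. \<Sum>j\<in>UNIV. f j * dz j vs)"
    then show "\<exists>f. a = (\<lambda>vs. \<Sum>j\<in>UNIV. f [j] ([] :: 'n list) * dz j vs)"
      by (intro exI [of _ "\<lambda>I J. f (hd I)"]) simp
  next
    fix a :: "'n covector" and f assume "a = (\<lambda>vs. \<Sum>j\<in>UNIV. f [j] ([] :: 'n list) * dz j vs)"
    then show "\<exists>f. a = (\<lambda>vs. \<Sum>j\<in>UNIV. f j * dz j vs)"
      by (intro exI [of _ "\<lambda>j. f [j] []"])
  qed
  finally show ?thesis .
qed

lemma pq_covectors_2_0_eq:
  "pq_covectors 2 0 = {a :: 'n::finite covector. \<exists>f. a = (\<lambda>vs. if length vs = 2 then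
      \<Sum>(j, k)\<in>UNIV. f j k * (vs ! 0 $ j * vs ! 1 $ k - vs ! 1 $ j * vs ! 0 $ k) else 0)}"
proof -
  have w: "wedge_list [dz j, dz k] vs = (if length vs = 2 then vs ! 0 $ j * vs ! 1 $ k - vs ! 1 $ j * vs ! 0 $ k else 0)"
    for j k :: 'n and vs by (subst wedge_list_two) (simp_all add: dz_wrong_degree)
  have "pq_covectors 2 0 = {a :: 'n covector. \<exists>f. a = (\<lambda>vs. \<Sum>(j, k)\<in>UNIV. f [j, k] ([] :: 'n list) * wedge_list [dz j, dz k] vs)}"
    unfolding pq_covectors_def sum_index_lists_2_0 by simp
  also have "\<dots> = {a :: 'n covector. \<exists>f. a = (\<lambda>vs. \<Sum>(j, k)\<in>UNIV. f j k * wedge_list [dz j, dz k] vs)}"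
  proof (intro Collect_cong iffI; elim exE)
    fix a :: "'n covector" and f assume "a = (\<lambda>vs. \<Sum>(j, k)\<in>UNIV. f j k * wedge_list [dz j, dz k] vs)"
    then show "\<exists>f. a = (\<lambda>vs. \<Sum>(j, k)\<in>UNIV. f [j, k] ([] :: 'n list) * wedge_list [dz j, dz k] vs)"
      by (intro exI [of _ "\<lambda>I J. f (hd I) (hd (tl I))"]) simp
  next
    fix a :: "'n covector" and f assume "a = (\<lambda>vs. \<Sum>(j, k)\<in>UNIV. f [j, k] ([] :: 'n list) * wedge_list [dz j, dz k] vs)"
    then show "\<exists>f. a = (\<lambda>vs. \<Sum>(j, k)\<in>UNIV. f j k * wedge_list [dz j, dz k] vs)"
      by (intro exI [of _ "\<lambda>j k. f [j, k] []"])
  qed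
  also have "\<dots> = {a :: 'n covector. \<exists>f. a = (\<lambda>vs. if length vs = 2 then
      \<Sum>(j, k)\<in>UNIV. f j k * (vs ! 0 $ j * vs ! 1 $ k - vs ! 1 $ j * vs ! 0 $ k) else 0)}"
  proof -
    have "(\<lambda>vs. \<Sum>(j, k)\<in>UNIV. f j k * wedge_list [dz j, dz k] vs) = (\<lambda>vs. if length vs = 2 then
      \<Sum>(j, k)\<in>UNIV. f j k * (vs ! 0 $ j * vs ! 1 $ k - vs ! 1 $ j * vs ! 0 $ k) else 0)" for f :: "'n \<Rightarrow> 'n \<Rightarrow> complex"
      by (rule ext) (simp add: w)
    then show ?thesis by simp
  qed
  finally show ?thesis .
qed

lemma pq_covectors_1_1_eq:
  "pq_covectors 1 1 = {a :: 'n::finite covector. \<exists>f. a = (\<lambda>vs. if length vs = 2 then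
      \<Sum>(j, k)\<in>UNIV. f j k * (vs ! 0 $ j * cnj (vs ! 1 $ k) - vs ! 1 $ j * cnj (vs ! 0 $ k)) else 0)}"
proof -
  have w: "wedge_list [dz j, cnj_covector (dz k)] vs =
      (if length vs = 2 then vs ! 0 $ j * cnj (vs ! 1 $ k) - vs ! 1 $ j * cnj (vs ! 0 $ k) else 0)"
    for j k :: 'n and vs by (subst wedge_list_two) (simp_all add: dz_wrong_degree)
  have "pq_covectors 1 1 = {a :: 'n covector. \<exists>f. a = (\<lambda>vs. \<Sum>(j, k)\<in>UNIV. f [j] [k] * wedge_list [dz j, cnj_covector (dz k)] vs)}"
    unfolding pq_covectors_def sum_index_lists_1_1 by simp
  also have "\<dots> = {a :: 'n covector. \<exists>f. a = (\<lambda>vs. \<Sum>(j, k)\<in>UNIV. f j k * wedge_list [dz j, cnj_covector (dz k)] vs)}"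
  proof (intro Collect_cong iffI; elim exE)
    fix a :: "'n covector" and f assume "a = (\<lambda>vs. \<Sum>(j, k)\<in>UNIV. f j k * wedge_list [dz j, cnj_covector (dz k)] vs)"
    then show "\<exists>f. a = (\<lambda>vs. \<Sum>(j, k)\<in>UNIV. f [j] [k] * wedge_list [dz j, cnj_covector (dz k)] vs)"
      by (intro exI [of _ "\<lambda>I J. f (hd I) (hd J)"]) simp
  next
    fix a :: "'n covector" and f assume "a = (\<lambda>vs. \<Sum>(j, k)\<in>UNIV. f [j] [k] * wedge_list [dz j, cnj_covector (dz k)] vs)"
    then show "\<exists>f. a = (\<lambda>vs. \<Sum>(j, k)\<in>UNIV. f j k * wedge_list [dz j, cnj_covector (dz k)] vs)"
      by (intro exI [of _ "\<lambda>j k. f [j] [k]"])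
  qed
  also have "\<dots> = {a :: 'n covector. \<exists>f. a = (\<lambda>vs. if length vs = 2 then
      \<Sum>(j, k)\<in>UNIV. f j k * (vs ! 0 $ j * cnj (vs ! 1 $ k) - vs ! 1 $ j * cnj (vs ! 0 $ k)) else 0)}"
  proof -
    have "(\<lambda>vs. \<Sum>(j, k)\<in>UNIV. f j k * wedge_list [dz j, cnj_covector (dz k)] vs) = (\<lambda>vs. if length vs = 2 then
      \<Sum>(j, k)\<in>UNIV. f j k * (vs ! 0 $ j * cnj (vs ! 1 $ k) - vs ! 1 $ j * cnj (vs ! 0 $ k)) else 0)" for f :: "'n \<Rightarrow> 'n \<Rightarrow> complex"
      by (rule ext) (simp add: w)
    then show ?thesis by simp
  qed
  finally show ?thesis .
qed

lemma list_length2: "length vs = 2 \<Longrightarrow> vs = [vs ! 0, vs ! 1]"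
  by (auto simp: numeral_2_eq_2 length_Suc_conv)

lemma vec_expansion: "v = (\<Sum>j\<in>UNIV. v $ j *s axis j 1)" for v :: "complex^'n::finite"
  by (simp add: vec_eq_iff axis_def if_distrib [of "(*) _"] cong: if_cong)

lemma complex_linear_expansion:
  fixes f :: "complex^'n::finite \<Rightarrow> complex"
  assumes "linear f" "\<And>v. f (\<i> *s v) = \<i> * f v"
  shows "f v = (\<Sum>j\<in>UNIV. v $ j * f (axis j 1))"
proof -
  have s: "f (c *s v) = c * f v" for c v
  proof -
    have "f (c *s v) = Re c *\<^sub>R f v + Im c *\<^sub>R (\<i> * f v)"
      by (subst smult_complex) (simp add: linear_add [OF assms(1)] linear_scale [OF assms(1)] assms(2))
    also have "\<dots> = c * f v" by (simp add: complex_eq_iff)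
    finally show ?thesis .
  qed
  have "f v = f (\<Sum>j\<in>UNIV. v $ j *s axis j 1)" using vec_expansion [of v] by simp
  also have "\<dots> = (\<Sum>j\<in>UNIV. v $ j * f (axis j 1))"
    by (simp add: linear_sum [OF assms(1)] s)
  finally show ?thesis .
qed

lemma complex_antilinear_expansion:
  fixes f :: "complex^'n::finite \<Rightarrow> complex"
  assumes "linear f" "\<And>v. f (\<i> *s v) = - \<i> * f v"
  shows "f v = (\<Sum>j\<in>UNIV. cnj (v $ j) * f (axis j 1))"
proof -
  have "linear (\<lambda>v. cnj (f v))"
    using assms(1) by (intro linearI) (simp_all add: linear_add linear_scale)
  then have "cnj (f v) = (\<Sum>j\<in>UNIV. v $ j * cnj (f (axis j 1)))"
    by (rule complex_linear_expansion) (simp add: assms(2))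
  then have "cnj (cnj (f v)) = (\<Sum>j\<in>UNIV. cnj (v $ j) * f (axis j 1))"
    by (simp only: cnj_sum complex_cnj_mult complex_cnj_cnj)
  then show ?thesis by simp
qed

text \<open>
  The next three characterizations make the type of a covector a matter of how it reacts to
  multiplication by \<open>\<i>\<close>.  Types are thereby preserved by complex-linear pull-backs and by
  limits, which is not visible in the definition by coefficients.
\<close>

lemma pq_1_0_iff:
  fixes a :: "'n::finite covector"
  shows "a \<in> pq_covectors 1 0 \<longleftrightarrow>
    (\<forall>xs. length xs \<noteq> 1 \<longrightarrow> a xs = 0) \<and> linear (\<lambda>v. a [v]) \<and> (\<forall>v. a [\<i> *s v] = \<i> * a [v])"
    (is "_ \<longleftrightarrow> ?R")
proof
  assume "a \<in> pq_covectors 1 0"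
  then obtain f where a: "a = (\<lambda>vs. \<Sum>j\<in>UNIV. f j * dz j vs)" unfolding pq_covectors_1_0_eq by auto
  have "linear (\<lambda>v. a [v])"
    by (intro linearI) (simp_all add: a algebra_simps sum.distrib scaleR_sum_right)
  then show ?R by (simp add: a dz_wrong_degree sum_distrib_left algebra_simps)
next
  assume R: ?R
  have "a vs = (\<Sum>j\<in>UNIV. a [axis j 1] * dz j vs)" for vs
  proof (cases "length vs = 1")
    case True
    then obtain v where "vs = [v]" by (auto simp: length_Suc_conv)
    then show ?thesis
      using complex_linear_expansion [of "\<lambda>v. a [v]" v] R by (simp add: mult.commute)
  qed (use R in \<open>simp add: dz_wrong_degree\<close>)
  then show "a \<in> pq_covectors 1 0" unfolding pq_covectors_1_0_eq
    by (intro CollectI exI [of _ "\<lambda>j. a [axis j 1]"]) (rule ext)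
qed

lemma pq_2_0_iff:
  fixes a :: "'n::finite covector"
  shows "a \<in> pq_covectors 2 0 \<longleftrightarrow>
    alternating a \<and> (\<forall>xs. length xs \<noteq> 2 \<longrightarrow> a xs = 0) \<and> (\<forall>u v. a [\<i> *s u, v] = \<i> * a [u, v])"
    (is "_ \<longleftrightarrow> ?R")
proof
  assume L: "a \<in> pq_covectors 2 0"
  then obtain f where a: "a = (\<lambda>vs. if length vs = 2 then
      \<Sum>(j, k)\<in>UNIV. f j k * (vs ! 0 $ j * vs ! 1 $ k - vs ! 1 $ j * vs ! 0 $ k) else 0)"
    by (auto simp: pq_covectors_2_0_eq)
  have "a [\<i> *s u, v] = \<i> * a [u, v]" for u v
    by (simp add: a sum_distrib_left case_prod_unfold algebra_simps)
  then show ?R using pq_alternating [OF L] by (simp add: a)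
next
  assume R: ?R
  have i2: "a [u, \<i> *s v] = \<i> * a [u, v]" for u v
    using R alternating_skew [of a u "\<i> *s v"] alternating_skew [of a u v] by simp
  have "a [u, v] = (\<Sum>(j, k)\<in>UNIV. a [axis j 1, axis k 1] / 2 * (u $ j * v $ k - v $ j * u $ k))" for u v
  proof -
    have X1: "a [u, v] = (\<Sum>j\<in>UNIV. u $ j * a [axis j 1, v])" for u v
      by (rule complex_linear_expansion) (use R alternating_linear2 in auto)
    have X2: "a [u, v] = (\<Sum>k\<in>UNIV. v $ k * a [u, axis k 1])" for u v
      by (rule complex_linear_expansion) (use R i2 alternating_linear2 in auto)
    have e: "a [u, v] = (\<Sum>j\<in>UNIV. \<Sum>k\<in>UNIV. a [axis j 1, axis k 1] * (u $ j * v $ k))" for u v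
      unfolding X1 [of u v]
      by (intro sum.cong refl) (subst X2 [of _ v], simp add: sum_distrib_left algebra_simps)
    have "a [u, v] = (a [u, v] - a [v, u]) / 2" using R alternating_skew [of a u v] by simp
    also have "\<dots> = (\<Sum>j\<in>UNIV. \<Sum>k\<in>UNIV. a [axis j 1, axis k 1] / 2 * (u $ j * v $ k - v $ j * u $ k))"
      unfolding e [of u v] e [of v u] sum_subtractf [symmetric] sum_divide_distrib
      by (intro sum.cong refl) (simp add: field_simps)
    finally show ?thesis by (simp add: sum.cartesian_product)
  qed
  then have "a vs = (if length vs = 2 then
      \<Sum>(j, k)\<in>UNIV. a [axis j 1, axis k 1] / 2 * (vs ! 0 $ j * vs ! 1 $ k - vs ! 1 $ j * vs ! 0 $ k) else 0)" for vs
    using R list_length2 [of vs] by metis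
  then show "a \<in> pq_covectors 2 0" unfolding pq_covectors_2_0_eq
    by (intro CollectI exI [of _ "\<lambda>j k. a [axis j 1, axis k 1] / 2"]) (rule ext)
qed

text \<open>
  An \<open>\<i>\<close>-invariant alternating form is the skew part of the sesquilinear form
  \<open>s u v = (a [u, v] + \<i> * a [u, \<i> *s v]) / 2\<close>, whose coefficients are those of \<open>a\<close>.
\<close>

lemma pq_1_1_iff:
  fixes a :: "'n::finite covector"
  shows "a \<in> pq_covectors 1 1 \<longleftrightarrow>
    alternating a \<and> (\<forall>xs. length xs \<noteq> 2 \<longrightarrow> a xs = 0) \<and> (\<forall>u v. a [\<i> *s u, \<i> *s v] = a [u, v])"
    (is "_ \<longleftrightarrow> ?R")
proof
  assume L: "a \<in> pq_covectors 1 1"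
  then obtain f where a: "a = (\<lambda>vs. if length vs = 2 then
      \<Sum>(j, k)\<in>UNIV. f j k * (vs ! 0 $ j * cnj (vs ! 1 $ k) - vs ! 1 $ j * cnj (vs ! 0 $ k)) else 0)"
    unfolding pq_covectors_1_1_eq by auto
  have "a [\<i> *s u, \<i> *s v] = a [u, v]" for u v
    by (simp add: a case_prod_unfold algebra_simps)
  then show ?R using pq_alternating [OF L] by (simp add: a)
next
  assume R: ?R
  then have alt: "alternating a" by blast
  note lin = alternating_linear2 [OF alt]
  have ii: "a [\<i> *s u, \<i> *s v] = a [u, v]" for u v using R by blast
  have i1: "a [\<i> *s u, v] = - a [u, \<i> *s v]" for u v
    using ii [of "\<i> *s u" v] linear_neg [OF lin(1) [of "\<i> *s v"], of u] by (simp add: smult_ii)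
  have m2: "a [u, - v] = - a [u, v]" "a [- u, v] = - a [u, v]" for u v
    using linear_neg [OF lin(2)] linear_neg [OF lin(1)] by blast+
  define s where "s u v = (a [u, v] + \<i> * a [u, \<i> *s v]) / 2" for u v
  have s_lin: "linear (\<lambda>u. s u v)" "linear (\<lambda>v. s u v)" for u v
    unfolding s_def
    by (auto intro!: linearI simp: linear_add [OF lin(1)] linear_add [OF lin(2)] linear_scale [OF lin(1)]
        linear_scale [OF lin(2)] smult_add smult_scaleR scaleR_conv_of_real [where 'a = complex] distrib_left
        add_divide_distrib mult.left_commute)
  have s1: "s (\<i> *s u) v = \<i> * s u v" for u v
    unfolding s_def i1 [of u v] ii by (simp add: algebra_simps)
  have s2: "s u (\<i> *s v) = - \<i> * s u v" for u v
    unfolding s_def smult_ii m2 by (simp add: algebra_simps)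
  have X1: "s u v = (\<Sum>j\<in>UNIV. u $ j * s (axis j 1) v)" for u v
    by (rule complex_linear_expansion) (use s_lin s1 in auto)
  have X2: "s u v = (\<Sum>k\<in>UNIV. cnj (v $ k) * s u (axis k 1))" for u v
    by (rule complex_antilinear_expansion) (use s_lin s2 in auto)
  have e: "s u v = (\<Sum>j\<in>UNIV. \<Sum>k\<in>UNIV. s (axis j 1) (axis k 1) * (u $ j * cnj (v $ k)))" for u v
    unfolding X1 [of u v]
    by (intro sum.cong refl) (subst X2 [of _ v], simp add: sum_distrib_left algebra_simps)
  have "a [u, v] = (\<Sum>(j, k)\<in>UNIV. s (axis j 1) (axis k 1) * (u $ j * cnj (v $ k) - v $ j * cnj (u $ k)))" for u v
  proof -
    have "a [u, v] = s u v - s v u"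
      using alternating_skew [OF alt, of u v] alternating_skew [OF alt, of "\<i> *s u" v] i1 [of u v]
      by (simp add: s_def field_simps)
    also have "\<dots> = (\<Sum>j\<in>UNIV. \<Sum>k\<in>UNIV. s (axis j 1) (axis k 1) * (u $ j * cnj (v $ k) - v $ j * cnj (u $ k)))"
      unfolding e [of u v] e [of v u] sum_subtractf [symmetric]
      by (intro sum.cong refl) (simp add: field_simps)
    finally show ?thesis by (simp add: sum.cartesian_product)
  qed
  then have "a vs = (if length vs = 2 then
      \<Sum>(j, k)\<in>UNIV. s (axis j 1) (axis k 1) * (vs ! 0 $ j * cnj (vs ! 1 $ k) - vs ! 1 $ j * cnj (vs ! 0 $ k)) else 0)" for vs
    using R list_length2 [of vs] by metis
  then show "a \<in> pq_covectors 1 1" unfolding pq_covectors_1_1_eq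
    by (intro CollectI exI [of _ "\<lambda>j k. s (axis j 1) (axis k 1)"]) (rule ext)
qed

section \<open>Simultaneous diagonalization of hermitian forms\<close>

text \<open>
  The real part of a hermitian form in the complex sense, that is, a symmetric real bilinear form
  which is invariant under multiplication by \<open>\<i>\<close>.
\<close>

definition hermitian_form :: "(complex^'n::finite \<Rightarrow> complex^'n \<Rightarrow> real) \<Rightarrow> bool" where
  "hermitian_form g \<longleftrightarrow> bilinear g \<and> (\<forall>u v. g u v = g v u) \<and> (\<forall>u v. g (\<i> *s u) (\<i> *s v) = g u v)"

definition positive_form :: "(complex^'n::finite \<Rightarrow> complex^'n \<Rightarrow> real) \<Rightarrow> bool" where
  "positive_form g \<longleftrightarrow> hermitian_form g \<and> (\<forall>v. v \<noteq> 0 \<longrightarrow> g v v > 0)"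

lemma hermitian_formD:
  assumes "hermitian_form g"
  shows "linear (\<lambda>u. g u v)" "linear (g u)" "g u v = g v u" "g (\<i> *s u) (\<i> *s v) = g u v"
    "g (\<i> *s u) v = - g u (\<i> *s v)" "g u (\<i> *s u) = 0" "g (\<i> *s u) u = 0"
proof -
  show lin: "linear (\<lambda>u. g u v)" "linear (g u)" for u v using assms by (auto simp: hermitian_form_def bilinear_def)
  show sym: "g u v = g v u" and ii: "g (\<i> *s u) (\<i> *s v) = g u v" for u v
    using assms by (auto simp: hermitian_form_def)
  show i1: "g (\<i> *s u) v = - g u (\<i> *s v)" for u v
    using ii [of "\<i> *s u" v] linear_neg [OF lin(1) [of "\<i> *s v"], of u] by (simp add: smult_ii)
  show "g u (\<i> *s u) = 0" "g (\<i> *s u) u = 0" for u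
    using i1 [of u u] sym [of u "\<i> *s u"] by simp_all
qed

lemmas hermitian_linear_simps =
  linear_add [OF hermitian_formD(1)] linear_add [OF hermitian_formD(2)]
  linear_diff [OF hermitian_formD(1)] linear_diff [OF hermitian_formD(2)]
  linear_scale [OF hermitian_formD(1)] linear_scale [OF hermitian_formD(2)]
  linear_sum [OF hermitian_formD(1)] linear_sum [OF hermitian_formD(2)]

text \<open>
  The first order condition at a maximum.
\<close>

lemma quadratic_nonpos_imp_zero:
  fixes c d :: real assumes "\<And>t. 2 * t * c + t\<^sup>2 * d \<le> 0" shows "c = 0"
proof (rule ccontr)
  assume "c \<noteq> 0"
  define D where "D = \<bar>d\<bar> + 1"
  have D: "D > 0" "2 * D + d > 0" by (auto simp: D_def)
  have "2 * (c / D) * c + (c / D)\<^sup>2 * d = (c\<^sup>2 * (2 * D + d)) / D\<^sup>2"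
    using D by (simp add: field_simps power2_eq_square)
  also have "\<dots> > 0" using D \<open>c \<noteq> 0\<close> by simp
  finally show False using assms [of "c / D"] by simp
qed

text \<open>
  One step of the spectral theorem.  On the complex orthogonal complement \<open>W\<close> of the eigenvectors
  found so far, the quotient \<open>h v v / g v v\<close> attains its maximum \<open>m\<close> at some \<open>w\<close>; varying \<open>w\<close> inside
  \<open>W\<close> shows that \<open>w\<close> is an eigenvector for \<open>m\<close> against all vectors of \<open>W\<close>, and
  the earlier eigenvectors are orthogonal to \<open>w\<close> for both forms.
\<close>

lemma eigenvector_extend:
  fixes g h :: "complex^'n::finite \<Rightarrow> complex^'n \<Rightarrow> real"
  assumes g: "positive_form g" and h: "hermitian_form h" and k: "k < CARD('n)"
    and on: "\<And>i j. i < k \<Longrightarrow> j < k \<Longrightarrow> g (e i) (e j) = (if i = j then 1 else 0)"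
      "\<And>i j. i < k \<Longrightarrow> j < k \<Longrightarrow> g (e i) (\<i> *s e j) = 0"
    and eig: "\<And>i v. i < k \<Longrightarrow> h (e i) v = l i * g (e i) v"
  shows "\<exists>w m. g w w = 1 \<and> (\<forall>i<k. g w (e i) = 0 \<and> g w (\<i> *s e i) = 0) \<and> (\<forall>v. h w v = m * g w v)"
proof -
  have hg: "hermitian_form g" and pos: "\<And>v. v \<noteq> 0 \<Longrightarrow> g v v > 0" using g by (auto simp: positive_form_def)
  note G = hermitian_formD [OF hg] and H = hermitian_formD [OF h]
  note Gs = hermitian_linear_simps [OF hg] and Hs = hermitian_linear_simps [OF h]
  define F where "F = e ` {..<k} \<union> (\<lambda>i. \<i> *s e i) ` {..<k}"
  define P where "P x = (\<Sum>i<k. g x (e i) *\<^sub>R e i + g x (\<i> *s e i) *\<^sub>R (\<i> *s e i))" for x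
  define W where "W = {v. \<forall>i<k. g v (e i) = 0 \<and> g v (\<i> *s e i) = 0}"
  have on': "g (\<i> *s e i) (e j) = 0" if "i < k" "j < k" for i j
    using on(2) that G(5) by simp
  have "span F \<noteq> UNIV"
  proof
    assume "span F = UNIV"
    then have "DIM(complex^'n) = dim F" by (metis dim_UNIV dim_span)
    also have "\<dots> \<le> card F" by (rule dim_le_card') (simp add: F_def)
    also have "\<dots> \<le> card (e ` {..<k}) + card ((\<lambda>i. \<i> *s e i) ` {..<k})" unfolding F_def by (rule card_Un_le)
    also have "\<dots> \<le> k + k" using card_image_le [of "{..<k}" e] card_image_le [of "{..<k}" "\<lambda>i. \<i> *s e i"] by simp
    finally show False using k by simp
  qed
  then obtain x0 where x0: "x0 \<notin> span F" by blast
  have PF: "P x \<in> span F" for x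
    unfolding P_def F_def
    by (intro span_sum span_add span_scale) (auto intro: span_base)
  have PW: "x - P x \<in> W" for x
  proof -
    have "g (P x) (e j) = g x (e j)" "g (P x) (\<i> *s e j) = g x (\<i> *s e j)" if j: "j < k" for j
    proof -
      have "g (P x) (e j) = (\<Sum>i<k. g x (e i) * g (e i) (e j) + g x (\<i> *s e i) * g (\<i> *s e i) (e j))"
        by (simp add: P_def Gs)
      also have "\<dots> = (\<Sum>i<k. if i = j then g x (e j) else 0)"
        by (rule sum.cong) (use on on' j in auto)
      finally show "g (P x) (e j) = g x (e j)" using j by simp
      have "g (P x) (\<i> *s e j) = (\<Sum>i<k. g x (e i) * g (e i) (\<i> *s e j) + g x (\<i> *s e i) * g (\<i> *s e i) (\<i> *s e j))"
        by (simp add: P_def Gs)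
      also have "\<dots> = (\<Sum>i<k. if i = j then g x (\<i> *s e j) else 0)"
        by (rule sum.cong) (use on G(4) j in auto)
      finally show "g (P x) (\<i> *s e j) = g x (\<i> *s e j)" using j by simp
    qed
    then show ?thesis by (simp add: W_def Gs)
  qed
  have Wscale: "r *\<^sub>R v \<in> W" if "v \<in> W" for r v using that by (simp add: W_def Gs)
  have "bounded_bilinear g" "bounded_bilinear h"
    using hg h bilinear_conv_bounded_bilinear by (auto simp: hermitian_form_def)
  note bb = this
  have cont: "continuous_on A (\<lambda>v. g v v)" "continuous_on A (\<lambda>v. h v v)" "continuous_on A (\<lambda>v. g v u)" for A u
    by (rule bounded_bilinear.continuous_on [OF bb(1) continuous_on_id continuous_on_id],
        rule bounded_bilinear.continuous_on [OF bb(2) continuous_on_id continuous_on_id],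
        rule bounded_bilinear.continuous_on [OF bb(1) continuous_on_id continuous_on_const])
  have "closed W"
  proof -
    have "W = (\<Inter>i\<in>{..<k}. {v. g v (e i) = 0} \<inter> {v. g v (\<i> *s e i) = 0})" by (auto simp: W_def)
    moreover have "closed {v. g v u = 0}" for u
      by (rule closed_Collect_eq) (auto intro: cont)
    ultimately show ?thesis by (auto intro!: closed_INT closed_Int)
  qed
  define S where "S = W \<inter> sphere 0 1"
  have "compact S" unfolding S_def using \<open>closed W\<close> by (simp add: closed_Int_compact)
  have norm_S: "(1 / norm v) *\<^sub>R v \<in> S" if "v \<in> W" "v \<noteq> 0" for v
    using that Wscale by (simp add: S_def)
  have "x0 - P x0 \<noteq> 0" using x0 PF [of x0] by auto
  then have "S \<noteq> {}" using norm_S [OF PW] by blast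
  have nz: "v \<noteq> 0" if "v \<in> S" for v using that by (auto simp: S_def)
  have "continuous_on S (\<lambda>v. h v v / g v v)"
    by (intro continuous_intros cont) (use nz pos in fastforce)
  \<comment> \<open>The maximum of the Rayleigh quotient on the unit sphere of the complement.\<close>
  then obtain w0 where w0: "w0 \<in> S" "\<And>v. v \<in> S \<Longrightarrow> h v v / g v v \<le> h w0 w0 / g w0 w0"
    using continuous_attains_sup [OF \<open>compact S\<close> \<open>S \<noteq> {}\<close>] by blast
  define m where "m = h w0 w0 / g w0 w0"
  have m: "h v v \<le> m * g v v" if "v \<in> W" for v
  proof (cases "v = 0")
    case True
    have "g 0 0 = 0" "h 0 0 = 0" using linear_0 [OF G(2)] linear_0 [OF H(2)] by auto
    then show ?thesis using True by simp
  next
    case False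
    then have "h v v / g v v \<le> m"
      using w0(2) [OF norm_S [OF that False]] by (simp add: m_def Gs Hs)
    then show ?thesis using pos [OF False] by (simp add: field_simps)
  qed
  have g0: "g w0 w0 > 0" using w0 nz pos by blast
  define w where "w = (1 / sqrt (g w0 w0)) *\<^sub>R w0"
  have wW: "w \<in> W" using w0 by (auto simp: w_def S_def intro: Wscale)
  have gw: "g w w = 1" using g0 by (simp add: w_def Gs field_simps)
  have hw: "h w w = m" using g0 by (simp add: w_def Hs m_def field_simps)
  have eqW: "h w y = m * g w y" if y: "y \<in> W" for y
  proof -
    \<comment> \<open>The inequality \<open>h \<le> m g\<close> at \<open>w + t y\<close>, with equality at \<open>t = 0\<close>.\<close>
    have "2 * t * (h w y - m * g w y) + t\<^sup>2 * (h y y - m * g y y) \<le> 0" for t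
    proof -
      have "w + t *\<^sub>R y \<in> W" using wW y by (simp add: W_def Gs)
      from m [OF this] have "h w w + t * h w y + t * h y w + t * t * h y y
          \<le> m * (g w w + t * g w y + t * g y w + t * t * g y y)"
        by (simp add: Gs Hs algebra_simps)
      then show ?thesis using gw hw G(3) [of y w] H(3) [of y w] by (simp add: algebra_simps power2_eq_square)
    qed
    then show ?thesis using quadratic_nonpos_imp_zero by fastforce
  qed
  have we: "g w (e i) = 0" "g w (\<i> *s e i) = 0" if "i < k" for i using wW that by (auto simp: W_def)
  have he: "h w (e i) = 0" "h w (\<i> *s e i) = 0" if i: "i < k" for i
  proof -
    show "h w (e i) = 0" using eig [OF i, of w] we(1) [OF i] H(3) [of w] G(3) [of w] by simp
    have "h w (\<i> *s e i) = - h (e i) (\<i> *s w)" using H(3) [of w] H(5) [of "e i" w] by simp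
    also have "\<dots> = - l i * g (e i) (\<i> *s w)" using eig [OF i] by simp
    also have "\<dots> = 0" using we(2) [OF i] G(3) [of w "\<i> *s e i"] G(5) [of "e i" w] by simp
    finally show "h w (\<i> *s e i) = 0" .
  qed
  have "h w v = m * g w v" for v
  proof -
    have "h w (P v) = 0" "g w (P v) = 0" by (simp_all add: P_def Gs Hs we he)
    moreover have "h w (v - P v) = m * g w (v - P v)" by (rule eqW [OF PW])
    ultimately show ?thesis by (simp add: Gs Hs)
  qed
  then show ?thesis using gw we by blast
qed

definition unitary_frame :: "(complex^'n::finite \<Rightarrow> complex^'n \<Rightarrow> real) \<Rightarrow> ('n \<Rightarrow> complex^'n) \<Rightarrow> bool" where
  "unitary_frame g e \<longleftrightarrow> (\<forall>j k. g (e j) (e k) = (if j = k then 1 else 0) \<and> g (e j) (\<i> *s e k) = 0)"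

lemma simultaneous_diagonalization:
  fixes g h :: "complex^'n::finite \<Rightarrow> complex^'n \<Rightarrow> real"
  assumes g: "positive_form g" and h: "hermitian_form h"
  obtains e l where "unitary_frame g e" "\<And>j v. h (e j) v = l j * g (e j) v"
proof -
  have hg: "hermitian_form g" using g by (simp add: positive_form_def)
  note G = hermitian_formD [OF hg]
  have "\<exists>e l. (\<forall>i<k. \<forall>j<k. g (e i) (e j) = (if i = j then 1 else 0) \<and> g (e i) (\<i> *s e j) = 0)
      \<and> (\<forall>i<k. \<forall>v. h (e i) v = l i * g (e i) v)" if "k \<le> CARD('n)" for k :: nat
    using that
  proof (induction k)
    case (Suc k)
    then have "k \<le> CARD('n)" by simp
    from Suc.IH [OF this] obtain e l where "\<forall>i<k. \<forall>j<k. g (e i) (e j) = (if i = j then 1 else 0) \<and> g (e i) (\<i> *s e j) = 0"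
      "\<forall>i<k. \<forall>v. h (e i) v = l i * g (e i) v" by blast
    then have el: "\<And>i j. i < k \<Longrightarrow> j < k \<Longrightarrow> g (e i) (e j) = (if i = j then 1 else 0)"
      "\<And>i j. i < k \<Longrightarrow> j < k \<Longrightarrow> g (e i) (\<i> *s e j) = 0" "\<And>i v. i < k \<Longrightarrow> h (e i) v = l i * g (e i) v" by auto
    have "k < CARD('n)" using Suc.prems by simp
    then have "\<exists>w m. g w w = 1 \<and> (\<forall>i<k. g w (e i) = 0 \<and> g w (\<i> *s e i) = 0) \<and> (\<forall>v. h w v = m * g w v)"
      by (rule eigenvector_extend [OF g h]) (use el in auto)
    then obtain w m where w: "g w w = 1" "\<And>i. i < k \<Longrightarrow> g w (e i) = 0" "\<And>i. i < k \<Longrightarrow> g w (\<i> *s e i) = 0"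
      "\<And>v. h w v = m * g w v" by blast
    have w': "g (e i) w = 0" "g (e i) (\<i> *s w) = 0" if "i < k" for i
      using w that G(3) [of w "e i"] G(3) [of w "\<i> *s e i"] G(5) [of "e i" w] by simp_all
    show ?case
      by (rule exI [of _ "e(k := w)"], rule exI [of _ "l(k := m)"])
        (use el w w' G(6) in \<open>auto simp: less_Suc_eq\<close>)
  qed simp
  from this [OF order_refl] obtain e :: "nat \<Rightarrow> complex^'n" and l
    where "\<forall>i<CARD('n). \<forall>j<CARD('n). g (e i) (e j) = (if i = j then 1 else 0) \<and> g (e i) (\<i> *s e j) = 0"
      "\<forall>i<CARD('n). \<forall>v. h (e i) v = l i * g (e i) v" by blast
  then have el: "\<And>i j. i < CARD('n) \<Longrightarrow> j < CARD('n) \<Longrightarrow> g (e i) (e j) = (if i = j then 1 else 0) \<and> g (e i) (\<i> *s e j) = 0"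
      "\<And>i v. i < CARD('n) \<Longrightarrow> h (e i) v = l i * g (e i) v" by simp_all
  obtain b :: "'n \<Rightarrow> nat" where b: "bij_betw b UNIV {0..<CARD('n)}"
    using ex_bij_betw_finite_nat [OF finite_class.finite_UNIV] by blast
  have b1: "b j < CARD('n)" "b j = b k \<longleftrightarrow> j = k" for j k
    using b by (auto simp: bij_betw_def inj_on_def)
  have "unitary_frame g (\<lambda>j. e (b j))" unfolding unitary_frame_def using el(1) b1 by simp
  moreover have "h (e (b j)) v = l (b j) * g (e (b j)) v" for j v using el(2) b1 by simp
  ultimately show ?thesis by (rule that)
qed

lemma unitary_frame_exists:
  assumes "positive_form g" obtains e where "unitary_frame g e"
proof -
  have "hermitian_form g" using assms by (simp add: positive_form_def)
  then show thesis by (rule simultaneous_diagonalization [OF assms]) (rule that)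
qed

lemma unitary_frameD:
  assumes "hermitian_form g" "unitary_frame g e"
  shows "g (e j) (e k) = (if j = k then 1 else 0)" "g (e j) (\<i> *s e k) = 0" "g (\<i> *s e j) (e k) = 0"
    "g (\<i> *s e j) (\<i> *s e k) = (if j = k then 1 else 0)"
  using assms hermitian_formD(4,5) [OF assms(1)] by (auto simp: unitary_frame_def)

section \<open>The norm of a two-covector\<close>

definition orthonormal_basis :: "(complex^'n::finite \<Rightarrow> complex^'n \<Rightarrow> real) \<Rightarrow> (complex^'n) set \<Rightarrow> bool" where
  "orthonormal_basis g B \<longleftrightarrow>
     finite B \<and> card B = 2 * CARD('n) \<and> (\<forall>u\<in>B. \<forall>v\<in>B. g u v = (if u = v then 1 else 0))"

lemma orthonormal_expansion:
  fixes g :: "complex^'n::finite \<Rightarrow> complex^'n \<Rightarrow> real"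
  assumes g: "positive_form g" and B: "orthonormal_basis g B"
  shows "x = (\<Sum>b\<in>B. g b x *\<^sub>R b)"
proof -
  have hg: "hermitian_form g" and pos: "\<And>v. v \<noteq> 0 \<Longrightarrow> g v v > 0" using g by (auto simp: positive_form_def)
  note Gs = hermitian_linear_simps [OF hg]
  have fB: "finite B" and cB: "card B = 2 * CARD('n)"
    and oB: "\<And>u v. u \<in> B \<Longrightarrow> v \<in> B \<Longrightarrow> g u v = (if u = v then 1 else 0)" using B by (auto simp: orthonormal_basis_def)
  have coeff: "g b (\<Sum>v\<in>B. u v *\<^sub>R v) = u b" if "b \<in> B" for u b
  proof -
    have "g b (\<Sum>v\<in>B. u v *\<^sub>R v) = (\<Sum>v\<in>B. if v = b then u b else 0)"
      by (simp add: Gs) (rule sum.cong, use oB that in auto)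
    then show ?thesis using fB that by simp
  qed
  have "independent B"
  proof
    assume "dependent B"
    then obtain u v where "v \<in> B" "u v \<noteq> 0" "(\<Sum>v\<in>B. u v *\<^sub>R v) = 0"
      using fB by (auto simp: dependent_finite)
    then show False using coeff [of v u] linear_0 [OF hermitian_formD(2) [OF hg]] by simp
  qed
  then have span: "span B = UNIV"
    using card_ge_dim_independent [of B UNIV] cB by auto
  define y where "y = x - (\<Sum>b\<in>B. g b x *\<^sub>R b)"
  have orth: "g b y = 0" if "b \<in> B" for b
    using coeff [OF that, of "\<lambda>b. g b x"] by (simp add: y_def Gs)
  have "g z y = 0" if "z \<in> span B" for z
    using that
  proof (induction z rule: span_induct_alt)
    case base then show ?case using linear_0 [OF hermitian_formD(1) [OF hg]] by simp
  next
    case (step c x z) then show ?case by (simp add: Gs orth)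
  qed
  then have "g y y = 0" using span by simp
  then have "y = 0" using pos by fastforce
  then show ?thesis by (simp add: y_def)
qed

lemma parseval:
  fixes f :: "complex^'n::finite \<Rightarrow> complex"
  assumes g: "positive_form g" and B: "orthonormal_basis g B" and B': "orthonormal_basis g B'" and f: "linear f"
  shows "(\<Sum>b\<in>B. (cmod (f b))\<^sup>2) = (\<Sum>b\<in>B'. (cmod (f b))\<^sup>2)"
proof -
  have hg: "hermitian_form g" using g by (auto simp: positive_form_def)
  have ex: "f x = (\<Sum>b\<in>B. of_real (g b x) * f b)" if "orthonormal_basis g B" for B x
  proof -
    have "f x = f (\<Sum>b\<in>B. g b x *\<^sub>R b)" using orthonormal_expansion [OF g that, of x] by simp
    then show ?thesis by (simp add: linear_sum [OF f] linear_scale [OF f] scaleR_conv_of_real [where 'a = complex])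
  qed
  have cm: "complex_of_real ((cmod z)\<^sup>2) = z * cnj z" for z by (rule complex_norm_square)
  have "complex_of_real (\<Sum>b\<in>B. (cmod (f b))\<^sup>2) = (\<Sum>b\<in>B. f b * cnj (f b))"
    by (simp add: cm del: of_real_power)
  also have "\<dots> = (\<Sum>b\<in>B. \<Sum>b'\<in>B'. of_real (g b' b) * f b' * cnj (f b))"
    by (rule sum.cong [OF refl], subst ex [OF B']) (simp add: sum_distrib_right)
  also have "\<dots> = (\<Sum>b'\<in>B'. \<Sum>b\<in>B. of_real (g b' b) * f b' * cnj (f b))"
    by (rule sum.swap)
  also have "\<dots> = (\<Sum>b'\<in>B'. f b' * cnj (\<Sum>b\<in>B. of_real (g b b') * f b))"
    by (rule sum.cong [OF refl]) (simp add: sum_distrib_left hermitian_formD(3) [OF hg, of _ b for b] mult_ac)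
  also have "\<dots> = (\<Sum>b'\<in>B'. f b' * cnj (f b'))"
    by (simp only: ex [OF B, symmetric])
  also have "\<dots> = complex_of_real (\<Sum>b\<in>B'. (cmod (f b))\<^sup>2)"
    by (simp add: cm del: of_real_power)
  finally show ?thesis by (simp only: of_real_eq_iff)
qed

text \<open>
  The basis in the definition of the covector norm is arbitrary; by Parseval's identity in each
  argument, any orthonormal basis yields the same value.
\<close>

lemma orthonormal_norm_indep:
  assumes g: "positive_form g" and B: "orthonormal_basis g B" and B': "orthonormal_basis g B'" and a: "alternating a"
  shows "(\<Sum>u\<in>B. \<Sum>v\<in>B. (cmod (a [u, v]))\<^sup>2) = (\<Sum>u\<in>B'. \<Sum>v\<in>B'. (cmod (a [u, v]))\<^sup>2)"
proof -
  have "(\<Sum>u\<in>B. \<Sum>v\<in>B. (cmod (a [u, v]))\<^sup>2) = (\<Sum>u\<in>B. \<Sum>v\<in>B'. (cmod (a [u, v]))\<^sup>2)"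
    by (intro sum.cong refl parseval [OF g B B'] alternating_linear2 [OF a])
  also have "\<dots> = (\<Sum>v\<in>B'. \<Sum>u\<in>B. (cmod (a [u, v]))\<^sup>2)" by (rule sum.swap)
  also have "\<dots> = (\<Sum>v\<in>B'. \<Sum>u\<in>B'. (cmod (a [u, v]))\<^sup>2)"
    by (intro sum.cong refl parseval [OF g B B'] alternating_linear2 [OF a])
  also have "\<dots> = (\<Sum>u\<in>B'. \<Sum>v\<in>B'. (cmod (a [u, v]))\<^sup>2)" by (rule sum.swap)
  finally show ?thesis .
qed

lemma unitary_frame_basis:
  fixes e :: "'n::finite \<Rightarrow> complex^'n"
  assumes g: "hermitian_form g" and e: "unitary_frame g e"
  shows "orthonormal_basis g (range e \<union> range (\<lambda>j. \<i> *s e j))"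
    and "(\<Sum>u\<in>range e \<union> range (\<lambda>j. \<i> *s e j). F u) = (\<Sum>j\<in>UNIV. F (e j) + (F (\<i> *s e j) :: 'b::comm_monoid_add))"
proof -
  note U = unitary_frameD [OF g e]
  have 1: "inj e" by (rule injI) (metis U(1) zero_neq_one)
  have 2: "inj (\<lambda>j. \<i> *s e j)" by (rule injI) (metis U(4) zero_neq_one)
  have 3: "range e \<inter> range (\<lambda>j. \<i> *s e j) = {}"
  proof -
    have "e j \<noteq> \<i> *s e k" for j k using U(1) [of j j] U(2) [of j k] by fastforce
    then show ?thesis by blast
  qed
  have "card (range e \<union> range (\<lambda>j. \<i> *s e j)) = 2 * CARD('n)"
    using 1 2 3 by (simp add: card_Un_disjoint card_image)
  then show "orthonormal_basis g (range e \<union> range (\<lambda>j. \<i> *s e j))"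
    unfolding orthonormal_basis_def using U 1 2 3 by (auto simp: inj_eq)
  show "(\<Sum>u\<in>range e \<union> range (\<lambda>j. \<i> *s e j). F u) = (\<Sum>j\<in>UNIV. F (e j) + F (\<i> *s e j))"
    using 1 2 3 by (simp add: sum.union_disjoint sum.reindex sum.distrib)
qed

lemma riem_hermitian:
  assumes "w \<in> pq_covectors 1 1" shows "hermitian_form (riem w)"
proof -
  have alt: "alternating w" and ii: "\<And>u v. w [\<i> *s u, \<i> *s v] = w [u, v]" using assms pq_1_1_iff by blast+
  note lin = alternating_linear2 [OF alt]
  have "bilinear (riem w)"
    unfolding bilinear_def riem_def
    by (auto intro!: linearI simp: smult_add smult_scaleR linear_add [OF lin(1)] linear_add [OF lin(2)]
        linear_scale [OF lin(1)] linear_scale [OF lin(2)])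
  moreover have "riem w u v = riem w v u" for u v
  proof -
    have "w [u, \<i> *s v] = w [\<i> *s u, \<i> *s (\<i> *s v)]" by (rule ii [symmetric])
    also have "\<dots> = - w [\<i> *s u, v]" using linear_neg [OF lin(2)] by (simp add: smult_ii)
    also have "\<dots> = w [v, \<i> *s u]" using alternating_skew [OF alt, of "\<i> *s u" v] by simp
    finally show ?thesis by (simp add: riem_def)
  qed
  moreover have "riem w (\<i> *s u) (\<i> *s v) = riem w u v" for u v unfolding riem_def ii ..
  ultimately show ?thesis by (simp add: hermitian_form_def)
qed

definition metric_covector :: "'n::finite covector \<Rightarrow> bool" where
  "metric_covector w \<longleftrightarrow> w \<in> pq_covectors 1 1 \<and> positive_definite w"

lemma metric_covectorD:
  assumes "metric_covector w"
  shows "positive_form (riem w)" "hermitian_form (riem w)" "alternating w" "length xs \<noteq> 2 \<Longrightarrow> w xs = 0"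
    "w [u, \<i> *s v] = of_real (riem w u v)" "w [u, v] = of_real (- riem w u (\<i> *s v))" "cnj (w xs) = w xs"
proof -
  have w: "w \<in> pq_covectors 1 1" and p: "positive_definite w" using assms by (auto simp: metric_covector_def)
  show "hermitian_form (riem w)" using w by (rule riem_hermitian)
  then show "positive_form (riem w)" using p by (simp add: positive_form_def positive_definite_def riem_def)
  show alt: "alternating w" and "length xs \<noteq> 2 \<Longrightarrow> w xs = 0" using w pq_1_1_iff by blast+
  show real: "cnj (w xs) = w xs" for xs using p by (metis cnj_covector_def positive_definite_def)
  show iv: "w [u, \<i> *s v] = of_real (riem w u v)" for v
    unfolding riem_def using real by (metis complex_is_Real_iff of_real_Re Reals_cnj_iff)
  show "w [u, v] = of_real (- riem w u (\<i> *s v))"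
  proof -
    have "w [u, - v] = of_real (riem w u (\<i> *s v))" using iv [of "\<i> *s v"] by (simp add: smult_ii)
    moreover have "w [u, - v] = - w [u, v]" using linear_neg [OF alternating_linear2(2) [OF alt]] .
    ultimately show ?thesis by (metis minus_minus of_real_minus)
  qed
qed

lemma covector_norm_basis:
  assumes w: "metric_covector w" and B: "orthonormal_basis (riem w) B" and a: "alternating a"
  shows "(covector_norm w 2 a)\<^sup>2 = (\<Sum>u\<in>B. \<Sum>v\<in>B. (cmod (a [u, v]))\<^sup>2) / 2"
proof -
  have eq: "riem_orthonormal_basis w = orthonormal_basis (riem w)"
    by (auto simp: fun_eq_iff riem_orthonormal_basis_def orthonormal_basis_def)
  define B0 where "B0 = (SOME B. riem_orthonormal_basis w B)"
  have B0: "orthonormal_basis (riem w) B0"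
    unfolding B0_def eq by (rule someI [of _ B]) (rule B)
  have "(\<Sum>vs\<in>{vs. set vs \<subseteq> B0 \<and> length vs = 2}. (cmod (a vs))\<^sup>2) = (\<Sum>(u, v)\<in>B0 \<times> B0. (cmod (a [u, v]))\<^sup>2)"
    by (rule sum.reindex_bij_witness [where i = "\<lambda>(u, v). [u, v]" and j = "\<lambda>vs. (vs ! 0, vs ! 1)"])
       (auto simp: numeral_2_eq_2 length_Suc_conv)
  also have "\<dots> = (\<Sum>u\<in>B0. \<Sum>v\<in>B0. (cmod (a [u, v]))\<^sup>2)" by (simp add: sum.cartesian_product)
  also have "\<dots> = (\<Sum>u\<in>B. \<Sum>v\<in>B. (cmod (a [u, v]))\<^sup>2)"
    by (rule orthonormal_norm_indep [OF metric_covectorD(1) [OF w] B0 B a])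
  finally show ?thesis
    by (simp add: covector_norm_def B0_def [symmetric] Let_def numeral_2_eq_2 sum_nonneg)
qed

text \<open>
  A \<open>(2,0)\<close>-covector is complex bilinear, so that each of the four pairs formed from
  \<open>e\<^sub>j, i e\<^sub>j\<close> and \<open>e\<^sub>k, i e\<^sub>k\<close> contributes the same amount.
\<close>

lemma covector_norm_unitary:
  assumes w: "metric_covector w" and e: "unitary_frame (riem w) e" and a: "a \<in> pq_covectors 2 0"
  shows "(covector_norm w 2 a)\<^sup>2 = 2 * (\<Sum>j\<in>UNIV. \<Sum>k\<in>UNIV. (cmod (a [e j, e k]))\<^sup>2)"
proof -
  note U = unitary_frame_basis [OF metric_covectorD(2) [OF w] e]
  have alt: "alternating a" and i1: "a [\<i> *s u, v] = \<i> * a [u, v]" for u v using a pq_2_0_iff by blast+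
  have i2: "a [u, \<i> *s v] = \<i> * a [u, v]" for u v
    using i1 alternating_skew [OF alt, of u "\<i> *s v"] alternating_skew [OF alt, of u v] by simp
  show ?thesis
    unfolding covector_norm_basis [OF w U(1) alt] U(2)
    by (simp add: i1 i2 norm_mult sum.distrib flip: sum_distrib_left)
qed

section \<open>The volume covector\<close>

text \<open>
  The recursion applied twice: a covector of degree 2 takes both of the first two vectors, one of
  them or none.
\<close>

lemma wedge_two_contract:
  fixes a b :: "'n::finite covector"
  assumes a: "\<And>xs. length xs \<noteq> 2 \<Longrightarrow> a xs = 0"
  shows "wedge a b (u # v # rest) = a [u, v] * b rest
     + wedge (\<lambda>xs. (-1) ^ length xs * a (u # xs)) (\<lambda>xs. b (v # xs)) rest
     + wedge (\<lambda>xs. - ((-1) ^ length xs) * a (v # xs)) (\<lambda>xs. b (u # xs)) rest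
     + wedge a (\<lambda>xs. b (u # v # xs)) rest"
proof -
  have 1: "(\<lambda>xs. a (u # v # xs)) = (\<lambda>xs. if xs = [] then a [u, v] else 0)"
    using a by (auto simp: fun_eq_iff)
  have 2: "(\<lambda>xs. (-1) ^ length xs * ((-1) ^ length xs * a xs)) = a"
    by (simp add: fun_eq_iff flip: mult.assoc power_mult_distrib)
  show ?thesis by (simp add: wedge_Cons 1 2 wedge_const_left)
qed

text \<open>
  If \<open>u\<close> and \<open>v\<close> are orthogonal to the remaining vectors then they must go to the same one of
  the \<open>Suc m\<close> factors.
\<close>

lemma wedge_power_contract:
  fixes w :: "'n::finite covector"
  assumes a: "\<And>xs. length xs \<noteq> 2 \<Longrightarrow> w xs = 0"
    and u: "\<And>x. x \<in> set rest \<Longrightarrow> w [u, x] = 0" and v: "\<And>x. x \<in> set rest \<Longrightarrow> w [v, x] = 0"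
  shows "wedge_list (replicate (Suc m) w) (u # v # rest) = of_nat (Suc m) * w [u, v] * wedge_list (replicate m w) rest"
  using u v
proof (induction m arbitrary: rest)
  case (0 rest)
  have "wedge w wedge_unit = w" by (simp add: fun_eq_iff wedge_unit_right)
  then show ?case using a [of "u # v # rest"] by (simp add: wedge_list_Cons wedge_list_Nil wedge_unit_def)
next
  case (Suc m)
  define W where "W = wedge_list (replicate (Suc m) w)"
  have z: "w (u # xs) = 0" "w (v # xs) = 0" if "set xs \<subseteq> set rest" for xs
  proof -
    have "w (u # xs) = 0 \<and> w (v # xs) = 0"
    proof (cases "length xs = 1")
      case True
      then obtain x where "xs = [x]" by (auto simp: length_Suc_conv)
      then show ?thesis using Suc.prems that by auto
    qed (use a in auto)
    then show "w (u # xs) = 0" "w (v # xs) = 0" by auto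
  qed
  have "wedge w (\<lambda>xs. W (u # v # xs)) rest
      = wedge w (\<lambda>xs. of_nat (Suc m) * w [u, v] * wedge_list (replicate m w) xs) rest"
  proof (rule wedge_cong)
    fix xs assume "set xs \<subseteq> set rest"
    then show "W (u # v # xs) = of_nat (Suc m) * w [u, v] * wedge_list (replicate m w) xs"
      unfolding W_def using Suc.IH [of xs] Suc.prems by blast
  qed simp
  also have "\<dots> = of_nat (Suc m) * w [u, v] * W rest"
    by (simp add: wedge_scale_right W_def wedge_list_Cons)
  finally have 4: "wedge w (\<lambda>xs. W (u # v # xs)) rest = of_nat (Suc m) * w [u, v] * W rest" .
  have "wedge_list (replicate (Suc (Suc m)) w) (u # v # rest) = wedge w W (u # v # rest)"
    by (simp add: W_def wedge_list_Cons)
  also have "\<dots> = w [u, v] * W rest + of_nat (Suc m) * w [u, v] * W rest"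
    using wedge_two_contract [where a = w and b = W and u = u and v = v and rest = rest, OF a]
    by (simp add: 4 wedge_zero_left z)
  also have "\<dots> = of_nat (Suc (Suc m)) * w [u, v] * W rest" by (simp add: algebra_simps)
  finally show ?case by (simp add: W_def)
qed

definition pairs :: "('n::finite \<Rightarrow> complex^'n) \<Rightarrow> 'n list \<Rightarrow> (complex^'n) list" where
  "pairs e js = concat (map (\<lambda>j. [e j, \<i> *s e j]) js)"

lemma pairs_simps: "pairs e [] = []" "pairs e (j # js) = e j # \<i> *s e j # pairs e js"
  by (simp_all add: pairs_def)

lemma set_pairs: "set (pairs e js) = e ` set js \<union> (\<lambda>j. \<i> *s e j) ` set js"
  by (induction js) (auto simp: pairs_simps)

lemma length_pairs: "length (pairs e js) = 2 * length js"
  by (induction js) (auto simp: pairs_simps)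

lemma frame_eq_pairs: "frame e = pairs e index_list"
  by (simp add: frame_def pairs_def)

lemma wedge_power_pairs:
  assumes a: "\<And>xs. length xs \<noteq> 2 \<Longrightarrow> w xs = 0"
    and o: "\<And>j k. j \<noteq> k \<Longrightarrow> w [e j, e k] = 0" "\<And>j k. j \<noteq> k \<Longrightarrow> w [e j, \<i> *s e k] = 0"
      "\<And>j k. j \<noteq> k \<Longrightarrow> w [\<i> *s e j, e k] = 0" "\<And>j k. j \<noteq> k \<Longrightarrow> w [\<i> *s e j, \<i> *s e k] = 0"
    and "distinct js"
  shows "wedge_list (replicate (length js) w) (pairs e js) = fact (length js) * (\<Prod>j\<in>set js. w [e j, \<i> *s e j])"
  using \<open>distinct js\<close>
proof (induction js)
  case (Cons j js)
  have "w [e j, x] = 0 \<and> w [\<i> *s e j, x] = 0" if "x \<in> set (pairs e js)" for x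
  proof -
    obtain k where k: "k \<in> set js" "x = e k \<or> x = \<i> *s e k" using \<open>x \<in> _\<close> by (auto simp: set_pairs)
    then have "j \<noteq> k" using Cons.prems by auto
    then show ?thesis using k(2) o by auto
  qed
  then have "wedge_list (replicate (Suc (length js)) w) (e j # \<i> *s e j # pairs e js)
      = of_nat (Suc (length js)) * w [e j, \<i> *s e j] * wedge_list (replicate (length js) w) (pairs e js)"
    by (intro wedge_power_contract [OF a]) auto
  then show ?case using Cons by (simp add: pairs_simps)
qed (simp add: pairs_simps wedge_list_Nil wedge_unit_def)

text \<open>
  An orthogonal frame splits the \<open>n\<close>-th power of \<open>w\<close> into \<open>n!\<close> equal products, and the
  factor \<open>n!\<close> is divided out in the volume.
\<close>

lemma volume_pairs:
  fixes w :: "'n::finite covector"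
  assumes w: "metric_covector w"
    and o: "\<And>j k. j \<noteq> k \<Longrightarrow> riem w (e j) (e k) = 0" "\<And>j k. j \<noteq> k \<Longrightarrow> riem w (e j) (\<i> *s e k) = 0"
    and js: "distinct js" "set js = UNIV"
  shows "volume_covector w (pairs e js) = of_real (\<Prod>j\<in>UNIV. riem w (e j) (e j))"
proof -
  note M = metric_covectorD [OF w] and H = hermitian_formD [OF metric_covectorD(2) [OF w]]
  have len: "length js = CARD('n)" using js by (metis distinct_card)
  have "wedge_list (replicate (length js) w) (pairs e js) = fact (length js) * (\<Prod>j\<in>set js. w [e j, \<i> *s e j])"
    by (rule wedge_power_pairs [OF M(4) _ _ _ _ js(1)]) (simp_all add: M(6) H(4,5) o smult_ii linear_neg [OF H(2)])
  then show ?thesis by (simp add: volume_covector_def len js M(5))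
qed

lemma alternating_volume:
  assumes "alternating w" shows "alternating (volume_covector w)"
proof -
  have "alternating (\<lambda>vs. (1 / fact CARD('a)) * wedge_list (replicate CARD('a) w) vs)"
    by (intro alternating_scale alternating_wedge_list) (use assms in auto)
  then show ?thesis by (simp add: volume_covector_def)
qed

lemma span_canonical_frame: "span (set (canonical_frame :: (complex^'n::finite) list)) = UNIV"
  by (simp add: set_canonical_frame)

lemma length_canonical_frame: "length (canonical_frame :: (complex^'n::finite) list) = 2 * CARD('n)"
  by (simp add: canonical_frame_eq length_frame)

text \<open>
  This is how values on the canonical frame are obtained from values on a frame adapted to a metric.
\<close>

lemma top_proportional:
  fixes a b :: "'n::finite covector"
  assumes "alternating a" "alternating b" "length vs = 2 * CARD('n)"
  shows "a vs * b canonical_frame = b vs * a canonical_frame"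
  using alternating_top_proportional [OF assms(1,2) span_canonical_frame distinct_canonical_frame, of vs] assms(3)
  by (simp add: length_canonical_frame)

lemma volume_unitary:
  assumes w: "metric_covector w" and e: "unitary_frame (riem w) e" and js: "distinct js" "set js = UNIV"
  shows "volume_covector w (pairs e js) = 1"
  using volume_pairs [OF w _ _ js, of e] unitary_frameD [OF metric_covectorD(2) [OF w] e] by simp

lemma continuous_on_wedge:
  fixes a b :: "'z::topological_space \<Rightarrow> 'n::finite covector"
  assumes "\<And>vs. continuous_on S (\<lambda>z. a z vs)" "\<And>vs. continuous_on S (\<lambda>z. b z vs)"
  shows "continuous_on S (\<lambda>z. wedge (a z) (b z) vs)"
  unfolding wedge_def by (intro continuous_intros assms)

lemma continuous_on_wedge_power:
  fixes a :: "'z::topological_space \<Rightarrow> 'n::finite covector"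
  assumes "\<And>vs. continuous_on S (\<lambda>z. a z vs)"
  shows "continuous_on S (\<lambda>z. wedge_list (replicate m (a z)) vs)"
proof (induction m arbitrary: vs)
  case 0 show ?case by (simp add: wedge_list_Nil)
next
  case (Suc m) show ?case by (simp add: wedge_list_Cons) (intro continuous_on_wedge assms Suc.IH)
qed

lemma continuous_on_volume:
  fixes a :: "'z::topological_space \<Rightarrow> 'n::finite covector"
  assumes "\<And>vs. continuous_on S (\<lambda>z. a z vs)"
  shows "continuous_on S (\<lambda>z. volume_covector (a z) vs)"
  unfolding volume_covector_def by (intro continuous_intros continuous_on_wedge_power assms) simp

lemma cnj_wedge: "cnj (wedge a b vs) = wedge (\<lambda>xs. cnj (a xs)) (\<lambda>xs. cnj (b xs)) vs"
  by (simp add: wedge_def cnj_sum)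

lemma cnj_wedge_power:
  assumes "\<And>xs. cnj (w xs) = w xs"
  shows "cnj (wedge_list (replicate m w) vs) = wedge_list (replicate m w) vs"
proof (induction m arbitrary: vs)
  case 0 then show ?case by (simp add: wedge_list_Nil wedge_unit_def)
next
  case (Suc m) then show ?case by (simp add: wedge_list_Cons cnj_wedge assms)
qed

lemma volume_real:
  assumes "metric_covector w" shows "volume_covector w vs = of_real (Re (volume_covector w vs))"
proof -
  have "cnj (volume_covector w vs) = volume_covector w vs"
    by (simp add: volume_covector_def cnj_wedge_power [OF metric_covectorD(7) [OF assms]])
  then show ?thesis by (metis complex_is_Real_iff of_real_Re Reals_cnj_iff)
qed

lemma volume_nonzero:
  assumes w: "metric_covector w" shows "volume_covector w canonical_frame \<noteq> 0"
proof
  assume 0: "volume_covector w canonical_frame = 0"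
  obtain e where e: "unitary_frame (riem w) e" by (rule unitary_frame_exists [OF metric_covectorD(1) [OF w]])
  have alt: "alternating (volume_covector w)" using alternating_volume metric_covectorD(3) [OF w] by blast
  have "volume_covector w (frame e) = 0"
    by (rule alternating_zero_on_basis [OF alt span_canonical_frame distinct_canonical_frame 0])
      (simp add: length_frame length_canonical_frame)
  then show False using volume_unitary [OF w e index_list] by (simp add: frame_eq_pairs)
qed

text \<open>
  \<open>i/2 \<Sum> dz\<^sub>j \<and> cnj dz\<^sub>j\<close>, whose Riemannian metric is the Euclidean one.
\<close>

definition std_covector :: "'n::finite covector" where
  "std_covector = (\<lambda>vs. if length vs = 2 then \<Sum>(j, k)\<in>UNIV. (if j = k then \<i> / 2 else 0) *
      (vs ! 0 $ j * cnj (vs ! 1 $ k) - vs ! 1 $ j * cnj (vs ! 0 $ k)) else 0)"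

lemma half_ii_mult_diff: "\<i> / 2 * (a * cnj b - b * cnj a) = of_real (a \<bullet> (- (\<i> * b)))"
proof -
  have "b * cnj a = cnj (a * cnj b)" by simp
  then have "\<i> / 2 * (a * cnj b - b * cnj a) = \<i> / 2 * (of_real (2 * Im (a * cnj b)) * \<i>)"
    by (simp only: complex_diff_cnj)
  also have "\<dots> = of_real (- Im (a * cnj b))" by (simp add: mult_ac)
  also have "- Im (a * cnj b) = a \<bullet> (- (\<i> * b))" by (simp add: inner_complex_def)
  finally show ?thesis .
qed
lemma std_covector_two: "std_covector [u, v] = of_real (u \<bullet> (- (\<i> *s v)))"
proof -
  have "std_covector [u, v] = (\<Sum>j\<in>UNIV. \<Sum>k\<in>UNIV. (if j = k then \<i> / 2 else 0) *
      (u $ j * cnj (v $ k) - v $ j * cnj (u $ k)))"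
    by (simp add: std_covector_def sum.cartesian_product)
  also have "\<dots> = (\<Sum>j\<in>UNIV. \<i> / 2 * (u $ j * cnj (v $ j) - v $ j * cnj (u $ j)))"
    by (intro sum.cong refl) (simp add: if_distrib [of "\<lambda>x. x * _"] cong: if_cong)
  also have "\<dots> = (\<Sum>j\<in>UNIV. of_real (u $ j \<bullet> (- (\<i> * v $ j))))"
    by (simp only: half_ii_mult_diff)
  finally show ?thesis by (simp add: inner_vec_def)
qed

lemma std_covector_riem: "riem std_covector u v = u \<bullet> v"
  by (simp add: riem_def std_covector_two smult_ii)

lemma std_covector_metric: "metric_covector std_covector"
proof -
  have "std_covector \<in> pq_covectors 1 1"
    unfolding pq_covectors_1_1_eq std_covector_def by (intro CollectI exI) (rule refl)
  moreover have "cnj_covector std_covector = (std_covector :: 'a covector)"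
  proof
    fix vs :: "(complex^'a) list"
    show "cnj_covector std_covector vs = std_covector vs"
    proof (cases "length vs = 2")
      case True
      then obtain u v where "vs = [u, v]" by (metis list_length2)
      then show ?thesis by (simp add: std_covector_two)
    qed (simp add: std_covector_def)
  qed
  moreover have "Re (std_covector [v, \<i> *s v]) > 0" if "v \<noteq> 0" for v :: "complex^'a"
    using std_covector_riem [of v v] that by (simp add: riem_def)
  ultimately show ?thesis by (simp add: metric_covector_def positive_definite_def)
qed

lemma std_unitary: "unitary_frame (riem std_covector) (\<lambda>j. axis j 1)"
proof -
  have "axis j 1 \<bullet> axis k (1 :: complex) = (if j = k then 1 else 0)" for j k :: 'a
    by (auto simp: inner_axis_axis)
  moreover have "axis j 1 \<bullet> (\<i> *s axis k (1 :: complex)) = 0" for j k :: 'a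
  proof -
    have "\<i> *s axis k 1 = axis k \<i>" by (simp add: axis_def vec_eq_iff)
    then show ?thesis by (simp add: inner_axis_axis inner_complex_def)
  qed
  ultimately show ?thesis by (simp add: unitary_frame_def std_covector_riem)
qed

lemma volume_std: "volume_covector std_covector canonical_frame = 1"
  using volume_unitary [OF std_covector_metric std_unitary index_list]
  by (simp add: canonical_frame_eq frame_eq_pairs)

lemma metric_covector_combine:
  assumes w: "metric_covector w" "metric_covector w'" and t: "0 \<le> s" "0 \<le> t" "s + t > (0::real)"
  shows "metric_covector (\<lambda>vs. of_real s * w vs + of_real t * w' vs)"
proof -
  have p: "w \<in> pq_covectors 1 1" "w' \<in> pq_covectors 1 1" "positive_definite w" "positive_definite w'"
    using w by (auto simp: metric_covector_def)
  have "(\<lambda>vs. of_real s * w vs + of_real t * w' vs) \<in> pq_covectors 1 1"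
    using p(1,2) unfolding pq_1_1_iff by (auto intro!: alternating_add alternating_scale)
  moreover have "s * Re (w [v, \<i> *s v]) + t * Re (w' [v, \<i> *s v]) > 0" if "v \<noteq> 0" for v
  proof -
    have "Re (w [v, \<i> *s v]) > 0" "Re (w' [v, \<i> *s v]) > 0" using that p(3,4) by (auto simp: positive_definite_def)
    then show ?thesis using t by (cases "s > 0") (auto intro: add_pos_nonneg add_nonneg_pos)
  qed
  moreover have "cnj_covector (\<lambda>vs. of_real s * w vs + of_real t * w' vs) = (\<lambda>vs. of_real s * w vs + of_real t * w' vs)"
    by (simp add: fun_eq_iff metric_covectorD(7) [OF w(1)] metric_covectorD(7) [OF w(2)])
  ultimately show ?thesis
    unfolding metric_covector_def positive_definite_def by simp
qed

text \<open>
  The volume of a metric covector is real and does not vanish.  Along the segment from \<open>w\<close> to the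
  standard covector, whose volume is 1, it cannot change its sign.
\<close>

lemma volume_pos:
  assumes w: "metric_covector w" shows "Re (volume_covector w canonical_frame) > 0"
proof (rule ccontr)
  assume neg: "\<not> ?thesis"
  define W where "W t = (\<lambda>vs. of_real (1 - t) * std_covector vs + of_real t * w vs)" for t :: real
  have m: "metric_covector (W t)" if "0 \<le> t" "t \<le> 1" for t
    unfolding W_def by (rule metric_covector_combine [OF std_covector_metric w]) (use that in auto)
  have "W 0 = std_covector" "W 1 = w" by (simp_all add: W_def fun_eq_iff)
  moreover have "continuous_on {0..1} (\<lambda>t. Re (volume_covector (W t) canonical_frame))"
    by (intro continuous_intros continuous_on_volume) (auto simp: W_def intro!: continuous_intros)
  ultimately have "\<exists>t\<ge>0. t \<le> 1 \<and> Re (volume_covector (W t) canonical_frame) = 0"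
    using neg by (intro IVT2') (simp_all add: volume_std)
  then obtain t where t: "0 \<le> t" "t \<le> 1" "Re (volume_covector (W t) canonical_frame) = 0" by blast
  then show False
    using volume_nonzero [OF m [OF t(1,2)]] volume_real [OF m [OF t(1,2)], of canonical_frame] by simp
qed

section \<open>The density of the squared norm\<close>

text \<open>
  The density of \<open>\<bar>a\<bar>\<^sup>2 dV\<close> with respect to Lebesgue measure.
\<close>

definition norm_density :: "'n::finite covector \<Rightarrow> 'n covector \<Rightarrow> real" where
  "norm_density w a = (covector_norm w 2 a)\<^sup>2 * Re (volume_covector w canonical_frame)"

text \<open>
  If \<open>w'\<close> is diagonal with eigenvalues \<open>l\<^sub>j\<close> in a unitary frame of \<open>w\<close> then
  dividing \<open>e\<^sub>j\<close> by the square root of \<open>l\<^sub>j\<close> yields a unitary frame of \<open>w'\<close>.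
\<close>

lemma unitary_frame_rescaled:
  assumes w: "metric_covector w" and w': "metric_covector w'" and e: "unitary_frame (riem w) e"
    and l: "\<And>j v. riem w' (e j) v = l j * riem w (e j) v"
  shows "l j > 0" "volume_covector w' canonical_frame = of_real (\<Prod>j\<in>UNIV. l j) * volume_covector w canonical_frame"
    "unitary_frame (riem w') (\<lambda>j. (1 / sqrt (l j)) *\<^sub>R e j)"
proof -
  note U = unitary_frameD [OF metric_covectorD(2) [OF w] e]
  note H' = hermitian_formD [OF metric_covectorD(2) [OF w']]
  have pos: "v \<noteq> 0 \<Longrightarrow> riem w' v v > 0" for v using metric_covectorD(1) [OF w'] by (auto simp: positive_form_def)
  have nz: "e j \<noteq> 0" for j
  proof
    assume "e j = 0"
    then have "riem w (e j) (e j) = 0" using linear_0 [OF hermitian_formD(2) [OF metric_covectorD(2) [OF w]]] by simp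
    then show False using U(1) [of j j] by simp
  qed
  show lpos: "l j > 0" for j using pos [OF nz [of j]] l [of j "e j"] U(1) [of j j] by simp
  have e': "riem w' (e j) (e k) = (if j = k then l j else 0)" "riem w' (e j) (\<i> *s e k) = 0" for j k
    by (simp_all add: l U)
  have lne: "l j \<noteq> 0" "0 \<le> l j" for j using lpos [of j] by simp_all
  have "unitary_frame (riem w') (\<lambda>j. (1 / sqrt (l j)) *\<^sub>R e j)"
    unfolding unitary_frame_def smult_scaleR
    using lne by (auto simp: linear_scale [OF H'(1)] linear_scale [OF H'(2)] e')
  then show "unitary_frame (riem w') (\<lambda>j. (1 / sqrt (l j)) *\<^sub>R e j)" .
  have "volume_covector w' (frame e) = of_real (\<Prod>j\<in>UNIV. l j)"
    using volume_pairs [OF w' _ _ index_list, of e] e' by (simp add: frame_eq_pairs)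
  moreover have "volume_covector w (frame e) = 1"
    using volume_unitary [OF w e index_list] by (simp add: frame_eq_pairs)
  moreover have "volume_covector w' (frame e) * volume_covector w canonical_frame
      = volume_covector w (frame e) * volume_covector w' canonical_frame"
    by (rule top_proportional)
      (use alternating_volume [OF metric_covectorD(3) [OF w]] alternating_volume [OF metric_covectorD(3) [OF w']]
        in \<open>simp_all add: length_frame\<close>)
  ultimately show "volume_covector w' canonical_frame = of_real (\<Prod>j\<in>UNIV. l j) * volume_covector w canonical_frame"
    by simp
qed

lemma norm_density_diag:
  assumes w: "metric_covector w" and w': "metric_covector w'" and e: "unitary_frame (riem w) e"
    and l: "\<And>j v. riem w' (e j) v = l j * riem w (e j) v" and a: "a \<in> pq_covectors 2 0"
  shows "norm_density w' a = (\<Prod>j\<in>UNIV. l j) * (2 * (\<Sum>j\<in>UNIV. \<Sum>k\<in>UNIV. (cmod (a [e j, e k]))\<^sup>2 / (l j * l k)))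
    * Re (volume_covector w canonical_frame)"
proof -
  note T = unitary_frame_rescaled [OF w w' e l]
  have alt: "alternating a" using a pq_2_0_iff by blast
  have "cmod (a [(1 / sqrt (l j)) *\<^sub>R e j, (1 / sqrt (l k)) *\<^sub>R e k]) = cmod (a [e j, e k]) / (sqrt (l j) * sqrt (l k))" for j k
    by (simp only: linear_scale [OF alternating_linear2(1) [OF alt]] linear_scale [OF alternating_linear2(2) [OF alt]])
      (use T(1) in \<open>simp add: less_imp_le\<close>)
  then have "(cmod (a [(1 / sqrt (l j)) *\<^sub>R e j, (1 / sqrt (l k)) *\<^sub>R e k]))\<^sup>2 = (cmod (a [e j, e k]))\<^sup>2 / (l j * l k)" for j k
    using T(1) by (simp add: power_divide power_mult_distrib less_imp_le)
  then have "(covector_norm w' 2 a)\<^sup>2 = 2 * (\<Sum>j\<in>UNIV. \<Sum>k\<in>UNIV. (cmod (a [e j, e k]))\<^sup>2 / (l j * l k))"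
    using covector_norm_unitary [OF w' T(3) a] by simp
  then show ?thesis by (simp add: norm_density_def T(2) del: of_real_prod)
qed

text \<open>
  Passing from \<open>w\<close> to \<open>w'\<close> multiplies \<open>\<bar>a [e\<^sub>j, e\<^sub>k]\<bar>\<^sup>2\<close> by the product of all eigenvalues except
  \<open>l\<^sub>j\<close> and \<open>l\<^sub>k\<close>, which are at most 1.  The form has degree 2, and for \<open>j = k\<close> the coefficient is 0;
  so the division by \<open>l\<^sub>j l\<^sub>k\<close> is always made up for by the volume.
\<close>

lemma norm_density_mono:
  fixes w :: "'n::finite covector"
  assumes w: "metric_covector w" and w': "metric_covector w'" and le: "\<And>v. riem w' v v \<le> riem w v v"
    and a: "a \<in> pq_covectors 2 0"
  shows "norm_density w' a \<le> norm_density w a"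
proof -
  obtain e l where e: "unitary_frame (riem w) e" and l: "\<And>j v. riem w' (e j) v = l j * riem w (e j) v"
    by (rule simultaneous_diagonalization [OF metric_covectorD(1) [OF w] metric_covectorD(2) [OF w']]) (rule that)
  note T = unitary_frame_rescaled [OF w w' e l]
  have l1: "l j \<le> 1" for j
    using le [of "e j"] l [of j "e j"] unitary_frameD(1) [OF metric_covectorD(2) [OF w] e, of j j] by simp
  have alt: "alternating a" using a pq_2_0_iff by blast
  have "(\<Prod>j\<in>UNIV. l j) * ((cmod (a [e j, e k]))\<^sup>2 / (l j * l k)) \<le> (cmod (a [e j, e k]))\<^sup>2" for j k
  proof (cases "j = k")
    case True then show ?thesis using alternatingD_Cons(3) [OF alt, of "e k" "[]"] by simp
  next
    case False
    have "(\<Prod>i\<in>UNIV. l i) = l j * l k * (\<Prod>i\<in>UNIV - {j, k}. l i)"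
    proof -
      have "(\<Prod>i\<in>UNIV. l i) = (\<Prod>i\<in>UNIV - {j, k}. l i) * (\<Prod>i\<in>{j, k}. l i)"
        by (rule prod.subset_diff) auto
      then show ?thesis using False by simp
    qed
    moreover have "(\<Prod>i\<in>UNIV - {j, k}. l i) \<le> 1" by (rule prod_le_1) (use T(1) l1 in \<open>auto intro: less_imp_le\<close>)
    moreover have "0 \<le> (\<Prod>i\<in>UNIV - {j, k}. l i)" by (rule prod_nonneg) (use T(1) in \<open>auto intro: less_imp_le\<close>)
    ultimately show ?thesis using T(1) [of j] T(1) [of k]
        mult_left_le_one_le [of "(cmod (a [e j, e k]))\<^sup>2" "\<Prod>i\<in>UNIV - {j, k}. l i"] by simp
  qed
  then have le: "(\<Prod>j\<in>UNIV. l j) * (\<Sum>j\<in>UNIV. \<Sum>k\<in>UNIV. (cmod (a [e j, e k]))\<^sup>2 / (l j * l k))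
      \<le> (\<Sum>j\<in>UNIV. \<Sum>k\<in>UNIV. (cmod (a [e j, e k]))\<^sup>2)"
    unfolding sum_distrib_left by (intro sum_mono)
  have "norm_density w' a = 2 * ((\<Prod>j\<in>UNIV. l j) * (\<Sum>j\<in>UNIV. \<Sum>k\<in>UNIV. (cmod (a [e j, e k]))\<^sup>2 / (l j * l k)))
    * Re (volume_covector w canonical_frame)"
    by (simp add: norm_density_diag [OF w w' e l a])
  also have "\<dots> \<le> 2 * (\<Sum>j\<in>UNIV. \<Sum>k\<in>UNIV. (cmod (a [e j, e k]))\<^sup>2) * Re (volume_covector w canonical_frame)"
    using le volume_pos [OF w] by (intro mult_right_mono mult_left_mono) auto
  also have "\<dots> = norm_density w a"
    by (simp add: norm_density_def covector_norm_unitary [OF w e a])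
  finally show ?thesis .
qed

lemma metric_covector_scale:
  assumes "metric_covector w" "c > 0" shows "metric_covector (\<lambda>vs. of_real c * w vs)"
  using metric_covector_combine [OF assms(1) assms(1), of c 0] assms(2) by simp

lemma norm_density_scale:
  fixes w :: "'n::finite covector"
  assumes w: "metric_covector w" and c: "c > 0" and a: "a \<in> pq_covectors 2 0"
  shows "norm_density (\<lambda>vs. of_real c * w vs) a = c ^ CARD('n) / c\<^sup>2 * norm_density w a"
proof -
  obtain e where e: "unitary_frame (riem w) e" by (rule unitary_frame_exists [OF metric_covectorD(1) [OF w]])
  have "riem (\<lambda>vs. of_real c * w vs) (e j) v = c * riem w (e j) v" for j v by (simp add: riem_def)
  note D = norm_density_diag [OF w metric_covector_scale [OF w c] e this a]
  have N: "norm_density w a = 2 * (\<Sum>j\<in>UNIV. \<Sum>k\<in>UNIV. (cmod (a [e j, e k]))\<^sup>2) * Re (volume_covector w canonical_frame)"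
    by (simp add: norm_density_def covector_norm_unitary [OF w e a])
  show ?thesis
    unfolding D N by (simp add: power2_eq_square [of c] flip: sum_divide_distrib)
qed

lemma norm_density_std:
  assumes a: "a \<in> pq_covectors 2 0"
  shows "norm_density std_covector a = 2 * (\<Sum>j\<in>UNIV. \<Sum>k\<in>UNIV. (cmod (a [axis j 1, axis k 1]))\<^sup>2)"
  by (simp add: norm_density_def volume_std covector_norm_unitary [OF std_covector_metric std_unitary a])

lemma norm_density_nonneg: "metric_covector w \<Longrightarrow> 0 \<le> norm_density w a"
  using volume_pos [of w] by (simp add: norm_density_def)

section \<open>Weakly semi-positive (1,1)-covectors\<close>

text \<open>
  Test \<open>b\<close> against the dual covectors \<open>al k\<close> of the frame vectors \<open>e\<^sub>k\<close>, \<open>k \<noteq> j\<close>.  The resulting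
  form of top degree is a positive multiple of \<open>b [e\<^sub>j, i e\<^sub>j]\<close> on the frame, and the volume of \<open>w\<close>
  identifies the orientation of the frame as the canonical one.
\<close>

lemma weakly_semipositive_diag:
  fixes w b :: "'n::finite covector"
  assumes w: "metric_covector w" and b: "b \<in> pq_covectors 1 1" and e: "unitary_frame (riem w) e"
    and semi: "\<And>as. length as = CARD('n) - 1 \<Longrightarrow> set as \<subseteq> pq_covectors 1 0 \<Longrightarrow>
        top_nonneg (wedge_list (b # map (\<lambda>a vs. \<i> * wedge a (cnj_covector a) vs) as))"
  shows "riem b (e j) (e j) \<ge> 0"
proof -
  note U = unitary_frameD [OF metric_covectorD(2) [OF w] e]
  note H = hermitian_formD [OF metric_covectorD(2) [OF w]]
  \<comment> \<open>The complex-linear functional that is 1 on \<open>e k\<close> and 0 on the other frame vectors.\<close>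
  define al where "al k = (\<lambda>vs. if length vs = 1 then Complex (riem w (e k) (hd vs)) (riem w (\<i> *s e k) (hd vs)) else 0)" for k
  define th where "th k = (\<lambda>vs. \<i> * wedge (al k) (cnj_covector (al k)) vs)" for k
  have al1: "al k \<in> pq_covectors 1 0" for k
  proof -
    have "linear (\<lambda>v. al k [v])"
      by (rule linearI) (simp_all add: al_def linear_add [OF H(2)] linear_scale [OF H(2)] complex_eq_iff)
    moreover have "al k [\<i> *s v] = \<i> * al k [v]" for v
      using H(4) [of "e k" v] H(5) [of "e k" v] by (simp add: al_def complex_eq_iff)
    ultimately show ?thesis unfolding pq_1_0_iff by (simp add: al_def)
  qed
  have ale: "al k [e m] = (if k = m then 1 else 0)" "al k [\<i> *s e m] = (if k = m then \<i> else 0)" for k m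
    by (simp_all add: al_def U complex_eq_iff)
  have th2: "th k vs = (if length vs = 2 then \<i> * (al k [vs ! 0] * cnj (al k [vs ! 1]) - al k [vs ! 1] * cnj (al k [vs ! 0])) else 0)" for k vs
    unfolding th_def by (subst wedge_deg1_deg1) (simp_all add: al_def)
  have th0: "th k xs = 0" if "x \<in> set xs" "x = e m \<or> x = \<i> *s e m" "m \<noteq> k" for k m x xs
  proof (cases "length xs = 2")
    case True
    then obtain u v where "xs = [u, v]" by (metis list_length2)
    then show ?thesis using that by (auto simp: th2 ale)
  qed (simp add: th2)
  have thk: "th k [e k, \<i> *s e k] = 2" for k by (simp add: th2 ale complex_eq_iff)
  have altth: "alternating (th k)" for k
  proof -
    have "alternating (al k)" using al1 pq_alternating by blast
    then show ?thesis unfolding th_def by (intro alternating_scale alternating_wedge alternating_cnj)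
  qed
  have alist0: "wedge_list (map th ks) xs = 0" if "x \<in> set xs" "x = e m \<or> x = \<i> *s e m" "m \<notin> set ks" for x m ks xs
    using that
  proof (induction ks arbitrary: xs)
    case Nil then show ?case by (auto simp: wedge_list_Nil wedge_unit_def)
  next
    case (Cons k ks)
    have "th k (nths xs I) * wedge_list (map th ks) (nths xs (- I)) = 0" for I
    proof -
      have "x \<in> set (nths xs I) \<or> x \<in> set (nths xs (- I))" using Cons.prems(1) by (auto simp: set_nths in_set_conv_nth)
      then show ?thesis
      proof
        assume "x \<in> set (nths xs I)"
        then have "th k (nths xs I) = 0" using th0 [of x "nths xs I" m k] Cons.prems by auto
        then show ?thesis by simp
      next
        assume "x \<in> set (nths xs (- I))"
        then have "wedge_list (map th ks) (nths xs (- I)) = 0" using Cons.IH Cons.prems by auto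
        then show ?thesis by simp
      qed
    qed
    then show ?case unfolding list.map wedge_list_Cons wedge_def mult.assoc by (simp only: mult_zero_right sum.neutral_const)
  qed
  have contract: "wedge a (wedge_list (map th ks)) (e m # \<i> *s e m # rest) = a [e m, \<i> *s e m] * wedge_list (map th ks) rest"
    if "m \<notin> set ks" "\<And>xs. length xs \<noteq> 2 \<Longrightarrow> a xs = 0" for a m ks rest
  proof -
    have "wedge_list (map th ks) (e m # xs) = 0" "wedge_list (map th ks) (\<i> *s e m # xs) = 0" for xs
      using that(1) by (auto intro: alist0)
    then show ?thesis
      using wedge_two_contract [where a = a and b = "wedge_list (map th ks)" and u = "e m" and v = "\<i> *s e m" and rest = rest, OF that(2)]
      by (simp add: wedge_zero_right)
  qed
  have pow: "wedge_list (map th ks) (pairs e ks) = 2 ^ length ks" if "distinct ks" for ks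
    using that
  proof (induction ks)
    case Nil then show ?case by (simp add: wedge_list_Nil wedge_unit_def pairs_simps)
  next
    case (Cons k ks)
    have "length xs \<noteq> 2 \<Longrightarrow> th k xs = 0" for xs by (simp add: th2)
    then show ?case using Cons contract [of k ks "th k" "pairs e ks"] by (simp add: wedge_list_Cons pairs_simps thk)
  qed
  define ks where "ks = remove1 j (index_list :: 'n list)"
  have ks: "distinct ks" "set ks = UNIV - {j}" "length ks = CARD('n) - 1"
    using index_list [where 'n = 'n]
    by (simp_all add: ks_def length_remove1 length_index_list set_remove1_eq distinct_remove1)
  define T where "T = wedge_list (b # map th ks)"
  have altb: "alternating b" and b2: "\<And>xs. length xs \<noteq> 2 \<Longrightarrow> b xs = 0" using b pq_1_1_iff by blast+
  have T1: "T (pairs e (j # ks)) = b [e j, \<i> *s e j] * 2 ^ length ks"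
    using contract [where m = j and ks = ks and a = b and rest = "pairs e ks", OF _ b2] ks by (simp add: T_def wedge_list_Cons pairs_simps pow)
  have T2: "volume_covector w (pairs e (j # ks)) = 1"
    by (rule volume_unitary [OF w e]) (use ks in auto)
  have T3: "T (pairs e (j # ks)) * volume_covector w canonical_frame
      = volume_covector w (pairs e (j # ks)) * T canonical_frame"
  proof (rule top_proportional)
    show "alternating T" unfolding T_def by (rule alternating_wedge_list) (use altb altth in auto)
    show "alternating (volume_covector w)" by (intro alternating_volume metric_covectorD(3) w)
    show "length (pairs e (j # ks)) = 2 * CARD('n)" by (simp add: length_pairs ks)
  qed
  have T4: "T canonical_frame \<in> \<real>\<^sub>\<ge>\<^sub>0"
  proof -
    have eq: "map (\<lambda>a vs. \<i> * wedge a (cnj_covector a) vs) (map al ks) = map th ks"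
      by (simp add: th_def [abs_def])
    have "set (map al ks) \<subseteq> pq_covectors 1 0" using al1 by auto
    from semi [OF _ this, unfolded eq] show ?thesis using ks(3) by (simp add: T_def top_nonneg_def)
  qed
  define V where "V = Re (volume_covector w canonical_frame)"
  have V: "V > 0" "volume_covector w canonical_frame = of_real V"
    using volume_pos [OF w] volume_real [OF w, of canonical_frame] by (simp_all add: V_def)
  have "b [e j, \<i> *s e j] * of_real (2 ^ length ks * V) = T canonical_frame"
    using T3 unfolding T1 T2 V(2) by (simp add: mult.assoc)
  then have "0 \<le> Re (b [e j, \<i> *s e j] * of_real (2 ^ length ks * V))"
    using T4 by (simp only: complex_nonneg_Reals_iff)
  then have "0 \<le> Re (b [e j, \<i> *s e j]) * (2 ^ length ks * V)"
    by (simp only: Re_complex_of_real times_complex.simps Im_complex_of_real mult_zero_right diff_zero)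
  moreover have "0 < 2 ^ length ks * V" using V(1) by simp
  ultimately have "0 \<le> Re (b [e j, \<i> *s e j])" by (meson not_le mult_neg_pos)
  then show ?thesis by (simp add: riem_def)
qed

lemma hermitian_diag_nonneg:
  assumes g: "positive_form g" and h: "hermitian_form h" and e: "unitary_frame g e"
    and l: "\<And>j v. h (e j) v = l j * g (e j) v" and nn: "\<And>j. h (e j) (e j) \<ge> 0"
  shows "h v v \<ge> 0"
proof -
  have hg: "hermitian_form g" using g by (simp add: positive_form_def)
  note U = unitary_frameD [OF hg e] and H = hermitian_formD [OF h] and G = hermitian_formD [OF hg]
  have l0: "l j \<ge> 0" for j using nn [of j] l [of j "e j"] U(1) [of j j] by simp
  have il: "h (\<i> *s e j) v = l j * g (\<i> *s e j) v" for j v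
    using H(5) [of "e j" v] G(5) [of "e j" v] l by simp
  have "h v v = h (\<Sum>j\<in>UNIV. g (e j) v *\<^sub>R e j + g (\<i> *s e j) v *\<^sub>R (\<i> *s e j)) v"
    using orthonormal_expansion [OF g unitary_frame_basis(1) [OF hg e], of v]
    by (simp add: unitary_frame_basis(2) [OF hg e])
  also have "\<dots> = (\<Sum>j\<in>UNIV. l j * (g (e j) v)\<^sup>2 + l j * (g (\<i> *s e j) v)\<^sup>2)"
    by (simp add: linear_sum [OF H(1)] linear_add [OF H(1)] linear_scale [OF H(1)] l il power2_eq_square mult_ac)
  also have "\<dots> \<ge> 0" using l0 by (intro sum_nonneg) auto
  finally show ?thesis .
qed

text \<open>
  Diagonalize \<open>b\<close> with respect to \<open>w\<close>; weak semi-positivity says that the eigenvalues are nonnegative.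
\<close>

lemma weakly_semipositive_imp_nonneg:
  fixes w b :: "'n::finite covector"
  assumes w: "metric_covector w" and b: "b \<in> pq_covectors 1 1"
    and semi: "\<And>as. length as = CARD('n) - 1 \<Longrightarrow> set as \<subseteq> pq_covectors 1 0 \<Longrightarrow>
        top_nonneg (wedge_list (b # map (\<lambda>a vs. \<i> * wedge a (cnj_covector a) vs) as))"
  shows "riem b v v \<ge> 0"
proof -
  obtain e l where e: "unitary_frame (riem w) e" and l: "\<And>j v. riem b (e j) v = l j * riem w (e j) v"
    by (rule simultaneous_diagonalization [OF metric_covectorD(1) [OF w] riem_hermitian [OF b]]) (rule that)
  show ?thesis
    by (rule hermitian_diag_nonneg [OF metric_covectorD(1) [OF w] riem_hermitian [OF b] e l
        weakly_semipositive_diag [OF w b e semi]])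
qed

section \<open>Pull-back along complex-linear maps\<close>

definition complex_linear :: "(complex^'n::finite \<Rightarrow> complex^'m::finite) \<Rightarrow> bool" where
  "complex_linear T \<longleftrightarrow> linear T \<and> (\<forall>v. T (\<i> *s v) = \<i> *s T v)"

lemma alternating_pull:
  assumes "alternating a" "linear T" shows "alternating (\<lambda>vs. a (map T vs))"
  using assms by (simp add: alternating_def linear_add linear_scale)

lemma pq_pull:
  assumes T: "complex_linear T"
  shows "a \<in> pq_covectors 1 0 \<Longrightarrow> (\<lambda>vs. a (map T vs)) \<in> pq_covectors 1 0"
    "a \<in> pq_covectors 2 0 \<Longrightarrow> (\<lambda>vs. a (map T vs)) \<in> pq_covectors 2 0"
    "a \<in> pq_covectors 1 1 \<Longrightarrow> (\<lambda>vs. a (map T vs)) \<in> pq_covectors 1 1"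
proof -
  have lin: "linear T" and i: "\<And>v. T (\<i> *s v) = \<i> *s T v" using T by (auto simp: complex_linear_def)
  show "a \<in> pq_covectors 1 0 \<Longrightarrow> (\<lambda>vs. a (map T vs)) \<in> pq_covectors 1 0"
    unfolding pq_1_0_iff using linear_compose [OF lin] by (auto simp: i o_def)
  show "a \<in> pq_covectors 2 0 \<Longrightarrow> (\<lambda>vs. a (map T vs)) \<in> pq_covectors 2 0"
    "a \<in> pq_covectors 1 1 \<Longrightarrow> (\<lambda>vs. a (map T vs)) \<in> pq_covectors 1 1"
    unfolding pq_2_0_iff pq_1_1_iff using alternating_pull [OF _ lin] by (simp_all add: i)
qed

lemma metric_pull:
  assumes T: "complex_linear T" "inj T" and w: "metric_covector w"
  shows "metric_covector (\<lambda>vs. w (map T vs))"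
proof -
  have i: "T (\<i> *s v) = \<i> *s T v" and nz: "v \<noteq> 0 \<Longrightarrow> T v \<noteq> 0" for v
    using T linear_injective_0 [of T] by (auto simp: complex_linear_def)
  have "positive_definite w" "w \<in> pq_covectors 1 1" using w by (auto simp: metric_covector_def)
  then show ?thesis
    using pq_pull(3) [OF T(1)] nz metric_covectorD(7) [OF w]
    by (auto simp: metric_covector_def positive_definite_def i fun_eq_iff)
qed

text \<open>
  A complex-linear isomorphism maps a unitary frame of the pulled back metric to a unitary frame.
  On the left, the density is the one with respect to the image of the canonical frame.
\<close>

lemma norm_density_pull:
  fixes T :: "complex^'n::finite \<Rightarrow> complex^'n"
  assumes T: "complex_linear T" "inj T" and w: "metric_covector w" and a: "a \<in> pq_covectors 2 0"
  shows "(covector_norm w 2 a)\<^sup>2 * Re (volume_covector w (map T canonical_frame))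
      = norm_density (\<lambda>vs. w (map T vs)) (\<lambda>vs. a (map T vs))"
proof -
  let ?w = "\<lambda>vs. w (map T vs)" and ?a = "\<lambda>vs. a (map T vs)"
  have m: "metric_covector ?w" by (rule metric_pull [OF T w])
  obtain e where e: "unitary_frame (riem ?w) e" by (rule unitary_frame_exists [OF metric_covectorD(1) [OF m]])
  have e': "unitary_frame (riem w) (\<lambda>j. T (e j))"
    using e T(1) by (auto simp: unitary_frame_def riem_def complex_linear_def linear_neg)
  have "(covector_norm ?w 2 ?a)\<^sup>2 = (covector_norm w 2 a)\<^sup>2"
    unfolding covector_norm_unitary [OF m e pq_pull(2) [OF T(1) a]] covector_norm_unitary [OF w e' a] by simp
  moreover have "volume_covector ?w canonical_frame = volume_covector w (map T canonical_frame)"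
    by (simp add: volume_covector_def wedge_list_map)
  ultimately show ?thesis by (simp add: norm_density_def)
qed

section \<open>Holomorphic functions of several variables\<close>

lemma norm_smult: "norm (c *s v) = cmod c * norm v" for v :: "complex^'n::finite"
proof -
  have "norm (c *s v) = L2_set (\<lambda>i. cmod c * cmod (v $ i)) UNIV"
    by (simp add: norm_vec_def norm_mult)
  also have "\<dots> = cmod c * L2_set (\<lambda>i. cmod (v $ i)) UNIV"
    by (simp add: L2_set_right_distrib)
  finally show ?thesis by (simp add: norm_vec_def)
qed

text \<open>
  Holomorphy in the sense of a complex-linear differential at each point of \<open>S\<close>; continuity of the
  differential is not part of it and follows for open \<open>S\<close>.
\<close>

definition hol_on :: "(complex^'n::finite) set \<Rightarrow> (complex^'n \<Rightarrow> complex) \<Rightarrow> bool" where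
  "hol_on S f \<longleftrightarrow> (\<forall>z\<in>S. f differentiable (at z) \<and> (\<forall>v. full_deriv f z (\<i> *s v) = \<i> * full_deriv f z v))"

lemma full_deriv_eq: "(f has_derivative D) (at z) \<Longrightarrow> full_deriv f z = D"
  using frechet_derivative_at [of f D z] by (auto simp: full_deriv_def fun_eq_iff)

lemma full_deriv_works: "f differentiable (at z) \<Longrightarrow> (f has_derivative full_deriv f z) (at z)"
  unfolding full_deriv_def [abs_def] by (rule frechet_derivative_works [THEN iffD1])

lemma linear_full_deriv: "f differentiable (at z) \<Longrightarrow> linear (full_deriv f z)"
  by (meson full_deriv_works has_derivative_linear)

lemma hol_onI:
  assumes "\<And>z. z \<in> S \<Longrightarrow> (f has_derivative D z) (at z)" "\<And>z v. z \<in> S \<Longrightarrow> D z (\<i> *s v) = \<i> * D z v"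
  shows "hol_on S f"
  unfolding hol_on_def using assms full_deriv_eq by (metis differentiableI)

lemma hol_onD:
  assumes "hol_on S f" "z \<in> S"
  shows "(f has_derivative full_deriv f z) (at z)" "full_deriv f z (\<i> *s v) = \<i> * full_deriv f z v"
  using assms full_deriv_works by (auto simp: hol_on_def)

lemma hol_on_smult:
  assumes "hol_on S f" "z \<in> S"
  shows "full_deriv f z (c *s v) = c * full_deriv f z v"
proof -
  have lin: "linear (full_deriv f z)" using hol_onD(1) [OF assms] by (rule has_derivative_linear)
  have "full_deriv f z (c *s v) = Re c *\<^sub>R full_deriv f z v + Im c *\<^sub>R (\<i> * full_deriv f z v)"
    by (subst smult_complex) (simp add: linear_add [OF lin] linear_scale [OF lin] hol_onD(2) [OF assms])
  also have "\<dots> = c * full_deriv f z v" by (simp add: complex_eq_iff)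
  finally show ?thesis .
qed

lemma hol_on_subset: "hol_on S f \<Longrightarrow> T \<subseteq> S \<Longrightarrow> hol_on T f"
  by (auto simp: hol_on_def)

lemma hol_on_imp_continuous_on: "hol_on S f \<Longrightarrow> continuous_on S f"
  by (meson continuous_at_imp_continuous_on differentiable_imp_continuous_within hol_on_def)

lemma hol_on_diff: "hol_on S f \<Longrightarrow> hol_on S g \<Longrightarrow> hol_on S (\<lambda>z. f z - g z)"
  by (rule hol_onI [where D = "\<lambda>z v. full_deriv f z v - full_deriv g z v"])
     (auto intro!: has_derivative_diff simp: hol_onD algebra_simps)

lemma hol_on_add: "hol_on S f \<Longrightarrow> hol_on S g \<Longrightarrow> hol_on S (\<lambda>z. f z + g z)"
  by (rule hol_onI [where D = "\<lambda>z v. full_deriv f z v + full_deriv g z v"])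
     (auto intro!: has_derivative_add simp: hol_onD algebra_simps)

lemma hol_on_mult: "hol_on S f \<Longrightarrow> hol_on S g \<Longrightarrow> hol_on S (\<lambda>z. f z * g z)"
  by (rule hol_onI [where D = "\<lambda>z v. f z * full_deriv g z v + full_deriv f z v * g z"])
     (rule has_derivative_mult [OF hol_onD(1) hol_onD(1)], assumption+, simp add: hol_onD(2) algebra_simps)

lemma hol_on_cmult: "hol_on S f \<Longrightarrow> hol_on S (\<lambda>z. c * f z)"
  by (rule hol_onI [where D = "\<lambda>z v. c * full_deriv f z v"])
     (auto intro!: has_derivative_mult_right simp: hol_onD algebra_simps)

lemma hol_on_const: "hol_on S (\<lambda>z. c)"
  by (rule hol_onI [where D = "\<lambda>z v. 0"]) auto

lemma hol_on_sum: "(\<And>i. i \<in> I \<Longrightarrow> hol_on S (f i)) \<Longrightarrow> hol_on S (\<lambda>z. \<Sum>i\<in>I. f i z)"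
  by (induction I rule: infinite_finite_induct) (auto intro: hol_on_const hol_on_add)

lemma hol_on_translate:
  assumes "hol_on S f" "\<And>z. z \<in> T \<Longrightarrow> z + a \<in> S"
  shows "hol_on T (\<lambda>z. f (z + a))"
proof (rule hol_onI [where D = "\<lambda>z. full_deriv f (z + a)"])
  fix z assume "z \<in> T"
  then have "z + a \<in> S" by (rule assms(2))
  have "((\<lambda>z. z + a) has_derivative (\<lambda>v. v)) (at z)" by (auto intro!: derivative_eq_intros)
  from has_derivative_compose [OF this] hol_onD(1) [OF assms(1) \<open>z + a \<in> S\<close>]
  show "((\<lambda>z. f (z + a)) has_derivative full_deriv f (z + a)) (at z)" by blast
  show "full_deriv f (z + a) (\<i> *s v) = \<i> * full_deriv f (z + a) v" for v
    by (rule hol_onD(2) [OF assms(1) \<open>z + a \<in> S\<close>])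
qed

text \<open>
  Restriction to complex lines brings in the theory of functions of one variable.
\<close>

lemma hol_on_line:
  assumes "hol_on S f" "z + w *s v \<in> S"
  shows "((\<lambda>\<zeta>. f (z + \<zeta> *s v)) has_field_derivative full_deriv f (z + w *s v) v) (at w)"
proof -
  have "linear (\<lambda>\<zeta>. \<zeta> *s v)" by (rule linearI) (simp_all add: vec_eq_iff algebra_simps)
  then have "((\<lambda>\<zeta>. \<zeta> *s v) has_derivative (\<lambda>\<zeta>. \<zeta> *s v)) (at w)"
    by (simp add: linear_imp_has_derivative)
  then have "((\<lambda>\<zeta>. z + \<zeta> *s v) has_derivative (\<lambda>\<zeta>. \<zeta> *s v)) (at w)"
    by (auto intro!: derivative_eq_intros)
  from has_derivative_compose [OF this hol_onD(1) [OF assms]]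
  have "((\<lambda>\<zeta>. f (z + \<zeta> *s v)) has_derivative (\<lambda>\<zeta>. full_deriv f (z + w *s v) (\<zeta> *s v))) (at w)" .
  then show ?thesis
    unfolding has_field_derivative_def hol_on_smult [OF assms] by (simp add: mult.commute [of _ "full_deriv _ _ _"])
qed

lemma line_in_cball:
  assumes "cball z r \<subseteq> S" "norm v \<le> 1" "cmod \<zeta> \<le> r"
  shows "z + \<zeta> *s v \<in> S"
proof -
  have "norm (\<zeta> *s v) \<le> r" unfolding norm_smult using assms(2,3) by (metis mult_left_le norm_ge_zero order_trans)
  then have "z + \<zeta> *s v \<in> cball z r" by (simp add: dist_norm)
  then show ?thesis using assms(1) by blast
qed

lemma hol_on_line_holomorphic:
  assumes "hol_on S f" "cball z r \<subseteq> S" "norm v \<le> 1"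
  shows "(\<lambda>\<zeta>. f (z + \<zeta> *s v)) holomorphic_on cball 0 r"
  unfolding holomorphic_on_def
proof
  fix \<zeta> :: complex assume "\<zeta> \<in> cball 0 r"
  then have "z + \<zeta> *s v \<in> S" by (intro line_in_cball [OF assms(2,3)]) simp
  from hol_on_line [OF assms(1) this]
  show "(\<lambda>\<zeta>. f (z + \<zeta> *s v)) field_differentiable at \<zeta> within cball 0 r"
    by (meson field_differentiable_at_within field_differentiable_def)
qed

lemma hol_on_deriv_bound1:
  assumes f: "hol_on S f" and S: "cball z r \<subseteq> S" and r: "r > 0" and v: "norm v \<le> 1"
    and M: "\<And>w. w \<in> cball z r \<Longrightarrow> cmod (f w) \<le> M"
  shows "cmod (full_deriv f z v) \<le> M / r"
proof -
  let ?g = "\<lambda>\<zeta>. f (z + \<zeta> *s v)"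
  have hol: "?g holomorphic_on cball 0 r" by (rule hol_on_line_holomorphic [OF f S v])
  have "norm ((deriv ^^ 1) ?g 0) \<le> fact 1 * M / r ^ 1"
  proof (rule Cauchy_inequality)
    show "?g holomorphic_on ball 0 r" using hol holomorphic_on_subset ball_subset_cball by blast
    show "continuous_on (cball 0 r) ?g" using hol by (rule holomorphic_on_imp_continuous_on)
    fix x :: complex assume "norm (0 - x) = r"
    then have "z + x *s v \<in> cball z r" by (intro line_in_cball [OF order_refl v]) simp
    then show "norm (?g x) \<le> M" by (rule M)
  qed (rule r)
  moreover have "deriv ?g 0 = full_deriv f z v"
  proof -
    have "z \<in> S" using S r by (meson centre_in_cball less_imp_le subsetD)
    then show ?thesis using hol_on_line [OF f, of z 0 v] by (simp add: DERIV_imp_deriv)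
  qed
  ultimately show ?thesis by simp
qed

lemma hol_on_deriv_bound:
  assumes f: "hol_on S f" and S: "cball z r \<subseteq> S" and r: "r > 0"
    and M: "\<And>w. w \<in> cball z r \<Longrightarrow> cmod (f w) \<le> M"
  shows "cmod (full_deriv f z v) \<le> M / r * norm v"
proof (cases "v = 0")
  case True
  have "z \<in> S" using S r by (meson centre_in_cball less_imp_le subsetD)
  then have "full_deriv f z 0 = 0"
    using hol_onD(1) [OF f] has_derivative_linear linear_0 by blast
  then show ?thesis using True by simp
next
  case False
  have "z \<in> S" using S r by (meson centre_in_cball less_imp_le subsetD)
  then have lin: "linear (full_deriv f z)" using hol_onD(1) [OF f] has_derivative_linear by blast
  have "cmod (full_deriv f z ((1 / norm v) *\<^sub>R v)) \<le> M / r"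
    by (rule hol_on_deriv_bound1 [OF f S r _ M]) (use False in auto)
  then show ?thesis using False by (simp add: linear_scale [OF lin] field_simps)
qed

text \<open>
  On the disc of radius \<open>r / 2\<close> the second derivative along the line is at most
  \<open>2 M / (r / 2)\<^sup>2\<close> by Cauchy's estimate.
\<close>

lemma hol_on_taylor_bound:
  assumes f: "hol_on S f" and S: "cball z r \<subseteq> S" and r: "r > 0" and v: "norm v \<le> 1"
    and M: "\<And>w. w \<in> cball z r \<Longrightarrow> cmod (f w) \<le> M" and h: "cmod h \<le> r / 2"
  shows "cmod (f (z + h *s v) - f z - h * full_deriv f z v) \<le> 8 * M / r\<^sup>2 * (cmod h)\<^sup>2"
proof -
  let ?g = "\<lambda>\<zeta>. f (z + \<zeta> *s v)"
  have hol: "?g holomorphic_on cball 0 r" by (rule hol_on_line_holomorphic [OF f S v])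
  have holb: "?g holomorphic_on ball 0 r" using hol holomorphic_on_subset ball_subset_cball by blast
  have zS: "z \<in> S" using S r by (meson centre_in_cball less_imp_le subsetD)
  have d0: "deriv ?g 0 = full_deriv f z v" using hol_on_line [OF f, of z 0 v] zS by (simp add: DERIV_imp_deriv)
  have sub: "cball 0 (r / 2) \<subseteq> ball (0::complex) r" using r by (auto simp: dist_norm)
  have "cmod ((deriv ^^ 0) ?g h - (\<Sum>i\<le>1. (deriv ^^ i) ?g 0 * (h - 0) ^ i / fact i))
      \<le> (8 * M / r\<^sup>2) * cmod (h - 0) ^ Suc 1 / fact 1"
  proof (rule complex_Taylor [of "cball 0 (r / 2)" 1 "\<lambda>i. (deriv ^^ i) ?g" "8 * M / r\<^sup>2" 0 h])
    show "((deriv ^^ i) ?g has_field_derivative (deriv ^^ Suc i) ?g x) (at x within cball 0 (r / 2))"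
      if "x \<in> cball 0 (r / 2)" for i x
    proof -
      have "((deriv ^^ i) ?g has_field_derivative deriv ((deriv ^^ i) ?g) x) (at x)"
        by (rule holomorphic_derivI [OF holomorphic_higher_deriv [OF holb open_ball]]) (use that sub in auto)
      then show ?thesis using DERIV_subset [of _ _ x UNIV] by simp
    qed
    show "cmod ((deriv ^^ Suc 1) ?g x) \<le> 8 * M / r\<^sup>2" if x: "x \<in> cball 0 (r / 2)" for x
    proof -
      have sub2: "cball x (r / 2) \<subseteq> cball 0 r"
      proof
        fix y assume "y \<in> cball x (r / 2)"
        then show "y \<in> cball 0 r" using x norm_triangle_sub [of y x] by (simp add: dist_norm norm_minus_commute)
      qed
      have "norm ((deriv ^^ 2) ?g x) \<le> fact 2 * M / (r / 2) ^ 2"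
      proof (rule Cauchy_inequality)
        show "?g holomorphic_on ball x (r / 2)"
          using hol sub2 by (meson ball_subset_cball holomorphic_on_subset order_trans)
        show "continuous_on (cball x (r / 2)) ?g"
          using hol sub2 by (meson continuous_on_subset holomorphic_on_imp_continuous_on)
        fix y assume "norm (x - y) = r / 2"
        then have "y \<in> cball 0 r" using sub2 by (auto simp: dist_norm)
        then have "z + y *s v \<in> cball z r" by (intro line_in_cball [OF order_refl v]) simp
        then show "norm (?g y) \<le> M" by (rule M)
      qed (use r in simp)
      also have "fact 2 * M / (r / 2) ^ 2 = 8 * M / r\<^sup>2" by (simp add: power_divide fact_2)
      finally show ?thesis by (simp add: numeral_2_eq_2)
    qed
  qed (use h r in auto)
  then show ?thesis using d0 by (simp add: power2_eq_square algebra_simps)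
qed

lemma hol_on_deriv_diff_bound:
  assumes f: "hol_on (ball z r) f" and g: "hol_on (ball z r) g" and r: "r > 0"
    and e: "\<And>w. w \<in> ball z r \<Longrightarrow> cmod (f w - g w) \<le> e" and w: "w \<in> ball z (r / 2)"
  shows "cmod (full_deriv f w v - full_deriv g w v) \<le> e / (r / 3) * norm v"
proof -
  have sub: "cball w (r / 3) \<subseteq> ball z r"
  proof
    fix y assume y: "y \<in> cball w (r / 3)"
    have "dist z y \<le> dist z w + dist w y" by (rule dist_triangle)
    then show "y \<in> ball z r" using y w r by simp
  qed
  have wb: "w \<in> ball z r" using w r by simp
  have "cmod (full_deriv (\<lambda>w. f w - g w) w v) \<le> e / (r / 3) * norm v"
    by (rule hol_on_deriv_bound [OF hol_on_diff [OF f g] sub]) (use r e sub in auto)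
  moreover have "full_deriv (\<lambda>w. f w - g w) w = (\<lambda>v. full_deriv f w v - full_deriv g w v)"
    by (rule full_deriv_eq [OF has_derivative_diff [OF hol_onD(1) [OF f wb] hol_onD(1) [OF g wb]]])
  ultimately show ?thesis by simp
qed

text \<open>
  Cauchy's estimate makes the derivatives uniformly Cauchy on the smaller ball; then the limit
  is differentiable and its differential, as a limit of complex-linear maps, is complex linear.
\<close>

lemma hol_on_limit:
  fixes F :: "nat \<Rightarrow> complex^'n::finite \<Rightarrow> complex"
  assumes F: "\<And>k. hol_on (ball z r) (F k)" and r: "r > 0"
    and lim: "uniform_limit (ball z r) F f sequentially"
  shows "hol_on (ball z (r / 2)) f"
    and "\<And>w v. w \<in> ball z (r / 2) \<Longrightarrow> (\<lambda>k. full_deriv (F k) w v) \<longlonglongrightarrow> full_deriv f w v"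
proof -
  let ?B = "ball z (r / 2)"
  have cauchy: "\<exists>N. \<forall>m\<ge>N. \<forall>n\<ge>N. \<forall>w\<in>?B. \<forall>v. cmod (full_deriv (F m) w v - full_deriv (F n) w v) \<le> e * norm v"
    if e: "e > 0" for e
  proof -
    \<comment> \<open>The functions differ by at most \<open>e r / 3\<close> on the large ball, and Cauchy discs of radius \<open>r / 3\<close> fit into it.\<close>
    have "e * r / 6 > 0" using e r by simp
    with lim have "\<forall>\<^sub>F n in sequentially. \<forall>x\<in>ball z r. dist (F n x) (f x) < e * r / 6"
      by (rule uniform_limitD)
    then obtain N where N: "\<And>n x. n \<ge> N \<Longrightarrow> x \<in> ball z r \<Longrightarrow> dist (F n x) (f x) < e * r / 6"
      unfolding eventually_sequentially by blast
    have "cmod (full_deriv (F m) w v - full_deriv (F n) w v) \<le> e * norm v" if "m \<ge> N" "n \<ge> N" "w \<in> ?B" for m n w v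
    proof -
      have "cmod (full_deriv (F m) w v - full_deriv (F n) w v) \<le> (e * r / 3) / (r / 3) * norm v"
      proof (rule hol_on_deriv_diff_bound [OF F F r _ \<open>w \<in> ?B\<close>])
        fix x assume "x \<in> ball z r"
        have "dist (F m x) (F n x) \<le> dist (F m x) (f x) + dist (F n x) (f x)" by (rule dist_triangle2)
        then show "cmod (F m x - F n x) \<le> e * r / 3"
          using N [OF \<open>m \<ge> N\<close> \<open>x \<in> _\<close>] N [OF \<open>n \<ge> N\<close> \<open>x \<in> _\<close>] by (simp add: dist_norm)
      qed
      then show ?thesis using r by simp
    qed
    then show ?thesis by blast
  qed
  have conv: "convergent (\<lambda>k. full_deriv (F k) w v)" if w: "w \<in> ?B" for w v
  proof -
    have "Cauchy (\<lambda>k. full_deriv (F k) w v)"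
    proof (rule metric_CauchyI)
      fix e :: real assume e: "e > 0"
      then have "e / (2 * (norm v + 1)) > 0" by (simp add: add_nonneg_pos)
      from cauchy [OF this] obtain N where N: "\<And>m n. m \<ge> N \<Longrightarrow> n \<ge> N \<Longrightarrow>
        cmod (full_deriv (F m) w v - full_deriv (F n) w v) \<le> e / (2 * (norm v + 1)) * norm v" using w by blast
      have "e / (2 * (norm v + 1)) * norm v < e"
      proof -
        have "norm v / (2 * (norm v + 1)) < 1" using norm_ge_zero [of v] by (simp add: divide_less_eq_1_pos add_nonneg_pos)
        then have "e * (norm v / (2 * (norm v + 1))) < e * 1" using e by (rule mult_strict_left_mono)
        then show ?thesis by simp
      qed
      then show "\<exists>N. \<forall>m\<ge>N. \<forall>n\<ge>N. dist (full_deriv (F m) w v) (full_deriv (F n) w v) < e"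
        using N unfolding dist_norm by (meson le_less_trans)
    qed
    then show ?thesis by (simp add: Cauchy_convergent_iff)
  qed
  define g where "g w v = lim (\<lambda>k. full_deriv (F k) w v)" for w v
  have glim: "(\<lambda>k. full_deriv (F k) w v) \<longlonglongrightarrow> g w v" if "w \<in> ?B" for w v
    using conv [OF that] by (simp add: g_def convergent_LIMSEQ_iff)
  have sub: "?B \<subseteq> ball z r" using r by (auto simp: subset_eq)
  have zB: "z \<in> ?B" using r by simp
  have nle: "\<forall>\<^sub>F n in sequentially. \<forall>x\<in>?B. \<forall>h. norm (full_deriv (F n) x h - g x h) \<le> e * norm h" if e: "e > 0" for e
  proof -
    obtain N where N: "\<And>m n w v. m \<ge> N \<Longrightarrow> n \<ge> N \<Longrightarrow> w \<in> ?B \<Longrightarrow>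
        cmod (full_deriv (F m) w v - full_deriv (F n) w v) \<le> e * norm v" using cauchy [OF e] by blast
    have "norm (full_deriv (F n) x h - g x h) \<le> e * norm h" if "n \<ge> N" "x \<in> ?B" for n x h
    proof (rule tendsto_upperbound)
      show "(\<lambda>m. norm (full_deriv (F n) x h - full_deriv (F m) x h)) \<longlonglongrightarrow> norm (full_deriv (F n) x h - g x h)"
        by (intro tendsto_intros glim that)
      show "\<forall>\<^sub>F m in sequentially. norm (full_deriv (F n) x h - full_deriv (F m) x h) \<le> e * norm h"
        unfolding eventually_sequentially using N [OF \<open>n \<ge> N\<close> _ \<open>x \<in> ?B\<close>] by blast
    qed simp
    then show ?thesis unfolding eventually_sequentially by blast
  qed
  have pt: "(\<lambda>n. F n x) \<longlonglongrightarrow> f x" if "x \<in> ball z r" for x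
    using lim that by (rule tendsto_uniform_limitI)
  have "\<exists>G. \<forall>x\<in>?B. (\<lambda>n. F n x) \<longlonglongrightarrow> G x \<and> (G has_derivative g x) (at x within ?B)"
  proof (rule has_derivative_sequence [OF _ _ nle zB pt])
    show "(F n has_derivative full_deriv (F n) x) (at x within ?B)" if "x \<in> ?B" for n x
      using hol_onD(1) [OF F, of x n] that sub has_derivative_at_withinI by blast
  qed (use zB sub in auto)
  then obtain G where G: "\<And>x. x \<in> ?B \<Longrightarrow> (\<lambda>n. F n x) \<longlonglongrightarrow> G x" "\<And>x. x \<in> ?B \<Longrightarrow> (G has_derivative g x) (at x within ?B)" by blast
  have fG: "f x = G x" if "x \<in> ?B" for x
    using G(1) [OF that] pt [of x] that sub LIMSEQ_unique by blast
  have fder: "(f has_derivative g x) (at x)" if "x \<in> ?B" for x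
  proof -
    have "(G has_derivative g x) (at x)" using G(2) [OF that] that by (simp add: at_within_open [OF _ open_ball])
    then show ?thesis
      by (rule has_derivative_transform_within_open [OF _ open_ball that]) (simp add: fG)
  qed
  show "hol_on ?B f"
  proof (rule hol_onI [OF fder])
    fix x v assume x: "x \<in> ?B"
    have "full_deriv (F k) x (\<i> *s v) = \<i> * full_deriv (F k) x v" for k
      by (rule hol_onD(2) [OF F]) (use x sub in auto)
    then have "(\<lambda>k. \<i> * full_deriv (F k) x v) \<longlonglongrightarrow> g x (\<i> *s v)" using glim [OF x, of "\<i> *s v"] by (simp only:)
    moreover have "(\<lambda>k. \<i> * full_deriv (F k) x v) \<longlonglongrightarrow> \<i> * g x v" by (intro tendsto_intros glim x)
    ultimately show "g x (\<i> *s v) = \<i> * g x v" by (rule LIMSEQ_unique)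
  qed
  show "(\<lambda>k. full_deriv (F k) w v) \<longlonglongrightarrow> full_deriv f w v" if "w \<in> ?B" for w v
    using glim [OF that] full_deriv_eq [OF fder [OF that]] by simp
qed

lemma hol_on_cong:
  assumes f: "hol_on S f" and S: "open S" and eq: "\<And>z. z \<in> S \<Longrightarrow> f z = g z"
  shows "hol_on S g"
proof (rule hol_onI [where D = "full_deriv f"])
  fix z assume z: "z \<in> S"
  show "(g has_derivative full_deriv f z) (at z)"
    by (rule has_derivative_transform_within_open [OF hol_onD(1) [OF f z] S z eq])
qed (rule hol_onD(2) [OF f])

lemma hol_on_local:
  assumes "\<And>z. z \<in> S \<Longrightarrow> \<exists>r>0. hol_on (ball z r) f" shows "hol_on S f"
  unfolding hol_on_def using assms by (metis centre_in_ball hol_on_def)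

text \<open>
  The difference quotients in a fixed direction are holomorphic and, by the Taylor estimate, converge
  uniformly to the derivative.  The direction \<open>v\<close> is first shrunk to a vector \<open>u\<close> of norm at most 1.
\<close>

lemma hol_on_deriv:
  fixes f :: "complex^'n::finite \<Rightarrow> complex"
  assumes f: "hol_on S f" and S: "open S"
  shows "hol_on S (\<lambda>z. full_deriv f z v)"
proof (rule hol_on_local)
  fix z0 assume "z0 \<in> S"
  then obtain R where R: "R > 0" "cball z0 R \<subseteq> S" using S open_contains_cball by blast
  define u where "u = (1 / (norm v + 1)) *\<^sub>R v"
  have nu: "norm u \<le> 1" by (simp add: u_def add_nonneg_pos divide_le_eq_1_pos)
  have vu: "v = (norm v + 1) *\<^sub>R u" using norm_ge_zero [of v] by (simp add: u_def add_nonneg_eq_0_iff)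
  have "continuous_on (cball z0 R) f" using hol_on_imp_continuous_on [OF f] R(2) continuous_on_subset by blast
  then have "bounded (f ` cball z0 R)" by (intro compact_imp_bounded compact_continuous_image compact_cball)
  then obtain M where M: "\<And>w. w \<in> cball z0 R \<Longrightarrow> cmod (f w) \<le> M" unfolding bounded_iff by blast
  have M0: "M \<ge> 0" using M [of z0] R(1) norm_ge_zero [of "f z0"] by (meson centre_in_cball less_imp_le order_trans)
  define h where "h k = R / 4 / real (Suc k)" for k
  have h: "0 < h k" "h k \<le> R / 4" for k using R(1) by (simp_all add: h_def divide_le_eq mult_le_cancel_left1)
  define F where "F k w = (1 / of_real (h k)) * (f (w + of_real (h k) *s u) - f w)" for k w
  have sub: "cball w (R / 2) \<subseteq> cball z0 R" if "w \<in> ball z0 (R / 2)" for w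
  proof
    fix y assume y: "y \<in> cball w (R / 2)"
    have "dist z0 y \<le> dist z0 w + dist w y" by (rule dist_triangle)
    then show "y \<in> cball z0 R" using y that by simp
  qed
  have inb: "w + of_real (h k) *s u \<in> cball z0 R" if "w \<in> ball z0 (R / 2)" for w k
    by (rule subsetD [OF sub [OF that] line_in_cball [OF order_refl nu]]) (use h [of k] in simp)
  have Fhol: "hol_on (ball z0 (R / 2)) (F k)" for k
  proof -
    have "hol_on (ball z0 (R / 2)) (\<lambda>w. f (w + of_real (h k) *s u))"
      by (rule hol_on_translate [OF f]) (use inb R(2) in blast)
    moreover have "hol_on (ball z0 (R / 2)) f"
      by (rule hol_on_subset [OF f]) (use R in \<open>auto simp: subset_eq\<close>)
    ultimately show ?thesis unfolding F_def by (intro hol_on_cmult hol_on_diff)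
  qed
  have est: "cmod (F k w - full_deriv f w u) \<le> 32 * M / R\<^sup>2 * h k" if w: "w \<in> ball z0 (R / 2)" for k w
  proof -
    have "cmod (f (w + of_real (h k) *s u) - f w - of_real (h k) * full_deriv f w u) \<le> 8 * M / (R / 2)\<^sup>2 * (cmod (of_real (h k)))\<^sup>2"
      by (rule hol_on_taylor_bound [OF f _ _ nu]) (use sub [OF w] R M h [of k] in auto)
    then have "cmod (f (w + of_real (h k) *s u) - f w - of_real (h k) * full_deriv f w u) / h k \<le> 32 * M / R\<^sup>2 * h k"
      using h [of k] by (simp add: divide_le_eq power_divide power2_eq_square)
    moreover have "F k w - full_deriv f w u = (f (w + of_real (h k) *s u) - f w - of_real (h k) * full_deriv f w u) / of_real (h k)"
      using h [of k] by (simp add: F_def field_simps)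
    ultimately show ?thesis using h [of k] by (simp add: norm_divide)
  qed
  have "uniform_limit (ball z0 (R / 2)) F (\<lambda>w. full_deriv f w u) sequentially"
  proof (rule uniform_limitI)
    fix e :: real assume e: "e > 0"
    have "(\<lambda>k. 32 * M / R\<^sup>2 * (R / 4 / real (Suc k))) \<longlonglongrightarrow> 32 * M / R\<^sup>2 * 0"
      by (intro tendsto_mult tendsto_const) (rule LIMSEQ_Suc [OF lim_const_over_n])
    then have "\<forall>\<^sub>F k in sequentially. 32 * M / R\<^sup>2 * h k < e"
      unfolding h_def using e by (intro order_tendstoD(2)) auto
    then show "\<forall>\<^sub>F k in sequentially. \<forall>w\<in>ball z0 (R / 2). dist (F k w) (full_deriv f w u) < e"
      unfolding dist_norm by eventually_elim (use est in \<open>blast intro: le_less_trans\<close>)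
  qed
  from hol_on_limit(1) [OF Fhol _ this] R(1) have "hol_on (ball z0 (R / 4)) (\<lambda>w. full_deriv f w u)" by simp
  then have "hol_on (ball z0 (R / 4)) (\<lambda>w. of_real (norm v + 1) * full_deriv f w u)" by (rule hol_on_cmult)
  moreover have "of_real (norm v + 1) * full_deriv f w u = full_deriv f w v" if "w \<in> ball z0 (R / 4)" for w
  proof -
    have "w \<in> S" using that R by (auto simp: subset_eq)
    then have "linear (full_deriv f w)" using hol_onD(1) [OF f] has_derivative_linear by blast
    from linear_scale [OF this, of "norm v + 1" u] show ?thesis using vu by (simp add: scaleR_conv_of_real)
  qed
  ultimately have "hol_on (ball z0 (R / 4)) (\<lambda>w. full_deriv f w v)"
    by (rule hol_on_cong [OF _ open_ball])
  then show "\<exists>r>0. hol_on (ball z0 r) (\<lambda>w. full_deriv f w v)" using R(1) by (intro exI [of _ "R / 4"]) simp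
qed

lemma hol_on_imp_smooth_on:
  assumes "hol_on S f" "open S" shows "smooth_on S f"
proof -
  have "C_k_on k S f" for k
    using assms(1)
  proof (induction k arbitrary: f)
    case 0 then show ?case by (simp add: hol_on_imp_continuous_on)
  next
    case (Suc k)
    have "C_k_on k S (\<lambda>z. full_deriv f z v)" for v by (rule Suc.IH [OF hol_on_deriv [OF Suc.prems assms(2)]])
    then show ?case using Suc.prems by (simp add: hol_on_def full_deriv_def)
  qed
  then show ?thesis by (simp add: smooth_on_def)
qed

section \<open>Isometries preserve Lebesgue measure\<close>

text \<open>
  By Vitali's theorem an open set is, up to a null set, a disjoint union of balls, and an isometry maps
  a ball to a ball of the same radius.
\<close>

lemma emeasure_isometry_open_le:
  fixes T :: "'a::euclidean_space \<Rightarrow> 'a"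
  assumes T: "bij T" "\<And>x y. dist (T x) (T y) = dist x y" and U: "open U"
  shows "emeasure lborel U \<le> emeasure lborel (T ` U)"
proof -
  define K where "K = {(x, r). 0 < r \<and> ball x r \<subseteq> U}"
  obtain C where C: "countable C" "C \<subseteq> K" "pairwise (\<lambda>i j. disjnt (ball (fst i) (snd i)) (ball (fst j) (snd j))) C"
    and neg: "negligible (U - (\<Union>i\<in>C. ball (fst i) (snd i)))"
  proof (rule Vitali_covering_theorem_balls [of U K fst snd])
    fix x and d :: real assume "x \<in> U" "0 < d"
    then obtain e where e: "e > 0" "ball x e \<subseteq> U" using U openE by blast
    have "ball x (min e (d / 2)) \<subseteq> U" using e by auto
    then show "\<exists>i. i \<in> K \<and> x \<in> ball (fst i) (snd i) \<and> snd i < d"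
      using \<open>0 < d\<close> e by (intro exI [of _ "(x, min e (d / 2))"]) (auto simp: K_def)
  qed (rule that)
  let ?B = "\<lambda>i. ball (fst i) (snd i)"
  have Kpos: "snd i > 0" "?B i \<subseteq> U" if "i \<in> C" for i
  proof -
    have "i \<in> K" using that C(2) by blast
    then show "snd i > 0" "?B i \<subseteq> U" by (cases i; simp add: K_def)+
  qed
  have TB: "T ` ball x r = ball (T x) r" for x r
  proof
    show "ball (T x) r \<subseteq> T ` ball x r"
    proof
      fix y assume "y \<in> ball (T x) r"
      moreover obtain y' where "y = T y'" using T(1) by (metis bij_pointE)
      ultimately show "y \<in> T ` ball x r" by (simp add: T(2))
    qed
  qed (auto simp: T(2))
  have UC [measurable]: "(\<Union>i\<in>C. ?B i) \<in> sets borel" by (intro borel_open open_UN) auto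
  have US [measurable]: "U \<in> sets borel" using U by simp
  have "U - (\<Union>i\<in>C. ?B i) \<in> null_sets lborel"
  proof -
    have "U - (\<Union>i\<in>C. ?B i) \<in> sets lborel"
      unfolding sets_lborel by (intro sets.Diff borel_open open_UN) (use U in auto)
    then show ?thesis using neg by (simp add: negligible_iff_null_sets null_sets_completion_iff)
  qed
  then have "emeasure lborel (U - (\<Union>i\<in>C. ?B i)) = 0" by auto
  moreover have "emeasure lborel U \<le> emeasure lborel ((\<Union>i\<in>C. ?B i) \<union> (U - (\<Union>i\<in>C. ?B i)))"
    by (rule emeasure_mono) auto
  moreover have "\<dots> \<le> emeasure lborel (\<Union>i\<in>C. ?B i) + emeasure lborel (U - (\<Union>i\<in>C. ?B i))"
    by (rule emeasure_subadditive) auto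
  ultimately have "emeasure lborel U \<le> emeasure lborel (\<Union>i\<in>C. ?B i)" by simp
  also have "\<dots> = (\<integral>\<^sup>+i. emeasure lborel (?B i) \<partial>count_space C)"
    by (rule emeasure_UN_countable) (use C in \<open>auto simp: disjoint_family_on_def pairwise_def disjnt_def\<close>)
  also have "\<dots> = (\<integral>\<^sup>+i. emeasure lborel (T ` ?B i) \<partial>count_space C)"
    by (rule nn_integral_cong) (use Kpos in \<open>simp add: TB emeasure_ball less_imp_le\<close>)
  also have "\<dots> = emeasure lborel (\<Union>i\<in>C. T ` ?B i)"
  proof (rule emeasure_UN_countable [symmetric])
    have "T ` ?B i \<inter> T ` ?B j = T ` (?B i \<inter> ?B j)" for i j using T(1) by (simp add: bij_is_inj image_Int)
    then show "disjoint_family_on (\<lambda>i. T ` ?B i) C"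
      using C(3) by (auto simp: disjoint_family_on_def pairwise_def disjnt_def)
  qed (use C in \<open>auto simp: TB\<close>)
  also have "\<dots> \<le> emeasure lborel (T ` U)"
  proof (rule emeasure_mono)
    have "T ` U = inv T -` U" using T(1) by (simp add: bij_vimage_eq_inv_image inv_inv_eq bij_imp_bij_inv)
    moreover have "continuous_on UNIV (inv T)"
    proof -
      have "dist (inv T x) (inv T y) = dist x y" for x y
        using T by (metis bij_inv_eq_iff)
      then show ?thesis unfolding continuous_on_iff by auto
    qed
    ultimately have "open (T ` U)" using U by (simp add: open_vimage)
    then show "T ` U \<in> sets lborel" by simp
  qed (use Kpos(2) in blast)
  finally show ?thesis .
qed

lemma distr_isometry:
  fixes T :: "'a::euclidean_space \<Rightarrow> 'a"
  assumes T: "bij T" "\<And>x y. dist (T x) (T y) = dist x y"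
  shows "T \<in> borel_measurable borel" "distr lborel borel T = lborel"
proof -
  have "continuous_on UNIV T" using T(2) unfolding continuous_on_iff by auto
  then show meas: "T \<in> borel_measurable borel" by (rule borel_measurable_continuous_onI)
  have iT: "bij (inv T)" "dist (inv T x) (inv T y) = dist x y" for x y
    using T by (auto simp: bij_imp_bij_inv) (metis bij_inv_eq_iff)
  have "lborel = distr lborel borel T"
  proof (rule lborel_eqI)
    fix l u :: 'a assume lu: "\<And>b. b \<in> Basis \<Longrightarrow> l \<bullet> b \<le> u \<bullet> b"
    have eq: "T -` box l u = inv T ` box l u" using T(1) by (rule bij_vimage_eq_inv_image)
    have "emeasure lborel (box l u) \<le> emeasure lborel (inv T ` box l u)"
      by (rule emeasure_isometry_open_le [OF iT open_box])
    moreover have "emeasure lborel (inv T ` box l u) \<le> emeasure lborel (T ` inv T ` box l u)"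
    proof (rule emeasure_isometry_open_le [OF T])
      show "open (inv T ` box l u)" unfolding eq [symmetric] using \<open>continuous_on UNIV T\<close> by (simp add: open_vimage open_box)
    qed
    moreover have "T ` inv T ` box l u = box l u" using T(1) by (simp add: bij_is_surj image_f_inv_f)
    ultimately have "emeasure lborel (T -` box l u) = emeasure lborel (box l u)" by (simp add: eq)
    then show "emeasure (distr lborel borel T) (box l u) = (\<Prod>b\<in>Basis. (u - l) \<bullet> b)"
      using meas lu by (simp add: emeasure_distr emeasure_lborel_box_eq)
  qed simp
  then show "distr lborel borel T = lborel" by simp
qed

lemma integral_isometry:
  fixes T :: "'a::euclidean_space \<Rightarrow> 'a" and h :: "'a \<Rightarrow> 'b::{banach, second_countable_topology}"
  assumes T: "bij T" "\<And>x y. dist (T x) (T y) = dist x y" and h: "h \<in> borel_measurable borel"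
  shows "(\<integral>x. h (T x) \<partial>lborel) = (\<integral>x. h x \<partial>lborel)"
  using integral_distr [of T lborel borel h] distr_isometry [OF T] h by simp

section \<open>The mean value property\<close>

lemma circle_mean_value:
  assumes G: "G holomorphic_on cball 0 r" and r: "r > 0"
  shows "((\<lambda>t. G (of_real r * exp (2 * of_real pi * \<i> * of_real t))) has_integral G 0) {0..1}"
proof -
  have "((\<lambda>u. G u / (u - 0)) has_contour_integral (2 * of_real pi * \<i> * G 0)) (circlepath 0 r)"
    by (rule Cauchy_integral_circlepath_simple [OF G]) (use r in simp)
  then have "((\<lambda>t. G (circlepath 0 r t) / (circlepath 0 r t - 0) * vector_derivative (circlepath 0 r) (at t within {0..1}))
      has_integral (2 * of_real pi * \<i> * G 0)) {0..1}"
    by (simp add: has_contour_integral_def)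
  moreover have "G (circlepath 0 r t) / (circlepath 0 r t - 0) * vector_derivative (circlepath 0 r) (at t within {0..1})
     = 2 * of_real pi * \<i> * G (of_real r * exp (2 * of_real pi * \<i> * of_real t))" if "t \<in> {0..1}" for t
    using that r by (simp add: vector_derivative_circlepath01) (simp add: circlepath)
  ultimately have "((\<lambda>t. 2 * of_real pi * \<i> * G (of_real r * exp (2 * of_real pi * \<i> * of_real t)))
      has_integral (2 * of_real pi * \<i> * G 0)) {0..1}"
    by (rule has_integral_eq [rotated])
  then have "((\<lambda>t. (1 / (2 * of_real pi * \<i>)) * (2 * of_real pi * \<i> * G (of_real r * exp (2 * of_real pi * \<i> * of_real t))))
      has_integral ((1 / (2 * of_real pi * \<i>)) * (2 * of_real pi * \<i> * G 0))) {0..1}"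
    by (rule has_integral_mult_right)
  then show ?thesis by simp
qed

text \<open>
  The mean value property for the holomorphic function \<open>f\<^sup>2\<close>.  Its mean over each circle
  \<open>t \<mapsto> z + e(t) w\<close> is its value at \<open>z\<close>.  Integrating this over \<open>w\<close> in the ball and exchanging the integrals,
  the rotations \<open>w \<mapsto> e(t) w\<close> can be removed because they preserve the ball and Lebesgue measure.
\<close>

lemma hol_on_point_le_L2:
  fixes f :: "complex^'n::finite \<Rightarrow> complex"
  assumes f: "hol_on S f" and S: "cball z r \<subseteq> S" and r: "r > 0"
  shows "(cmod (f z))\<^sup>2 * measure lborel (cball (0 :: complex^'n) r)
      \<le> (\<integral>w. indicator (cball z r) w * (cmod (f w))\<^sup>2 \<partial>lborel)"
proof -
  define g where "g w = (f (z + w))\<^sup>2" for w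
  define e where "e t = exp (2 * of_real pi * \<i> * of_real t)" for t :: real
  have e1: "cmod (e t) = 1" for t by (simp add: e_def)
  have einv: "inverse (e t) * e t = 1" for t using e1 [of t] by (metis left_inverse norm_zero zero_neq_one)
  let ?C = "cball (0 :: complex^'n) r"
  have contf: "continuous_on (cball z r) f" using hol_on_imp_continuous_on [OF f] S continuous_on_subset by blast
  have contg: "continuous_on ?C g"
    unfolding g_def
    by (intro continuous_intros continuous_on_compose2 [OF contf]) (auto simp: dist_norm)
  have mean: "((\<lambda>t. g (e t *s w)) has_integral g 0) {0..1}" if w: "w \<in> ?C" for w
  proof -
    define u where "u = of_real (1 / r) *s w"
    have u: "norm u \<le> 1" using w r by (simp add: u_def norm_smult norm_divide divide_le_eq)
    have "(\<lambda>\<zeta>. (f (z + \<zeta> *s u))\<^sup>2) holomorphic_on cball 0 r"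
      by (intro holomorphic_intros hol_on_line_holomorphic [OF f S u])
    from circle_mean_value [OF this r] have "((\<lambda>t. (f (z + (of_real r * e t) *s u))\<^sup>2) has_integral (f (z + 0 *s u))\<^sup>2) {0..1}"
      by (simp add: e_def)
    moreover have "(of_real r * e t) *s u = e t *s w" for t
      using r by (simp add: u_def vec_eq_iff)
    ultimately show ?thesis by (simp add: g_def)
  qed
  \<comment> \<open>Fubini is applied to this function on the compact set \<open>{0..1} \<times> ?C\<close>.\<close>
  define \<Phi> where "\<Phi> t w = indicator ({0..1} \<times> ?C) (t, w) *\<^sub>R g (e t *s w)" for t w
  have controt: "continuous_on UNIV (\<lambda>(t, w :: complex^'n). e t *s w)"
    unfolding e_def case_prod_unfold vector_scalar_mult_def
    by (intro continuous_on_vec_lambda continuous_intros)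
  have rotC: "e t *s w \<in> ?C \<longleftrightarrow> w \<in> ?C" for t w by (simp add: norm_smult e1)
  have "integrable lborel (\<lambda>p. indicator ({0..1} \<times> ?C) p *\<^sub>R g ((\<lambda>(t, w). e t *s w) p))"
  proof (rule borel_integrable_compact)
    show "compact ({0..1::real} \<times> ?C)" by (intro compact_Times compact_Icc compact_cball)
    show "continuous_on ({0..1::real} \<times> ?C) (\<lambda>p. g ((\<lambda>(t, w). e t *s w) p))"
      by (rule continuous_on_compose2 [OF contg continuous_on_subset [OF controt subset_UNIV]]) (auto simp: norm_smult e1)
  qed
  then have int\<Phi>: "integrable (lborel \<Otimes>\<^sub>M lborel) (case_prod \<Phi>)"
    by (simp add: lborel_prod \<Phi>_def [abs_def] case_prod_unfold)
  have innert: "(\<integral>t. \<Phi> t w \<partial>lborel) = indicator ?C w *\<^sub>R g 0" for w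
  proof (cases "w \<in> ?C")
    case True
    have c: "continuous_on {0..1} (\<lambda>t. g (e t *s w))"
    proof (rule continuous_on_compose2 [OF contg])
      show "continuous_on {0..1} (\<lambda>t. e t *s w)"
        unfolding e_def vector_scalar_mult_def by (intro continuous_on_vec_lambda continuous_intros)
    qed (use True in \<open>auto simp: norm_smult e1\<close>)
    have "(\<integral>t. \<Phi> t w \<partial>lborel) = (LINT t:{0..1}|lborel. g (e t *s w))"
      unfolding set_lebesgue_integral_def \<Phi>_def by (rule Bochner_Integration.integral_cong) (use True in \<open>auto simp: indicator_def\<close>)
    also have "\<dots> = integral {0..1} (\<lambda>t. g (e t *s w))"
      by (rule set_borel_integral_eq_integral) (simp add: borel_integrable_compact [OF compact_Icc c] set_integrable_def)
    also have "\<dots> = g 0" using mean [OF True] by (rule integral_unique)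
    finally show ?thesis using True by simp
  next
    case False then show ?thesis by (simp add: \<Phi>_def)
  qed
  define h where "h w = indicator ?C w *\<^sub>R g w" for w
  have inth: "integrable lborel h" unfolding h_def by (rule borel_integrable_compact [OF compact_cball contg])
  have innerw: "(\<integral>w. \<Phi> t w \<partial>lborel) = indicator {0..1} t *\<^sub>R (\<integral>w. h w \<partial>lborel)" for t
  proof (cases "t \<in> {0..1}")
    case True
    have "(\<integral>w. \<Phi> t w \<partial>lborel) = (\<integral>w. h (e t *s w) \<partial>lborel)"
      using True rotC by (intro Bochner_Integration.integral_cong) (auto simp: \<Phi>_def h_def indicator_def)
    also have "\<dots> = (\<integral>w. h w \<partial>lborel)"
    proof (rule integral_isometry)
      show "bij (\<lambda>w. e t *s w)"
        by (rule o_bij [of "\<lambda>w. inverse (e t) *s w"])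
           (auto simp: fun_eq_iff vector_smult_assoc einv mult.commute [of "e t"])
      have "e t *s x - e t *s y = e t *s (x - y)" for x y :: "complex^'n" by (simp add: vec_eq_iff algebra_simps)
      then show "dist (e t *s x) (e t *s y) = dist x y" for x y :: "complex^'n"
        unfolding dist_norm by (simp only: norm_smult e1 mult_1)
      show "h \<in> borel_measurable borel" using inth by simp
    qed
    finally show ?thesis using True by simp
  next
    case False
    then have "\<Phi> t w = 0" for w by (auto simp: \<Phi>_def indicator_def)
    then show ?thesis using False by simp
  qed
  have "(\<integral>w. (\<integral>t. \<Phi> t w \<partial>lborel) \<partial>lborel) = (\<integral>t. (\<integral>w. \<Phi> t w \<partial>lborel) \<partial>lborel)"
    by (rule lborel_pair.Fubini_integral [OF int\<Phi>])
  then have "(\<integral>w. indicator ?C w *\<^sub>R g 0 \<partial>lborel) = (\<integral>t. indicator {0..1::real} t *\<^sub>R (\<integral>w. h w \<partial>lborel) \<partial>lborel)"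
    by (simp only: innert innerw)
  moreover have "(\<integral>w. indicator ?C w *\<^sub>R g 0 \<partial>lborel) = measure lborel ?C *\<^sub>R g 0"
    using emeasure_lborel_cball_finite [of "0 :: complex^'n" r]
    by (subst integral_scaleR_left) (auto intro!: integrable_real_indicator)
  ultimately have "measure lborel ?C *\<^sub>R g 0 = (\<integral>w. h w \<partial>lborel)"
    by (simp add: measure_def)
  then have "measure lborel ?C * cmod (g 0) = cmod (\<integral>w. h w \<partial>lborel)"
    by (metis abs_of_nonneg measure_nonneg norm_scaleR)
  also have "\<dots> \<le> (\<integral>w. norm (h w) \<partial>lborel)" by (rule integral_norm_bound)
  also have "\<dots> = (\<integral>w. indicator (cball z r) (z + w) * (cmod (f (z + w)))\<^sup>2 \<partial>lborel)"
    by (rule Bochner_Integration.integral_cong) (auto simp: h_def g_def indicator_def norm_power dist_norm)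
  also have "\<dots> = (\<integral>w. indicator (cball z r) w * (cmod (f w))\<^sup>2 \<partial>lborel)"
  proof (rule integral_isometry)
    show "bij (\<lambda>w. z + w)" by simp
    have "integrable lborel (\<lambda>w. indicator (cball z r) w *\<^sub>R (cmod (f w))\<^sup>2)"
      by (rule borel_integrable_compact) (auto intro!: continuous_intros contf)
    then show "(\<lambda>w. indicator (cball z r) w * (cmod (f w))\<^sup>2) \<in> borel_measurable borel" by simp
  qed simp
  finally show ?thesis by (simp add: g_def norm_power mult.commute)
qed

section \<open>Symmetry of second derivatives\<close>

text \<open>
  Young's form of the symmetry of second derivatives asks only for differentiability of the first
  derivative at the point \<open>z\<close>.  The mean value theorem in direction \<open>v\<close> and the linear approximation
  of \<open>\<phi>' _ v\<close> at \<open>z\<close> evaluate the second difference, which is symmetric in \<open>u\<close> and \<open>v\<close>.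
\<close>

lemma second_difference_limit:
  fixes \<phi> :: "'a::real_normed_vector \<Rightarrow> real"
  assumes S: "open S" "z \<in> S" and der: "\<And>w. w \<in> S \<Longrightarrow> (\<phi> has_derivative \<phi>' w) (at w)"
    and A: "((\<lambda>w. \<phi>' w v) has_derivative A) (at z)"
  shows "((\<lambda>t. (\<phi> (z + t *\<^sub>R u + t *\<^sub>R v) - \<phi> (z + t *\<^sub>R u) - \<phi> (z + t *\<^sub>R v) + \<phi> z) / t\<^sup>2) \<longlongrightarrow> A u) (at_right 0)"
proof (rule tendstoI)
  fix \<epsilon> :: real assume \<epsilon>: "\<epsilon> > 0"
  \<comment> \<open>All points that occur lie within \<open>t K\<close> of \<open>z\<close>, and the two errors add up to at most \<open>e t K\<close>.\<close>
  define K where "K = norm u + 2 * norm v + 1"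
  have K: "K > 0" using norm_ge_zero [of u] norm_ge_zero [of v] by (simp add: K_def add_nonneg_pos)
  define e where "e = \<epsilon> / K"
  have e: "e > 0" using \<epsilon> K by (simp add: e_def)
  obtain d where d: "d > 0" "\<And>y. norm (y - z) < d \<Longrightarrow> norm (\<phi>' y v - \<phi>' z v - A (y - z)) \<le> e * norm (y - z)"
    using A e unfolding has_derivative_at_alt by blast
  obtain \<rho> where \<rho>: "\<rho> > 0" "ball z \<rho> \<subseteq> S" using S openE by blast
  have linA: "linear A" using A by (rule has_derivative_linear)
  define m where "m = min d \<rho> / K"
  have m: "m > 0" using d \<rho> K by (simp add: m_def)
  have "dist ((\<phi> (z + t *\<^sub>R u + t *\<^sub>R v) - \<phi> (z + t *\<^sub>R u) - \<phi> (z + t *\<^sub>R v) + \<phi> z) / t\<^sup>2) (A u) < \<epsilon>" if t: "0 < t" "t < m" for t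
  proof -
    have tK: "t * K < min d \<rho>" using t K by (simp add: m_def pos_less_divide_eq)
    have n1: "norm (t *\<^sub>R u + s *\<^sub>R v) \<le> t * (norm u + norm v)" and n2: "norm (s *\<^sub>R v) \<le> t * norm v"
      if "0 \<le> s" "s \<le> t" for s
    proof -
      show "norm (s *\<^sub>R v) \<le> t * norm v" using that by (simp add: mult_right_mono)
      then show "norm (t *\<^sub>R u + s *\<^sub>R v) \<le> t * (norm u + norm v)"
        using norm_triangle_ineq [of "t *\<^sub>R u" "s *\<^sub>R v"] t by (simp add: algebra_simps)
    qed
    have le: "t * (norm u + norm v) < min d \<rho>" "t * norm v < min d \<rho>"
    proof -
      have "t * (norm u + norm v) \<le> t * K" "t * norm v \<le> t * K"
        using t norm_ge_zero [of u] norm_ge_zero [of v] by (auto intro!: mult_left_mono simp: K_def simp del: norm_ge_zero)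
      then show "t * (norm u + norm v) < min d \<rho>" "t * norm v < min d \<rho>" using tK by linarith+
    qed
    have inS: "z + (t *\<^sub>R u + s *\<^sub>R v) \<in> S" "z + s *\<^sub>R v \<in> S" if "0 \<le> s" "s \<le> t" for s
    proof -
      have "z + y \<in> S" if "norm y < min d \<rho>" for y using that \<rho>(2) by (auto simp: subset_eq dist_norm)
      then show "z + (t *\<^sub>R u + s *\<^sub>R v) \<in> S" "z + s *\<^sub>R v \<in> S"
        using n1 [OF that] n2 [OF that] le by (meson le_less_trans)+
    qed
    define h where "h s = \<phi> (z + (t *\<^sub>R u + s *\<^sub>R v)) - \<phi> (z + s *\<^sub>R v)" for s
    have line: "((\<lambda>s. \<phi> (a + s *\<^sub>R v)) has_real_derivative \<phi>' (a + s *\<^sub>R v) v) (at s)" if "a + s *\<^sub>R v \<in> S" for a s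
    proof -
      have "((\<lambda>s. a + s *\<^sub>R v) has_derivative (\<lambda>s. s *\<^sub>R v)) (at s)" by (auto intro!: derivative_eq_intros)
      from has_derivative_compose [OF this der [OF that]]
      have "((\<lambda>s. \<phi> (a + s *\<^sub>R v)) has_derivative (\<lambda>x. \<phi>' (a + s *\<^sub>R v) (x *\<^sub>R v))) (at s)" .
      moreover have "(\<lambda>x. \<phi>' (a + s *\<^sub>R v) (x *\<^sub>R v)) = (*) (\<phi>' (a + s *\<^sub>R v) v)"
        using linear_scale [OF has_derivative_linear [OF der [OF that]]] by (simp add: fun_eq_iff mult.commute)
      ultimately show ?thesis by (simp add: has_field_derivative_def)
    qed
    have "\<exists>\<xi>. 0 < \<xi> \<and> \<xi> < t \<and> h t - h 0 = (t - 0) * (\<phi>' (z + (t *\<^sub>R u + \<xi> *\<^sub>R v)) v - \<phi>' (z + \<xi> *\<^sub>R v) v)"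
    proof (rule MVT2 [OF t(1)])
      fix s :: real assume s: "0 \<le> s" "s \<le> t"
      have "((\<lambda>s. \<phi> (z + t *\<^sub>R u + s *\<^sub>R v) - \<phi> (z + s *\<^sub>R v)) has_real_derivative
          (\<phi>' (z + t *\<^sub>R u + s *\<^sub>R v) v - \<phi>' (z + s *\<^sub>R v) v)) (at s)"
        by (intro DERIV_diff line) (use inS [OF s] in \<open>simp_all add: add.assoc\<close>)
      then show "(h has_real_derivative (\<phi>' (z + (t *\<^sub>R u + s *\<^sub>R v)) v - \<phi>' (z + s *\<^sub>R v) v)) (at s)"
        by (simp add: h_def [abs_def] add.assoc)
    qed
    then obtain \<xi> where \<xi>: "0 < \<xi>" "\<xi> < t" "h t - h 0 = t * (\<phi>' (z + (t *\<^sub>R u + \<xi> *\<^sub>R v)) v - \<phi>' (z + \<xi> *\<^sub>R v) v)" by auto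
    define E1 where "E1 = \<phi>' (z + (t *\<^sub>R u + \<xi> *\<^sub>R v)) v - \<phi>' z v - A (t *\<^sub>R u + \<xi> *\<^sub>R v)"
    define E2 where "E2 = \<phi>' (z + \<xi> *\<^sub>R v) v - \<phi>' z v - A (\<xi> *\<^sub>R v)"
    have "\<bar>E1\<bar> \<le> e * norm (t *\<^sub>R u + \<xi> *\<^sub>R v)" "\<bar>E2\<bar> \<le> e * norm (\<xi> *\<^sub>R v)"
      using d(2) [of "z + (t *\<^sub>R u + \<xi> *\<^sub>R v)"] d(2) [of "z + \<xi> *\<^sub>R v"] n1 [of \<xi>] n2 [of \<xi>] \<xi> le
      by (auto simp: E1_def E2_def)
    then have E: "\<bar>E1\<bar> \<le> e * (t * (norm u + norm v))" "\<bar>E2\<bar> \<le> e * (t * norm v)"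
      using n1 [of \<xi>] n2 [of \<xi>] \<xi> e by (meson less_imp_le mult_left_mono order_trans)+
    have "\<phi>' (z + (t *\<^sub>R u + \<xi> *\<^sub>R v)) v - \<phi>' (z + \<xi> *\<^sub>R v) v = t * A u + (E1 - E2)"
      by (simp add: E1_def E2_def linear_add [OF linA] linear_scale [OF linA])
    with \<xi>(3) have "h t - h 0 = t * (t * A u + (E1 - E2))" by (simp only:)
    then have "h t - h 0 = t\<^sup>2 * A u + t * (E1 - E2)" by (simp add: power2_eq_square algebra_simps)
    moreover have "h t - h 0 = \<phi> (z + t *\<^sub>R u + t *\<^sub>R v) - \<phi> (z + t *\<^sub>R u) - \<phi> (z + t *\<^sub>R v) + \<phi> z"
      by (simp add: h_def add.assoc)
    ultimately have "(\<phi> (z + t *\<^sub>R u + t *\<^sub>R v) - \<phi> (z + t *\<^sub>R u) - \<phi> (z + t *\<^sub>R v) + \<phi> z) / t\<^sup>2 - A u = (E1 - E2) / t"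
    proof -
      have "D / t\<^sup>2 - A u = (E1 - E2) / t" if "D = t\<^sup>2 * A u + t * (E1 - E2)" for D
        unfolding that using t by (simp add: field_simps power2_eq_square)
      then show ?thesis using \<open>h t - h 0 = t\<^sup>2 * A u + t * (E1 - E2)\<close>
          \<open>h t - h 0 = \<phi> (z + t *\<^sub>R u + t *\<^sub>R v) - \<phi> (z + t *\<^sub>R u) - \<phi> (z + t *\<^sub>R v) + \<phi> z\<close>
        by metis
    qed
    moreover have "\<bar>(E1 - E2) / t\<bar> < \<epsilon>"
    proof -
      have "\<bar>E1 - E2\<bar> \<le> e * (t * (norm u + norm v)) + e * (t * norm v)" using E by linarith
      also have "\<dots> = t * (e * (norm u + 2 * norm v))" by (simp add: algebra_simps)
      also have "\<dots> < t * (e * K)" using t e by (simp add: K_def)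
      also have "\<dots> = t * \<epsilon>" using K by (simp add: e_def)
      finally show ?thesis using t by (simp add: abs_divide divide_less_eq mult.commute)
    qed
    ultimately show ?thesis by (simp add: dist_norm)
  qed
  then show "\<forall>\<^sub>F t in at_right 0. dist ((\<phi> (z + t *\<^sub>R u + t *\<^sub>R v) - \<phi> (z + t *\<^sub>R u) - \<phi> (z + t *\<^sub>R v) + \<phi> z) / t\<^sup>2) (A u) < \<epsilon>"
    unfolding eventually_at_right_field using m by blast
qed

lemma second_derivative_symmetric_real:
  fixes \<phi> :: "'a::real_normed_vector \<Rightarrow> real"
  assumes S: "open S" "z \<in> S" and der: "\<And>w. w \<in> S \<Longrightarrow> (\<phi> has_derivative \<phi>' w) (at w)"
    and A: "((\<lambda>w. \<phi>' w v) has_derivative A) (at z)" and B: "((\<lambda>w. \<phi>' w u) has_derivative B) (at z)"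
  shows "A u = B v"
proof (rule tendsto_unique)
  let ?F = "\<lambda>t. (\<phi> (z + t *\<^sub>R u + t *\<^sub>R v) - \<phi> (z + t *\<^sub>R u) - \<phi> (z + t *\<^sub>R v) + \<phi> z) / t\<^sup>2"
  show "(?F \<longlongrightarrow> A u) (at_right 0)" by (rule second_difference_limit [OF S der A])
  have "((\<lambda>t. (\<phi> (z + t *\<^sub>R v + t *\<^sub>R u) - \<phi> (z + t *\<^sub>R v) - \<phi> (z + t *\<^sub>R u) + \<phi> z) / t\<^sup>2) \<longlongrightarrow> B v) (at_right 0)"
    by (rule second_difference_limit [OF S der B])
  then show "(?F \<longlongrightarrow> B v) (at_right 0)" by (simp add: algebra_simps)
qed simp

lemma full_deriv_commute:
  fixes f :: "complex^'n::finite \<Rightarrow> complex"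
  assumes S: "open S" "z \<in> S" and f: "\<And>w. w \<in> S \<Longrightarrow> f differentiable (at w)"
    and v: "(\<lambda>w. full_deriv f w v) differentiable (at z)" and u: "(\<lambda>w. full_deriv f w u) differentiable (at z)"
  shows "full_deriv (\<lambda>w. full_deriv f w v) z u = full_deriv (\<lambda>w. full_deriv f w u) z v"
proof -
  have "P (full_deriv (\<lambda>w. full_deriv f w v) z u) = P (full_deriv (\<lambda>w. full_deriv f w u) z v)"
    if P: "bounded_linear P" for P :: "complex \<Rightarrow> real"
  proof (rule second_derivative_symmetric_real [OF S, where \<phi> = "\<lambda>w. P (f w)" and \<phi>' = "\<lambda>w v. P (full_deriv f w v)"])
    show "((\<lambda>w. P (f w)) has_derivative (\<lambda>v. P (full_deriv f w v))) (at w)" if "w \<in> S" for w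
      by (rule bounded_linear.has_derivative [OF P full_deriv_works [OF f [OF that]]])
    show "((\<lambda>w. P (full_deriv f w v)) has_derivative (\<lambda>u. P (full_deriv (\<lambda>w. full_deriv f w v) z u))) (at z)"
      by (rule bounded_linear.has_derivative [OF P full_deriv_works [OF v]])
    show "((\<lambda>w. P (full_deriv f w u)) has_derivative (\<lambda>v. P (full_deriv (\<lambda>w. full_deriv f w u) z v))) (at z)"
      by (rule bounded_linear.has_derivative [OF P full_deriv_works [OF u]])
  qed
  from this [OF bounded_linear_Re] this [OF bounded_linear_Im] show ?thesis by (simp add: complex_eq_iff)
qed

section \<open>Charts and local representations\<close>

lemma hol_on_compose:
  fixes \<tau> :: "complex^'n::finite \<Rightarrow> complex^'m::finite"
  assumes \<tau>: "(\<tau> has_derivative T) (at z)" "\<And>v. T (\<i> *s v) = \<i> *s T v" and f: "hol_on {\<tau> z} f"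
  shows "hol_on {z} (\<lambda>w. f (\<tau> w))" "full_deriv (\<lambda>w. f (\<tau> w)) z v = full_deriv f (\<tau> z) (T v)"
proof -
  have "((\<lambda>w. f (\<tau> w)) has_derivative (\<lambda>v. full_deriv f (\<tau> z) (T v))) (at z)"
    using has_derivative_compose [OF \<tau>(1) hol_onD(1) [OF f]] by simp
  then show "hol_on {z} (\<lambda>w. f (\<tau> w))" "full_deriv (\<lambda>w. f (\<tau> w)) z v = full_deriv f (\<tau> z) (T v)"
    using hol_onD(2) [OF f] by (auto intro!: hol_onI [where D = "\<lambda>_ v. full_deriv f (\<tau> z) (T v)"] simp: \<tau>(2) full_deriv_eq)
qed

definition transition :: "('m, 'n) chart \<Rightarrow> ('m, 'n) chart \<Rightarrow> complex^'n \<Rightarrow> complex^'n" where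
  "transition c c' = chart_fun c' \<circ> chart_inv c"

definition dtransition :: "('m, 'n::finite) chart \<Rightarrow> ('m, 'n) chart \<Rightarrow> complex^'n \<Rightarrow> complex^'n \<Rightarrow> complex^'n" where
  "dtransition c c' z = frechet_derivative (transition c c') (at z)"

definition overlap :: "('m, 'n) chart \<Rightarrow> ('m, 'n) chart \<Rightarrow> (complex^'n) set" where
  "overlap c c' = chart_fun c ` (chart_dom c \<inter> chart_dom c')"

context
  fixes A :: "('m::topological_space, 'n::finite) chart set"
  assumes A: "complex_atlas A"
begin

lemma chart_open: "c \<in> A \<Longrightarrow> open (chart_dom c)" "c \<in> A \<Longrightarrow> open (chart_img c)"
  using A by (auto simp: complex_atlas_def)

lemma chart_homeo: "c \<in> A \<Longrightarrow> homeomorphism (chart_dom c) (chart_img c) (chart_fun c) (chart_inv c)"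
  using A by (auto simp: complex_atlas_def)

lemma chart_inverse:
  assumes "c \<in> A"
  shows "x \<in> chart_dom c \<Longrightarrow> chart_inv c (chart_fun c x) = x" "z \<in> chart_img c \<Longrightarrow> chart_fun c (chart_inv c z) = z"
    "x \<in> chart_dom c \<Longrightarrow> chart_fun c x \<in> chart_img c" "z \<in> chart_img c \<Longrightarrow> chart_inv c z \<in> chart_dom c"
    "continuous_on (chart_dom c) (chart_fun c)" "continuous_on (chart_img c) (chart_inv c)"
  using chart_homeo [OF assms] by (auto simp: homeomorphism_def)

lemma chart_at: "chart_at A x \<in> A" "x \<in> chart_dom (chart_at A x)"
proof -
  have "x \<in> (\<Union>c\<in>A. chart_dom c)" using A by (simp add: complex_atlas_def)
  then have "\<exists>c. c \<in> A \<and> x \<in> chart_dom c" by blast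
  then have "chart_at A x \<in> A \<and> x \<in> chart_dom (chart_at A x)" unfolding chart_at_def by (rule someI_ex)
  then show "chart_at A x \<in> A" "x \<in> chart_dom (chart_at A x)" by auto
qed

lemma overlap_iff:
  assumes "c \<in> A" shows "z \<in> overlap c c' \<longleftrightarrow> z \<in> chart_img c \<and> chart_inv c z \<in> chart_dom c'"
proof
  assume "z \<in> overlap c c'"
  then obtain x where "x \<in> chart_dom c" "x \<in> chart_dom c'" "z = chart_fun c x" by (auto simp: overlap_def)
  then show "z \<in> chart_img c \<and> chart_inv c z \<in> chart_dom c'" using chart_inverse [OF assms] by simp
next
  assume "z \<in> chart_img c \<and> chart_inv c z \<in> chart_dom c'"
  then show "z \<in> overlap c c'" using chart_inverse [OF assms] unfolding overlap_def by (metis IntI image_eqI)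
qed

lemma open_overlap:
  assumes "c \<in> A" "c' \<in> A" shows "open (overlap c c')"
proof -
  have "overlap c c' = chart_img c \<inter> chart_inv c -` chart_dom c'"
    by (rule set_eqI) (simp only: overlap_iff [OF assms(1)] Int_iff vimage_eq)
  then show ?thesis
    using continuous_open_preimage [OF chart_inverse(6) [OF assms(1)] chart_open(2) [OF assms(1)] chart_open(1) [OF assms(2)]] by simp
qed

lemma transition_derivative:
  assumes "c \<in> A" "c' \<in> A" "z \<in> overlap c c'"
  shows "(transition c c' has_derivative dtransition c c' z) (at z)" "complex_linear (dtransition c c' z)"
    "dtransition c c' z (\<i> *s v) = \<i> *s dtransition c c' z v"
proof -
  have "holomorphic_map_on (transition c c') (overlap c c')"
    using A assms(1,2) by (auto simp: complex_atlas_def transition_def overlap_def)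
  then obtain D where D: "(transition c c' has_derivative D) (at z)" "\<And>a v. D (a *s v) = a *s D v"
    using assms(3) by (auto simp: holomorphic_map_on_def)
  then have "dtransition c c' z = D" using frechet_derivative_at [OF D(1)] by (simp add: dtransition_def)
  then show "(transition c c' has_derivative dtransition c c' z) (at z)" "complex_linear (dtransition c c' z)"
    "dtransition c c' z (\<i> *s v) = \<i> *s dtransition c c' z v"
    using D has_derivative_linear [OF D(1)] by (auto simp: complex_linear_def)
qed

lemma transition_overlap:
  assumes "c \<in> A" "c' \<in> A" "z \<in> overlap c c'"
  shows "transition c c' z \<in> chart_img c'" "chart_inv c' (transition c c' z) = chart_inv c z"
  using assms overlap_iff [OF assms(1), of z c'] chart_inverse [OF assms(1)] chart_inverse [OF assms(2)]
  by (auto simp: transition_def)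

lemma dtransition_chain:
  assumes c: "c \<in> A" "c' \<in> A" "c'' \<in> A" and z: "z \<in> overlap c c'" "chart_inv c z \<in> chart_dom c''"
  shows "dtransition c c'' z v = dtransition c' c'' (transition c c' z) (dtransition c c' z v)"
proof -
  have z2: "transition c c' z \<in> overlap c' c''" using transition_overlap [OF c(1,2) z(1)] z(2) overlap_iff [OF c(2)] by simp
  have "((transition c' c'' \<circ> transition c c') has_derivative (dtransition c' c'' (transition c c' z) \<circ> dtransition c c' z)) (at z)"
    by (rule diff_chain_at [OF transition_derivative(1) [OF c(1,2) z(1)] transition_derivative(1) [OF c(2,3) z2]])
  then have "(transition c c'' has_derivative (dtransition c' c'' (transition c c' z) \<circ> dtransition c c' z)) (at z)"
  proof (rule has_derivative_transform_within_open [OF _ open_overlap [OF c(1,2)] z(1)])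
    fix w assume "w \<in> overlap c c'"
    then show "(transition c' c'' \<circ> transition c c') w = transition c c'' w"
      using transition_overlap [OF c(1,2)] by (simp add: transition_def [of c' c''] transition_def [of c c''])
  qed
  then show ?thesis using frechet_derivative_at by (metis dtransition_def o_apply)
qed

lemma dtransition_self:
  assumes c: "c \<in> A" and z: "z \<in> chart_img c" shows "transition c c z = z" "dtransition c c z v = v"
proof -
  show "transition c c z = z" using chart_inverse [OF c] z by (simp add: transition_def)
  have "((\<lambda>w. w) has_derivative (\<lambda>v. v)) (at z)" by simp
  then have "(transition c c has_derivative (\<lambda>v. v)) (at z)"
    by (rule has_derivative_transform_within_open [OF _ chart_open(2) [OF c] z])
      (use chart_inverse [OF c] in \<open>simp add: transition_def\<close>)
  then show "dtransition c c z v = v" using frechet_derivative_at by (metis dtransition_def)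
qed

lemma dtransition_inj:
  assumes c: "c \<in> A" "c' \<in> A" and z: "z \<in> overlap c c'" shows "inj (dtransition c c' z)"
proof (rule injI)
  fix u v assume eq: "dtransition c c' z u = dtransition c c' z v"
  have z': "z \<in> chart_img c" "chart_inv c z \<in> chart_dom c" using z overlap_iff [OF c(1)] chart_inverse [OF c(1)] by auto
  have "u = dtransition c' c (transition c c' z) (dtransition c c' z u)" for u
    using dtransition_chain [OF c c(1) z z'(2), of u] dtransition_self(2) [OF c(1) z'(1), of u] by simp
  then show "u = v" using eq by metis
qed

lemma local_rep_eq:
  "local_rep A \<alpha> c z vs = \<alpha> (chart_inv c z) (map (dtransition c (chart_at A (chart_inv c z)) z) vs)"
  by (simp add: local_rep_def dtransition_def transition_def Let_def)

lemma in_overlap_chart_at: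
  assumes "c \<in> A" "z \<in> chart_img c" shows "z \<in> overlap c (chart_at A (chart_inv c z))"
  using overlap_iff [OF assms(1)] assms(2) chart_at by blast

lemma local_rep_change:
  assumes c: "c \<in> A" "c' \<in> A" and z: "z \<in> overlap c c'"
  shows "local_rep A \<alpha> c z vs = local_rep A \<alpha> c' (transition c c' z) (map (dtransition c c' z) vs)"
proof -
  let ?c = "chart_at A (chart_inv c z)"
  have "dtransition c ?c z = (\<lambda>v. dtransition c' ?c (transition c c' z) (dtransition c c' z v))"
    by (rule ext) (rule dtransition_chain [OF c chart_at(1) z chart_at(2)])
  then show ?thesis
    by (simp add: local_rep_eq transition_overlap [OF c z] o_def)
qed

lemma local_rep_center:
  "local_rep A \<alpha> (chart_at A x) (chart_fun (chart_at A x) x) vs = \<alpha> x vs"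
proof -
  let ?c = "chart_at A x"
  have c: "?c \<in> A" "x \<in> chart_dom ?c" by (rule chart_at)+
  have x: "chart_inv ?c (chart_fun ?c x) = x" "chart_fun ?c x \<in> chart_img ?c" using chart_inverse [OF c(1)] c(2) by auto
  have "dtransition ?c ?c (chart_fun ?c x) = (\<lambda>v. v)" using dtransition_self(2) [OF c(1) x(2)] by blast
  then show ?thesis by (simp add: local_rep_eq x)
qed

text \<open>
  All local representations at one point are pull-backs along the same linear isomorphism, so that
  pointwise algebra transfers from forms to their local representations.
\<close>

lemma local_rep_pull:
  assumes "c \<in> A" "z \<in> chart_img c"
  obtains T where "complex_linear T" "inj T" "\<And>\<alpha> vs. local_rep A \<alpha> c z vs = \<alpha> (chart_inv c z) (map T vs)"
proof
  let ?c = "chart_at A (chart_inv c z)"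
  note o = in_overlap_chart_at [OF assms]
  show "complex_linear (dtransition c ?c z)" by (rule transition_derivative(2) [OF assms(1) chart_at(1) o])
  show "inj (dtransition c ?c z)" by (rule dtransition_inj [OF assms(1) chart_at(1) o])
  show "local_rep A \<alpha> c z vs = \<alpha> (chart_inv c z) (map (dtransition c ?c z) vs)" for \<alpha> vs by (rule local_rep_eq)
qed

lemma local_rep_pq:
  assumes "c \<in> A" "z \<in> chart_img c"
  shows "\<alpha> (chart_inv c z) \<in> pq_covectors 1 0 \<Longrightarrow> local_rep A \<alpha> c z \<in> pq_covectors 1 0"
    "\<alpha> (chart_inv c z) \<in> pq_covectors 2 0 \<Longrightarrow> local_rep A \<alpha> c z \<in> pq_covectors 2 0"
    "\<alpha> (chart_inv c z) \<in> pq_covectors 1 1 \<Longrightarrow> local_rep A \<alpha> c z \<in> pq_covectors 1 1"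
    "metric_covector (\<alpha> (chart_inv c z)) \<Longrightarrow> metric_covector (local_rep A \<alpha> c z)"
proof -
  obtain T where T: "complex_linear T" "inj T" "\<And>\<alpha> vs. local_rep A \<alpha> c z vs = \<alpha> (chart_inv c z) (map T vs)"
    by (rule local_rep_pull [OF assms]) (rule that)
  have eq: "local_rep A \<alpha> c z = (\<lambda>vs. \<alpha> (chart_inv c z) (map T vs))" for \<alpha> using T(3) by blast
  show "\<alpha> (chart_inv c z) \<in> pq_covectors 1 0 \<Longrightarrow> local_rep A \<alpha> c z \<in> pq_covectors 1 0"
    "\<alpha> (chart_inv c z) \<in> pq_covectors 2 0 \<Longrightarrow> local_rep A \<alpha> c z \<in> pq_covectors 2 0"
    "\<alpha> (chart_inv c z) \<in> pq_covectors 1 1 \<Longrightarrow> local_rep A \<alpha> c z \<in> pq_covectors 1 1"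
    "metric_covector (\<alpha> (chart_inv c z)) \<Longrightarrow> metric_covector (local_rep A \<alpha> c z)"
    unfolding eq by (rule pq_pull [OF T(1)], assumption)+ (rule metric_pull [OF T(1,2)])
qed

lemma norm_density_local_rep:
  assumes c: "c \<in> A" and z: "z \<in> chart_img c"
    and w: "metric_covector (\<omega> (chart_inv c z))" and a: "\<alpha> (chart_inv c z) \<in> pq_covectors 2 0"
  shows "Re (local_rep A (\<lambda>x vs. of_real ((covector_norm (\<omega> x) 2 (\<alpha> x))\<^sup>2) * volume_covector (\<omega> x) vs) c z canonical_frame)
       = norm_density (local_rep A \<omega> c z) (local_rep A \<alpha> c z)"
proof -
  obtain T where T: "complex_linear T" "inj T" "\<And>\<alpha> vs. local_rep A \<alpha> c z vs = \<alpha> (chart_inv c z) (map T vs)"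
    by (rule local_rep_pull [OF c z]) (rule that)
  have eq: "local_rep A \<alpha> c z = (\<lambda>vs. \<alpha> (chart_inv c z) (map T vs))" for \<alpha> using T(3) by blast
  show ?thesis
    unfolding eq using norm_density_pull [OF T(1,2) w a] by simp
qed

lemma transition_component_hol:
  assumes "c \<in> A" "c' \<in> A"
  shows "hol_on (overlap c c') (\<lambda>w. transition c c' w $ i)"
    "z \<in> overlap c c' \<Longrightarrow> full_deriv (\<lambda>w. transition c c' w $ i) z v = dtransition c c' z v $ i"
    "hol_on (overlap c c') (\<lambda>w. dtransition c c' w v $ i)"
proof -
  have d: "((\<lambda>w. transition c c' w $ i) has_derivative (\<lambda>v. dtransition c c' z v $ i)) (at z)" if "z \<in> overlap c c'" for z
    by (rule bounded_linear.has_derivative [OF bounded_linear_vec_nth transition_derivative(1) [OF assms that]])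
  show h: "hol_on (overlap c c') (\<lambda>w. transition c c' w $ i)"
    by (rule hol_onI [OF d]) (simp_all add: transition_derivative(3) [OF assms])
  show e: "full_deriv (\<lambda>w. transition c c' w $ i) z v = dtransition c c' z v $ i" if "z \<in> overlap c c'" for z
    by (simp add: full_deriv_eq [OF d [OF that]])
  show "hol_on (overlap c c') (\<lambda>w. dtransition c c' w v $ i)"
    by (rule hol_on_cong [OF hol_on_deriv [OF h open_overlap [OF assms]] open_overlap [OF assms] e])
qed

end

section \<open>Smooth functions\<close>

lemma full_deriv_cong_open:
  assumes "open S" "z \<in> S" "\<And>w. w \<in> S \<Longrightarrow> f w = g w"
  shows "f differentiable (at z) \<longleftrightarrow> g differentiable (at z)" "full_deriv f z = full_deriv g z"
proof -
  have iff: "(f has_derivative D) (at z) \<longleftrightarrow> (g has_derivative D) (at z)" for D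
    using has_derivative_transform_within_open [OF _ assms(1,2)] assms(3) by metis
  then show "f differentiable (at z) \<longleftrightarrow> g differentiable (at z)" by (simp add: differentiable_def)
  show "full_deriv f z = full_deriv g z"
    using iff by (simp add: full_deriv_def [abs_def] frechet_derivative_def)
qed

lemma C_k_on_cong:
  assumes "open S" "\<And>z. z \<in> S \<Longrightarrow> f z = g z" "C_k_on k S f" shows "C_k_on k S g"
  using assms(2,3)
proof (induction k arbitrary: f g)
  case 0 then show ?case using continuous_on_cong [of S S f g] by simp
next
  case (Suc k)
  note fg = full_deriv_cong_open [OF assms(1) _ Suc.prems(1)]
  have "C_k_on k S (\<lambda>z. full_deriv g z v)" for v
  proof (rule Suc.IH)
    show "C_k_on k S (\<lambda>z. full_deriv f z v)" using Suc.prems(2) by (simp add: full_deriv_def)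
  qed (simp add: fg)
  then show ?case using Suc.prems(2) fg(1) by (auto simp: full_deriv_def)
qed

lemma smooth_on_cong: "open S \<Longrightarrow> (\<And>z. z \<in> S \<Longrightarrow> f z = g z) \<Longrightarrow> smooth_on S f \<Longrightarrow> smooth_on S g"
  unfolding smooth_on_def using C_k_on_cong by blast

lemma smooth_onD:
  assumes "smooth_on S f"
  shows "continuous_on S f" "z \<in> S \<Longrightarrow> f differentiable (at z)" "smooth_on S (\<lambda>z. full_deriv f z v)"
proof -
  have k: "C_k_on k S f" for k using assms by (simp add: smooth_on_def)
  show "continuous_on S f" using k [of 0] by simp
  show "z \<in> S \<Longrightarrow> f differentiable (at z)" using k [of 1] by simp
  show "smooth_on S (\<lambda>z. full_deriv f z v)"
    unfolding smooth_on_def using k [of "Suc _"] by (auto simp: full_deriv_def)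
qed

lemma full_deriv_linear_comb:
  assumes "f differentiable (at z)" "g differentiable (at z)"
  shows "(\<lambda>w. a * f w + b * g w) differentiable (at z)"
    "full_deriv (\<lambda>w. a * f w + b * g w) z v = a * full_deriv f z v + b * full_deriv g z v"
proof -
  have "((\<lambda>w. a * f w + b * g w) has_derivative (\<lambda>v. a * full_deriv f z v + b * full_deriv g z v)) (at z)"
    by (intro has_derivative_add has_derivative_mult_right full_deriv_works assms)
  then show "(\<lambda>w. a * f w + b * g w) differentiable (at z)"
    "full_deriv (\<lambda>w. a * f w + b * g w) z v = a * full_deriv f z v + b * full_deriv g z v"
    by (auto simp: full_deriv_eq differentiableI)
qed

lemma C_k_on_linear_comb:
  assumes "open S" "C_k_on k S f" "C_k_on k S g" shows "C_k_on k S (\<lambda>z. a * f z + b * g z)"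
  using assms(2,3)
proof (induction k arbitrary: f g)
  case 0 then show ?case by (auto intro!: continuous_intros)
next
  case (Suc k)
  have d: "f differentiable (at z)" "g differentiable (at z)" if "z \<in> S" for z using Suc.prems that by auto
  have "C_k_on k S (\<lambda>z. full_deriv (\<lambda>z. a * f z + b * g z) z v)" for v
  proof (rule C_k_on_cong [OF assms(1)])
    show "C_k_on k S (\<lambda>z. a * full_deriv f z v + b * full_deriv g z v)"
      by (rule Suc.IH) (use Suc.prems in \<open>simp_all add: full_deriv_def\<close>)
  qed (simp add: full_deriv_linear_comb [OF d])
  then show ?case using full_deriv_linear_comb(1) [OF d] by (simp add: full_deriv_def)
qed

lemma smooth_on_linear_comb:
  "open S \<Longrightarrow> smooth_on S f \<Longrightarrow> smooth_on S g \<Longrightarrow> smooth_on S (\<lambda>z. a * f z + b * g z)"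
  unfolding smooth_on_def using C_k_on_linear_comb by blast

lemma full_deriv_cnj:
  assumes "f differentiable (at z)"
  shows "(\<lambda>w. cnj (f w)) differentiable (at z)" "full_deriv (\<lambda>w. cnj (f w)) z v = cnj (full_deriv f z v)"
proof -
  have "((\<lambda>w. cnj (f w)) has_derivative (\<lambda>v. cnj (full_deriv f z v))) (at z)"
    by (rule bounded_linear.has_derivative [OF bounded_linear_cnj full_deriv_works [OF assms]])
  then show "(\<lambda>w. cnj (f w)) differentiable (at z)" "full_deriv (\<lambda>w. cnj (f w)) z v = cnj (full_deriv f z v)"
    by (auto simp: full_deriv_eq differentiableI)
qed

lemma smooth_on_cnj:
  assumes "open S" "smooth_on S f" shows "smooth_on S (\<lambda>z. cnj (f z))"
proof -
  have "C_k_on k S (\<lambda>z. cnj (f z))" if "C_k_on k S f" for k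
    using that
  proof (induction k arbitrary: f)
    case 0 then show ?case by (auto intro!: continuous_intros)
  next
    case (Suc k)
    have d: "f differentiable (at z)" if "z \<in> S" for z using Suc.prems that by auto
    have "C_k_on k S (\<lambda>z. full_deriv (\<lambda>z. cnj (f z)) z v)" for v
    proof (rule C_k_on_cong [OF assms(1)])
      show "C_k_on k S (\<lambda>z. cnj (full_deriv f z v))"
        by (rule Suc.IH) (use Suc.prems in \<open>simp add: full_deriv_def\<close>)
    qed (simp add: full_deriv_cnj [OF d])
    then show ?case using full_deriv_cnj(1) [OF d] by (simp add: full_deriv_def)
  qed
  then show ?thesis using assms(2) by (simp add: smooth_on_def)
qed

lemma smooth_on_zero: "smooth_on S (\<lambda>z. 0)"
proof -
  have "full_deriv (\<lambda>z. 0) z v = 0" for z v :: "complex^'a::finite"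
    using full_deriv_eq [of "\<lambda>z :: complex^'a. 0" "\<lambda>v. 0" z] by simp
  then have "C_k_on k S (\<lambda>z. 0)" for k
    by (induction k) (simp_all add: full_deriv_def)
  then show ?thesis by (simp add: smooth_on_def)
qed

section \<open>Derivatives of forms in local coordinates\<close>

lemma pq_1_0_expansion:
  assumes "a \<in> pq_covectors 1 0" shows "a [v] = (\<Sum>i\<in>UNIV. v $ i * a [axis i 1])"
  by (rule complex_linear_expansion) (use assms pq_1_0_iff in blast)+

lemma pq_2_0_smult:
  assumes "a \<in> pq_covectors 2 0"
  shows "a [\<i> *s u, v] = \<i> * a [u, v]" "a [u, \<i> *s v] = \<i> * a [u, v]"
proof -
  have alt: "alternating a" and i1: "a [\<i> *s u, v] = \<i> * a [u, v]" for u v using assms pq_2_0_iff by blast+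
  show "a [\<i> *s u, v] = \<i> * a [u, v]" by (rule i1)
  show "a [u, \<i> *s v] = \<i> * a [u, v]"
    using i1 [of v u] alternating_skew [OF alt, of u "\<i> *s v"] alternating_skew [OF alt, of u v] by simp
qed

lemma pq_2_0_expansion:
  assumes a: "a \<in> pq_covectors 2 0"
  shows "a [u, v] = (\<Sum>i\<in>UNIV. \<Sum>j\<in>UNIV. u $ i * v $ j * a [axis i 1, axis j 1])"
proof -
  have alt: "alternating a" using a pq_2_0_iff by blast
  note lin = alternating_linear2 [OF alt]
  have 1: "a [u, v] = (\<Sum>i\<in>UNIV. u $ i * a [axis i 1, v])" for u
    by (rule complex_linear_expansion) (use lin pq_2_0_smult [OF a] in auto)
  have 2: "a [u, v] = (\<Sum>i\<in>UNIV. v $ i * a [u, axis i 1])" for u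
    by (rule complex_linear_expansion) (use lin pq_2_0_smult [OF a] in auto)
  show ?thesis
    unfolding 1 [of u] by (intro sum.cong refl) (subst 2, simp add: sum_distrib_left mult.assoc)
qed

lemma alternating_deriv_two:
  "alternating_deriv D a z [u, v] = D (\<lambda>w. a w [v]) z u - D (\<lambda>w. a w [u]) z v"
  by (simp add: alternating_deriv_def lessThan_Suc numeral_2_eq_2)

lemma alternating_deriv_three:
  "alternating_deriv D a z [u, v, w] = D (\<lambda>y. a y [v, w]) z u - D (\<lambda>y. a y [u, w]) z v + D (\<lambda>y. a y [u, v]) z w"
  by (simp add: alternating_deriv_def lessThan_Suc numeral_2_eq_2)

lemma full_deriv_zero [simp]: "full_deriv (\<lambda>w. 0) z v = 0"
  using full_deriv_eq [of "\<lambda>w. 0" "\<lambda>v. 0" z] by simp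

lemma antihol_deriv_zero [simp]: "antihol_deriv (\<lambda>w. 0) z v = 0"
  by (simp add: antihol_deriv_def)

lemma alternating_deriv_wrong_degree:
  assumes "\<And>z v. D (\<lambda>w. 0) z v = 0" "\<And>w xs. length xs \<noteq> k \<Longrightarrow> a w xs = 0" "length vs \<noteq> Suc k"
  shows "alternating_deriv D a z vs = 0"
proof -
  have "a w (take i vs @ drop (Suc i) vs) = 0" if "i < length vs" for i w
    using assms(2,3) that by simp
  then show ?thesis by (simp add: alternating_deriv_def assms(1))
qed

lemma list_length3: "length vs = 3 \<Longrightarrow> \<exists>u v w. vs = [u, v, w]"
  by (auto simp: numeral_3_eq_3 length_Suc_conv)

lemma hol_at_cong:
  assumes "hol_on {z} f" "open S" "z \<in> S" "\<And>w. w \<in> S \<Longrightarrow> f w = g w"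
  shows "hol_on {z} g"
  using assms(1) full_deriv_cong_open [OF assms(2-4)] by (simp add: hol_on_def)

lemma hol_on_singletonI: "hol_on S f \<Longrightarrow> z \<in> S \<Longrightarrow> hol_on {z} f"
  by (simp add: hol_on_def)

text \<open>
  Here \<open>H u v w\<close> is the derivative along \<open>u\<close> of \<open>h [v, w]\<close> for a \<open>(2,0)\<close>-form \<open>h\<close>, and \<open>closed\<close> says
  \<open>d (h + cnj h) = 0\<close>.  Replacing arguments by their multiples by \<open>\<i>\<close> separates the types in this equation:
  the \<open>(2,1)\<close>-part is the antiholomorphic derivative of \<open>h\<close>.
\<close>

lemma antiholomorphic_part_zero:
  fixes H :: "complex^'n::finite \<Rightarrow> complex^'n \<Rightarrow> complex^'n \<Rightarrow> complex"
  assumes neg: "\<And>u v w. H (- u) v w = - H u v w"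
    and i: "\<And>u v w. H u (\<i> *s v) w = \<i> * H u v w" "\<And>u v w. H u v (\<i> *s w) = \<i> * H u v w"
    and closed: "\<And>u v w. Re (H u v w - H v u w + H w u v) = 0"
  shows "H (\<i> *s u) v w = \<i> * H u v w"
proof -
  note I = closed [of u v w] closed [of "\<i> *s u" v w] closed [of u "\<i> *s v" w] closed [of u v "\<i> *s w"]
    closed [of "\<i> *s u" "\<i> *s v" w] closed [of "\<i> *s u" v "\<i> *s w"] closed [of u "\<i> *s v" "\<i> *s w"]
    closed [of "\<i> *s u" "\<i> *s v" "\<i> *s w"]
  show ?thesis
    using I by (simp add: i complex_eq_iff)
qed

context
  fixes A :: "('m::topological_space, 'n::finite) chart set"
  assumes A: "complex_atlas A"
begin

definition smooth_rep :: "('m, 'n) form \<Rightarrow> bool" where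
  "smooth_rep \<alpha> \<longleftrightarrow> (\<forall>c\<in>A. \<forall>vs. smooth_on (chart_img c) (\<lambda>z. local_rep A \<alpha> c z vs))"

lemma smooth_repD:
  "smooth_rep \<alpha> \<Longrightarrow> c \<in> A \<Longrightarrow> smooth_on (chart_img c) (\<lambda>z. local_rep A \<alpha> c z vs)"
  "smooth_rep \<alpha> \<Longrightarrow> c \<in> A \<Longrightarrow> z \<in> chart_img c \<Longrightarrow> (\<lambda>z. local_rep A \<alpha> c z vs) differentiable (at z)"
  unfolding smooth_rep_def by (blast, rule smooth_onD(2) [of "chart_img c"]) auto

lemma smooth_formsD:
  assumes "\<alpha> \<in> smooth_forms A p q" shows "\<alpha> x \<in> pq_covectors p q" "smooth_rep \<alpha>"
  using assms by (auto simp: smooth_forms_def smooth_rep_def)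

lemma smooth_formsI: "(\<And>x. \<alpha> x \<in> pq_covectors p q) \<Longrightarrow> smooth_rep \<alpha> \<Longrightarrow> \<alpha> \<in> smooth_forms A p q"
  by (simp add: smooth_forms_def smooth_rep_def)

lemma center_in_img: "chart_at A x \<in> A" "chart_fun (chart_at A x) x \<in> chart_img (chart_at A x)"
  "chart_inv (chart_at A x) (chart_fun (chart_at A x) x) = x"
  using chart_at [OF A] chart_inverse [OF A chart_at(1) [OF A]] by blast+

lemma transition_center:
  assumes "c \<in> A" "z \<in> chart_img c"
  shows "transition c (chart_at A (chart_inv c z)) z = chart_fun (chart_at A (chart_inv c z)) (chart_inv c z)"
  by (simp add: transition_def)

section \<open>Derivatives of one-forms are independent of the chart\<close>

lemma one_form_expansion:
  assumes \<alpha>: "\<And>x. \<alpha> x \<in> pq_covectors 1 0" and c: "c \<in> A" "z \<in> chart_img c"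
  shows "local_rep A \<alpha> c z [v] = (\<Sum>i\<in>UNIV. v $ i * local_rep A \<alpha> c z [axis i 1])"
  by (rule pq_1_0_expansion [OF local_rep_pq(1) [OF A c \<alpha>]])

lemma one_form_full_deriv:
  assumes \<alpha>: "\<And>x. \<alpha> x \<in> pq_covectors 1 0" and sm: "smooth_rep \<alpha>" and c: "c \<in> A" "z \<in> chart_img c"
  shows "full_deriv (\<lambda>w. local_rep A \<alpha> c w [v]) z u = (\<Sum>i\<in>UNIV. v $ i * full_deriv (\<lambda>w. local_rep A \<alpha> c w [axis i 1]) z u)"
proof -
  have "((\<lambda>w. \<Sum>i\<in>UNIV. v $ i * local_rep A \<alpha> c w [axis i 1]) has_derivative
      (\<lambda>u. \<Sum>i\<in>UNIV. v $ i * full_deriv (\<lambda>w. local_rep A \<alpha> c w [axis i 1]) z u)) (at z)"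
    by (intro has_derivative_sum has_derivative_mult_right full_deriv_works smooth_repD(2) [OF sm c])
  then have "((\<lambda>w. local_rep A \<alpha> c w [v]) has_derivative
      (\<lambda>u. \<Sum>i\<in>UNIV. v $ i * full_deriv (\<lambda>w. local_rep A \<alpha> c w [axis i 1]) z u)) (at z)"
    by (rule has_derivative_transform_within_open [OF _ chart_open(2) [OF A c(1)] c(2)])
      (simp add: one_form_expansion [OF \<alpha> c(1), symmetric])
  then show ?thesis by (simp add: full_deriv_eq)
qed

text \<open>
  The product rule for \<open>\<alpha>\<^bsub>c\<^esub>(z) v = \<alpha>\<^bsub>c'\<^esub>(\<tau> z) (d\<tau>\<^bsub>z\<^esub> v)\<close>.  The first summand contains second derivatives
  of the transition map \<open>\<tau>\<close>.
\<close>

lemma one_form_change_deriv: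
  assumes \<alpha>: "\<And>x. \<alpha> x \<in> pq_covectors 1 0" and sm: "smooth_rep \<alpha>" and c: "c \<in> A" "c' \<in> A" and z: "z \<in> overlap c c'"
  shows "full_deriv (\<lambda>w. local_rep A \<alpha> c w [v]) z u =
     (\<Sum>i\<in>UNIV. full_deriv (\<lambda>w. dtransition c c' w v $ i) z u * local_rep A \<alpha> c' (transition c c' z) [axis i 1])
     + full_deriv (\<lambda>w. local_rep A \<alpha> c' w [dtransition c c' z v]) (transition c c' z) (dtransition c c' z u)"
proof -
  let ?\<tau> = "transition c c'" and ?f = "\<lambda>i w. local_rep A \<alpha> c' w [axis i 1]" and ?g = "\<lambda>i w. dtransition c c' w v $ i"
  note z' = transition_overlap(1) [OF A c z]
  have f: "((\<lambda>w. ?f i (?\<tau> w)) has_derivative (\<lambda>u. full_deriv (?f i) (?\<tau> z) (dtransition c c' z u))) (at z)" for i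
    by (rule has_derivative_compose [OF transition_derivative(1) [OF A c z] full_deriv_works [OF smooth_repD(2) [OF sm c(2) z']]])
  have g: "(?g i has_derivative full_deriv (?g i) z) (at z)" for i
    by (rule hol_onD(1) [OF transition_component_hol(3) [OF A c] z])
  have "((\<lambda>w. \<Sum>i\<in>UNIV. ?g i w * ?f i (?\<tau> w)) has_derivative
     (\<lambda>u. \<Sum>i\<in>UNIV. ?g i z * full_deriv (?f i) (?\<tau> z) (dtransition c c' z u) + full_deriv (?g i) z u * ?f i (?\<tau> z))) (at z)"
    by (intro has_derivative_sum has_derivative_mult f g)
  then have "((\<lambda>w. local_rep A \<alpha> c w [v]) has_derivative
     (\<lambda>u. \<Sum>i\<in>UNIV. ?g i z * full_deriv (?f i) (?\<tau> z) (dtransition c c' z u) + full_deriv (?g i) z u * ?f i (?\<tau> z))) (at z)"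
  proof (rule has_derivative_transform_within_open [OF _ open_overlap [OF A c] z])
    fix w assume w: "w \<in> overlap c c'"
    show "(\<Sum>i\<in>UNIV. ?g i w * ?f i (?\<tau> w)) = local_rep A \<alpha> c w [v]"
      using one_form_expansion [OF \<alpha> c(2) transition_overlap(1) [OF A c w], where v = "dtransition c c' w v"]
        local_rep_change [OF A c w, of \<alpha> "[v]"] by simp
  qed
  then show ?thesis
    using one_form_full_deriv [OF \<alpha> sm c(2) z', where v = "dtransition c c' z v" and u = "dtransition c c' z u"]
    by (simp add: full_deriv_eq sum.distrib)
qed

lemma transition_second_deriv_symmetric:
  assumes c: "c \<in> A" "c' \<in> A" and z: "z \<in> overlap c c'"
  shows "full_deriv (\<lambda>w. dtransition c c' w v $ i) z u = full_deriv (\<lambda>w. dtransition c c' w u $ i) z v"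
proof -
  let ?t = "\<lambda>w. transition c c' w $ i"
  note o = open_overlap [OF A c]
  have eq: "full_deriv (\<lambda>w. dtransition c c' w v $ i) z = full_deriv (\<lambda>w. full_deriv ?t w v) z" for v
    by (rule full_deriv_cong_open(2) [OF o z]) (simp add: transition_component_hol(2) [OF A c])
  have d: "(\<lambda>w. full_deriv ?t w v) differentiable (at z)" for v
    using hol_on_deriv [OF transition_component_hol(1) [OF A c] o] z by (auto simp: hol_on_def)
  have "?t differentiable (at w)" if "w \<in> overlap c c'" for w
    using transition_component_hol(1) [OF A c] that by (auto simp: hol_on_def)
  then show ?thesis unfolding eq by (rule full_deriv_commute [OF o z _ d d])
qed

text \<open>
  The second derivatives of the transition map are symmetric and drop out.
\<close>

lemma exterior_derivative_change:
  assumes \<alpha>: "\<And>x. \<alpha> x \<in> pq_covectors 1 0" and sm: "smooth_rep \<alpha>" and c: "c \<in> A" "c' \<in> A" and z: "z \<in> overlap c c'"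
  shows "alternating_deriv full_deriv (local_rep A \<alpha> c) z [u, v]
    = alternating_deriv full_deriv (local_rep A \<alpha> c') (transition c c' z) [dtransition c c' z u, dtransition c c' z v]"
  unfolding alternating_deriv_two one_form_change_deriv [OF \<alpha> sm c z]
  by (simp add: transition_second_deriv_symmetric [OF c z, of v _ u])

text \<open>
  The second derivatives of the transition map are complex linear, so that their antiholomorphic part is 0.
\<close>

lemma antihol_deriv_change:
  assumes \<alpha>: "\<And>x. \<alpha> x \<in> pq_covectors 1 0" and sm: "smooth_rep \<alpha>" and c: "c \<in> A" "c' \<in> A" and z: "z \<in> overlap c c'"
  shows "alternating_deriv antihol_deriv (local_rep A \<alpha> c) z [u, v]
    = alternating_deriv antihol_deriv (local_rep A \<alpha> c') (transition c c' z) [dtransition c c' z u, dtransition c c' z v]"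
proof -
  have "antihol_deriv (\<lambda>w. local_rep A \<alpha> c w [v]) z u
     = antihol_deriv (\<lambda>w. local_rep A \<alpha> c' w [dtransition c c' z v]) (transition c c' z) (dtransition c c' z u)" for u v
  proof -
    have "full_deriv (\<lambda>w. dtransition c c' w v $ i) z (\<i> *s u) = \<i> * full_deriv (\<lambda>w. dtransition c c' w v $ i) z u" for i
      by (rule hol_onD(2) [OF transition_component_hol(3) [OF A c] z])
    then show ?thesis
      unfolding antihol_deriv_def one_form_change_deriv [OF \<alpha> sm c z]
      by (simp add: transition_derivative(3) [OF A c z] distrib_left sum_distrib_left sum_negf flip: mult.assoc)
  qed
  then show ?thesis unfolding alternating_deriv_two by simp
qed

lemma local_rep_wrong_degree:
  assumes "\<And>x xs. length xs \<noteq> k \<Longrightarrow> \<alpha> x xs = 0" "length xs \<noteq> k" shows "local_rep A \<alpha> c w xs = 0"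
  by (simp add: local_rep_eq [OF A] assms)

text \<open>
  The derivatives of a form are defined by means of one chosen chart at each point.  For one-forms they may be
  computed in any chart, whence the derivative of a smooth one-form is smooth.
\<close>

lemma local_rep_form_deriv:
  assumes \<alpha>: "\<And>x. \<alpha> x \<in> pq_covectors 1 0" and sm: "smooth_rep \<alpha>" and c: "c \<in> A" "z \<in> chart_img c"
    and D: "D = full_deriv \<or> D = antihol_deriv"
  shows "local_rep A (form_deriv D A \<alpha>) c z vs = alternating_deriv D (local_rep A \<alpha> c) z vs"
proof -
  let ?x = "chart_inv c z"
  let ?c = "chart_at A ?x"
  note o = in_overlap_chart_at [OF A c]
  have "length xs \<noteq> 1 \<Longrightarrow> \<alpha> x xs = 0" for x xs using \<alpha> [of x] pq_1_0_iff by blast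
  note off = local_rep_wrong_degree [OF this]
  have eq: "local_rep A (form_deriv D A \<alpha>) c z vs
     = alternating_deriv D (local_rep A \<alpha> ?c) (transition c ?c z) (map (dtransition c ?c z) vs)"
    by (simp add: local_rep_eq [OF A] form_deriv_def Let_def transition_center [OF c])
  show ?thesis
  proof (cases "length vs = 2")
    case True
    then obtain u v where vs: "vs = [u, v]" by (metis list_length2)
    show ?thesis
      unfolding eq unfolding vs using D exterior_derivative_change [OF \<alpha> sm c(1) chart_at(1) [OF A] o, of u v]
        antihol_deriv_change [OF \<alpha> sm c(1) chart_at(1) [OF A] o, of u v] by auto
  next
    case False
    have D0: "D (\<lambda>w. 0) z v = 0" for z v using D by auto
    have "alternating_deriv D (local_rep A \<alpha> c') z' vs' = 0" if "length vs' = length vs" for c' z' vs'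
      by (rule alternating_deriv_wrong_degree [where k = 1 and D = D]) (use D0 off False that in auto)
    then show ?thesis unfolding eq by simp
  qed
qed

section \<open>Linearity of the exterior derivative\<close>

lemma local_rep_linear_comb:
  "local_rep A (\<lambda>x vs. a * \<alpha> x vs + b * \<beta> x vs) c z vs = a * local_rep A \<alpha> c z vs + b * local_rep A \<beta> c z vs"
  by (simp add: local_rep_eq [OF A])

lemma local_rep_cnj: "local_rep A (cnj_form \<alpha>) c z vs = cnj (local_rep A \<alpha> c z vs)"
  by (simp add: local_rep_eq [OF A] cnj_form_def)

lemma cnj_form_apply: "cnj_form \<alpha> x vs = cnj (\<alpha> x vs)"
  by (simp add: cnj_form_def)

lemma smooth_rep_linear_comb: "smooth_rep \<alpha> \<Longrightarrow> smooth_rep \<beta> \<Longrightarrow> smooth_rep (\<lambda>x vs. a * \<alpha> x vs + b * \<beta> x vs)"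
  unfolding smooth_rep_def local_rep_linear_comb
  using smooth_on_linear_comb chart_open(2) [OF A] by blast

lemma smooth_rep_cnj: "smooth_rep \<alpha> \<Longrightarrow> smooth_rep (cnj_form \<alpha>)"
  unfolding smooth_rep_def local_rep_cnj using smooth_on_cnj chart_open(2) [OF A] by blast

lemma smooth_rep_add: "smooth_rep \<alpha> \<Longrightarrow> smooth_rep \<beta> \<Longrightarrow> smooth_rep (\<alpha> + \<beta>)"
  using smooth_rep_linear_comb [of \<alpha> \<beta> 1 1] by (simp add: plus_fun_def)

lemma smooth_rep_scale: "smooth_rep \<alpha> \<Longrightarrow> smooth_rep (scale_form s \<alpha>)"
  using smooth_rep_linear_comb [of \<alpha> \<alpha> "of_real s" 0] by (simp add: scale_form_def)

lemma d_form_linear_comb: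
  assumes "smooth_rep \<alpha>" "smooth_rep \<beta>"
  shows "d_form A (\<lambda>x vs. a * \<alpha> x vs + b * \<beta> x vs) x vs = a * d_form A \<alpha> x vs + b * d_form A \<beta> x vs"
proof -
  note c = center_in_img(1,2) [of x]
  have "full_deriv (\<lambda>w. a * local_rep A \<alpha> (chart_at A x) w xs + b * local_rep A \<beta> (chart_at A x) w xs) (chart_fun (chart_at A x) x) v
     = a * full_deriv (\<lambda>w. local_rep A \<alpha> (chart_at A x) w xs) (chart_fun (chart_at A x) x) v
     + b * full_deriv (\<lambda>w. local_rep A \<beta> (chart_at A x) w xs) (chart_fun (chart_at A x) x) v" for xs v
    by (rule full_deriv_linear_comb(2) [OF smooth_repD(2) [OF assms(1) c] smooth_repD(2) [OF assms(2) c]])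
  then show ?thesis
    by (simp add: d_form_def form_deriv_def Let_def alternating_deriv_def local_rep_linear_comb
        sum_distrib_left sum.distrib algebra_simps)
qed

lemma d_form_add: "smooth_rep \<alpha> \<Longrightarrow> smooth_rep \<beta> \<Longrightarrow> d_form A (\<alpha> + \<beta>) = d_form A \<alpha> + d_form A \<beta>"
  using d_form_linear_comb [of \<alpha> \<beta> 1 1] by (simp add: plus_fun_def fun_eq_iff)

lemma d_form_scale: "smooth_rep \<alpha> \<Longrightarrow> d_form A (scale_form s \<alpha>) = scale_form s (d_form A \<alpha>)"
  using d_form_linear_comb [of \<alpha> \<alpha> "of_real s" 0] by (simp add: scale_form_def fun_eq_iff)

lemma d_form_cnj:
  assumes "smooth_rep \<alpha>" shows "d_form A (cnj_form \<alpha>) = cnj_form (d_form A \<alpha>)"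
proof (intro ext)
  fix x vs
  note c = center_in_img(1,2) [of x]
  have "full_deriv (\<lambda>w. cnj (local_rep A \<alpha> (chart_at A x) w xs)) (chart_fun (chart_at A x) x) v
     = cnj (full_deriv (\<lambda>w. local_rep A \<alpha> (chart_at A x) w xs) (chart_fun (chart_at A x) x) v)" for xs v
    by (rule full_deriv_cnj(2) [OF smooth_repD(2) [OF assms c]])
  then show "d_form A (cnj_form \<alpha>) x vs = cnj_form (d_form A \<alpha>) x vs"
    by (simp add: d_form_def form_deriv_def Let_def alternating_deriv_def local_rep_cnj cnj_form_apply)
qed

section \<open>First and second derivatives of one-forms\<close>

lemma del_plus_delbar: "del A \<alpha> + delbar A \<alpha> = d_form A \<alpha>"
proof -
  have "hol_deriv f z v + antihol_deriv f z v = full_deriv f z v" for f :: "complex^'n \<Rightarrow> complex" and z v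
    by (simp add: hol_deriv_def antihol_deriv_def field_simps)
  then show ?thesis
    by (simp add: fun_eq_iff del_def delbar_def d_form_def form_deriv_def Let_def alternating_deriv_def
        flip: sum.distrib distrib_left)
qed

lemma del_cnj:
  assumes "smooth_rep \<alpha>" shows "del A (cnj_form \<alpha>) = cnj_form (delbar A \<alpha>)"
proof (intro ext)
  fix x vs
  note c = center_in_img(1,2) [of x]
  have "hol_deriv (\<lambda>w. cnj (local_rep A \<alpha> (chart_at A x) w xs)) (chart_fun (chart_at A x) x) v
     = cnj (antihol_deriv (\<lambda>w. local_rep A \<alpha> (chart_at A x) w xs) (chart_fun (chart_at A x) x) v)" for xs v
    by (simp add: hol_deriv_def antihol_deriv_def full_deriv_cnj(2) [OF smooth_repD(2) [OF assms c]])
  then show "del A (cnj_form \<alpha>) x vs = cnj_form (delbar A \<alpha>) x vs"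
    by (simp add: del_def delbar_def form_deriv_def Let_def alternating_deriv_def local_rep_cnj cnj_form_apply)
qed

lemma smooth_rep_form_deriv:
  assumes \<alpha>: "\<alpha> \<in> smooth_forms A 1 0"
  shows "smooth_rep (d_form A \<alpha>)" "smooth_rep (delbar A \<alpha>)"
proof -
  note pq = smooth_formsD(1) [OF \<alpha>] and sm = smooth_formsD(2) [OF \<alpha>]
  have "smooth_on (chart_img c) (\<lambda>z. local_rep A (form_deriv D A \<alpha>) c z vs)"
    if c: "c \<in> A" and D: "D = full_deriv \<or> D = antihol_deriv" for c vs D
  proof (rule smooth_on_cong [OF chart_open(2) [OF A c]])
    show "alternating_deriv D (local_rep A \<alpha> c) z vs = local_rep A (form_deriv D A \<alpha>) c z vs" if "z \<in> chart_img c" for z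
      by (rule local_rep_form_deriv [OF pq sm c that D, symmetric])
    have f: "smooth_on (chart_img c) (\<lambda>z. full_deriv (\<lambda>w. local_rep A \<alpha> c w xs) z v)" for xs v
      by (rule smooth_onD(3) [OF smooth_repD(1) [OF sm c]])
    have Dsm: "smooth_on (chart_img c) (\<lambda>z. D (\<lambda>w. local_rep A \<alpha> c w xs) z v)" for xs v
    proof -
      have "antihol_deriv (\<lambda>w. local_rep A \<alpha> c w xs) z v
        = 1 / 2 * full_deriv (\<lambda>w. local_rep A \<alpha> c w xs) z v + \<i> / 2 * full_deriv (\<lambda>w. local_rep A \<alpha> c w xs) z (\<i> *s v)" for z
        by (simp add: antihol_deriv_def field_simps)
      then have "smooth_on (chart_img c) (\<lambda>z. antihol_deriv (\<lambda>w. local_rep A \<alpha> c w xs) z v)"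
        using smooth_on_linear_comb [OF chart_open(2) [OF A c] f f, of "1/2" xs v "\<i> / 2" xs "\<i> *s v"] by simp
      then show ?thesis using f D by auto
    qed
    show "smooth_on (chart_img c) (\<lambda>z. alternating_deriv D (local_rep A \<alpha> c) z vs)"
    proof (cases "length vs = 2")
      case True
      then obtain u v where vs: "vs = [u, v]" by (metis list_length2)
      show ?thesis
        using smooth_on_linear_comb [OF chart_open(2) [OF A c] Dsm Dsm, of 1 "[v]" u "-1" "[u]" v]
        by (simp add: vs alternating_deriv_two)
    next
      case False
      have "length xs \<noteq> 1 \<Longrightarrow> \<alpha> x xs = 0" for x xs using pq [of x] pq_1_0_iff by blast
      note off = local_rep_wrong_degree [OF this]
      have "alternating_deriv D (local_rep A \<alpha> c) z vs = 0" for z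
        by (rule alternating_deriv_wrong_degree [where k = 1]) (use D off False in auto)
      then show ?thesis by (simp add: smooth_on_zero)
    qed
  qed
  then show "smooth_rep (d_form A \<alpha>)" "smooth_rep (delbar A \<alpha>)"
    by (simp_all add: smooth_rep_def d_form_def delbar_def)
qed

lemma alternating_deg2:
  assumes "\<And>xs. length xs \<noteq> 2 \<Longrightarrow> a xs = 0" "\<And>v. linear (\<lambda>u. a [u, v])" "\<And>u. linear (\<lambda>v. a [u, v])" "\<And>u. a [u, u] = 0"
  shows "alternating (a :: 'n covector)"
proof -
  have cases: "length (xs @ u # ys) \<noteq> 2 \<or> (\<exists>y. xs = [] \<and> ys = [y]) \<or> (\<exists>x. xs = [x] \<and> ys = [])" for xs ys and u :: "complex^'n"
    by (cases xs; cases ys) auto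
  have "a (xs @ (u + v) # ys) = a (xs @ u # ys) + a (xs @ v # ys)" for xs u v ys
    using cases [of xs u ys] assms(1) linear_add [OF assms(2)] linear_add [OF assms(3)] by auto
  moreover have "a (xs @ (r *\<^sub>R u) # ys) = of_real r * a (xs @ u # ys)" for xs r u ys
    using cases [of xs u ys] assms(1) linear_scale [OF assms(2)] linear_scale [OF assms(3)]
    by (auto simp: scaleR_conv_of_real)
  moreover have "a (xs @ u # u # ys) = 0" for xs u ys
  proof (cases "length (xs @ u # u # ys) = 2")
    case True
    then have "xs = []" "ys = []" by auto
    then show ?thesis by (simp add: assms(4))
  qed (rule assms(1))
  ultimately show ?thesis unfolding alternating_def by blast
qed

text \<open>
  \<open>B u v\<close>, the antiholomorphic derivative along \<open>u\<close> of \<open>\<alpha> [v]\<close>, is antilinear in \<open>u\<close> and linear in \<open>v\<close>.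
\<close>

lemma delbar_smooth_form:
  assumes \<alpha>: "\<alpha> \<in> smooth_forms A 1 0" shows "delbar A \<alpha> \<in> smooth_forms A 1 1"
proof (rule smooth_formsI [OF _ smooth_rep_form_deriv(2) [OF \<alpha>]])
  fix x
  note pq = smooth_formsD(1) [OF \<alpha>] and sm = smooth_formsD(2) [OF \<alpha>]
  let ?c = "chart_at A x" and ?z = "chart_fun (chart_at A x) x"
  note c = center_in_img(1,2) [of x]
  define B where "B u v = antihol_deriv (\<lambda>w. local_rep A \<alpha> ?c w [v]) ?z u" for u v
  have B: "B u v = (\<Sum>i\<in>UNIV. v $ i * antihol_deriv (\<lambda>w. local_rep A \<alpha> ?c w [axis i 1]) ?z u)" for u v
    unfolding B_def antihol_deriv_def one_form_full_deriv [OF pq sm c, of v]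
    by (simp add: sum_distrib_left flip: sum.distrib sum_divide_distrib) (simp add: algebra_simps)
  have lin: "linear (full_deriv (\<lambda>w. local_rep A \<alpha> ?c w vs) ?z)" for vs
    by (rule linear_full_deriv [OF smooth_repD(2) [OF sm c]])
  have Blin1: "linear (\<lambda>u. B u v)" for v
    unfolding B_def antihol_deriv_def
    by (rule linearI) (simp_all add: linear_add [OF lin] linear_scale [OF lin] smult_add smult_scaleR
        scaleR_conv_of_real [where 'a = complex] add_divide_distrib distrib_left mult.left_commute)
  have Blin2: "linear (\<lambda>v. B u v)" for u
    unfolding B by (rule linearI) (simp_all add: algebra_simps sum.distrib scaleR_sum_right)
  have Bi1: "B (\<i> *s u) v = - \<i> * B u v" for u v
    unfolding B_def antihol_deriv_def by (simp add: smult_ii linear_neg [OF lin] algebra_simps diff_divide_distrib)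
  have Bi2: "B u (\<i> *s v) = \<i> * B u v" for u v
    unfolding B by (simp add: sum_distrib_left algebra_simps)
  have two: "delbar A \<alpha> x [u, v] = B u v - B v u" for u v
    by (simp add: delbar_def form_deriv_def Let_def alternating_deriv_two B_def)
  have "length xs \<noteq> 1 \<Longrightarrow> \<alpha> x xs = 0" for x xs using pq [of x] pq_1_0_iff by blast
  note off' = local_rep_wrong_degree [OF this]
  have off: "delbar A \<alpha> x xs = 0" if "length xs \<noteq> 2" for xs
    unfolding delbar_def form_deriv_def Let_def
    by (rule alternating_deriv_wrong_degree [where k = 1]) (use off' that in auto)
  have "alternating (delbar A \<alpha> x)"
    by (rule alternating_deg2 [OF off]) (simp_all add: two linear_compose_sub Blin1 Blin2)
  moreover have "delbar A \<alpha> x [\<i> *s u, \<i> *s v] = delbar A \<alpha> x [u, v]" for u v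
    by (simp add: two Bi1 Bi2)
  ultimately show "delbar A \<alpha> x \<in> pq_covectors 1 1" unfolding pq_1_1_iff using off by blast
qed

lemma cnj_smooth_form_1_1:
  assumes "\<alpha> \<in> smooth_forms A 1 1" shows "cnj_form \<alpha> \<in> smooth_forms A 1 1"
proof (rule smooth_formsI [OF _ smooth_rep_cnj [OF smooth_formsD(2) [OF assms]]])
  fix x
  have "\<alpha> x \<in> pq_covectors 1 1" by (rule smooth_formsD(1) [OF assms])
  then show "cnj_form \<alpha> x \<in> pq_covectors 1 1"
    unfolding pq_1_1_iff cnj_form_def by (simp add: alternating_cnj)
qed

lemma smooth_form_linear_comb_1_1:
  assumes "\<alpha> \<in> smooth_forms A 1 1" "\<beta> \<in> smooth_forms A 1 1"
  shows "(\<lambda>x vs. a * \<alpha> x vs + b * \<beta> x vs) \<in> smooth_forms A 1 1"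
proof (rule smooth_formsI [OF _ smooth_rep_linear_comb [OF smooth_formsD(2) [OF assms(1)] smooth_formsD(2) [OF assms(2)]]])
  fix x
  have "\<alpha> x \<in> pq_covectors 1 1" "\<beta> x \<in> pq_covectors 1 1" using smooth_formsD(1) assms by blast+
  then show "(\<lambda>vs. a * \<alpha> x vs + b * \<beta> x vs) \<in> pq_covectors 1 1"
    unfolding pq_1_1_iff by (auto intro!: alternating_add alternating_scale)
qed

lemma smooth_form_linear_comb_2_0:
  assumes "\<alpha> \<in> smooth_forms A 2 0" "\<beta> \<in> smooth_forms A 2 0"
  shows "(\<lambda>x vs. a * \<alpha> x vs + b * \<beta> x vs) \<in> smooth_forms A 2 0"
proof (rule smooth_formsI [OF _ smooth_rep_linear_comb [OF smooth_formsD(2) [OF assms(1)] smooth_formsD(2) [OF assms(2)]]])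
  fix x
  have "\<alpha> x \<in> pq_covectors 2 0" "\<beta> x \<in> pq_covectors 2 0" using smooth_formsD(1) assms by blast+
  then show "(\<lambda>vs. a * \<alpha> x vs + b * \<beta> x vs) \<in> pq_covectors 2 0"
    unfolding pq_2_0_iff by (auto intro!: alternating_add alternating_scale simp: algebra_simps)
qed

lemma d_d_zero:
  assumes \<alpha>: "\<alpha> \<in> smooth_forms A 1 0" shows "d_form A (d_form A \<alpha>) = 0"
proof (intro ext)
  fix x vs
  note pq = smooth_formsD(1) [OF \<alpha>] and sm = smooth_formsD(2) [OF \<alpha>]
  let ?c = "chart_at A x" and ?z = "chart_fun (chart_at A x) x"
  note c = center_in_img(1,2) [of x]
  let ?a = "\<lambda>v w. local_rep A \<alpha> ?c w [v]"
  note o = chart_open(2) [OF A c(1)]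
  have rep: "local_rep A (d_form A \<alpha>) ?c w xs = alternating_deriv full_deriv (local_rep A \<alpha> ?c) w xs" if "w \<in> chart_img ?c" for w xs
    unfolding d_form_def by (rule local_rep_form_deriv [OF pq sm c(1) that]) simp
  have da: "?a v differentiable (at w)" if "w \<in> chart_img ?c" for v w by (rule smooth_repD(2) [OF sm c(1) that])
  have dda: "(\<lambda>w. full_deriv (?a v) w u) differentiable (at ?z)" for u v
    by (rule smooth_onD(2) [OF smooth_onD(3) [OF smooth_repD(1) [OF sm c(1)]] c(2)])
  have sym: "full_deriv (\<lambda>w. full_deriv (?a y) w v) ?z u = full_deriv (\<lambda>w. full_deriv (?a y) w u) ?z v" for u v y
    by (rule full_deriv_commute [OF o c(2) da dda dda])
  have two: "full_deriv (\<lambda>w. local_rep A (d_form A \<alpha>) ?c w [v, y]) ?z u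
      = full_deriv (\<lambda>w. full_deriv (?a y) w v) ?z u - full_deriv (\<lambda>w. full_deriv (?a v) w y) ?z u" for u v y
  proof -
    have "full_deriv (\<lambda>w. local_rep A (d_form A \<alpha>) ?c w [v, y]) ?z
        = full_deriv (\<lambda>w. 1 * full_deriv (?a y) w v + (- 1) * full_deriv (?a v) w y) ?z"
      by (rule full_deriv_cong_open(2) [OF o c(2)]) (simp add: rep alternating_deriv_two)
    then show ?thesis by (simp only: full_deriv_linear_comb(2) [OF dda dda]) simp
  qed
  show "d_form A (d_form A \<alpha>) x vs = 0 x vs"
  proof (cases "length vs = 3")
    case True
    then obtain u v y where vs: "vs = [u, v, y]" using list_length3 by blast
    have "d_form A (d_form A \<alpha>) x vs = alternating_deriv full_deriv (local_rep A (d_form A \<alpha>) ?c) ?z vs"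
      by (subst d_form_def) (simp add: form_deriv_def Let_def)
    also have "\<dots> = 0"
      unfolding vs alternating_deriv_three two
      using sym [of y v u] sym [of v u y] sym [of u v y] sym [of y u v] sym [of v y u] sym [of u y v] by simp
    finally show ?thesis by simp
  next
    case False
    have "length xs \<noteq> 1 \<Longrightarrow> \<alpha> x xs = 0" for x xs using pq [of x] pq_1_0_iff by blast
    note off' = local_rep_wrong_degree [OF this]
    have "d_form A \<alpha> x xs = 0" if "length xs \<noteq> 2" for x xs
      unfolding d_form_def form_deriv_def Let_def
      by (rule alternating_deriv_wrong_degree [where k = 1]) (use off' that in auto)
    note off'' = local_rep_wrong_degree [OF this]
    have "alternating_deriv full_deriv (local_rep A (d_form A \<alpha>) ?c) ?z vs = 0"
      by (rule alternating_deriv_wrong_degree [where k = 2]) (use off'' False in auto)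
    then show ?thesis by (subst d_form_def) (simp add: form_deriv_def Let_def)
  qed
qed

section \<open>Closing forms differ by holomorphic two-forms\<close>

lemma two_form_change:
  assumes h: "\<And>x. h x \<in> pq_covectors 2 0" and c: "c \<in> A" "c' \<in> A" and z: "z \<in> overlap c c'"
  shows "local_rep A h c z [u, v] = (\<Sum>i\<in>UNIV. \<Sum>j\<in>UNIV. dtransition c c' z u $ i * dtransition c c' z v $ j
      * local_rep A h c' (transition c c' z) [axis i 1, axis j 1])"
  using local_rep_change [OF A c z, of h "[u, v]"]
    pq_2_0_expansion [OF local_rep_pq(2) [OF A c(2) transition_overlap(1) [OF A c z] h], where u = "dtransition c c' z u" and v = "dtransition c c' z v"]
  by simp

lemma hol_two_form_change:
  assumes h: "\<And>x. h x \<in> pq_covectors 2 0" and c: "c \<in> A" "c' \<in> A" and z: "z \<in> overlap c c'"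
    and hol: "\<And>i j. hol_on {transition c c' z} (\<lambda>w. local_rep A h c' w [axis i 1, axis j 1])"
  shows "hol_on {z} (\<lambda>w. local_rep A h c w [u, v])"
proof (rule hol_at_cong [OF _ open_overlap [OF A c] z])
  show "hol_on {z} (\<lambda>w. \<Sum>i\<in>UNIV. \<Sum>j\<in>UNIV. dtransition c c' w u $ i * dtransition c c' w v $ j
      * local_rep A h c' (transition c c' w) [axis i 1, axis j 1])"
    by (intro hol_on_sum hol_on_mult hol_on_singletonI [OF transition_component_hol(3) [OF A c] z]
        hol_on_compose(1) [OF transition_derivative(1,3) [OF A c z] hol])
qed (rule two_form_change [OF h c, symmetric])

text \<open>
  At the centre of the chart chosen for a point, the equation \<open>d (h + cnj h) = 0\<close> says that \<open>h\<close> has a complex-linear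
  differential.  Holomorphy in another chart follows, since the components change by holomorphic factors.
\<close>

lemma closed_two_form_hol:
  assumes h: "h \<in> smooth_forms A 2 0" and d: "d_form A (h + cnj_form h) = 0" and c: "c \<in> A"
  shows "hol_on (chart_img c) (\<lambda>z. local_rep A h c z [u, v])"
proof -
  note pq = smooth_formsD(1) [OF h] and sm = smooth_formsD(2) [OF h]
  have center: "hol_on {chart_fun (chart_at A x) x} (\<lambda>w. local_rep A h (chart_at A x) w [v, y])" for x v y
  proof -
    let ?c = "chart_at A x" and ?z = "chart_fun (chart_at A x) x"
    note c = center_in_img(1,2) [of x]
    note o = chart_open(2) [OF A c(1)]
    define H where "H u v w = full_deriv (\<lambda>y. local_rep A h ?c y [v, w]) ?z u" for u v w
    note lp = local_rep_pq(2) [OF A c(1) _ pq]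
    have diff: "(\<lambda>y. local_rep A h ?c y vs) differentiable (at ?z)" for vs by (rule smooth_repD(2) [OF sm c])
    have mult: "full_deriv (\<lambda>y. \<i> * local_rep A h ?c y vs) ?z u = \<i> * full_deriv (\<lambda>y. local_rep A h ?c y vs) ?z u" for vs u
      using full_deriv_linear_comb(2) [OF diff diff, of \<i> vs 0 vs u] by simp
    have "H (\<i> *s u) v w = \<i> * H u v w" for u v w
    proof (rule antiholomorphic_part_zero)
      show "H (- u) v w = - H u v w" for u v w
        unfolding H_def by (rule linear_neg [OF linear_full_deriv [OF diff]])
      show "H u (\<i> *s v) w = \<i> * H u v w" for u v w
        unfolding H_def using full_deriv_cong_open(2) [OF o c(2), of "\<lambda>y. local_rep A h ?c y [\<i> *s v, w]" "\<lambda>y. \<i> * local_rep A h ?c y [v, w]"]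
        by (simp add: pq_2_0_smult [OF lp] mult)
      show "H u v (\<i> *s w) = \<i> * H u v w" for u v w
        unfolding H_def using full_deriv_cong_open(2) [OF o c(2), of "\<lambda>y. local_rep A h ?c y [v, \<i> *s w]" "\<lambda>y. \<i> * local_rep A h ?c y [v, w]"]
        by (simp add: pq_2_0_smult [OF lp] mult)
      show "Re (H u v w - H v u w + H w u v) = 0" for u v w
      proof -
        have three: "d_form A h x [u, v, w] = H u v w - H v u w + H w u v"
          by (simp add: d_form_def form_deriv_def Let_def alternating_deriv_three H_def)
        have "d_form A h + cnj_form (d_form A h) = 0"
          using d d_form_add [OF sm smooth_rep_cnj [OF sm]] d_form_cnj [OF sm] by simp
        then have "d_form A h x [u, v, w] + cnj (d_form A h x [u, v, w]) = 0"
          by (simp add: fun_eq_iff cnj_form_def)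
        then show ?thesis unfolding three by (simp add: complex_eq_iff)
      qed
    qed
    then show ?thesis using diff by (simp add: hol_on_def H_def)
  qed
  show ?thesis
  proof (rule hol_onI)
    fix z assume z: "z \<in> chart_img c"
    have "hol_on {z} (\<lambda>w. local_rep A h c w [u, v])"
    proof (rule hol_two_form_change [OF pq c chart_at(1) [OF A] in_overlap_chart_at [OF A c z]])
      show "hol_on {transition c (chart_at A (chart_inv c z)) z} (\<lambda>w. local_rep A h (chart_at A (chart_inv c z)) w [axis i 1, axis j 1])" for i j
        unfolding transition_center [OF c z] by (rule center)
    qed
    from hol_onD [OF this]
    show "((\<lambda>w. local_rep A h c w [u, v]) has_derivative full_deriv (\<lambda>w. local_rep A h c w [u, v]) z) (at z)"
      "full_deriv (\<lambda>w. local_rep A h c w [u, v]) z (\<i> *s y) = \<i> * full_deriv (\<lambda>w. local_rep A h c w [u, v]) z y" for y by auto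
  qed
qed

end

section \<open>Continuity of the norm density\<close>

lemma positive_form_lower:
  fixes g :: "complex^'n::finite \<Rightarrow> complex^'n \<Rightarrow> real"
  assumes g: "positive_form g"
  obtains \<delta> where "\<delta> > 0" "\<And>v. \<delta> * (norm v)\<^sup>2 \<le> g v v"
proof -
  have hg: "hermitian_form g" and pos: "\<And>v. v \<noteq> 0 \<Longrightarrow> g v v > 0" using g by (auto simp: positive_form_def)
  have bb: "bounded_bilinear g" using hg bilinear_conv_bounded_bilinear by (auto simp: hermitian_form_def)
  have c: "continuous_on (sphere 0 1) (\<lambda>v. g v v)"
    by (rule bounded_bilinear.continuous_on [OF bb continuous_on_id continuous_on_id])
  obtain v1 :: "complex^'n" where "norm v1 = 1" by (rule vector_choose_size [of 1]) auto
  then have "sphere (0 :: complex^'n) 1 \<noteq> {}" by auto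
  then obtain v0 where v0: "v0 \<in> sphere 0 1" "\<And>v. v \<in> sphere 0 1 \<Longrightarrow> g v0 v0 \<le> g v v"
    using continuous_attains_inf [OF compact_sphere _ c] by blast
  show thesis
  proof (rule that)
    show "g v0 v0 > 0" using v0(1) by (intro pos) auto
    show "g v0 v0 * (norm v)\<^sup>2 \<le> g v v" for v
    proof (cases "v = 0")
      case True
      then show ?thesis using linear_0 [OF hermitian_formD(2) [OF hg]] by simp
    next
      case False
      then have "g v0 v0 \<le> g ((1 / norm v) *\<^sub>R v) ((1 / norm v) *\<^sub>R v)" by (intro v0(2)) simp
      also have "\<dots> = g v v / (norm v)\<^sup>2" using False by (simp add: hermitian_linear_simps [OF hg] power2_eq_square)
      finally show ?thesis using False by (simp add: pos_le_divide_eq)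
    qed
  qed
qed

text \<open>
  An explicit constant, continuous in \<open>g\<close>, takes the place of the operator norm.
\<close>

lemma bilinear_norm_bound:
  fixes g :: "complex^'n::finite \<Rightarrow> complex^'n \<Rightarrow> real"
  assumes "bilinear g"
  shows "\<bar>g v v\<bar> \<le> (\<Sum>b\<in>Basis. \<Sum>b'\<in>Basis. \<bar>g b b'\<bar>) * (norm v)\<^sup>2"
proof -
  have l1: "linear (\<lambda>u. g u v)" and l2: "linear (g u)" for u v using assms by (auto simp: bilinear_def)
  have 1: "g v y = (\<Sum>b\<in>Basis. (v \<bullet> b) * g b y)" for y
  proof -
    have "g (\<Sum>b\<in>Basis. (v \<bullet> b) *\<^sub>R b) y = (\<Sum>b\<in>Basis. (v \<bullet> b) * g b y)"
      by (simp only: linear_sum [OF l1] linear_scale [OF l1] real_scaleR_def)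
    then show ?thesis by (simp only: euclidean_representation)
  qed
  have 2: "g b v = (\<Sum>b'\<in>Basis. (v \<bullet> b') * g b b')" for b
  proof -
    have "g b (\<Sum>b'\<in>Basis. (v \<bullet> b') *\<^sub>R b') = (\<Sum>b'\<in>Basis. (v \<bullet> b') * g b b')"
      by (simp only: linear_sum [OF l2] linear_scale [OF l2] real_scaleR_def)
    then show ?thesis by (simp only: euclidean_representation)
  qed
  have "g v v = (\<Sum>b\<in>Basis. \<Sum>b'\<in>Basis. (v \<bullet> b) * ((v \<bullet> b') * g b b'))"
    unfolding 1 [of v] by (intro sum.cong refl) (subst 2, simp only: sum_distrib_left)
  then have "\<bar>g v v\<bar> \<le> (\<Sum>b\<in>Basis. \<bar>\<Sum>b'\<in>Basis. (v \<bullet> b) * ((v \<bullet> b') * g b b')\<bar>)"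
    by (simp only: sum_abs)
  also have "\<dots> \<le> (\<Sum>b\<in>Basis. \<Sum>b'\<in>Basis. \<bar>(v \<bullet> b) * ((v \<bullet> b') * g b b')\<bar>)"
    by (intro sum_mono sum_abs)
  also have "\<dots> \<le> (\<Sum>b\<in>Basis. \<Sum>b'\<in>Basis. \<bar>g b b'\<bar> * (norm v)\<^sup>2)"
  proof (intro sum_mono)
    fix b b' :: "complex^'n" assume "b \<in> Basis" "b' \<in> Basis"
    then have "\<bar>v \<bullet> b\<bar> * \<bar>v \<bullet> b'\<bar> \<le> norm v * norm v" by (intro mult_mono Basis_le_norm) auto
    then have "\<bar>g b b'\<bar> * (\<bar>v \<bullet> b\<bar> * \<bar>v \<bullet> b'\<bar>) \<le> \<bar>g b b'\<bar> * (norm v * norm v)" by (intro mult_left_mono) auto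
    then show "\<bar>(v \<bullet> b) * ((v \<bullet> b') * g b b')\<bar> \<le> \<bar>g b b'\<bar> * (norm v)\<^sup>2"
      by (simp add: abs_mult power2_eq_square mult_ac)
  qed
  finally show ?thesis by (simp add: sum_distrib_right)
qed

lemma hermitian_form_bilinear: "hermitian_form g \<Longrightarrow> bilinear g"
  by (simp add: hermitian_form_def)

lemma continuous_riem:
  assumes "\<And>vs. continuous_on S (\<lambda>z. w z vs)" shows "continuous_on S (\<lambda>z. riem (w z) u v)"
  unfolding riem_def by (intro continuous_intros assms)

text \<open>
  Nearby metrics are close relative to each other, uniformly in the vector.
\<close>

lemma eventually_riem_close:
  fixes w :: "'z::topological_space \<Rightarrow> 'n::finite covector"
  assumes w: "\<And>z. z \<in> S \<Longrightarrow> metric_covector (w z)" and cont: "\<And>vs. continuous_on S (\<lambda>z. w z vs)"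
    and z0: "z0 \<in> S" and e: "e > 0"
  shows "\<forall>\<^sub>F z in at z0 within S. \<forall>v. (1 - e) * riem (w z0) v v \<le> riem (w z) v v \<and> riem (w z) v v \<le> (1 + e) * riem (w z0) v v"
proof -
  obtain \<delta> where \<delta>: "\<delta> > 0" "\<And>v. \<delta> * (norm v)\<^sup>2 \<le> riem (w z0) v v"
    by (rule positive_form_lower [OF metric_covectorD(1) [OF w [OF z0]]]) (rule that)
  define D where "D z = (\<Sum>b\<in>Basis. \<Sum>b'\<in>Basis. \<bar>riem (w z) b b' - riem (w z0) b b'\<bar>)" for z
  have "continuous_on S D" unfolding D_def by (intro continuous_intros continuous_riem cont)
  then have "(D \<longlongrightarrow> D z0) (at z0 within S)" using z0 by (simp add: continuous_on_def)
  then have "(D \<longlongrightarrow> 0) (at z0 within S)" by (simp add: D_def)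
  then have "\<forall>\<^sub>F z in at z0 within S. D z < e * \<delta>" using e \<delta>(1) by (intro order_tendstoD(2)) auto
  moreover have "\<forall>\<^sub>F z in at z0 within S. z \<in> S" by (simp add: eventually_at_filter)
  ultimately show ?thesis
  proof eventually_elim
    case (elim z)
    show ?case
    proof
      fix v
      note B = hermitian_form_bilinear [OF metric_covectorD(2) [OF w]]
      have "bilinear (\<lambda>u v. riem (w z) u v - riem (w z0) u v)"
        using B [OF elim(2)] B [OF z0] by (auto simp: bilinear_def intro: linear_compose_sub)
      from bilinear_norm_bound [OF this, of v] have "\<bar>riem (w z) v v - riem (w z0) v v\<bar> \<le> D z * (norm v)\<^sup>2"
        by (simp add: D_def)
      also have "\<dots> \<le> e * \<delta> * (norm v)\<^sup>2" using elim(1) by (intro mult_right_mono) auto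
      also have "\<dots> \<le> e * riem (w z0) v v" using \<delta>(2) [of v] e by (simp add: mult.assoc)
      finally show "(1 - e) * riem (w z0) v v \<le> riem (w z) v v \<and> riem (w z) v v \<le> (1 + e) * riem (w z0) v v"
        by (simp add: algebra_simps abs_le_iff)
    qed
  qed
qed

lemma riem_scale: "riem (\<lambda>vs. of_real c * w vs) u v = c * riem w u v"
  by (simp add: riem_def)

text \<open>
  Near \<open>z0\<close> the metric \<open>w z\<close> lies between \<open>(1 - t) w z0\<close> and \<open>(1 + t) w z0\<close>.  By monotonicity the density of \<open>a z\<close> lies
  between the densities for these two multiples of a fixed metric, which are continuous in \<open>z\<close>.  This avoids any
  continuous choice of orthonormal bases.
\<close>

lemma continuous_on_norm_density:
  fixes w a :: "'z::topological_space \<Rightarrow> 'n::finite covector"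
  assumes w: "\<And>z. z \<in> S \<Longrightarrow> metric_covector (w z)" and cw: "\<And>vs. continuous_on S (\<lambda>z. w z vs)"
    and a: "\<And>z. z \<in> S \<Longrightarrow> a z \<in> pq_covectors 2 0" and ca: "\<And>vs. continuous_on S (\<lambda>z. a z vs)"
  shows "continuous_on S (\<lambda>z. norm_density (w z) (a z))"
  unfolding continuous_on_def
proof
  fix z0 assume z0: "z0 \<in> S"
  note w0 = w [OF z0]
  define N where "N z = norm_density (w z0) (a z)" for z
  define g where "g c = c ^ CARD('n) / c\<^sup>2" for c :: real
  obtain e where e: "unitary_frame (riem (w z0)) e" by (rule unitary_frame_exists [OF metric_covectorD(1) [OF w0]])
  have N_eq: "N z = 2 * (\<Sum>j\<in>UNIV. \<Sum>k\<in>UNIV. (cmod (a z [e j, e k]))\<^sup>2) * Re (volume_covector (w z0) canonical_frame)"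
    if "z \<in> S" for z
    by (simp add: N_def norm_density_def covector_norm_unitary [OF w0 e a [OF that]])
  have "continuous_on S (\<lambda>z. 2 * (\<Sum>j\<in>UNIV. \<Sum>k\<in>UNIV. (cmod (a z [e j, e k]))\<^sup>2) * Re (volume_covector (w z0) canonical_frame))"
    by (intro continuous_intros ca)
  then have "continuous_on S N" by (rule continuous_on_eq) (simp add: N_eq)
  then have Nlim: "(N \<longlongrightarrow> N z0) (at z0 within S)" using z0 by (simp add: continuous_on_def)
  have inS: "\<forall>\<^sub>F z in at z0 within S. z \<in> S" by (simp add: eventually_at_filter)
  have close: "\<forall>\<^sub>F z in at z0 within S. \<forall>v. (1 - t) * riem (w z0) v v \<le> riem (w z) v v \<and> riem (w z) v v \<le> (1 + t) * riem (w z0) v v"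
    if "0 < t" for t
    by (rule eventually_riem_close [OF w cw z0 that])
  have lower: "\<forall>\<^sub>F z in at z0 within S. g (1 - t) * N z \<le> norm_density (w z) (a z)" if t: "0 < t" "t < 1" for t
    using close [OF t(1)] inS
  proof eventually_elim
    case (elim z)
    have "g (1 - t) * N z = norm_density (\<lambda>vs. of_real (1 - t) * w z0 vs) (a z)"
      using norm_density_scale [OF w0 _ a [OF elim(2)], of "1 - t"] t by (simp add: g_def N_def)
    also have "\<dots> \<le> norm_density (w z) (a z)"
    proof (rule norm_density_mono [OF w [OF elim(2)] metric_covector_scale [OF w0] _ a [OF elim(2)]])
      show "riem (\<lambda>vs. of_real (1 - t) * w z0 vs) v v \<le> riem (w z) v v" for v
        unfolding riem_scale using elim(1) by blast
    qed (use t in simp)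
    finally show ?case .
  qed
  have upper: "\<forall>\<^sub>F z in at z0 within S. norm_density (w z) (a z) \<le> g (1 + t) * N z" if t: "0 < t" for t
    using close [OF t] inS
  proof eventually_elim
    case (elim z)
    have "norm_density (w z) (a z) \<le> norm_density (\<lambda>vs. of_real (1 + t) * w z0 vs) (a z)"
    proof (rule norm_density_mono [OF metric_covector_scale [OF w0] w [OF elim(2)] _ a [OF elim(2)]])
      show "riem (w z) v v \<le> riem (\<lambda>vs. of_real (1 + t) * w z0 vs) v v" for v
        unfolding riem_scale using elim(1) by blast
    qed (use t in simp)
    also have "\<dots> = g (1 + t) * N z"
      using norm_density_scale [OF w0 _ a [OF elim(2)], of "1 + t"] t by (simp add: g_def N_def)
    finally show ?case .
  qed
  have glim: "((\<lambda>t. g (1 - t) * N z0) \<longlongrightarrow> N z0) (at_right 0)" "((\<lambda>t. g (1 + t) * N z0) \<longlongrightarrow> N z0) (at_right 0)"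
  proof -
    have g1: "isCont g 1" unfolding g_def by (intro continuous_intros) simp
    have "((\<lambda>t. 1 - t) \<longlongrightarrow> 1 - 0) (at_right (0::real))" "((\<lambda>t. 1 + t) \<longlongrightarrow> 1 + 0) (at_right (0::real))"
      by (intro tendsto_intros)+
    then have "((\<lambda>t. g (1 - t)) \<longlongrightarrow> g 1) (at_right 0)" "((\<lambda>t. g (1 + t)) \<longlongrightarrow> g 1) (at_right 0)"
      using isCont_tendsto_compose [OF g1] by simp_all
    then have "((\<lambda>t. g (1 - t) * N z0) \<longlongrightarrow> g 1 * N z0) (at_right 0)" "((\<lambda>t. g (1 + t) * N z0) \<longlongrightarrow> g 1 * N z0) (at_right 0)"
      by (auto intro!: tendsto_mult_right)
    then show "((\<lambda>t. g (1 - t) * N z0) \<longlongrightarrow> N z0) (at_right 0)" "((\<lambda>t. g (1 + t) * N z0) \<longlongrightarrow> N z0) (at_right 0)"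
      by (simp_all add: g_def)
  qed
  have small: "\<forall>\<^sub>F t in at_right (0::real). 0 < t \<and> t < 1"
    unfolding eventually_at_right_field by (intro exI [of _ 1]) auto
  have "((\<lambda>z. norm_density (w z) (a z)) \<longlongrightarrow> N z0) (at z0 within S)"
  proof (rule order_tendstoI)
    fix l assume "l < N z0"
    then have "\<forall>\<^sub>F t in at_right 0. l < g (1 - t) * N z0" using glim(1) by (intro order_tendstoD(1))
    then have "\<forall>\<^sub>F t in at_right 0. l < g (1 - t) * N z0 \<and> 0 < t \<and> t < 1" using small by (rule eventually_conj)
    from eventually_happens' [OF trivial_limit_at_right_real this]
    obtain t where t: "l < g (1 - t) * N z0" "0 < t" "t < 1" by auto
    have "((\<lambda>z. g (1 - t) * N z) \<longlongrightarrow> g (1 - t) * N z0) (at z0 within S)" by (intro tendsto_intros Nlim)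
    then have "\<forall>\<^sub>F z in at z0 within S. l < g (1 - t) * N z" using t(1) by (rule order_tendstoD(1))
    then show "\<forall>\<^sub>F z in at z0 within S. l < norm_density (w z) (a z)"
      using lower [OF t(2,3)] by eventually_elim linarith
  next
    fix l assume "N z0 < l"
    then have "\<forall>\<^sub>F t in at_right 0. g (1 + t) * N z0 < l" using glim(2) by (intro order_tendstoD(2))
    then have "\<forall>\<^sub>F t in at_right 0. g (1 + t) * N z0 < l \<and> 0 < t \<and> t < 1" using small by (rule eventually_conj)
    from eventually_happens' [OF trivial_limit_at_right_real this]
    obtain t where t: "g (1 + t) * N z0 < l" "0 < t" by auto
    have "((\<lambda>z. g (1 + t) * N z) \<longlongrightarrow> g (1 + t) * N z0) (at z0 within S)" by (intro tendsto_intros Nlim)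
    then have "\<forall>\<^sub>F z in at z0 within S. g (1 + t) * N z < l" using t(1) by (rule order_tendstoD(2))
    then show "\<forall>\<^sub>F z in at z0 within S. norm_density (w z) (a z) < l"
      using upper [OF t(2)] by eventually_elim linarith
  qed
  then show "((\<lambda>z. norm_density (w z) (a z)) \<longlongrightarrow> norm_density (w z0) (a z0)) (at z0 within S)"
    by (simp add: N_def)
qed

lemma metric_local_lower:
  fixes w :: "complex^'k::finite \<Rightarrow> 'n::finite covector"
  assumes S: "open S" and w: "\<And>z. z \<in> S \<Longrightarrow> metric_covector (w z)" and cont: "\<And>vs. continuous_on S (\<lambda>z. w z vs)"
    and z0: "z0 \<in> S"
  obtains \<delta> r where "\<delta> > 0" "r > 0" "ball z0 r \<subseteq> S" "\<And>z v. z \<in> ball z0 r \<Longrightarrow> \<delta> * (norm v)\<^sup>2 \<le> riem (w z) v v"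
proof -
  obtain \<delta> where \<delta>: "\<delta> > 0" "\<And>v. \<delta> * (norm v)\<^sup>2 \<le> riem (w z0) v v"
    by (rule positive_form_lower [OF metric_covectorD(1) [OF w [OF z0]]]) (rule that)
  have "\<forall>\<^sub>F z in at z0 within S. \<forall>v. (1 - 1/2) * riem (w z0) v v \<le> riem (w z) v v \<and> riem (w z) v v \<le> (1 + 1/2) * riem (w z0) v v"
    by (rule eventually_riem_close [OF w cont z0]) simp_all
  then obtain d where d: "d > 0" "\<And>z v. z \<in> S \<Longrightarrow> z \<noteq> z0 \<Longrightarrow> dist z z0 < d \<Longrightarrow> (1/2) * riem (w z0) v v \<le> riem (w z) v v"
    unfolding eventually_at by fastforce
  obtain r where r: "r > 0" "ball z0 r \<subseteq> S" using S z0 openE by blast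
  show thesis
  proof (rule that [of "\<delta> / 2" "min d r"])
    show "\<delta> / 2 * (norm v)\<^sup>2 \<le> riem (w z) v v" if "z \<in> ball z0 (min d r)" for z v
    proof (cases "z = z0")
      case True
      have "0 \<le> \<delta> * (norm v)\<^sup>2" using \<delta>(1) by simp
      then show ?thesis using \<delta>(2) [of v] True by simp
    next
      case False
      have "(1/2) * riem (w z0) v v \<le> riem (w z) v v" by (rule d(2)) (use that False r in \<open>auto simp: dist_commute\<close>)
      then show ?thesis using \<delta>(2) [of v] by simp
    qed
  qed (use \<delta> d r in auto)
qed

text \<open>
  Comparison with the multiple \<open>\<delta>\<close> of the Euclidean metric.
\<close>

lemma norm_density_lower:
  assumes w: "metric_covector w" and \<delta>: "\<delta> > 0" "\<And>v. \<delta> * (norm v)\<^sup>2 \<le> riem w v v" and a: "a \<in> pq_covectors 2 0"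
  shows "\<delta> ^ CARD('n) / \<delta>\<^sup>2 * 2 * (cmod (a [axis i 1, axis j 1]))\<^sup>2 \<le> norm_density (w :: 'n::finite covector) a"
proof -
  have "(cmod (a [axis i 1, axis j 1]))\<^sup>2 \<le> (\<Sum>j\<in>UNIV. (cmod (a [axis i 1, axis j 1]))\<^sup>2)"
    by (rule member_le_sum) auto
  also have "\<dots> \<le> (\<Sum>i\<in>UNIV. \<Sum>j\<in>UNIV. (cmod (a [axis i 1, axis j 1]))\<^sup>2)"
    by (rule member_le_sum [where f = "\<lambda>i. \<Sum>j\<in>UNIV. (cmod (a [axis i 1, axis j 1]))\<^sup>2"]) (auto intro: sum_nonneg)
  finally have "\<delta> ^ CARD('n) / \<delta>\<^sup>2 * 2 * (cmod (a [axis i 1, axis j 1]))\<^sup>2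
     \<le> \<delta> ^ CARD('n) / \<delta>\<^sup>2 * 2 * (\<Sum>i\<in>UNIV. \<Sum>j\<in>UNIV. (cmod (a [axis i 1, axis j 1]))\<^sup>2)"
    using \<delta>(1) by (intro mult_left_mono) auto
  also have "\<dots> = norm_density (\<lambda>vs. of_real \<delta> * std_covector vs) a"
    unfolding norm_density_scale [OF std_covector_metric \<delta>(1) a] norm_density_std [OF a] by simp
  also have "\<dots> \<le> norm_density w a"
  proof (rule norm_density_mono [OF w metric_covector_scale [OF std_covector_metric \<delta>(1)] _ a])
    show "riem (\<lambda>vs. of_real \<delta> * std_covector vs) v v \<le> riem w v v" for v
      unfolding riem_scale std_covector_riem using \<delta>(2) [of v] by (simp only: power2_norm_eq_inner)
  qed
  finally show ?thesis .
qed

lemma norm_density_parallelogram: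
  assumes w: "metric_covector w" and a: "a \<in> pq_covectors 2 0" and b: "b \<in> pq_covectors 2 0"
  shows "norm_density w (\<lambda>vs. a vs - b vs) = 2 * norm_density w a + 2 * norm_density w b
    - 4 * norm_density w (\<lambda>vs. a vs / 2 + b vs / 2)"
proof -
  obtain e where e: "unitary_frame (riem w) e" by (rule unitary_frame_exists [OF metric_covectorD(1) [OF w]])
  have d: "(\<lambda>vs. a vs - b vs) \<in> pq_covectors 2 0" "(\<lambda>vs. a vs / 2 + b vs / 2) \<in> pq_covectors 2 0"
    using a b alternating_combine [of a b 1 1] alternating_combine [of a b "1/2" "-1/2"]
    unfolding pq_2_0_iff by (auto simp: algebra_simps)
  have P: "(cmod (x - y))\<^sup>2 = 2 * (cmod x)\<^sup>2 + 2 * (cmod y)\<^sup>2 - 4 * (cmod (x / 2 + y / 2))\<^sup>2" for x y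
    unfolding cmod_power2 by (simp add: power2_eq_square field_simps)
  have S: "(\<Sum>j\<in>UNIV. \<Sum>k\<in>UNIV. (cmod (a [e j, e k] - b [e j, e k]))\<^sup>2)
      = 2 * (\<Sum>j\<in>UNIV. \<Sum>k\<in>UNIV. (cmod (a [e j, e k]))\<^sup>2) + 2 * (\<Sum>j\<in>UNIV. \<Sum>k\<in>UNIV. (cmod (b [e j, e k]))\<^sup>2)
        - 4 * (\<Sum>j\<in>UNIV. \<Sum>k\<in>UNIV. (cmod (a [e j, e k] / 2 + b [e j, e k] / 2))\<^sup>2)"
    by (simp only: P sum.distrib sum_subtractf sum_distrib_left)
  show ?thesis
    unfolding norm_density_def covector_norm_unitary [OF w e a] covector_norm_unitary [OF w e b]
      covector_norm_unitary [OF w e d(1)] covector_norm_unitary [OF w e d(2)] S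
    by (simp add: algebra_simps)
qed

lemma norm_density_real_scale:
  assumes w: "metric_covector w" and a: "a \<in> pq_covectors 2 0"
  shows "norm_density w (\<lambda>vs. of_real c * a vs) = c\<^sup>2 * norm_density w a"
proof -
  obtain e where e: "unitary_frame (riem w) e" by (rule unitary_frame_exists [OF metric_covectorD(1) [OF w]])
  have d: "(\<lambda>vs. of_real c * a vs) \<in> pq_covectors 2 0"
    using a unfolding pq_2_0_iff by (auto intro!: alternating_scale)
  show ?thesis
    unfolding norm_density_def covector_norm_unitary [OF w e a] covector_norm_unitary [OF w e d]
    by (simp add: norm_mult power_mult_distrib flip: sum_distrib_left)
qed

lemma norm_density_tendsto:
  assumes w: "metric_covector w" and a: "\<And>k. a k \<in> pq_covectors 2 0" and b: "b \<in> pq_covectors 2 0"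
    and lim: "\<And>vs. (\<lambda>k. a k vs) \<longlonglongrightarrow> b vs"
  shows "(\<lambda>k. norm_density w (a k)) \<longlonglongrightarrow> norm_density w b"
proof -
  obtain e where e: "unitary_frame (riem w) e" by (rule unitary_frame_exists [OF metric_covectorD(1) [OF w]])
  show ?thesis
    unfolding norm_density_def covector_norm_unitary [OF w e a] covector_norm_unitary [OF w e b]
    by (intro tendsto_intros lim)
qed

section \<open>Limits of covectors and integrals\<close>

lemma real_fatou:
  fixes f :: "nat \<Rightarrow> 'a \<Rightarrow> real"
  assumes f: "\<And>k. integrable M (f k)" "\<And>k x. 0 \<le> f k x" and g: "integrable M g"
    and lim: "\<And>x. (\<lambda>k. f k x) \<longlonglongrightarrow> g x" and m: "(\<lambda>k. \<integral>x. f k x \<partial>M) \<longlonglongrightarrow> m"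
  shows "(\<integral>x. g x \<partial>M) \<le> m"
proof -
  have g0: "0 \<le> g x" for x using LIMSEQ_le_const [OF lim] f(2) by blast
  have m0: "0 \<le> m" using LIMSEQ_le_const [OF m] f(2) by (meson Bochner_Integration.integral_nonneg)
  have "ennreal (\<integral>x. g x \<partial>M) = (\<integral>\<^sup>+x. ennreal (g x) \<partial>M)"
    using nn_integral_eq_integral [OF g] g0 by simp
  also have "\<dots> = (\<integral>\<^sup>+x. liminf (\<lambda>k. ennreal (f k x)) \<partial>M)"
  proof (rule nn_integral_cong)
    fix x
    have "(\<lambda>k. ennreal (f k x)) \<longlonglongrightarrow> ennreal (g x)" using lim by (rule tendsto_ennrealI)
    then show "ennreal (g x) = liminf (\<lambda>k. ennreal (f k x))" by (simp add: lim_imp_Liminf)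
  qed
  also have "\<dots> \<le> liminf (\<lambda>k. \<integral>\<^sup>+x. ennreal (f k x) \<partial>M)"
    by (rule nn_integral_liminf) (use f(1) in auto)
  also have "\<dots> = liminf (\<lambda>k. ennreal (\<integral>x. f k x \<partial>M))"
    using nn_integral_eq_integral [OF f(1)] f(2) by simp
  also have "\<dots> = ennreal m"
    using tendsto_ennrealI [OF m] by (simp add: lim_imp_Liminf)
  finally show ?thesis using m0 by (simp add: ennreal_le_iff)
qed

lemma alternating_limit:
  fixes a :: "nat \<Rightarrow> 'n::finite covector"
  assumes a: "\<And>k. alternating (a k)" and lim: "\<And>vs. (\<lambda>k. a k vs) \<longlonglongrightarrow> b vs"
  shows "alternating b"
proof -
  have "b (xs @ (u + v) # ys) = b (xs @ u # ys) + b (xs @ v # ys)" for xs u v ys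
  proof (rule LIMSEQ_unique [OF lim])
    show "(\<lambda>k. a k (xs @ (u + v) # ys)) \<longlonglongrightarrow> b (xs @ u # ys) + b (xs @ v # ys)"
      unfolding alternatingD(1) [OF a] by (intro tendsto_intros lim)
  qed
  moreover have "b (xs @ (r *\<^sub>R u) # ys) = of_real r * b (xs @ u # ys)" for xs r u ys
  proof (rule LIMSEQ_unique [OF lim])
    show "(\<lambda>k. a k (xs @ (r *\<^sub>R u) # ys)) \<longlonglongrightarrow> of_real r * b (xs @ u # ys)"
      unfolding alternatingD(2) [OF a] by (intro tendsto_intros lim)
  qed
  moreover have "b (xs @ u # u # ys) = 0" for xs u ys
    using lim [of "xs @ u # u # ys"] unfolding alternatingD(3) [OF a] by (simp add: LIMSEQ_const_iff)
  ultimately show ?thesis by (simp add: alternating_def)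
qed

lemma pq_2_0_limit:
  assumes a: "\<And>k. a k \<in> pq_covectors 2 0" and lim: "\<And>vs. (\<lambda>k. a k vs) \<longlonglongrightarrow> b vs"
  shows "b \<in> pq_covectors 2 0"
proof -
  have "alternating b" by (rule alternating_limit [OF _ lim]) (use a pq_2_0_iff in blast)
  moreover have "b xs = 0" if "length xs \<noteq> 2" for xs
  proof -
    have "a k xs = 0" for k using a [of k] that pq_2_0_iff by blast
    then show ?thesis using lim [of xs] by (simp add: LIMSEQ_const_iff)
  qed
  moreover have "b [\<i> *s u, v] = \<i> * b [u, v]" for u v
  proof (rule LIMSEQ_unique [OF lim])
    show "(\<lambda>k. a k [\<i> *s u, v]) \<longlonglongrightarrow> \<i> * b [u, v]"
      unfolding pq_2_0_smult(1) [OF a] by (intro tendsto_intros lim)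
  qed
  ultimately show ?thesis unfolding pq_2_0_iff by blast
qed

section \<open>The L2 norm as one integral\<close>

text \<open>
  Pull back a bump function on a ball around each point, choose finitely many bumps whose sum is positive,
  collect those that belong to the same chart, and divide by the sum.
\<close>

lemma partition_of_unity_exists:
  fixes A :: "('m::t2_space, 'n::finite) chart set"
  assumes M: "compact_complex_manifold A"
  shows "\<exists>C \<eta>. partition_of_unity A C \<eta>"
proof -
  have A: "complex_atlas A" and cpt: "compact (UNIV :: 'm set)" using M by (auto simp: compact_complex_manifold_def)
  have "\<exists>b :: 'm \<Rightarrow> real. continuous_on UNIV b \<and> (\<forall>y. 0 \<le> b y) \<and> b x > 0 \<and> closure {y. b y \<noteq> 0} \<subseteq> chart_dom (chart_at A x)" for x
  proof -
    let ?c = "chart_at A x"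
    let ?z = "chart_fun ?c x"
    have c: "?c \<in> A" "x \<in> chart_dom ?c" by (rule chart_at [OF A])+
    note ci = chart_inverse [OF A c(1)]
    have "?z \<in> chart_img ?c" using ci c by blast
    then obtain r where r: "r > 0" "cball ?z r \<subseteq> chart_img ?c"
      using chart_open(2) [OF A c(1)] open_contains_cball by blast
    define K where "K = chart_inv ?c ` cball ?z r"
    have "compact K" unfolding K_def
      by (rule compact_continuous_image [OF continuous_on_subset [OF ci(6) r(2)] compact_cball])
    then have clK: "closed K" by (rule compact_imp_closed)
    have KU: "K \<subseteq> chart_dom ?c" using r(2) ci(4) by (auto simp: K_def)
    define b where "b y = (if y \<in> chart_dom ?c then max 0 (r - dist (chart_fun ?c y) ?z) else 0)" for y
    have bK: "b y = 0" if "y \<notin> K" for y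
    proof (cases "y \<in> chart_dom ?c \<and> dist (chart_fun ?c y) ?z \<le> r")
      case True
      then have "y = chart_inv ?c (chart_fun ?c y)" "chart_fun ?c y \<in> cball ?z r" using ci by (auto simp: dist_commute)
      then show ?thesis using that unfolding K_def by blast
    qed (auto simp: b_def)
    have "continuous_on (chart_dom ?c \<union> - K) b"
    proof (rule continuous_on_open_Un)
      have "continuous_on (chart_dom ?c) (\<lambda>y. max 0 (r - dist (chart_fun ?c y) ?z))"
        by (intro continuous_intros ci(5))
      then show "continuous_on (chart_dom ?c) b" by (rule continuous_on_eq) (simp add: b_def)
      show "continuous_on (- K) b" using bK by (subst continuous_on_cong [OF refl, of _ _ "\<lambda>_. 0"]) auto
    qed (use chart_open(1) [OF A c(1)] clK in auto)
    moreover have "chart_dom ?c \<union> - K = UNIV" using KU by auto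
    ultimately have "continuous_on UNIV b" by simp
    moreover have "0 \<le> b y" for y by (simp add: b_def)
    moreover have "b x > 0" using c r by (simp add: b_def)
    moreover have "closure {y. b y \<noteq> 0} \<subseteq> chart_dom ?c"
    proof -
      have "closure {y. b y \<noteq> 0} \<subseteq> K" by (rule closure_minimal [OF _ clK]) (use bK in auto)
      then show ?thesis using KU by blast
    qed
    ultimately show ?thesis by blast
  qed
  then obtain b :: "'m \<Rightarrow> 'm \<Rightarrow> real" where b: "\<And>x. continuous_on UNIV (b x)" "\<And>x y. 0 \<le> b x y" "\<And>x. b x x > 0"
    "\<And>x. closure {y. b x y \<noteq> 0} \<subseteq> chart_dom (chart_at A x)" by metis
  have op: "open {y. 0 < b x y}" for x
    by (rule open_Collect_less [OF continuous_on_const b(1)])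
  have "UNIV \<subseteq> (\<Union>x\<in>UNIV. {y. 0 < b x y})" using b(3) by blast
  then obtain X where X: "finite X" "UNIV \<subseteq> (\<Union>x\<in>X. {y. 0 < b x y})"
    using compactE_image [OF cpt, of UNIV "\<lambda>x. {y. 0 < b x y}"] op by (metis subset_UNIV)
  \<comment> \<open>Each bump is positive at its centre, so finitely many of them have a positive sum everywhere.\<close>
  define T where "T y = (\<Sum>x\<in>X. b x y)" for y
  have T: "T y > 0" for y
  proof -
    obtain x where "x \<in> X" "0 < b x y" using X(2) by blast
    then show ?thesis unfolding T_def using X(1) b(2) by (intro sum_pos2) auto
  qed
  have Tne: "(\<Sum>x\<in>X. b x y) \<noteq> 0" for y using T [of y] by (simp add: T_def)
  define \<eta> where "\<eta> c y = (\<Sum>x\<in>{x\<in>X. chart_at A x = c}. b x y) / T y" for c y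
  have "partition_of_unity A (chart_at A ` X) \<eta>"
    unfolding partition_of_unity_def
  proof (intro conjI ballI allI)
    show "finite (chart_at A ` X)" using X by simp
    show "chart_at A ` X \<subseteq> A" using chart_at(1) [OF A] by blast
    show "continuous_on UNIV (\<eta> c)" for c
      unfolding \<eta>_def T_def by (intro continuous_intros b(1)) (use Tne in blast)
    show "0 \<le> \<eta> c y" for c y unfolding \<eta>_def using T [of y] b(2) by (intro divide_nonneg_pos sum_nonneg)
    show "closure {y. \<eta> c y \<noteq> 0} \<subseteq> chart_dom c" for c
    proof -
      have "closure {y. \<eta> c y \<noteq> 0} \<subseteq> (\<Union>x\<in>{x\<in>X. chart_at A x = c}. closure {y. b x y \<noteq> 0})"
      proof (rule closure_minimal)
        show "{y. \<eta> c y \<noteq> 0} \<subseteq> (\<Union>x\<in>{x\<in>X. chart_at A x = c}. closure {y. b x y \<noteq> 0})"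
        proof
          fix y assume "y \<in> {y. \<eta> c y \<noteq> 0}"
          then have "(\<Sum>x\<in>{x\<in>X. chart_at A x = c}. b x y) \<noteq> 0" by (auto simp: \<eta>_def)
          then obtain x where "x \<in> {x\<in>X. chart_at A x = c}" "b x y \<noteq> 0" by (rule sum.not_neutral_contains_not_neutral)
          then show "y \<in> (\<Union>x\<in>{x\<in>X. chart_at A x = c}. closure {y. b x y \<noteq> 0})"
            using closure_subset [of "{y. b x y \<noteq> 0}"] by blast
        qed
        show "closed (\<Union>x\<in>{x\<in>X. chart_at A x = c}. closure {y. b x y \<noteq> 0})" using X(1) by (intro closed_UN) auto
      qed
      also have "\<dots> \<subseteq> chart_dom c" using b(4) by blast
      finally show ?thesis .
    qed
    show "(\<Sum>c\<in>chart_at A ` X. \<eta> c y) = 1" for y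
    proof -
      have "(\<Sum>c\<in>chart_at A ` X. \<eta> c y) = (\<Sum>c\<in>chart_at A ` X. \<Sum>x\<in>{x\<in>X. chart_at A x = c}. b x y) / T y"
        by (simp add: \<eta>_def sum_divide_distrib)
      also have "(\<Sum>c\<in>chart_at A ` X. \<Sum>x\<in>{x\<in>X. chart_at A x = c}. b x y) = T y"
        unfolding T_def by (rule sum.image_gen [OF X(1), symmetric])
      finally show ?thesis using T [of y] by simp
    qed
  qed
  then show ?thesis by blast
qed

text \<open>
  The choice made in the definition of the integral of a form.
\<close>

definition pou :: "('m::topological_space, 'n) chart set \<Rightarrow> ('m, 'n) chart set \<times> (('m, 'n) chart \<Rightarrow> 'm \<Rightarrow> real)" where
  "pou A = (SOME (C, \<eta>). partition_of_unity A C \<eta>)"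

text \<open>
  The integrand of the squared norm: the contributions of the charts, extended by 0, are added up on
  \<open>\<complex>\<^sup>n\<close>, so that limits and inequalities concern a single integral.
\<close>

definition norm_integrand ::
  "('m::topological_space, 'n::finite) chart set \<Rightarrow> ('m, 'n) form \<Rightarrow> ('m, 'n) form \<Rightarrow> complex^'n \<Rightarrow> real" where
  "norm_integrand A \<omega> \<alpha> z = (\<Sum>c\<in>fst (pou A). indicator (chart_img c) z *
      (snd (pou A) c (chart_inv c z) * norm_density (local_rep A \<omega> c z) (local_rep A \<alpha> c z)))"

definition sq_norm ::
  "('m::topological_space, 'n::finite) chart set \<Rightarrow> ('m, 'n) form \<Rightarrow> ('m, 'n) form \<Rightarrow> real" where
  "sq_norm A \<omega> \<alpha> = (\<integral>z. norm_integrand A \<omega> \<alpha> z \<partial>lborel)"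

context
  fixes A :: "('m::t2_space, 'n::finite) chart set"
  assumes M: "compact_complex_manifold A"
begin

lemma atlas: "complex_atlas A" using M by (simp add: compact_complex_manifold_def)

lemma pou: "partition_of_unity A (fst (pou A)) (snd (pou A))"
proof -
  have "\<exists>p. case p of (C, \<eta>) \<Rightarrow> partition_of_unity A C \<eta>" using partition_of_unity_exists [OF M] by auto
  then have "case pou A of (C, \<eta>) \<Rightarrow> partition_of_unity A C \<eta>" unfolding pou_def by (rule someI_ex)
  then show ?thesis by (simp add: case_prod_unfold)
qed

lemma pouD:
  "finite (fst (pou A))" "c \<in> fst (pou A) \<Longrightarrow> c \<in> A" "c \<in> fst (pou A) \<Longrightarrow> continuous_on UNIV (snd (pou A) c)"
  "c \<in> fst (pou A) \<Longrightarrow> 0 \<le> snd (pou A) c x" "c \<in> fst (pou A) \<Longrightarrow> closure {x. snd (pou A) c x \<noteq> 0} \<subseteq> chart_dom c"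
  "(\<Sum>c\<in>fst (pou A). snd (pou A) c x) = 1"
  using pou unfolding partition_of_unity_def by auto

lemma local_rep_metric:
  assumes "\<And>x. metric_covector (\<omega> x)" "c \<in> A" "z \<in> chart_img c"
  shows "metric_covector (local_rep A \<omega> c z)"
  by (rule local_rep_pq(4) [OF atlas assms(2,3,1)])

lemma local_rep_2_0:
  assumes "\<And>x. \<alpha> x \<in> pq_covectors 2 0" "c \<in> A" "z \<in> chart_img c"
  shows "local_rep A \<alpha> c z \<in> pq_covectors 2 0"
  by (rule local_rep_pq(2) [OF atlas assms(2,3,1)])

lemma norm_integrand_nonneg:
  assumes \<omega>: "\<And>x. metric_covector (\<omega> x)"
  shows "0 \<le> norm_integrand A \<omega> \<alpha> z"
  unfolding norm_integrand_def
proof (rule sum_nonneg)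
  fix c assume c: "c \<in> fst (pou A)"
  show "0 \<le> indicator (chart_img c) z * (snd (pou A) c (chart_inv c z) * norm_density (local_rep A \<omega> c z) (local_rep A \<alpha> c z))"
  proof (cases "z \<in> chart_img c")
    case True
    then show ?thesis using pouD(4) [OF c] norm_density_nonneg [OF local_rep_metric [OF \<omega> pouD(2) [OF c] True]] by simp
  qed simp
qed

lemma norm_integrand_term_integrable:
  assumes \<omega>: "\<And>x. metric_covector (\<omega> x)" "smooth_rep A \<omega>"
    and \<alpha>: "\<And>x. \<alpha> x \<in> pq_covectors 2 0" "smooth_rep A \<alpha>" and c: "c \<in> fst (pou A)"
  shows "integrable lborel (\<lambda>z. indicator (chart_img c) z *
      (snd (pou A) c (chart_inv c z) * norm_density (local_rep A \<omega> c z) (local_rep A \<alpha> c z)))"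
proof -
  note cA = pouD(2) [OF c]
  note ci = chart_inverse [OF atlas cA]
  let ?f = "\<lambda>z. snd (pou A) c (chart_inv c z) * norm_density (local_rep A \<omega> c z) (local_rep A \<alpha> c z)"
  have co: "continuous_on (chart_img c) (\<lambda>z. local_rep A \<beta> c z vs)" if "smooth_rep A \<beta>" for \<beta> vs
    by (rule smooth_onD(1) [OF smooth_repD(1) [OF atlas that cA]])
  have cf: "continuous_on (chart_img c) ?f"
    by (intro continuous_on_mult continuous_on_norm_density co \<omega>(2) \<alpha>(2) local_rep_metric [OF \<omega>(1) cA] local_rep_2_0 [OF \<alpha>(1) cA])
      (auto intro: continuous_on_compose2 [OF pouD(3) [OF c] ci(6)])
  define K where "K = chart_fun c ` closure {x. snd (pou A) c x \<noteq> 0}"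
  have "compact (closure {x. snd (pou A) c x \<noteq> 0})"
    using M compact_Int_closed [of UNIV "closure {x. snd (pou A) c x \<noteq> 0}"] by (simp add: compact_complex_manifold_def)
  then have "compact K" unfolding K_def
    by (intro compact_continuous_image continuous_on_subset [OF ci(5) pouD(5) [OF c]])
  moreover have KI: "K \<subseteq> chart_img c" unfolding K_def using pouD(5) [OF c] ci(3) by auto
  ultimately have int: "integrable lborel (\<lambda>z. indicator K z *\<^sub>R ?f z)"
    by (intro borel_integrable_compact continuous_on_subset [OF cf])
  have "indicator K z *\<^sub>R ?f z = indicator (chart_img c) z * ?f z" for z
  proof (cases "z \<in> chart_img c \<and> z \<notin> K")
    case True
    have "snd (pou A) c (chart_inv c z) = 0"
    proof (rule ccontr)
      assume "\<not> ?thesis"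
      then have "chart_inv c z \<in> {x. snd (pou A) c x \<noteq> 0}" by (rule CollectI)
      then have "chart_inv c z \<in> closure {x. snd (pou A) c x \<noteq> 0}" by (rule subsetD [OF closure_subset])
      then have "chart_fun c (chart_inv c z) \<in> K" unfolding K_def by blast
      then show False using True ci(2) by simp
    qed
    then show ?thesis using True by simp
  next
    case False
    then have "z \<in> chart_img c \<longleftrightarrow> z \<in> K" using KI by blast
    then show ?thesis by (simp add: indicator_def)
  qed
  then have "(\<lambda>z. indicator K z *\<^sub>R ?f z) = (\<lambda>z. indicator (chart_img c) z * ?f z)" by (rule ext)
  then show ?thesis using int by (simp only:)
qed

lemma norm_integrand_integrable:
  assumes "\<And>x. metric_covector (\<omega> x)" "smooth_rep A \<omega>" "\<And>x. \<alpha> x \<in> pq_covectors 2 0" "smooth_rep A \<alpha>"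
  shows "integrable lborel (norm_integrand A \<omega> \<alpha>)"
proof -
  have "integrable lborel (\<lambda>z. \<Sum>c\<in>fst (pou A). indicator (chart_img c) z *
      (snd (pou A) c (chart_inv c z) * norm_density (local_rep A \<omega> c z) (local_rep A \<alpha> c z)))"
    by (intro Bochner_Integration.integrable_sum norm_integrand_term_integrable assms)
  then show ?thesis by (simp add: norm_integrand_def [abs_def])
qed

text \<open>
  The volume covector takes real values, so that the complex integral in the definition of the norm is the
  real integral of the density.
\<close>

lemma L2_norm_eq_norm_integrand:
  assumes \<omega>: "\<And>x. metric_covector (\<omega> x)" "smooth_rep A \<omega>"
    and \<alpha>: "\<And>x. \<alpha> x \<in> pq_covectors 2 0" "smooth_rep A \<alpha>"
  shows "L2_norm_form A \<omega> 2 \<alpha> = sqrt (\<integral>z. norm_integrand A \<omega> \<alpha> z \<partial>lborel)"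
proof -
  let ?\<tau> = "\<lambda>x vs. of_real ((covector_norm (\<omega> x) 2 (\<alpha> x))\<^sup>2) * volume_covector (\<omega> x) vs"
  have real: "local_rep A ?\<tau> c z canonical_frame = of_real (norm_density (local_rep A \<omega> c z) (local_rep A \<alpha> c z))"
    if c: "c \<in> A" and z: "z \<in> chart_img c" for c z
  proof -
    have "Im (local_rep A ?\<tau> c z canonical_frame) = 0"
      unfolding local_rep_eq [OF atlas] by (subst volume_real [OF \<omega>(1)]) simp
    then show ?thesis using norm_density_local_rep [OF atlas c z \<omega>(1) \<alpha>(1)] by (simp add: complex_eq_iff)
  qed
  have "form_integral A ?\<tau> = (\<Sum>c\<in>fst (pou A). LINT z : chart_img c | lborel.
            snd (pou A) c (chart_inv c z) *\<^sub>R local_rep A ?\<tau> c z canonical_frame)"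
    unfolding form_integral_def pou_def [symmetric] by (simp add: Let_def case_prod_unfold)
  also have "\<dots> = (\<Sum>c\<in>fst (pou A). of_real (\<integral>z. indicator (chart_img c) z *
      (snd (pou A) c (chart_inv c z) * norm_density (local_rep A \<omega> c z) (local_rep A \<alpha> c z)) \<partial>lborel))"
  proof (rule sum.cong [OF refl])
    fix c assume c: "c \<in> fst (pou A)"
    show "(LINT z : chart_img c | lborel. snd (pou A) c (chart_inv c z) *\<^sub>R local_rep A ?\<tau> c z canonical_frame)
      = of_real (\<integral>z. indicator (chart_img c) z *
      (snd (pou A) c (chart_inv c z) * norm_density (local_rep A \<omega> c z) (local_rep A \<alpha> c z)) \<partial>lborel)"
      unfolding set_lebesgue_integral_def integral_complex_of_real [symmetric]
      by (rule Bochner_Integration.integral_cong)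
        (use real [OF pouD(2) [OF c]] in \<open>auto simp: indicator_def scaleR_conv_of_real\<close>)
  qed
  also have "\<dots> = of_real (\<integral>z. norm_integrand A \<omega> \<alpha> z \<partial>lborel)"
    unfolding norm_integrand_def
    by (subst Bochner_Integration.integral_sum) (simp_all add: norm_integrand_term_integrable [OF \<omega> \<alpha>])
  finally show ?thesis by (simp add: L2_norm_form_def)
qed

lemma hermitian_metricD:
  assumes "hermitian_metric A \<omega>"
  shows "metric_covector (\<omega> x)" "smooth_rep A \<omega>" "\<omega> \<in> smooth_forms A 1 1"
  using assms smooth_formsD [OF atlas] unfolding hermitian_metric_def metric_covector_def by blast+

lemma norm_integrand_integrable_hermitian:
  assumes "hermitian_metric A \<omega>" "\<alpha> \<in> smooth_forms A 2 0"
  shows "integrable lborel (norm_integrand A \<omega> \<alpha>)"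
  by (rule norm_integrand_integrable [OF hermitian_metricD(1,2) [OF assms(1)] smooth_formsD [OF atlas assms(2)]])

lemma sq_norm_nonneg: "hermitian_metric A \<omega> \<Longrightarrow> 0 \<le> sq_norm A \<omega> \<alpha>"
  unfolding sq_norm_def
  by (intro Bochner_Integration.integral_nonneg norm_integrand_nonneg hermitian_metricD(1))

lemma L2_norm_sq_norm:
  assumes "hermitian_metric A \<omega>" "\<alpha> \<in> smooth_forms A 2 0"
  shows "L2_norm_form A \<omega> 2 \<alpha> = sqrt (sq_norm A \<omega> \<alpha>)"
  unfolding sq_norm_def
  by (rule L2_norm_eq_norm_integrand [OF hermitian_metricD(1,2) [OF assms(1)] smooth_formsD [OF atlas assms(2)]])

text \<open>
  Identities between densities are only available inside the charts; outside, the indicator makes them irrelevant.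
\<close>

lemma norm_integrand_term_cong:
  assumes "\<And>c. c \<in> A \<Longrightarrow> z \<in> chart_img c \<Longrightarrow>
    norm_density (local_rep A \<omega> c z) (local_rep A \<alpha> c z) = F c"
  shows "norm_integrand A \<omega> \<alpha> z = (\<Sum>c\<in>fst (pou A). indicator (chart_img c) z * (snd (pou A) c (chart_inv c z) * F c))"
  unfolding norm_integrand_def
  by (intro sum.cong refl) (use assms pouD(2) in \<open>auto simp: indicator_def\<close>)

lemma smooth_form_2_0_arith:
  assumes "\<alpha> \<in> smooth_forms A 2 0" "\<beta> \<in> smooth_forms A 2 0"
  shows "(\<lambda>x vs. \<alpha> x vs - \<beta> x vs) \<in> smooth_forms A 2 0" "(\<lambda>x vs. \<alpha> x vs / 2 + \<beta> x vs / 2) \<in> smooth_forms A 2 0"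
    "(\<lambda>x vs. \<alpha> x vs + \<beta> x vs) \<in> smooth_forms A 2 0" "(\<lambda>x vs. of_real s * \<alpha> x vs) \<in> smooth_forms A 2 0"
  using smooth_form_linear_comb_2_0 [OF atlas assms, of 1 "-1"] smooth_form_linear_comb_2_0 [OF atlas assms, of "1/2" "1/2"]
    smooth_form_linear_comb_2_0 [OF atlas assms, of 1 1] smooth_form_linear_comb_2_0 [OF atlas assms, of "of_real s" 0]
  by simp_all

lemma local_rep_arith:
  "local_rep A (\<lambda>x vs. \<alpha> x vs - \<beta> x vs) c z = (\<lambda>vs. local_rep A \<alpha> c z vs - local_rep A \<beta> c z vs)"
  "local_rep A (\<lambda>x vs. \<alpha> x vs / 2 + \<beta> x vs / 2) c z = (\<lambda>vs. local_rep A \<alpha> c z vs / 2 + local_rep A \<beta> c z vs / 2)"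
  "local_rep A (\<lambda>x vs. of_real s * \<alpha> x vs) c z = (\<lambda>vs. of_real s * local_rep A \<alpha> c z vs)"
  by (simp_all add: fun_eq_iff local_rep_eq [OF atlas])

lemma sq_norm_parallelogram:
  assumes \<omega>: "hermitian_metric A \<omega>" and \<alpha>: "\<alpha> \<in> smooth_forms A 2 0" and \<beta>: "\<beta> \<in> smooth_forms A 2 0"
  shows "sq_norm A \<omega> (\<lambda>x vs. \<alpha> x vs - \<beta> x vs) = 2 * sq_norm A \<omega> \<alpha> + 2 * sq_norm A \<omega> \<beta>
     - 4 * sq_norm A \<omega> (\<lambda>x vs. \<alpha> x vs / 2 + \<beta> x vs / 2)"
proof -
  have "norm_integrand A \<omega> (\<lambda>x vs. \<alpha> x vs - \<beta> x vs) z = 2 * norm_integrand A \<omega> \<alpha> z + 2 * norm_integrand A \<omega> \<beta> z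
     - 4 * norm_integrand A \<omega> (\<lambda>x vs. \<alpha> x vs / 2 + \<beta> x vs / 2) z" for z
  proof -
    have "norm_density (local_rep A \<omega> c z) (local_rep A (\<lambda>x vs. \<alpha> x vs - \<beta> x vs) c z)
      = 2 * norm_density (local_rep A \<omega> c z) (local_rep A \<alpha> c z) + 2 * norm_density (local_rep A \<omega> c z) (local_rep A \<beta> c z)
      - 4 * norm_density (local_rep A \<omega> c z) (local_rep A (\<lambda>x vs. \<alpha> x vs / 2 + \<beta> x vs / 2) c z)"
      if c: "c \<in> A" and z: "z \<in> chart_img c" for c
      unfolding local_rep_arith
      by (rule norm_density_parallelogram [OF local_rep_metric [OF hermitian_metricD(1) [OF \<omega>] c z]
          local_rep_2_0 [OF smooth_formsD(1) [OF atlas \<alpha>] c z] local_rep_2_0 [OF smooth_formsD(1) [OF atlas \<beta>] c z]])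
    from norm_integrand_term_cong [OF this] show ?thesis
      by (simp add: norm_integrand_def sum_distrib_left algebra_simps sum.distrib sum_subtractf)
  qed
  then show ?thesis
    using norm_integrand_integrable_hermitian [OF \<omega> \<alpha>] norm_integrand_integrable_hermitian [OF \<omega> \<beta>] norm_integrand_integrable_hermitian [OF \<omega> smooth_form_2_0_arith(2) [OF \<alpha> \<beta>]]
    by (simp add: sq_norm_def)
qed

lemma sq_norm_scale:
  assumes \<omega>: "hermitian_metric A \<omega>" and \<alpha>: "\<alpha> \<in> smooth_forms A 2 0"
  shows "sq_norm A \<omega> (\<lambda>x vs. of_real s * \<alpha> x vs) = s\<^sup>2 * sq_norm A \<omega> \<alpha>"
proof -
  have "norm_integrand A \<omega> (\<lambda>x vs. of_real s * \<alpha> x vs) z = s\<^sup>2 * norm_integrand A \<omega> \<alpha> z" for z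
  proof -
    have "norm_density (local_rep A \<omega> c z) (local_rep A (\<lambda>x vs. of_real s * \<alpha> x vs) c z)
      = s\<^sup>2 * norm_density (local_rep A \<omega> c z) (local_rep A \<alpha> c z)"
      if c: "c \<in> A" and z: "z \<in> chart_img c" for c
      unfolding local_rep_arith
      by (rule norm_density_real_scale [OF local_rep_metric [OF hermitian_metricD(1) [OF \<omega>] c z]
          local_rep_2_0 [OF smooth_formsD(1) [OF atlas \<alpha>] c z]])
    from norm_integrand_term_cong [OF this] show ?thesis
      by (simp add: norm_integrand_def sum_distrib_left mult.left_commute)
  qed
  then show ?thesis by (simp add: sq_norm_def)
qed

lemma sq_norm_mono:
  assumes \<omega>: "hermitian_metric A \<omega>" and \<omega>': "hermitian_metric A \<omega>'" and \<alpha>: "\<alpha> \<in> smooth_forms A 2 0"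
    and le: "\<And>x v. riem (\<omega>' x) v v \<le> riem (\<omega> x) v v"
  shows "sq_norm A \<omega>' \<alpha> \<le> sq_norm A \<omega> \<alpha>"
  unfolding sq_norm_def
proof (rule integral_mono [OF norm_integrand_integrable_hermitian [OF \<omega>' \<alpha>] norm_integrand_integrable_hermitian [OF \<omega> \<alpha>]])
  fix z
  show "norm_integrand A \<omega>' \<alpha> z \<le> norm_integrand A \<omega> \<alpha> z"
    unfolding norm_integrand_def
  proof (rule sum_mono)
    fix c assume c: "c \<in> fst (pou A)"
    note cA = pouD(2) [OF c]
    show "indicator (chart_img c) z * (snd (pou A) c (chart_inv c z) * norm_density (local_rep A \<omega>' c z) (local_rep A \<alpha> c z))
      \<le> indicator (chart_img c) z * (snd (pou A) c (chart_inv c z) * norm_density (local_rep A \<omega> c z) (local_rep A \<alpha> c z))"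
    proof (cases "z \<in> chart_img c")
      case True
      obtain T where T: "complex_linear T" "inj T" "\<And>\<alpha> vs. local_rep A \<alpha> c z vs = \<alpha> (chart_inv c z) (map T vs)"
        by (rule local_rep_pull [OF atlas cA True]) (rule that)
      have "riem (local_rep A \<omega>' c z) v v \<le> riem (local_rep A \<omega> c z) v v" for v
        using le [of "chart_inv c z" "T v"] T(1) by (simp add: riem_def T(3) complex_linear_def)
      then have "norm_density (local_rep A \<omega>' c z) (local_rep A \<alpha> c z) \<le> norm_density (local_rep A \<omega> c z) (local_rep A \<alpha> c z)"
        by (rule norm_density_mono [OF local_rep_metric [OF hermitian_metricD(1) [OF \<omega>] cA True]
            local_rep_metric [OF hermitian_metricD(1) [OF \<omega>'] cA True] _ local_rep_2_0 [OF smooth_formsD(1) [OF atlas \<alpha>] cA True]])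
      then show ?thesis using pouD(4) [OF c] True by (simp add: mult_left_mono)
    qed simp
  qed
qed

section \<open>The L2 norm controls holomorphic two-forms\<close>

text \<open>
  Around \<open>x\<close> use a chart whose weight in the partition of unity is positive at \<open>x\<close>; there the weight and the
  metric are bounded from below.
\<close>

lemma norm_integrand_local_lower:
  assumes \<omega>: "hermitian_metric A \<omega>"
  obtains c R K where "c \<in> A" "x \<in> chart_dom c" "R > 0" "ball (chart_fun c x) R \<subseteq> chart_img c" "K > 0"
    "\<And>\<alpha> z i j. \<alpha> \<in> smooth_forms A 2 0 \<Longrightarrow> z \<in> ball (chart_fun c x) R \<Longrightarrow>
       K * (cmod (local_rep A \<alpha> c z [axis i 1, axis j 1]))\<^sup>2 \<le> norm_integrand A \<omega> \<alpha> z"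
proof -
  have "\<exists>c\<in>fst (pou A). snd (pou A) c x \<noteq> 0"
    using pouD(6) [of x] by (metis sum.neutral zero_neq_one)
  then obtain c where c: "c \<in> fst (pou A)" "snd (pou A) c x \<noteq> 0" by blast
  define t where "t = snd (pou A) c x"
  have t: "t > 0" using c(2) pouD(4) [OF c(1), of x] by (simp add: t_def)
  note cA = pouD(2) [OF c(1)]
  note ci = chart_inverse [OF atlas cA]
  have "x \<in> {x. snd (pou A) c x \<noteq> 0}" using c(2) by simp
  then have x: "x \<in> chart_dom c" by (rule subsetD [OF order_trans [OF closure_subset pouD(5) [OF c(1)]]])
  let ?z = "chart_fun c x"
  have z: "?z \<in> chart_img c" "chart_inv c ?z = x" using ci x by auto
  obtain \<delta> r1 where \<delta>: "\<delta> > 0" "r1 > 0" "ball ?z r1 \<subseteq> chart_img c"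
    "\<And>z v. z \<in> ball ?z r1 \<Longrightarrow> \<delta> * (norm v)\<^sup>2 \<le> riem (local_rep A \<omega> c z) v v"
    by (rule metric_local_lower [OF chart_open(2) [OF atlas cA] local_rep_metric [OF hermitian_metricD(1) [OF \<omega>] cA]
          smooth_onD(1) [OF smooth_repD(1) [OF atlas hermitian_metricD(2) [OF \<omega>] cA]] z(1)], assumption, rule that)
  have "continuous_on (chart_img c) (\<lambda>z. snd (pou A) c (chart_inv c z))"
    by (rule continuous_on_compose2 [OF pouD(3) [OF c(1)] ci(6)]) auto
  then have "isCont (\<lambda>z. snd (pou A) c (chart_inv c z)) ?z"
    using continuous_on_eq_continuous_at [OF chart_open(2) [OF atlas cA]] z(1) by blast
  then have "((\<lambda>z. snd (pou A) c (chart_inv c z)) \<longlongrightarrow> snd (pou A) c (chart_inv c ?z)) (nhds ?z)"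
    unfolding isCont_def by (rule tendsto_at_iff_tendsto_nhds [THEN iffD1])
  then have "((\<lambda>z. snd (pou A) c (chart_inv c z)) \<longlongrightarrow> t) (nhds ?z)"
    by (simp only: z(2) t_def)
  then have "\<forall>\<^sub>F z in nhds ?z. t / 2 < snd (pou A) c (chart_inv c z)"
    by (rule order_tendstoD(1)) (use t in simp)
  then obtain r2 where r2: "r2 > 0" "\<And>z. dist z ?z < r2 \<Longrightarrow> t / 2 < snd (pou A) c (chart_inv c z)"
    unfolding eventually_nhds_metric by blast
  define R where "R = min r1 r2"
  define K where "K = t / 2 * (\<delta> ^ CARD('n) / \<delta>\<^sup>2 * 2)"
  show thesis
  proof (rule that [OF cA x])
    show "R > 0" using \<delta>(2) r2(1) by (simp add: R_def)
    show "ball ?z R \<subseteq> chart_img c" using \<delta>(3) by (auto simp: R_def)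
    show "K > 0" using t \<delta>(1) by (simp add: K_def)
    fix \<alpha> z i j assume \<alpha>: "\<alpha> \<in> smooth_forms A 2 0" and zb: "z \<in> ball ?z R"
    have zi: "z \<in> chart_img c" using zb \<delta>(3) by (auto simp: R_def)
    let ?a = "local_rep A \<alpha> c z [axis i 1, axis j 1]"
    have "\<delta> ^ CARD('n) / \<delta>\<^sup>2 * 2 * (cmod ?a)\<^sup>2 \<le> norm_density (local_rep A \<omega> c z) (local_rep A \<alpha> c z)"
      by (rule norm_density_lower [OF local_rep_metric [OF hermitian_metricD(1) [OF \<omega>] cA zi] \<delta>(1) \<delta>(4)
            local_rep_2_0 [OF smooth_formsD(1) [OF atlas \<alpha>] cA zi]]) (use zb in \<open>simp add: R_def\<close>)
    moreover have "t / 2 \<le> snd (pou A) c (chart_inv c z)"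
      using r2(2) [of z] zb by (simp add: R_def dist_commute less_imp_le)
    ultimately have "t / 2 * (\<delta> ^ CARD('n) / \<delta>\<^sup>2 * 2 * (cmod ?a)\<^sup>2)
        \<le> snd (pou A) c (chart_inv c z) * norm_density (local_rep A \<omega> c z) (local_rep A \<alpha> c z)"
      using t \<delta>(1) by (intro mult_mono) auto
    also have "\<dots> = indicator (chart_img c) z * (snd (pou A) c (chart_inv c z) * norm_density (local_rep A \<omega> c z) (local_rep A \<alpha> c z))"
      using zi by simp
    also have "\<dots> \<le> norm_integrand A \<omega> \<alpha> z"
      unfolding norm_integrand_def
    proof (rule member_le_sum [OF c(1)])
      fix c' assume "c' \<in> fst (pou A) - {c}"
      then have c': "c' \<in> fst (pou A)" by simp
      show "0 \<le> indicator (chart_img c') z * (snd (pou A) c' (chart_inv c' z) * norm_density (local_rep A \<omega> c' z) (local_rep A \<alpha> c' z))"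
        using pouD(4) [OF c'] norm_density_nonneg [OF local_rep_metric [OF hermitian_metricD(1) [OF \<omega>] pouD(2) [OF c']]]
        by (cases "z \<in> chart_img c'") simp_all
    qed (rule pouD(1))
    finally show "K * (cmod ?a)\<^sup>2 \<le> norm_integrand A \<omega> \<alpha> z" by (simp add: K_def mult.assoc)
  qed
qed

text \<open>
  A form is evaluated through the chart chosen at \<open>x\<close>, whereas \<open>c\<close> may be another chart.
\<close>

lemma two_form_zeroI:
  assumes \<alpha>: "\<And>x. \<alpha> x \<in> pq_covectors 2 0" and c: "c \<in> A" "x \<in> chart_dom c"
    and z: "\<And>i j. local_rep A \<alpha> c (chart_fun c x) [axis i 1, axis j 1] = 0"
  shows "\<alpha> x vs = 0"
proof (cases "length vs = 2")
  case False
  then show ?thesis using \<alpha> [of x] pq_2_0_iff by blast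
next
  case True
  then obtain u v where vs: "vs = [u, v]" by (metis list_length2)
  let ?c = "chart_at A x" and ?z = "chart_fun (chart_at A x) x"
  note ct = center_in_img [OF atlas, of x]
  have o: "?z \<in> overlap ?c c" using overlap_iff [OF atlas ct(1)] ct c by auto
  have "transition ?c c ?z = chart_fun c x" by (simp add: transition_def ct)
  then have "local_rep A \<alpha> ?c ?z [u, v] = 0"
    using two_form_change [OF atlas \<alpha> ct(1) c(1) o, where u = u and v = v] by (simp add: z)
  then show ?thesis using local_rep_center [OF atlas, of \<alpha> x "[u, v]"] by (simp add: vs)
qed

text \<open>
  A component that does not vanish at \<open>x\<close> is bounded away from 0 on a ball, which has positive measure.
\<close>

lemma sq_norm_zero_imp:
  assumes \<omega>: "hermitian_metric A \<omega>" and \<alpha>: "\<alpha> \<in> smooth_forms A 2 0" and 0: "sq_norm A \<omega> \<alpha> = 0"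
  shows "\<alpha> x vs = 0"
proof -
  obtain c R K where c: "c \<in> A" "x \<in> chart_dom c" "R > 0" "ball (chart_fun c x) R \<subseteq> chart_img c" "K > 0"
    and K: "\<And>\<alpha> z i j. \<alpha> \<in> smooth_forms A 2 0 \<Longrightarrow> z \<in> ball (chart_fun c x) R \<Longrightarrow>
       K * (cmod (local_rep A \<alpha> c z [axis i 1, axis j 1]))\<^sup>2 \<le> norm_integrand A \<omega> \<alpha> z"
    by (rule norm_integrand_local_lower [OF \<omega>, of x]) (rule that)
  have nn: "0 \<le> norm_integrand A \<omega> \<alpha> z" for z by (rule norm_integrand_nonneg [OF hermitian_metricD(1) [OF \<omega>]])
  have ae: "AE z in lborel. norm_integrand A \<omega> \<alpha> z = 0"
    using integral_nonneg_eq_0_iff_AE [OF norm_integrand_integrable_hermitian [OF \<omega> \<alpha>]] nn 0 by (simp add: sq_norm_def)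
  have "local_rep A \<alpha> c (chart_fun c x) [axis i 1, axis j 1] = 0" for i j
  proof (rule ccontr)
    let ?f = "\<lambda>z. local_rep A \<alpha> c z [axis i 1, axis j 1]" and ?z = "chart_fun c x"
    assume nz: "?f ?z \<noteq> 0"
    have "continuous_on (ball ?z R) ?f"
      by (rule continuous_on_subset [OF smooth_onD(1) [OF smooth_repD(1) [OF atlas smooth_formsD(2) [OF atlas \<alpha>] c(1)]] c(4)])
    then have "open (ball ?z R \<inter> ?f -` (- {0}))" by (rule continuous_open_preimage) auto
    moreover have "?z \<in> ball ?z R \<inter> ?f -` (- {0})" using c(3) nz by simp
    ultimately obtain r where r: "r > 0" "ball ?z r \<subseteq> ball ?z R \<inter> ?f -` (- {0})" using openE by blast
    have "norm_integrand A \<omega> \<alpha> z \<noteq> 0" if "z \<in> ball ?z r" for z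
    proof -
      have "z \<in> ball ?z R" "?f z \<noteq> 0" using that r(2) by auto
      then have "0 < K * (cmod (?f z))\<^sup>2" using c(5) by simp
      also have "\<dots> \<le> norm_integrand A \<omega> \<alpha> z" by (rule K [OF \<alpha> \<open>z \<in> ball ?z R\<close>])
      finally show ?thesis by simp
    qed
    then have "AE z in lborel. z \<notin> ball ?z r" using ae by (auto elim!: eventually_mono)
    then have "emeasure lborel (ball ?z r) = 0" by (subst (asm) AE_iff_measurable [OF _ refl]) (auto simp: ball_def)
    then show False using content_ball_pos [OF r(1), of ?z] by (simp add: measure_def)
  qed
  then show ?thesis by (rule two_form_zeroI [OF smooth_formsD(1) [OF atlas \<alpha>] c(1,2)])
qed

text \<open>
  The mean value inequality for the components of \<open>h\<close> on balls of radius \<open>R / 3\<close> around points of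
  the ball of radius \<open>R / 3\<close>.
\<close>

lemma hol_two_form_sup_bound:
  assumes \<omega>: "hermitian_metric A \<omega>"
  obtains c r B where "c \<in> A" "x \<in> chart_dom c" "r > 0" "ball (chart_fun c x) r \<subseteq> chart_img c" "B \<ge> 0"
    "\<And>h z i j. h \<in> smooth_forms A 2 0 \<Longrightarrow> d_form A (h + cnj_form h) = 0 \<Longrightarrow> z \<in> ball (chart_fun c x) r \<Longrightarrow>
       (cmod (local_rep A h c z [axis i 1, axis j 1]))\<^sup>2 \<le> B * sq_norm A \<omega> h"
proof -
  obtain c R K where c: "c \<in> A" "x \<in> chart_dom c" "R > 0" "ball (chart_fun c x) R \<subseteq> chart_img c" "K > 0"
    and K: "\<And>\<alpha> z i j. \<alpha> \<in> smooth_forms A 2 0 \<Longrightarrow> z \<in> ball (chart_fun c x) R \<Longrightarrow>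
       K * (cmod (local_rep A \<alpha> c z [axis i 1, axis j 1]))\<^sup>2 \<le> norm_integrand A \<omega> \<alpha> z"
    by (rule norm_integrand_local_lower [OF \<omega>, of x]) (rule that)
  let ?z = "chart_fun c x"
  define r where "r = R / 3"
  have r: "r > 0" using c(3) by (simp add: r_def)
  define V where "V = measure lborel (cball (0 :: complex^'n) r)"
  have V: "V > 0" using content_cball_pos [OF r, of "0 :: complex^'n"] by (simp add: V_def measure_def)
  show thesis
  proof (rule that [OF c(1,2) r])
    show "ball ?z r \<subseteq> chart_img c" using c(3,4) by (auto simp: r_def)
    show "0 \<le> 1 / (K * V)" using c(5) V by simp
    fix h z i j assume h: "h \<in> smooth_forms A 2 0" "d_form A (h + cnj_form h) = 0" and z: "z \<in> ball ?z r"
    let ?f = "\<lambda>w. local_rep A h c w [axis i 1, axis j 1]"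
    have hol: "hol_on (chart_img c) ?f" by (rule closed_two_form_hol [OF atlas h c(1)])
    have sub: "cball z r \<subseteq> ball ?z R"
    proof
      fix y assume "y \<in> cball z r"
      then show "y \<in> ball ?z R" using z dist_triangle [of ?z y z] c(3) by (simp add: r_def)
    qed
    then have sub': "cball z r \<subseteq> chart_img c" using c(4) by blast
    have cf: "continuous_on (cball z r) ?f" by (rule continuous_on_subset [OF hol_on_imp_continuous_on [OF hol] sub'])
    have "(cmod (?f z))\<^sup>2 * V \<le> (\<integral>w. indicator (cball z r) w * (cmod (?f w))\<^sup>2 \<partial>lborel)"
      unfolding V_def by (rule hol_on_point_le_L2 [OF hol sub' r])
    also have "\<dots> \<le> (\<integral>w. (1 / K) * norm_integrand A \<omega> h w \<partial>lborel)"
    proof (rule integral_mono)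
      have "integrable lborel (\<lambda>w. indicator (cball z r) w *\<^sub>R (cmod (?f w))\<^sup>2)"
        by (rule borel_integrable_compact) (auto intro!: continuous_intros cf)
      then show "integrable lborel (\<lambda>w. indicator (cball z r) w * (cmod (?f w))\<^sup>2)" by simp
      show "integrable lborel (\<lambda>w. (1 / K) * norm_integrand A \<omega> h w)"
        by (rule integrable_mult_right [OF norm_integrand_integrable_hermitian [OF \<omega> h(1)]])
      fix w
      show "indicator (cball z r) w * (cmod (?f w))\<^sup>2 \<le> (1 / K) * norm_integrand A \<omega> h w"
      proof (cases "w \<in> cball z r")
        case True
        then have "K * (cmod (?f w))\<^sup>2 \<le> norm_integrand A \<omega> h w" using sub by (intro K [OF h(1)]) blast
        then show ?thesis using True c(5) by (simp add: pos_le_divide_eq mult.commute)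
      next
        case False
        then show ?thesis using norm_integrand_nonneg [OF hermitian_metricD(1) [OF \<omega>], where \<alpha> = h and z = w] c(5) by simp
      qed
    qed
    also have "\<dots> = (1 / K) * sq_norm A \<omega> h" by (simp add: sq_norm_def)
    finally show "(cmod (?f z))\<^sup>2 \<le> 1 / (K * V) * sq_norm A \<omega> h"
      using V c(5) by (simp add: field_simps)
  qed
qed

section \<open>The torsion form\<close>

text \<open>
  The equation \<open>d (\<rho> + \<omega> + cnj \<rho>) = 0\<close>, resolved by linearity.
\<close>

lemma closing_iff:
  assumes \<omega>: "smooth_rep A \<omega>"
  shows "\<rho> \<in> closing_20_forms A \<omega> \<longleftrightarrow> \<rho> \<in> smooth_forms A 2 0 \<and>
    (\<forall>x vs. d_form A \<rho> x vs + d_form A \<omega> x vs + cnj (d_form A \<rho> x vs) = 0)"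
proof -
  have "d_form A (\<rho> + \<omega> + cnj_form \<rho>) = d_form A \<rho> + d_form A \<omega> + cnj_form (d_form A \<rho>)" if "\<rho> \<in> smooth_forms A 2 0"
  proof -
    note sm = smooth_formsD(2) [OF atlas that]
    show ?thesis
      by (simp add: d_form_add [OF atlas smooth_rep_add [OF atlas sm \<omega>] smooth_rep_cnj [OF atlas sm]]
          d_form_add [OF atlas sm \<omega>] d_form_cnj [OF atlas sm])
  qed
  then show ?thesis by (auto simp: closing_20_forms_def fun_eq_iff cnj_form_def)
qed

lemma closing_arith:
  assumes \<omega>: "smooth_rep A \<omega>" and \<rho>: "\<rho> \<in> closing_20_forms A \<omega>" and \<sigma>: "\<sigma> \<in> closing_20_forms A \<omega>"
  shows "(\<lambda>x vs. \<rho> x vs - \<sigma> x vs) \<in> smooth_forms A 2 0"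
    "d_form A ((\<lambda>x vs. \<rho> x vs - \<sigma> x vs) + cnj_form (\<lambda>x vs. \<rho> x vs - \<sigma> x vs)) = 0"
    "(\<lambda>x vs. \<rho> x vs / 2 + \<sigma> x vs / 2) \<in> closing_20_forms A \<omega>"
proof -
  have s: "\<rho> \<in> smooth_forms A 2 0" "\<sigma> \<in> smooth_forms A 2 0"
    and c: "\<And>x vs. d_form A \<rho> x vs + d_form A \<omega> x vs + cnj (d_form A \<rho> x vs) = 0"
      "\<And>x vs. d_form A \<sigma> x vs + d_form A \<omega> x vs + cnj (d_form A \<sigma> x vs) = 0"
    using \<rho> \<sigma> unfolding closing_iff [OF \<omega>] by blast+
  note sm = smooth_formsD(2) [OF atlas s(1)] smooth_formsD(2) [OF atlas s(2)]
  show d: "(\<lambda>x vs. \<rho> x vs - \<sigma> x vs) \<in> smooth_forms A 2 0" by (rule smooth_form_2_0_arith(1) [OF s])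
  have dd: "d_form A (\<lambda>x vs. \<rho> x vs - \<sigma> x vs) x vs = d_form A \<rho> x vs - d_form A \<sigma> x vs" for x vs
    using d_form_linear_comb [OF atlas sm, of 1 "-1" x vs] by simp
  have dm: "d_form A (\<lambda>x vs. \<rho> x vs / 2 + \<sigma> x vs / 2) x vs = d_form A \<rho> x vs / 2 + d_form A \<sigma> x vs / 2" for x vs
    using d_form_linear_comb [OF atlas sm, of "1/2" "1/2" x vs] by simp
  note smd = smooth_formsD(2) [OF atlas d]
  have "d_form A (\<lambda>x vs. \<rho> x vs - \<sigma> x vs) x vs + cnj (d_form A (\<lambda>x vs. \<rho> x vs - \<sigma> x vs) x vs) = 0" for x vs
  proof -
    have "d_form A \<rho> x vs - d_form A \<sigma> x vs + cnj (d_form A \<rho> x vs - d_form A \<sigma> x vs)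
      = (d_form A \<rho> x vs + d_form A \<omega> x vs + cnj (d_form A \<rho> x vs)) - (d_form A \<sigma> x vs + d_form A \<omega> x vs + cnj (d_form A \<sigma> x vs))"
      by simp
    then show ?thesis unfolding dd c by simp
  qed
  then show "d_form A ((\<lambda>x vs. \<rho> x vs - \<sigma> x vs) + cnj_form (\<lambda>x vs. \<rho> x vs - \<sigma> x vs)) = 0"
    unfolding d_form_add [OF atlas smd smooth_rep_cnj [OF atlas smd]] d_form_cnj [OF atlas smd]
    by (simp add: fun_eq_iff cnj_form_def)
  have "d_form A (\<lambda>x vs. \<rho> x vs / 2 + \<sigma> x vs / 2) x vs + d_form A \<omega> x vs + cnj (d_form A (\<lambda>x vs. \<rho> x vs / 2 + \<sigma> x vs / 2) x vs) = 0" for x vs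
  proof -
    have "d_form A \<rho> x vs / 2 + d_form A \<sigma> x vs / 2 + d_form A \<omega> x vs + cnj (d_form A \<rho> x vs / 2 + d_form A \<sigma> x vs / 2)
      = (d_form A \<rho> x vs + d_form A \<omega> x vs + cnj (d_form A \<rho> x vs)) / 2 + (d_form A \<sigma> x vs + d_form A \<omega> x vs + cnj (d_form A \<sigma> x vs)) / 2"
      by (simp add: field_simps)
    then show ?thesis unfolding dm c by simp
  qed
  then show "(\<lambda>x vs. \<rho> x vs / 2 + \<sigma> x vs / 2) \<in> closing_20_forms A \<omega>"
    unfolding closing_iff [OF \<omega>] using smooth_form_2_0_arith(2) [OF s] by blast
qed

text \<open>
  The sup bound holds in one chart around each point.  Any other chart is related to it by the transition
  map, whose differential is bounded near \<open>z\<close>.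
\<close>

lemma hol_form_local_bound:
  assumes \<omega>: "hermitian_metric A \<omega>" and c: "c \<in> A" "z \<in> chart_img c"
  obtains r C where "r > 0" "ball z r \<subseteq> chart_img c" "C > 0"
    "\<And>h w. h \<in> smooth_forms A 2 0 \<Longrightarrow> d_form A (h + cnj_form h) = 0 \<Longrightarrow> w \<in> ball z r \<Longrightarrow>
       cmod (local_rep A h c w [u, v]) \<le> C * sqrt (sq_norm A \<omega> h)"
proof -
  obtain c' r' B where c': "c' \<in> A" "chart_inv c z \<in> chart_dom c'" "r' > 0" "ball (chart_fun c' (chart_inv c z)) r' \<subseteq> chart_img c'" "B \<ge> 0"
    and B: "\<And>h w i j. h \<in> smooth_forms A 2 0 \<Longrightarrow> d_form A (h + cnj_form h) = 0 \<Longrightarrow> w \<in> ball (chart_fun c' (chart_inv c z)) r' \<Longrightarrow>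
       (cmod (local_rep A h c' w [axis i 1, axis j 1]))\<^sup>2 \<le> B * sq_norm A \<omega> h"
    by (rule hol_two_form_sup_bound [OF \<omega>, of "chart_inv c z"]) (rule that)
  let ?t = "transition c c'"
  have o: "z \<in> overlap c c'" using overlap_iff [OF atlas c(1)] c(2) c'(2) by blast
  note oo = open_overlap [OF atlas c(1) c'(1)]
  define K where "K w = (\<Sum>i\<in>UNIV. \<Sum>j\<in>UNIV. cmod (dtransition c c' w u $ i) * cmod (dtransition c c' w v $ j))" for w
  have "continuous_on (overlap c c') (\<lambda>w. dtransition c c' w y $ i)" for i y
    by (rule hol_on_imp_continuous_on [OF transition_component_hol(3) [OF atlas c(1) c'(1)]])
  then have "continuous_on (overlap c c') K" unfolding K_def by (intro continuous_on_sum continuous_on_mult continuous_on_norm)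
  then have "isCont K z" using continuous_on_eq_continuous_at [OF oo] o by blast
  then have "(K \<longlongrightarrow> K z) (nhds z)" unfolding isCont_def by (rule tendsto_at_iff_tendsto_nhds [THEN iffD1])
  then have e1: "\<forall>\<^sub>F w in nhds z. K w < K z + 1" by (rule order_tendstoD(2)) simp
  have "isCont ?t z" by (rule has_derivative_continuous [OF transition_derivative(1) [OF atlas c(1) c'(1) o]])
  then have "(?t \<longlongrightarrow> ?t z) (nhds z)" unfolding isCont_def by (rule tendsto_at_iff_tendsto_nhds [THEN iffD1])
  then have e2: "\<forall>\<^sub>F w in nhds z. ?t w \<in> ball (chart_fun c' (chart_inv c z)) r'"
    by (rule topological_tendstoD) (use c'(3) in \<open>auto simp: transition_def\<close>)
  have e3: "\<forall>\<^sub>F w in nhds z. w \<in> overlap c c'" using oo o eventually_nhds_in_open by blast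
  from eventually_conj [OF e1 eventually_conj [OF e2 e3]]
  obtain r where r: "r > 0" "\<And>w. dist w z < r \<Longrightarrow> K w < K z + 1 \<and> ?t w \<in> ball (chart_fun c' (chart_inv c z)) r' \<and> w \<in> overlap c c'"
    unfolding eventually_nhds_metric by blast
  have K0: "0 \<le> K w" for w unfolding K_def by (intro sum_nonneg) auto
  show thesis
  proof (rule that)
    show "r > 0" by (rule r(1))
    show "ball z r \<subseteq> chart_img c" using r(2) overlap_iff [OF atlas c(1)] by (auto simp: dist_commute)
    show "(K z + 1) * (sqrt B + 1) > 0" using K0 [of z] c'(5) by (intro mult_pos_pos) (auto intro: add_nonneg_pos)
    fix h w assume h: "h \<in> smooth_forms A 2 0" "d_form A (h + cnj_form h) = 0" and w: "w \<in> ball z r"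
    have w': "K w < K z + 1" "?t w \<in> ball (chart_fun c' (chart_inv c z)) r'" "w \<in> overlap c c'"
      using r(2) [of w] w by (auto simp: dist_commute)
    note N = sq_norm_nonneg [OF \<omega>, of h]
    have b: "cmod (local_rep A h c' (?t w) [axis i 1, axis j 1]) \<le> sqrt (B * sq_norm A \<omega> h)" for i j
      by (rule real_le_rsqrt [OF B [OF h w'(2)]])
    have "cmod (local_rep A h c w [u, v]) \<le> (\<Sum>i\<in>UNIV. \<Sum>j\<in>UNIV. cmod (dtransition c c' w u $ i) * cmod (dtransition c c' w v $ j)
        * cmod (local_rep A h c' (?t w) [axis i 1, axis j 1]))"
      unfolding two_form_change [OF atlas smooth_formsD(1) [OF atlas h(1)] c(1) c'(1) w'(3), where u = u and v = v]
      by (intro order_trans [OF norm_sum] sum_mono) (simp add: norm_mult)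
    also have "\<dots> \<le> (\<Sum>i\<in>UNIV. \<Sum>j\<in>UNIV. cmod (dtransition c c' w u $ i) * cmod (dtransition c c' w v $ j) * sqrt (B * sq_norm A \<omega> h))"
      by (intro sum_mono mult_left_mono b) simp
    also have "\<dots> = K w * (sqrt B * sqrt (sq_norm A \<omega> h))" by (simp add: K_def sum_distrib_right real_sqrt_mult)
    also have "\<dots> \<le> (K z + 1) * ((sqrt B + 1) * sqrt (sq_norm A \<omega> h))"
      using w'(1) K0 N c'(5) by (intro mult_mono) auto
    finally show "cmod (local_rep A h c w [u, v]) \<le> (K z + 1) * (sqrt B + 1) * sqrt (sq_norm A \<omega> h)" by (simp add: mult.assoc)
  qed
qed

text \<open>
  Completeness of the space of holomorphic two-forms in the \<open>L\<^sup>2\<close> norm: Cauchy sequences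
  converge locally uniformly in each chart, and so do their derivatives.
\<close>

lemma hol_forms_limit:
  assumes \<omega>: "hermitian_metric A \<omega>"
    and h: "\<And>k. h k \<in> smooth_forms A 2 0" "\<And>k. d_form A (h k + cnj_form (h k)) = 0"
    and hh: "\<And>k l. d_form A ((\<lambda>x vs. h k x vs - h l x vs) + cnj_form (\<lambda>x vs. h k x vs - h l x vs)) = 0"
    and a: "\<And>k l. sq_norm A \<omega> (\<lambda>x vs. h k x vs - h l x vs) \<le> a k + a l" "a \<longlonglongrightarrow> 0"
  obtains H where "H \<in> smooth_forms A 2 0" "\<And>x vs. (\<lambda>k. h k x vs) \<longlonglongrightarrow> H x vs"
    "\<And>x vs. (\<lambda>k. d_form A (h k) x vs) \<longlonglongrightarrow> d_form A H x vs"
proof -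
  note pq = smooth_formsD(1) [OF atlas h(1)] and sm = smooth_formsD(2) [OF atlas h(1)]
  have off: "h k x vs = 0" if "length vs \<noteq> 2" for k x vs using pq [of k x] that pq_2_0_iff by blast
  have unif: "\<exists>r>0. ball z r \<subseteq> chart_img c \<and> uniform_limit (ball z r) (\<lambda>k w. local_rep A (h k) c w [u, v])
      (\<lambda>w. lim (\<lambda>k. local_rep A (h k) c w [u, v])) sequentially"
    if c: "c \<in> A" "z \<in> chart_img c" for c z u v
  proof -
    obtain r C where r: "r > 0" "ball z r \<subseteq> chart_img c" "C > 0"
      and C: "\<And>h w. h \<in> smooth_forms A 2 0 \<Longrightarrow> d_form A (h + cnj_form h) = 0 \<Longrightarrow> w \<in> ball z r \<Longrightarrow>
       cmod (local_rep A h c w [u, v]) \<le> C * sqrt (sq_norm A \<omega> h)"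
      by (rule hol_form_local_bound [OF \<omega> c, where u = u and v = v]) (rule that)
    have "uniformly_Cauchy_on (ball z r) (\<lambda>k w. local_rep A (h k) c w [u, v])"
      unfolding uniformly_Cauchy_on_def
    proof (intro allI impI)
      fix e :: real assume e: "e > 0"
      have "\<forall>\<^sub>F k in sequentially. a k < (e / C)\<^sup>2 / 2" using e r(3) by (intro order_tendstoD(2) [OF a(2)]) simp
      then obtain N where N: "\<And>k. k \<ge> N \<Longrightarrow> a k < (e / C)\<^sup>2 / 2" unfolding eventually_sequentially by blast
      have "dist (local_rep A (h k) c w [u, v]) (local_rep A (h l) c w [u, v]) < e" if w: "w \<in> ball z r" and kl: "k \<ge> N" "l \<ge> N" for w k l
      proof -
        have "sq_norm A \<omega> (\<lambda>x vs. h k x vs - h l x vs) < (e / C)\<^sup>2"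
          using a(1) [of k l] N [OF kl(1)] N [OF kl(2)] by linarith
        then have "sqrt (sq_norm A \<omega> (\<lambda>x vs. h k x vs - h l x vs)) < e / C"
          using e r(3) by (intro real_less_lsqrt) (auto simp: sq_norm_nonneg [OF \<omega>])
        then have "C * sqrt (sq_norm A \<omega> (\<lambda>x vs. h k x vs - h l x vs)) < e" using r(3) by (simp add: pos_less_divide_eq mult.commute)
        moreover have "cmod (local_rep A (h k) c w [u, v] - local_rep A (h l) c w [u, v]) \<le> C * sqrt (sq_norm A \<omega> (\<lambda>x vs. h k x vs - h l x vs))"
          using C [OF smooth_form_2_0_arith(1) [OF h(1) h(1)] hh w, of k l] unfolding local_rep_arith .
        ultimately show ?thesis by (simp add: dist_norm)
      qed
      then show "\<exists>N. \<forall>w\<in>ball z r. \<forall>k\<ge>N. \<forall>l\<ge>N. dist (local_rep A (h k) c w [u, v]) (local_rep A (h l) c w [u, v]) < e" by blast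
    qed
    then have "uniformly_convergent_on (ball z r) (\<lambda>k w. local_rep A (h k) c w [u, v])" by (rule Cauchy_uniformly_convergent)
    then show ?thesis using r unfolding uniformly_convergent_uniform_limit_iff by blast
  qed
  define H where "H x vs = lim (\<lambda>k. h k x vs)" for x vs
  have Hlim: "(\<lambda>k. h k x vs) \<longlonglongrightarrow> H x vs" for x vs
  proof (cases "length vs = 2")
    case False
    then show ?thesis by (simp add: H_def off)
  next
    case True
    then obtain u v where vs: "vs = [u, v]" by (metis list_length2)
    let ?c = "chart_at A x" and ?z = "chart_fun (chart_at A x) x"
    obtain r where r: "r > 0" "ball ?z r \<subseteq> chart_img ?c"
      and u: "uniform_limit (ball ?z r) (\<lambda>k w. local_rep A (h k) ?c w [u, v]) (\<lambda>w. lim (\<lambda>k. local_rep A (h k) ?c w [u, v])) sequentially"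
      using unif [OF center_in_img(1,2) [OF atlas, of x], of u v] by blast
    have "?z \<in> ball ?z r" using r(1) by simp
    from tendsto_uniform_limitI [OF u this] show ?thesis
      by (simp add: local_rep_center [OF atlas] vs H_def)
  qed
  have rlim: "(\<lambda>k. local_rep A (h k) c z vs) \<longlonglongrightarrow> local_rep A H c z vs" for c z vs
    unfolding local_rep_eq [OF atlas] by (rule Hlim)
  have Hpq: "H x \<in> pq_covectors 2 0" for x by (rule pq_2_0_limit [OF pq Hlim])
  have Hoff: "H x vs = 0" if "length vs \<noteq> 2" for x vs using Hpq [of x] that pq_2_0_iff by blast
  have loc: "\<exists>r>0. hol_on (ball z r) (\<lambda>w. local_rep A H c w [u, v]) \<and>
      (\<forall>y. (\<lambda>k. full_deriv (\<lambda>w. local_rep A (h k) c w [u, v]) z y) \<longlonglongrightarrow> full_deriv (\<lambda>w. local_rep A H c w [u, v]) z y)"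
    if c: "c \<in> A" "z \<in> chart_img c" for c z u v
  proof -
    obtain r where r: "r > 0" "ball z r \<subseteq> chart_img c"
      and u: "uniform_limit (ball z r) (\<lambda>k w. local_rep A (h k) c w [u, v]) (\<lambda>w. lim (\<lambda>k. local_rep A (h k) c w [u, v])) sequentially"
      using unif [OF c, of u v] by blast
    have u': "uniform_limit (ball z r) (\<lambda>k w. local_rep A (h k) c w [u, v]) (\<lambda>w. local_rep A H c w [u, v]) sequentially"
      using u unfolding limI [OF rlim] .
    have hol: "hol_on (ball z r) (\<lambda>w. local_rep A (h k) c w [u, v])" for k
      by (rule hol_on_subset [OF closed_two_form_hol [OF atlas h(1) h(2) c(1)] r(2)])
    have "hol_on (ball z (r / 2)) (\<lambda>w. local_rep A H c w [u, v])" by (rule hol_on_limit(1) [OF hol r(1) u'])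
    moreover have "(\<lambda>k. full_deriv (\<lambda>w. local_rep A (h k) c w [u, v]) z y) \<longlonglongrightarrow> full_deriv (\<lambda>w. local_rep A H c w [u, v]) z y" for y
      by (rule hol_on_limit(2) [OF hol r(1) u']) (use r(1) in simp)
    ultimately show ?thesis using r(1) by (intro exI [of _ "r / 2"]) auto
  qed
  have Hsm: "H \<in> smooth_forms A 2 0"
  proof (rule smooth_formsI [OF atlas Hpq])
    show "smooth_rep A H"
      unfolding smooth_rep_def [OF atlas]
    proof (intro ballI allI)
      fix c vs assume c: "c \<in> A"
      show "smooth_on (chart_img c) (\<lambda>z. local_rep A H c z vs)"
      proof (cases "length vs = 2")
        case True
        then obtain u v where vs: "vs = [u, v]" by (metis list_length2)
        have "hol_on (chart_img c) (\<lambda>z. local_rep A H c z [u, v])"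
          by (rule hol_on_local) (use loc [OF c] in blast)
        then show ?thesis unfolding vs by (rule hol_on_imp_smooth_on [OF _ chart_open(2) [OF atlas c]])
      next
        case False
        then show ?thesis by (simp add: local_rep_wrong_degree [OF atlas Hoff] smooth_on_zero)
      qed
    qed
  qed
  have dlim: "(\<lambda>k. full_deriv (\<lambda>w. local_rep A (h k) c w vs) z y) \<longlonglongrightarrow> full_deriv (\<lambda>w. local_rep A H c w vs) z y"
    if c: "c \<in> A" "z \<in> chart_img c" for c z vs y
  proof (cases "length vs = 2")
    case True
    then obtain u v where vs: "vs = [u, v]" by (metis list_length2)
    show ?thesis unfolding vs using loc [OF c, of u v] by blast
  next
    case False
    have "local_rep A H c w vs = 0" "local_rep A (h k) c w vs = 0" for w k
      by (rule local_rep_wrong_degree [OF atlas Hoff False], assumption) (rule local_rep_wrong_degree [OF atlas off False], assumption)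
    then show ?thesis by simp
  qed
  have "(\<lambda>k. d_form A (h k) x vs) \<longlonglongrightarrow> d_form A H x vs" for x vs
    unfolding d_form_def form_deriv_def Let_def alternating_deriv_def
    by (intro tendsto_sum tendsto_mult tendsto_const dlim center_in_img(1,2) [OF atlas])
  with Hsm Hlim show thesis by (rule that)
qed

text \<open>
  Subtracting the first member turns a sequence of closing forms into a sequence of holomorphic two-forms.
\<close>

lemma closing_complete:
  assumes \<omega>: "hermitian_metric A \<omega>" and \<rho>: "\<And>k. \<rho> k \<in> closing_20_forms A \<omega>"
    and a: "\<And>k l. sq_norm A \<omega> (\<lambda>x vs. \<rho> k x vs - \<rho> l x vs) \<le> a k + a l" "a \<longlonglongrightarrow> 0"
  obtains \<sigma> where "\<sigma> \<in> closing_20_forms A \<omega>" "\<And>x vs. (\<lambda>k. \<rho> k x vs) \<longlonglongrightarrow> \<sigma> x vs"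
proof -
  note \<omega>s = hermitian_metricD(2) [OF \<omega>]
  define h where "h k = (\<lambda>x vs. \<rho> k x vs - \<rho> 0 x vs)" for k
  have s0: "\<rho> 0 \<in> smooth_forms A 2 0" and c0: "\<And>x vs. d_form A (\<rho> 0) x vs + d_form A \<omega> x vs + cnj (d_form A (\<rho> 0) x vs) = 0"
    using \<rho> [of 0] unfolding closing_iff [OF \<omega>s] by blast+
  have h: "h k \<in> smooth_forms A 2 0" "d_form A (h k + cnj_form (h k)) = 0" for k
    unfolding h_def by (rule closing_arith [OF \<omega>s \<rho> \<rho>])+
  have hd: "(\<lambda>x vs. h k x vs - h l x vs) = (\<lambda>x vs. \<rho> k x vs - \<rho> l x vs)" for k l by (simp add: h_def)
  have hh: "d_form A ((\<lambda>x vs. h k x vs - h l x vs) + cnj_form (\<lambda>x vs. h k x vs - h l x vs)) = 0" for k l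
    unfolding hd by (rule closing_arith(2) [OF \<omega>s \<rho> \<rho>])
  have aa: "sq_norm A \<omega> (\<lambda>x vs. h k x vs - h l x vs) \<le> a k + a l" for k l unfolding hd by (rule a(1))
  obtain H where H: "H \<in> smooth_forms A 2 0" "\<And>x vs. (\<lambda>k. h k x vs) \<longlonglongrightarrow> H x vs"
    "\<And>x vs. (\<lambda>k. d_form A (h k) x vs) \<longlonglongrightarrow> d_form A H x vs"
    by (rule hol_forms_limit [OF \<omega> h hh aa a(2)]) (rule that)
  have d: "d_form A (h k) x vs + cnj (d_form A (h k) x vs) = 0" for k x vs
  proof -
    note smh = smooth_formsD(2) [OF atlas h(1) [of k]]
    have "d_form A (h k + cnj_form (h k)) x vs = d_form A (h k) x vs + cnj (d_form A (h k) x vs)"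
      by (simp add: d_form_add [OF atlas smh smooth_rep_cnj [OF atlas smh]] d_form_cnj [OF atlas smh] cnj_form_apply [OF atlas])
    then show ?thesis unfolding h(2) by simp
  qed
  have "(\<lambda>k. d_form A (h k) x vs + cnj (d_form A (h k) x vs)) \<longlonglongrightarrow> d_form A H x vs + cnj (d_form A H x vs)" for x vs
    by (intro tendsto_add tendsto_cnj H(3))
  then have dH: "d_form A H x vs + cnj (d_form A H x vs) = 0" for x vs
    unfolding d using LIMSEQ_unique tendsto_const by blast
  define \<sigma> where "\<sigma> = (\<lambda>x vs. \<rho> 0 x vs + H x vs)"
  have ds: "d_form A \<sigma> x vs = d_form A (\<rho> 0) x vs + d_form A H x vs" for x vs
    using d_form_linear_comb [OF atlas smooth_formsD(2) [OF atlas s0] smooth_formsD(2) [OF atlas H(1)], of 1 1 x vs] by (simp add: \<sigma>_def)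
  show thesis
  proof (rule that [of \<sigma>])
    have "d_form A \<sigma> x vs + d_form A \<omega> x vs + cnj (d_form A \<sigma> x vs) = 0" for x vs
    proof -
      have "d_form A \<sigma> x vs + d_form A \<omega> x vs + cnj (d_form A \<sigma> x vs)
        = (d_form A (\<rho> 0) x vs + d_form A \<omega> x vs + cnj (d_form A (\<rho> 0) x vs)) + (d_form A H x vs + cnj (d_form A H x vs))"
        by (simp add: ds)
      then show ?thesis unfolding c0 dH by simp
    qed
    then show "\<sigma> \<in> closing_20_forms A \<omega>"
      unfolding closing_iff [OF \<omega>s] using smooth_form_2_0_arith(3) [OF s0 H(1)] by (simp add: \<sigma>_def)
    have "(\<lambda>k. \<rho> 0 x vs + h k x vs) \<longlonglongrightarrow> \<sigma> x vs" for x vs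
      unfolding \<sigma>_def by (intro tendsto_add tendsto_const H(2))
    then show "(\<lambda>k. \<rho> k x vs) \<longlonglongrightarrow> \<sigma> x vs" for x vs by (simp add: h_def)
  qed
qed

lemma norm_integrand_tendsto:
  assumes \<omega>: "hermitian_metric A \<omega>" and \<rho>: "\<And>k. \<rho> k \<in> smooth_forms A 2 0" and \<sigma>: "\<sigma> \<in> smooth_forms A 2 0"
    and lim: "\<And>x vs. (\<lambda>k. \<rho> k x vs) \<longlonglongrightarrow> \<sigma> x vs"
  shows "(\<lambda>k. norm_integrand A \<omega> (\<rho> k) z) \<longlonglongrightarrow> norm_integrand A \<omega> \<sigma> z"
  unfolding norm_integrand_def
proof (rule tendsto_sum)
  fix c assume c: "c \<in> fst (pou A)"
  note cA = pouD(2) [OF c]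
  show "(\<lambda>k. indicator (chart_img c) z * (snd (pou A) c (chart_inv c z) * norm_density (local_rep A \<omega> c z) (local_rep A (\<rho> k) c z)))
    \<longlonglongrightarrow> indicator (chart_img c) z * (snd (pou A) c (chart_inv c z) * norm_density (local_rep A \<omega> c z) (local_rep A \<sigma> c z))"
  proof (cases "z \<in> chart_img c")
    case True
    have "(\<lambda>k. norm_density (local_rep A \<omega> c z) (local_rep A (\<rho> k) c z)) \<longlonglongrightarrow> norm_density (local_rep A \<omega> c z) (local_rep A \<sigma> c z)"
    proof (rule norm_density_tendsto)
      show "metric_covector (local_rep A \<omega> c z)" by (rule local_rep_metric [OF hermitian_metricD(1) [OF \<omega>] cA True])
      show "local_rep A (\<rho> k) c z \<in> pq_covectors 2 0" for k by (rule local_rep_2_0 [OF smooth_formsD(1) [OF atlas \<rho>] cA True])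
      show "local_rep A \<sigma> c z \<in> pq_covectors 2 0" by (rule local_rep_2_0 [OF smooth_formsD(1) [OF atlas \<sigma>] cA True])
      show "(\<lambda>k. local_rep A (\<rho> k) c z vs) \<longlonglongrightarrow> local_rep A \<sigma> c z vs" for vs unfolding local_rep_eq [OF atlas] by (rule lim)
    qed
    then show ?thesis by (intro tendsto_mult tendsto_const)
  qed simp
qed

text \<open>
  By the parallelogram law, and because the mean of two closing forms is a closing form, two closing forms whose
  squared norms are within \<open>\<epsilon>\<close> of the infimum differ by a form of squared norm at most \<open>4 \<epsilon>\<close>.  This gives both convergence of a minimising
  sequence and uniqueness.
\<close>

lemma minimal_closing_form:
  assumes \<omega>: "hermitian_metric A \<omega>" and ne: "\<rho>0 \<in> closing_20_forms A \<omega>"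
  shows "\<exists>!\<rho>. \<rho> \<in> closing_20_forms A \<omega> \<and> (\<forall>\<sigma>\<in>closing_20_forms A \<omega>. sq_norm A \<omega> \<rho> \<le> sq_norm A \<omega> \<sigma>)"
proof -
  let ?C = "closing_20_forms A \<omega>" and ?N = "sq_norm A \<omega>"
  note \<omega>s = hermitian_metricD(2) [OF \<omega>]
  have CS: "\<rho> \<in> smooth_forms A 2 0" if "\<rho> \<in> ?C" for \<rho> using that closing_iff [OF \<omega>s] by blast
  define m where "m = Inf (?N ` ?C)"
  have bdd: "bdd_below (?N ` ?C)" using sq_norm_nonneg [OF \<omega>] by (intro bdd_belowI2)
  have m: "m \<le> ?N \<rho>" if "\<rho> \<in> ?C" for \<rho> unfolding m_def by (rule cInf_lower [OF _ bdd]) (use that in blast)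
  have par: "?N (\<lambda>x vs. \<rho> x vs - \<sigma> x vs) \<le> 2 * ?N \<rho> + 2 * ?N \<sigma> - 4 * m" if "\<rho> \<in> ?C" "\<sigma> \<in> ?C" for \<rho> \<sigma>
    using sq_norm_parallelogram [OF \<omega> CS [OF that(1)] CS [OF that(2)]] m [OF closing_arith(3) [OF \<omega>s that]] by linarith
  have "\<exists>\<rho>\<in>?C. ?N \<rho> < m + 1 / real (Suc k)" for k
  proof -
    have "Inf (?N ` ?C) < m + 1 / real (Suc k)" by (simp add: m_def)
    from cInf_lessD [OF _ this] show ?thesis using ne by blast
  qed
  then have "\<forall>k. \<exists>\<rho>. \<rho> \<in> ?C \<and> ?N \<rho> < m + 1 / real (Suc k)" by blast
  from choice [OF this] obtain \<rho> where \<rho>: "\<And>k. \<rho> k \<in> ?C" "\<And>k. ?N (\<rho> k) < m + 1 / real (Suc k)" by blast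
  \<comment> \<open>The parallelogram law bounds the squared norm of \<open>\<rho> k - \<rho> l\<close> by \<open>a k + a l\<close>.\<close>
  define a where "a k = 2 * (1 / real (Suc k))" for k
  have "a \<longlonglongrightarrow> 2 * 0" unfolding a_def by (intro tendsto_mult tendsto_const LIMSEQ_Suc [OF lim_const_over_n])
  then have a0: "a \<longlonglongrightarrow> 0" by simp
  have aa: "?N (\<lambda>x vs. \<rho> k x vs - \<rho> l x vs) \<le> a k + a l" for k l
    using par [OF \<rho>(1) \<rho>(1), of k l] \<rho>(2) [of k] \<rho>(2) [of l] unfolding a_def by linarith
  obtain \<sigma> where \<sigma>: "\<sigma> \<in> ?C" "\<And>x vs. (\<lambda>k. \<rho> k x vs) \<longlonglongrightarrow> \<sigma> x vs"
    by (rule closing_complete [OF \<omega> \<rho>(1) aa a0]) (rule that)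
  have Nlim: "(\<lambda>k. ?N (\<rho> k)) \<longlonglongrightarrow> m"
  proof (rule tendsto_sandwich)
    show "\<forall>\<^sub>F k in sequentially. m \<le> ?N (\<rho> k)" using m \<rho>(1) by simp
    show "\<forall>\<^sub>F k in sequentially. ?N (\<rho> k) \<le> m + 1 / real (Suc k)" using \<rho>(2) by (simp add: less_imp_le)
    have "(\<lambda>k. m + 1 / real (Suc k)) \<longlonglongrightarrow> m + 0" by (intro tendsto_add tendsto_const LIMSEQ_Suc [OF lim_const_over_n])
    then show "(\<lambda>k. m + 1 / real (Suc k)) \<longlonglongrightarrow> m" by simp
  qed simp
  have \<sigma>m: "?N \<sigma> \<le> m"
    unfolding sq_norm_def
  proof (rule real_fatou)
    show "integrable lborel (norm_integrand A \<omega> (\<rho> k))" for k by (rule norm_integrand_integrable_hermitian [OF \<omega> CS [OF \<rho>(1)]])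
    show "integrable lborel (norm_integrand A \<omega> \<sigma>)" by (rule norm_integrand_integrable_hermitian [OF \<omega> CS [OF \<sigma>(1)]])
    show "0 \<le> norm_integrand A \<omega> (\<rho> k) z" for k z by (rule norm_integrand_nonneg [OF hermitian_metricD(1) [OF \<omega>]])
    show "(\<lambda>k. norm_integrand A \<omega> (\<rho> k) z) \<longlonglongrightarrow> norm_integrand A \<omega> \<sigma> z" for z
      by (rule norm_integrand_tendsto [OF \<omega> CS [OF \<rho>(1)] CS [OF \<sigma>(1)] \<sigma>(2)])
    show "(\<lambda>k. \<integral>z. norm_integrand A \<omega> (\<rho> k) z \<partial>lborel) \<longlonglongrightarrow> m" using Nlim by (simp add: sq_norm_def)
  qed
  show ?thesis
  proof (rule ex1I [of _ \<sigma>])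
    show "\<sigma> \<in> ?C \<and> (\<forall>\<tau>\<in>?C. ?N \<sigma> \<le> ?N \<tau>)" using \<sigma>(1) \<sigma>m m by fastforce
    fix \<tau> assume \<tau>: "\<tau> \<in> ?C \<and> (\<forall>\<sigma>\<in>?C. ?N \<tau> \<le> ?N \<sigma>)"
    then have t: "\<tau> \<in> ?C" "?N \<tau> \<le> ?N \<sigma>" using \<sigma>(1) by auto
    have "?N (\<lambda>x vs. \<tau> x vs - \<sigma> x vs) = 0"
      using par [OF t(1) \<sigma>(1)] t(2) \<sigma>m sq_norm_nonneg [OF \<omega>, of "\<lambda>x vs. \<tau> x vs - \<sigma> x vs"] by linarith
    then have "\<tau> x vs - \<sigma> x vs = 0" for x vs
      by (rule sq_norm_zero_imp [OF \<omega> smooth_form_2_0_arith(1) [OF CS [OF t(1)] CS [OF \<sigma>(1)]]])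
    then show "\<tau> = \<sigma>" by (simp add: fun_eq_iff)
  qed
qed

lemma torsion_form_minimal:
  assumes \<omega>: "hermitian_metric A \<omega>" and ne: "\<rho>0 \<in> closing_20_forms A \<omega>"
  shows "torsion_form A \<omega> \<in> closing_20_forms A \<omega>" "energy A \<omega> = sq_norm A \<omega> (torsion_form A \<omega>)"
    "\<sigma> \<in> closing_20_forms A \<omega> \<Longrightarrow> energy A \<omega> \<le> sq_norm A \<omega> \<sigma>"
proof -
  have CS: "\<rho> \<in> smooth_forms A 2 0" if "\<rho> \<in> closing_20_forms A \<omega>" for \<rho>
    using that closing_iff [OF hermitian_metricD(2) [OF \<omega>]] by blast
  have "(\<rho> \<in> closing_20_forms A \<omega> \<and> (\<forall>\<sigma>\<in>closing_20_forms A \<omega>. L2_norm_form A \<omega> 2 \<rho> \<le> L2_norm_form A \<omega> 2 \<sigma>)) \<longleftrightarrow>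
     (\<rho> \<in> closing_20_forms A \<omega> \<and> (\<forall>\<sigma>\<in>closing_20_forms A \<omega>. sq_norm A \<omega> \<rho> \<le> sq_norm A \<omega> \<sigma>))" for \<rho>
    using L2_norm_sq_norm [OF \<omega> CS] by auto
  then have T: "torsion_form A \<omega> = (THE \<rho>. \<rho> \<in> closing_20_forms A \<omega> \<and> (\<forall>\<sigma>\<in>closing_20_forms A \<omega>. sq_norm A \<omega> \<rho> \<le> sq_norm A \<omega> \<sigma>))"
    by (simp add: torsion_form_def)
  have t: "torsion_form A \<omega> \<in> closing_20_forms A \<omega> \<and> (\<forall>\<sigma>\<in>closing_20_forms A \<omega>. sq_norm A \<omega> (torsion_form A \<omega>) \<le> sq_norm A \<omega> \<sigma>)"
    unfolding T by (rule theI' [OF minimal_closing_form [OF \<omega> ne]])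
  then show "torsion_form A \<omega> \<in> closing_20_forms A \<omega>" by blast
  show e: "energy A \<omega> = sq_norm A \<omega> (torsion_form A \<omega>)"
    unfolding energy_def using L2_norm_sq_norm [OF \<omega> CS] t sq_norm_nonneg [OF \<omega>] by simp
  show "\<sigma> \<in> closing_20_forms A \<omega> \<Longrightarrow> energy A \<omega> \<le> sq_norm A \<omega> \<sigma>" unfolding e using t by blast
qed

section \<open>Exact perturbations of a metric\<close>

text \<open>
  Written as the linear combination to which \<open>smooth_rep_linear_comb\<close> applies.
\<close>

lemma del_eq: "del A \<alpha> = (\<lambda>x vs. 1 * d_form A \<alpha> x vs + (-1) * delbar A \<alpha> x vs)"
  using del_plus_delbar [OF atlas, of \<alpha>] by (simp add: fun_eq_iff algebra_simps flip: add_implies_diff)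

lemma del_smooth_form:
  assumes \<alpha>: "\<alpha> \<in> smooth_forms A 1 0" shows "del A \<alpha> \<in> smooth_forms A 2 0"
proof (rule smooth_formsI [OF atlas])
  note A = atlas
  show "smooth_rep A (del A \<alpha>)"
    unfolding del_eq by (rule smooth_rep_linear_comb [OF A smooth_rep_form_deriv [OF A \<alpha>]])
  fix x
  note pq = smooth_formsD(1) [OF A \<alpha>] and sm = smooth_formsD(2) [OF A \<alpha>]
  let ?c = "chart_at A x" and ?z = "chart_fun (chart_at A x) x"
  note c = center_in_img(1,2) [OF A, of x]
  define B where "B u v = hol_deriv (\<lambda>w. local_rep A \<alpha> ?c w [v]) ?z u" for u v
  have B: "B u v = (\<Sum>i\<in>UNIV. v $ i * hol_deriv (\<lambda>w. local_rep A \<alpha> ?c w [axis i 1]) ?z u)" for u v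
    unfolding B_def hol_deriv_def one_form_full_deriv [OF A pq sm c, of v]
    by (simp add: sum_distrib_left flip: sum_subtractf sum_divide_distrib) (simp add: algebra_simps)
  have lin: "linear (full_deriv (\<lambda>w. local_rep A \<alpha> ?c w vs) ?z)" for vs
    by (rule linear_full_deriv [OF smooth_repD(2) [OF A sm c]])
  have Blin1: "linear (\<lambda>u. B u v)" for v
    unfolding B_def hol_deriv_def
    by (rule linearI) (simp_all add: linear_add [OF lin] linear_scale [OF lin] smult_add smult_scaleR
        scaleR_conv_of_real [where 'a = complex] add_divide_distrib diff_divide_distrib distrib_left right_diff_distrib mult.left_commute)
  have Blin2: "linear (\<lambda>v. B u v)" for u
    unfolding B by (rule linearI) (simp_all add: algebra_simps sum.distrib scaleR_sum_right)
  have Bi1: "B (\<i> *s u) v = \<i> * B u v" for u v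
    unfolding B_def hol_deriv_def by (simp add: smult_ii linear_neg [OF lin] algebra_simps diff_divide_distrib add_divide_distrib)
  have Bi2: "B u (\<i> *s v) = \<i> * B u v" for u v
    unfolding B by (simp add: sum_distrib_left algebra_simps)
  have two: "del A \<alpha> x [u, v] = B u v - B v u" for u v
    by (simp add: del_def form_deriv_def Let_def alternating_deriv_two B_def)
  have "length xs \<noteq> 1 \<Longrightarrow> \<alpha> x xs = 0" for x xs using pq [of x] pq_1_0_iff by blast
  note off' = local_rep_wrong_degree [OF A this]
  have off: "del A \<alpha> x xs = 0" if "length xs \<noteq> 2" for xs
    unfolding del_def form_deriv_def Let_def
    by (rule alternating_deriv_wrong_degree [where k = 1]) (use off' that in \<open>auto simp: hol_deriv_def\<close>)
  have "alternating (del A \<alpha> x)"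
    by (rule alternating_deg2 [OF A off]) (simp_all add: two linear_compose_sub Blin1 Blin2)
  moreover have "del A \<alpha> x [\<i> *s u, v] = \<i> * del A \<alpha> x [u, v]" for u v
    by (simp add: two Bi1 Bi2 right_diff_distrib)
  ultimately show "del A \<alpha> x \<in> pq_covectors 2 0" unfolding pq_2_0_iff using off by blast
qed

text \<open>
  \<open>d (\<partial>u) = - d (delbar A u)\<close> because \<open>d (d u) = 0\<close>; together with the conjugate identity, the
  changes of \<open>\<sigma>\<close> and of \<open>\<omega>\<close> cancel.
\<close>

lemma closing_translate:
  assumes \<omega>: "smooth_rep A \<omega>" and \<sigma>: "\<sigma> \<in> closing_20_forms A \<omega>" and u: "u \<in> smooth_forms A 1 0"
  shows "(\<lambda>x vs. \<sigma> x vs + of_real s * del A u x vs)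
    \<in> closing_20_forms A (\<omega> + scale_form s (delbar A u + del A (cnj_form u)))"
proof -
  note A = atlas
  note sm = smooth_formsD(2) [OF A u]
  note smd = smooth_formsD(2) [OF A del_smooth_form [OF u]] and smb = smooth_formsD(2) [OF A delbar_smooth_form [OF A u]]
  have s: "\<sigma> \<in> smooth_forms A 2 0" and c: "\<And>x vs. d_form A \<sigma> x vs + d_form A \<omega> x vs + cnj (d_form A \<sigma> x vs) = 0"
    using \<sigma> unfolding closing_iff [OF \<omega>] by blast+
  let ?g = "delbar A u + cnj_form (delbar A u)"
  have g: "smooth_rep A ?g" by (rule smooth_rep_add [OF A smb smooth_rep_cnj [OF A smb]])
  have "d_form A (del A u + delbar A u) = 0" unfolding del_plus_delbar [OF A] by (rule d_d_zero [OF A u])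
  then have dd: "d_form A (del A u) x vs = - d_form A (delbar A u) x vs" for x vs
    unfolding d_form_add [OF A smd smb] by (simp add: fun_eq_iff eq_neg_iff_add_eq_0)
  have d1: "d_form A (\<lambda>x vs. \<sigma> x vs + of_real s * del A u x vs) x vs = d_form A \<sigma> x vs + of_real s * d_form A (del A u) x vs" for x vs
    using d_form_linear_comb [OF A smooth_formsD(2) [OF A s] smd, of 1 "of_real s" x vs] by simp
  have d2: "d_form A (\<omega> + scale_form s ?g) x vs
      = d_form A \<omega> x vs + of_real s * (d_form A (delbar A u) x vs + cnj (d_form A (delbar A u) x vs))" for x vs
    unfolding d_form_add [OF A \<omega> smooth_rep_scale [OF A g]] d_form_scale [OF A g] d_form_add [OF A smb smooth_rep_cnj [OF A smb]] d_form_cnj [OF A smb]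
    by (simp add: scale_form_def cnj_form_apply [OF A])
  have "d_form A (\<lambda>x vs. \<sigma> x vs + of_real s * del A u x vs) x vs + d_form A (\<omega> + scale_form s ?g) x vs
     + cnj (d_form A (\<lambda>x vs. \<sigma> x vs + of_real s * del A u x vs) x vs) = 0" for x vs
    using c [of x vs] by (simp add: d1 d2 dd algebra_simps)
  moreover have "(\<lambda>x vs. \<sigma> x vs + of_real s * del A u x vs) \<in> smooth_forms A 2 0"
    using smooth_form_linear_comb_2_0 [OF A s del_smooth_form [OF u], of 1 "of_real s"] by simp
  ultimately show ?thesis
    unfolding del_cnj [OF A sm] closing_iff [OF smooth_rep_add [OF A \<omega> smooth_rep_scale [OF A g]]] by blast
qed

lemma exact_perturbation:
  assumes u: "u \<in> smooth_forms A 1 0"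
  shows "delbar A u + del A (cnj_form u) \<in> smooth_forms A 1 1" "cnj (((delbar A u + del A (cnj_form u)) x) vs) = (delbar A u + del A (cnj_form u)) x vs"
    "riem ((delbar A u + del A (cnj_form u)) x) v v = 2 * riem (delbar A u x) v v"
proof -
  note A = atlas
  note b = delbar_smooth_form [OF A u]
  have eq: "delbar A u + del A (cnj_form u) = (\<lambda>x vs. 1 * delbar A u x vs + 1 * cnj_form (delbar A u) x vs)"
    unfolding del_cnj [OF A smooth_formsD(2) [OF A u]] by (simp add: fun_eq_iff)
  show "delbar A u + del A (cnj_form u) \<in> smooth_forms A 1 1"
    unfolding eq by (rule smooth_form_linear_comb_1_1 [OF A b cnj_smooth_form_1_1 [OF A b]])
  show "cnj (((delbar A u + del A (cnj_form u)) x) vs) = (delbar A u + del A (cnj_form u)) x vs"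
    unfolding eq by (simp add: cnj_form_apply [OF A] add.commute)
  show "riem ((delbar A u + del A (cnj_form u)) x) v v = 2 * riem (delbar A u x) v v"
    unfolding eq riem_def by (simp add: cnj_form_apply [OF A])
qed

lemma hermitian_metric_addI:
  assumes \<omega>: "\<omega> \<in> smooth_forms A 1 1" "\<And>x vs. cnj (\<omega> x vs) = \<omega> x vs"
    and \<gamma>: "\<gamma> \<in> smooth_forms A 1 1" "\<And>x vs. cnj (\<gamma> x vs) = \<gamma> x vs"
    and pos: "\<And>x v. v \<noteq> 0 \<Longrightarrow> 0 < riem (\<omega> x) v v + s * riem (\<gamma> x) v v"
  shows "hermitian_metric A (\<omega> + scale_form s \<gamma>)"
proof -
  have eq: "\<omega> + scale_form s \<gamma> = (\<lambda>x vs. 1 * \<omega> x vs + of_real s * \<gamma> x vs)"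
    by (simp add: fun_eq_iff scale_form_def)
  have "positive_definite ((\<omega> + scale_form s \<gamma>) x)" for x
    unfolding positive_definite_def cnj_covector_def fun_eq_iff
    using pos [of _ x] \<omega>(2) \<gamma>(2) by (simp add: riem_def scale_form_def)
  moreover have "\<omega> + scale_form s \<gamma> \<in> smooth_forms A 1 1"
    unfolding eq by (rule smooth_form_linear_comb_1_1 [OF atlas \<omega>(1) \<gamma>(1)])
  ultimately show ?thesis by (simp add: hermitian_metric_def)
qed

text \<open>
  In a chart, \<open>\<omega>\<close> is bounded from below and \<open>\<gamma>\<close> from above by multiples of the Euclidean metric, locally uniformly; then
  compactness.
\<close>

lemma small_perturbation_positive:
  assumes \<omega>: "hermitian_metric A \<omega>" and \<gamma>: "\<gamma> \<in> smooth_forms A 1 1"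
  obtains s0 where "s0 > 0" "\<And>s y v. \<bar>s\<bar> < s0 \<Longrightarrow> v \<noteq> 0 \<Longrightarrow> 0 < riem (\<omega> y) v v + s * riem (\<gamma> y) v v"
proof -
  note A = atlas
  have "\<exists>U s0. open U \<and> x \<in> U \<and> s0 > 0 \<and> (\<forall>y\<in>U. \<forall>s v. \<bar>s\<bar> < s0 \<longrightarrow> v \<noteq> 0 \<longrightarrow> 0 < riem (\<omega> y) v v + s * riem (\<gamma> y) v v)" for x
  proof -
    let ?c = "chart_at A x" and ?z = "chart_fun (chart_at A x) x"
    note c = center_in_img [OF A, of x]
    note ci = chart_inverse [OF A c(1)]
    note co = chart_open [OF A c(1)]
    obtain \<delta> r where \<delta>: "\<delta> > 0" "r > 0" "ball ?z r \<subseteq> chart_img ?c"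
      "\<And>w v. w \<in> ball ?z r \<Longrightarrow> \<delta> * (norm v)\<^sup>2 \<le> riem (local_rep A \<omega> ?c w) v v"
      by (rule metric_local_lower [OF co(2) local_rep_metric [OF hermitian_metricD(1) [OF \<omega>] c(1)]
            smooth_onD(1) [OF smooth_repD(1) [OF A hermitian_metricD(2) [OF \<omega>] c(1)]] c(2)], assumption, rule that)
    define D where "D w = (\<Sum>b\<in>Basis. \<Sum>b'\<in>Basis. \<bar>riem (local_rep A \<gamma> ?c w) b b'\<bar>)" for w
    have "continuous_on (chart_img ?c) D"
      unfolding D_def
      by (intro continuous_on_sum continuous_on_rabs continuous_riem smooth_onD(1) [OF smooth_repD(1) [OF A smooth_formsD(2) [OF A \<gamma>] c(1)]])
    then have "isCont D ?z" using continuous_on_eq_continuous_at [OF co(2)] c(2) by blast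
    then have "(D \<longlongrightarrow> D ?z) (nhds ?z)" unfolding isCont_def by (rule tendsto_at_iff_tendsto_nhds [THEN iffD1])
    then have "\<forall>\<^sub>F w in nhds ?z. D w < D ?z + 1" by (rule order_tendstoD(2)) simp
    then obtain r2 where r2: "r2 > 0" "\<And>w. dist w ?z < r2 \<Longrightarrow> D w < D ?z + 1" unfolding eventually_nhds_metric by blast
    have D0: "0 \<le> D w" for w unfolding D_def by (intro sum_nonneg) auto
    define U where "U = chart_dom ?c \<inter> chart_fun ?c -` ball ?z (min r r2)"
    have "open U" unfolding U_def by (rule continuous_open_preimage [OF ci(5) co(1) open_ball])
    moreover have "x \<in> U" using chart_at(2) [OF A, of x] \<delta>(2) r2(1) by (simp add: U_def)
    moreover have "\<delta> / (D ?z + 1) > 0" using \<delta>(1) D0 [of ?z] by simp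
    moreover have "0 < riem (\<omega> y) v v + s * riem (\<gamma> y) v v" if y: "y \<in> U" and s: "\<bar>s\<bar> < \<delta> / (D ?z + 1)" and v: "v \<noteq> 0" for y s v
    proof -
      let ?w = "chart_fun ?c y"
      have w: "?w \<in> ball ?z r" "dist ?w ?z < r2" "?w \<in> chart_img ?c" "chart_inv ?c ?w = y"
        using y \<delta>(3) ci(1) by (auto simp: U_def dist_commute)
      obtain T where T: "complex_linear T" "inj T" "\<And>\<alpha> vs. local_rep A \<alpha> ?c ?w vs = \<alpha> (chart_inv ?c ?w) (map T vs)"
        by (rule local_rep_pull [OF A c(1) w(3)]) (rule that)
      have Tl: "linear T" "\<And>v. T (\<i> *s v) = \<i> *s T v" using T(1) by (auto simp: complex_linear_def)
      obtain v' where v': "v = T v'" using linear_injective_imp_surjective [OF Tl(1) T(2)] by (metis surjD)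
      have rr: "riem (\<alpha> y) v v = riem (local_rep A \<alpha> ?c ?w) v' v'" for \<alpha>
        by (simp add: riem_def T(3) w(4) v' Tl(2))
      have v0: "norm v' > 0" using v v' linear_0 [OF Tl(1)] by auto
      have gpq: "local_rep A \<gamma> ?c ?w \<in> pq_covectors 1 1"
        by (rule local_rep_pq(3) [OF A c(1) w(3) smooth_formsD(1) [OF A \<gamma>]])
      have "\<bar>riem (local_rep A \<gamma> ?c ?w) v' v'\<bar> \<le> D ?w * (norm v')\<^sup>2"
        unfolding D_def by (rule bilinear_norm_bound [OF hermitian_form_bilinear [OF riem_hermitian [OF gpq]]])
      also have "\<dots> \<le> (D ?z + 1) * (norm v')\<^sup>2" using r2(2) [OF w(2)] by (intro mult_right_mono) auto
      finally have "\<bar>s\<bar> * \<bar>riem (local_rep A \<gamma> ?c ?w) v' v'\<bar> \<le> \<bar>s\<bar> * ((D ?z + 1) * (norm v')\<^sup>2)" by (rule mult_left_mono) simp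
      also have "\<dots> = (\<bar>s\<bar> * (D ?z + 1)) * (norm v')\<^sup>2" by (simp only: mult.assoc)
      also have "\<dots> < \<delta> * (norm v')\<^sup>2"
      proof (rule mult_strict_right_mono)
        show "\<bar>s\<bar> * (D ?z + 1) < \<delta>" using s D0 [of ?z] by (simp add: pos_less_divide_eq)
      qed (use v0 in simp)
      also have "\<dots> \<le> riem (local_rep A \<omega> ?c ?w) v' v'" by (rule \<delta>(4) [OF w(1)])
      finally have "\<bar>s * riem (\<gamma> y) v v\<bar> < riem (\<omega> y) v v" by (simp add: rr abs_mult)
      then show ?thesis by linarith
    qed
    ultimately show ?thesis by blast
  qed
  then obtain U S where US: "\<And>x. open (U x)" "\<And>x. x \<in> U x" "\<And>x. S x > (0::real)"
    "\<And>x y s v. y \<in> U x \<Longrightarrow> \<bar>s\<bar> < S x \<Longrightarrow> v \<noteq> 0 \<Longrightarrow> 0 < riem (\<omega> y) v v + s * riem (\<gamma> y) v v" by metis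
  have cpt: "compact (UNIV :: 'm set)" using M by (simp add: compact_complex_manifold_def)
  obtain X where X: "finite X" "UNIV \<subseteq> (\<Union>x\<in>X. U x)"
    using compactE_image [OF cpt, of UNIV U] US(1,2) by (metis UNIV_I UN_I subsetI)
  have Xne: "X \<noteq> {}" using X(2) by auto
  show thesis
  proof (rule that [of "Min (S ` X)"])
    show "Min (S ` X) > 0" using X(1) Xne US(3) by simp
    fix s :: real and y v assume s: "\<bar>s\<bar> < Min (S ` X)" and v: "v \<noteq> (0 :: complex^'n)"
    obtain x where x: "x \<in> X" "y \<in> U x" using X(2) by blast
    then have "\<bar>s\<bar> < S x" using s X(1) Xne by simp
    then show "0 < riem (\<omega> y) v v + s * riem (\<gamma> y) v v" by (rule US(4) [OF x(2) _ v])
  qed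
qed

text \<open>
  A member of the class is an exact perturbation with \<open>s = 1\<close>, so that closing forms of \<open>\<omega>0\<close> yield closing forms
  of \<open>\<omega>\<close>.
\<close>

lemma metric_class_hermitian:
  assumes \<omega>0: "hermitian_symplectic A \<omega>0" and \<omega>: "\<omega> \<in> metric_class A \<omega>0"
  shows "hermitian_metric A \<omega>" "\<exists>\<sigma>. \<sigma> \<in> closing_20_forms A \<omega>"
proof -
  obtain u where u: "u \<in> smooth_forms A 1 0" "\<omega> = \<omega>0 + del A (cnj_form u) + delbar A u" and pos: "\<And>x. positive_definite (\<omega> x)"
    using \<omega> unfolding metric_class_def by blast
  have h0: "hermitian_metric A \<omega>0" using \<omega>0 by (simp add: hermitian_symplectic_def)
  obtain \<sigma> where \<sigma>: "\<sigma> \<in> closing_20_forms A \<omega>0" using \<omega>0 unfolding hermitian_symplectic_def by blast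
  have eq: "\<omega> = \<omega>0 + scale_form 1 (delbar A u + del A (cnj_form u))"
    unfolding u(2) by (simp add: scale_form_def fun_eq_iff)
  have "\<omega> = (\<lambda>x vs. 1 * \<omega>0 x vs + 1 * (delbar A u + del A (cnj_form u)) x vs)"
    unfolding u(2) by (simp add: fun_eq_iff)
  also have "\<dots> \<in> smooth_forms A 1 1"
    by (rule smooth_form_linear_comb_1_1 [OF atlas hermitian_metricD(3) [OF h0] exact_perturbation(1) [OF u(1)]])
  finally show "hermitian_metric A \<omega>" using pos by (simp add: hermitian_metric_def)
  show "\<exists>\<sigma>. \<sigma> \<in> closing_20_forms A \<omega>"
    unfolding eq using closing_translate [OF hermitian_metricD(2) [OF h0] \<sigma> u(1)] by blast
qed

text \<open>
  With \<open>\<sigma> = \<rho>\<close> and \<open>u = \<xi>\<close>, the translated closing form is the multiple \<open>(1 + s) \<rho>\<close> of the torsion form.  For \<open>s < 0\<close> its norm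
  can be estimated by the norm for the larger metric \<open>\<omega>\<close>.
\<close>

lemma energy_perturbation_le:
  assumes \<omega>: "hermitian_metric A \<omega>" and \<rho>: "torsion_form A \<omega> \<in> closing_20_forms A \<omega>" "torsion_form A \<omega> = del A \<xi>"
    and \<xi>: "\<xi> \<in> smooth_forms A 1 0" and semi: "weakly_semipositive 1 (delbar A \<xi>)"
  obtains s0 where "s0 > 0" "\<And>s. - s0 < s \<Longrightarrow> s < 0 \<Longrightarrow>
    energy A (\<omega> + scale_form s (delbar A \<xi> + del A (cnj_form \<xi>))) \<le> (1 + s)\<^sup>2 * energy A \<omega>"
proof -
  note A = atlas
  let ?\<gamma> = "delbar A \<xi> + del A (cnj_form \<xi>)"
  note \<gamma> = exact_perturbation [OF \<xi>]
  have \<gamma>0: "riem (?\<gamma> x) v v \<ge> 0" for x v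
  proof -
    have "riem (delbar A \<xi> x) v v \<ge> 0"
      by (rule weakly_semipositive_imp_nonneg [OF hermitian_metricD(1) [OF \<omega>, of x] smooth_formsD(1) [OF A delbar_smooth_form [OF A \<xi>]]])
        (use semi in \<open>simp add: weakly_semipositive_def\<close>)
    then show ?thesis unfolding \<gamma>(3) by simp
  qed
  obtain s0 where s0: "s0 > 0" "\<And>s y v. \<bar>s\<bar> < s0 \<Longrightarrow> v \<noteq> 0 \<Longrightarrow> 0 < riem (\<omega> y) v v + s * riem (?\<gamma> y) v v"
    by (rule small_perturbation_positive [OF \<omega> \<gamma>(1)]) (rule that)
  have s\<rho>: "torsion_form A \<omega> \<in> smooth_forms A 2 0" unfolding \<rho>(2) by (rule del_smooth_form [OF \<xi>])
  show thesis
  proof (rule that [OF s0(1)])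
    fix s assume s: "- s0 < s" "s < 0"
    let ?\<omega> = "\<omega> + scale_form s ?\<gamma>" and ?\<rho> = "\<lambda>x vs. of_real (1 + s) * torsion_form A \<omega> x vs"
    have hs: "hermitian_metric A ?\<omega>"
      by (rule hermitian_metric_addI [OF hermitian_metricD(3) [OF \<omega>] metric_covectorD(7) [OF hermitian_metricD(1) [OF \<omega>]] \<gamma>(1,2)])
        (rule s0(2), use s in auto)
    have eq: "?\<rho> = (\<lambda>x vs. torsion_form A \<omega> x vs + of_real s * del A \<xi> x vs)"
      by (simp add: \<rho>(2)[symmetric] fun_eq_iff algebra_simps)
    have cl: "?\<rho> \<in> closing_20_forms A ?\<omega>"
      unfolding eq by (rule closing_translate [OF hermitian_metricD(2) [OF \<omega>] \<rho>(1) \<xi>])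
    have "energy A ?\<omega> \<le> sq_norm A ?\<omega> ?\<rho>" by (rule torsion_form_minimal(3) [OF hs cl cl])
    also have "\<dots> = (1 + s)\<^sup>2 * sq_norm A ?\<omega> (torsion_form A \<omega>)" by (rule sq_norm_scale [OF hs s\<rho>])
    also have "\<dots> \<le> (1 + s)\<^sup>2 * sq_norm A \<omega> (torsion_form A \<omega>)"
    proof (rule mult_left_mono [OF sq_norm_mono [OF \<omega> hs s\<rho>]])
      show "riem (?\<omega> x) v v \<le> riem (\<omega> x) v v" for x v
        using mult_nonpos_nonneg [of s, OF _ \<gamma>0 [of x v]] s(2) by (simp add: riem_def scale_form_def)
    qed simp
    also have "\<dots> = (1 + s)\<^sup>2 * energy A \<omega>" using torsion_form_minimal(2) [OF \<omega> \<rho>(1)] by simp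
    finally show "energy A ?\<omega> \<le> (1 + s)\<^sup>2 * energy A \<omega>" .
  qed
qed

end

section \<open>Critical points\<close>

text \<open>
  The function \<open>(1 + s)\<^sup>2 f 0 - f s\<close> is nonnegative for \<open>s < 0\<close> and 0 at \<open>s = 0\<close>, and its derivative there is \<open>2 f 0\<close>, which
  therefore is not positive.
\<close>

lemma critical_value_zero:
  fixes f :: "real \<Rightarrow> real"
  assumes f: "(f has_real_derivative 0) (at 0)" and s0: "s0 > 0"
    and le: "\<And>s. - s0 < s \<Longrightarrow> s < 0 \<Longrightarrow> f s \<le> (1 + s)\<^sup>2 * f 0" and nn: "f 0 \<ge> 0"
  shows "f 0 = 0"
proof (rule ccontr)
  assume "f 0 \<noteq> 0"
  then have e: "f 0 > 0" using nn by simp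
  have "((\<lambda>s. (1 + s)\<^sup>2 * f 0 - f s) has_real_derivative 2 * f 0) (at 0)"
    by (rule derivative_eq_intros f refl | simp)+
  from DERIV_pos_inc_left [OF this] e obtain d where d: "d > 0" "\<And>h. 0 < h \<Longrightarrow> h < d \<Longrightarrow> (1 - h)\<^sup>2 * f 0 - f (- h) < 0"
    by auto
  define h where "h = min s0 d / 2"
  have h: "0 < h" "h < d" "h < s0" using s0 d(1) by (auto simp: h_def)
  show False using le [of "- h"] d(2) [OF h(1,2)] h by simp
qed

theorem corollary1p7:
  fixes A :: "('m::t2_space, 'n::finite) chart set"
    and \<omega>\<^sub>0 \<omega> :: "('m, 'n) form"
  assumes "compact_complex_manifold A"
    and "hermitian_symplectic A \<omega>\<^sub>0"
    and "\<omega> \<in> metric_class A \<omega>\<^sub>0"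
    and "critical_point A \<omega>\<^sub>0 \<omega>"
    and "\<exists>\<xi>\<in>smooth_forms A 1 0. torsion_form A \<omega> = del A \<xi> \<and> weakly_semipositive 1 (delbar A \<xi>)"
  shows "kaehler_metric A \<omega>"
proof -
  note M = assms(1)
  note A = atlas [OF M]
  obtain \<xi> where \<xi>: "\<xi> \<in> smooth_forms A 1 0" "torsion_form A \<omega> = del A \<xi>" "weakly_semipositive 1 (delbar A \<xi>)"
    using assms(5) by blast
  note h = metric_class_hermitian(1) [OF M assms(2,3)]
  obtain \<sigma> where \<sigma>: "\<sigma> \<in> closing_20_forms A \<omega>" using metric_class_hermitian(2) [OF M assms(2,3)] by blast
  note t = torsion_form_minimal [OF M h \<sigma>]
  let ?f = "\<lambda>s. energy A (\<omega> + scale_form s (delbar A \<xi> + del A (cnj_form \<xi>)))"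
  have f0: "?f 0 = energy A \<omega>"
  proof -
    have "\<omega> + scale_form 0 (delbar A \<xi> + del A (cnj_form \<xi>)) = \<omega>" by (simp add: fun_eq_iff scale_form_def)
    then show ?thesis by simp
  qed
  obtain s0 where s0: "s0 > 0" "\<And>s. - s0 < s \<Longrightarrow> s < 0 \<Longrightarrow> ?f s \<le> (1 + s)\<^sup>2 * energy A \<omega>"
    by (rule energy_perturbation_le [OF M h t(1) \<xi>(2,1,3)]) (rule that)
  have "?f 0 = 0"
  proof (rule critical_value_zero [of ?f])
    show "(?f has_real_derivative 0) (at 0)" using assms(4) \<xi>(1) unfolding critical_point_def by blast
    show "s0 > 0" by (rule s0(1))
    show "?f s \<le> (1 + s)\<^sup>2 * ?f 0" if "- s0 < s" "s < 0" for s unfolding f0 by (rule s0(2) [OF that])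
    show "?f 0 \<ge> 0" unfolding f0 by (simp add: energy_def)
  qed
  then have z: "torsion_form A \<omega> x vs = 0" for x vs
    using t(2) closing_iff [OF M hermitian_metricD(2) [OF M h]] t(1) f0 by (intro sq_norm_zero_imp [OF M h]) auto
  then have "torsion_form A \<omega> = 0" by (simp add: fun_eq_iff)
  moreover have "(0 :: ('m, 'n) form) + \<omega> + cnj_form 0 = \<omega>" by (simp add: fun_eq_iff cnj_form_def cnj_covector_def)
  ultimately have "d_form A \<omega> = 0" using t(1) by (simp add: closing_20_forms_def)
  then show ?thesis using h by (simp add: kaehler_metric_def)
qed

end
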